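(* Let $\mathfrak{g}$ be the Lie algebra of a connected reductive algebraic group over $\mathbb{C}$. If $\mathcal{O}$ is a little nilpotent orbit of $\mathfrak{g}$, then $\mathcal{O}$ verifies $\mathrm{RC}_1$ and $\mathrm{RC}_2(m)$ for every integer $m\ge 1$.
   Context: For a nilpotent orbit $\mathcal{O}$ of $\mathfrak{g}$, $\mathfrak{g}_{\mathcal{O}}$ is the smallest semisimple ideal of $\mathfrak{g}$ containing $\mathcal{O}$. $\mathcal{O}$ is called little if $0<2\dim\mathcal{O}\le\dim\mathfrak{g}_{\mathcal{O}}$. For a scheme $X$ of finite type over $\mathbb{C}$ and $m\in\mathbb{N}$, $\mathcal{J}_m(X)$ denotes the $m$-th jet scheme of $X$, i.e. the scheme with $\mathrm{Hom}(Z,\mathcal{J}_m(X))=\mathrm{Hom}(Z\times \mathrm{Spec}\,\mathbb{C}[t]/(t^{m+1}),X)$ for every scheme $Z$ over $\mathbb{C}$, and $\pi_{X,m}:\mathcal{J}_m(X)\to X$ is the canonical projection. Closures $\overline{\mathcal{O}}$ of nilpotent orbits are regarded as reduced affine schemes. Definitions: a nilpotent orbit $\mathcal{O}$ verifies $\mathrm{RC}_1$ if $\pi_{\overline{\mathcal{O}},1}^{-1}(0)$ is not contained in the closure of $\pi_{\overline{\mathcal{O}},1}^{-1}(\mathcal{O})$. For $m\ge1$, $\mathcal{O}$ verifies $\mathrm{RC}_2(m)$ if for some nilpotent orbit $\mathcal{O}'$ contained in $\overline{\mathcal{O}}\setminus\mathcal{O}$, we have $\dim\pi_{\overline{\mathcal{O}},m}^{-1}(\mathcal{O}')\ge\dim\pi_{\overline{\mathcal{O}},m}^{-1}(\mathcal{O})=(m+1)\dim\mathcal{O}$.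 *)

theory Defs
  imports "HOL-Analysis.Analysis" "HOL-Computational_Algebra.Polynomial" "HOL-Library.Extended_Nat"
begin

section \<open>Zariski topology, irreducibility and Krull dimension\<close>

text \<open>
  \<open>poly_fun C\<close> is the algebra of complex functions generated by the coordinate functions in \<open>C\<close>.
  Varieties are represented by their sets of complex points.
\<close>

inductive_set poly_fun :: "('p \<Rightarrow> complex) set \<Rightarrow> ('p \<Rightarrow> complex) set"
  for C :: "('p \<Rightarrow> complex) set" where
  coord: "c \<in> C \<Longrightarrow> c \<in> poly_fun C"
| const: "(\<lambda>_. a) \<in> poly_fun C"
| add: "f \<in> poly_fun C \<Longrightarrow> g \<in> poly_fun C \<Longrightarrow> (\<lambda>p. f p + g p) \<in> poly_fun C"
| mult: "f \<in> poly_fun C \<Longrightarrow> g \<in> poly_fun C \<Longrightarrow> (\<lambda>p. f p * g p) \<in> poly_fun C"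

definition zero_set :: "('p \<Rightarrow> complex) set \<Rightarrow> 'p set" where
  "zero_set F = {p. \<forall>f\<in>F. f p = 0}"

definition zariski :: "('p \<Rightarrow> complex) set \<Rightarrow> 'p topology" where
  "zariski C = topology (\<lambda>U. \<exists>F\<subseteq>poly_fun C. U = - zero_set F)"

lemma istopology_zariski: "istopology (\<lambda>U. \<exists>F\<subseteq>poly_fun C. U = - zero_set F)"
  unfolding istopology_def
proof (intro conjI allI impI)
  fix S T :: "'a set"
  assume "\<exists>F\<subseteq>poly_fun C. S = - zero_set F" "\<exists>F\<subseteq>poly_fun C. T = - zero_set F"
  then obtain F G where F: "F \<subseteq> poly_fun C" "S = - zero_set F"
    and G: "G \<subseteq> poly_fun C" "T = - zero_set G" by blast
  let ?H = "{(\<lambda>p. f p * g p) | f g. f \<in> F \<and> g \<in> G}"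
  have "?H \<subseteq> poly_fun C" using F G by (auto intro: poly_fun.mult)
  moreover have "S \<inter> T = - zero_set ?H"
    unfolding F G by (auto simp: zero_set_def) (metis mult_eq_0_iff)
  ultimately show "\<exists>F\<subseteq>poly_fun C. S \<inter> T = - zero_set F" by blast
next
  fix K :: "'a set set"
  assume "\<forall>U\<in>K. \<exists>F\<subseteq>poly_fun C. U = - zero_set F"
  then obtain F where F: "\<And>U. U \<in> K \<Longrightarrow> F U \<subseteq> poly_fun C" "\<And>U. U \<in> K \<Longrightarrow> U = - zero_set (F U)"
    by metis
  have "(\<Union>U\<in>K. F U) \<subseteq> poly_fun C" using F by blast
  moreover have "\<Union>K = (\<Union>U\<in>K. - zero_set (F U))" using F(2) by auto
  then have "\<Union>K = - zero_set (\<Union>U\<in>K. F U)" by (auto simp: zero_set_def)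
  ultimately show "\<exists>F\<subseteq>poly_fun C. \<Union>K = - zero_set F" by blast
qed

lemma openin_zariski: "openin (zariski C) U \<longleftrightarrow> (\<exists>F\<subseteq>poly_fun C. U = - zero_set F)"
  unfolding zariski_def by (simp add: istopology_zariski topology_inverse')

lemma topspace_zariski [simp]: "topspace (zariski C) = UNIV"
proof -
  have "openin (zariski C) UNIV"
    unfolding openin_zariski
    by (rule exI[of _ "{\<lambda>_. 1}"]) (auto simp: zero_set_def intro: poly_fun.const)
  then show ?thesis using openin_subset by blast
qed

lemma closedin_zariski: "closedin (zariski C) S \<longleftrightarrow> (\<exists>F\<subseteq>poly_fun C. S = zero_set F)"
  by (simp add: closedin_def openin_zariski Compl_eq_Diff_UNIV [symmetric])

definition irreducible_space :: "'a topology \<Rightarrow> bool" where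
  "irreducible_space X \<longleftrightarrow> topspace X \<noteq> {} \<and>
     (\<forall>A B. closedin X A \<and> closedin X B \<and> A \<union> B = topspace X \<longrightarrow> A = topspace X \<or> B = topspace X)"

text \<open>
  The empty space gets dimension \<open>0\<close> here, as \<^typ>\<open>enat\<close> has no \<open>-\<infinity>\<close>; below, the dimension
  is only taken of nonempty spaces.
\<close>

definition krull_dim :: "'a topology \<Rightarrow> enat" where
  "krull_dim X = Sup {enat n | n. \<exists>Z.
     (\<forall>i\<le>n. closedin X (Z i) \<and> irreducible_space (subtopology X (Z i))) \<and>
     (\<forall>i<n. Z i \<subset> Z (Suc i))}"


section \<open>Matrices\<close>

definition cscale :: "complex \<Rightarrow> complex^'n^'n \<Rightarrow> complex^'n^'n" (infixr "*\<^sub>C" 75) where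
  "c *\<^sub>C A = (\<chi> i j. c * A $ i $ j)"

interpretation cmat: vector_space "cscale :: complex \<Rightarrow> complex^'n^'n \<Rightarrow> complex^'n^'n"
  by unfold_locales (auto simp: cscale_def vec_eq_iff algebra_simps)

definition mat_coords :: "(complex^'n^'n \<Rightarrow> complex) set" where
  "mat_coords = {(\<lambda>A. A $ i $ j) | i j. True}"

abbreviation mat_zariski :: "(complex^'n^'n) topology" where
  "mat_zariski \<equiv> zariski mat_coords"

text \<open>The power operation of the type class on \<^typ>\<open>complex^'n^'n\<close> is entrywise, hence the iteration of \<open>**\<close>.\<close>

definition nilpotent_mat :: "complex^'n^'n \<Rightarrow> bool" where
  "nilpotent_mat A \<longleftrightarrow> (\<exists>k. (((**) A) ^^ k) (mat 1) = 0)"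


section \<open>Jet schemes\<close>

text \<open>
  Let \<open>X\<close> be a closed set of matrices with its reduced structure and let \<open>I(X)\<close> be the ideal of
  polynomial functions vanishing on it. A complex point of the \<open>m\<close>-th jet scheme of \<open>X\<close> is an algebra
  homomorphism from the coordinate ring of \<open>X\<close> to \<open>\<complex>[t]/(t^(m+1))\<close>, that is, an arc
  \<open>\<gamma> 0 + t \<gamma> 1 + \<dots> + t^m \<gamma> m\<close> with \<open>f (\<gamma> 0 + t \<gamma> 1 + \<dots> + t^m \<gamma> m) = 0\<close> modulo \<open>t^(m+1)\<close> for all
  \<open>f\<close> in \<open>I(X)\<close>. Jets are stored as functions on \<open>nat\<close> vanishing beyond \<open>m\<close>.
\<close>

definition vanishing_ideal :: "(complex^'n^'n) set \<Rightarrow> (complex^'n^'n \<Rightarrow> complex) set" where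
  "vanishing_ideal X = {f \<in> poly_fun mat_coords. \<forall>x\<in>X. f x = 0}"

definition arc :: "nat \<Rightarrow> (nat \<Rightarrow> complex^'n^'n) \<Rightarrow> complex \<Rightarrow> complex^'n^'n" where
  "arc m \<gamma> t = (\<Sum>k\<le>m. t ^ k *\<^sub>C \<gamma> k)"

lemma poly_fun_arc: "f \<in> poly_fun mat_coords \<Longrightarrow> \<exists>q. \<forall>t. f (arc m \<gamma> t) = poly q t"
proof (induction rule: poly_fun.induct)
  case (coord c)
  then obtain i j where "c = (\<lambda>A. A $ i $ j)" by (auto simp: mat_coords_def)
  then have "c (arc m \<gamma> t) = poly (\<Sum>k\<le>m. monom (\<gamma> k $ i $ j) k) t" for t
    by (simp add: arc_def cscale_def poly_sum poly_monom mult.commute)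
  then show ?case by blast
next
  case (const a)
  then show ?case by (intro exI[of _ "[:a:]"]) simp
next
  case (add f g)
  then show ?case by (metis poly_add)
next
  case (mult f g)
  then show ?case by (metis poly_mult)
qed

definition jets :: "nat \<Rightarrow> (complex^'n^'n) set \<Rightarrow> (nat \<Rightarrow> complex^'n^'n) set" where
  "jets m X = {\<gamma>. (\<forall>k>m. \<gamma> k = 0) \<and>
     (\<forall>f\<in>vanishing_ideal X. \<exists>q. \<forall>t. f (arc m \<gamma> t) = t ^ (m + 1) * poly q t)}"

text \<open>The canonical projection of \<open>jets m X\<close> to \<open>X\<close> is \<open>\<gamma> \<mapsto> \<gamma> 0\<close>; this is the preimage of \<open>S\<close>.\<close>

definition jets_over :: "nat \<Rightarrow> (complex^'n^'n) set \<Rightarrow> (complex^'n^'n) set \<Rightarrow> (nat \<Rightarrow> complex^'n^'n) set" where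
  "jets_over m X S = {\<gamma> \<in> jets m X. \<gamma> 0 \<in> S}"

text \<open>
  Only the coordinates of index \<open>k \<le> m\<close> are nonzero on \<open>jets m X\<close>, so this topology induces on it the
  Zariski topology of the affine space of \<open>(m+1)\<close>-tuples of matrices.
\<close>

abbreviation jet_zariski :: "(nat \<Rightarrow> complex^'n^'n) topology" where
  "jet_zariski \<equiv> zariski {(\<lambda>\<gamma>. \<gamma> k $ i $ j) | k i j. True}"


section \<open>Reductive groups and their Lie algebras\<close>

text \<open>
  Affine algebraic groups over the complex numbers are represented as Zariski closed subgroups of
  some \<open>GL\<^sub>n\<close>.
\<close>

definition algebraic_group :: "(complex^'n^'n) set \<Rightarrow> bool" where
  "algebraic_group G \<longleftrightarrow> closedin (subtopology mat_zariski {A. invertible A}) G \<and>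
     mat 1 \<in> G \<and> (\<forall>A\<in>G. \<forall>B\<in>G. A ** B \<in> G) \<and> (\<forall>A\<in>G. matrix_inv A \<in> G)"

definition normal_in :: "(complex^'n^'n) set \<Rightarrow> (complex^'n^'n) set \<Rightarrow> bool" where
  "normal_in U G \<longleftrightarrow> U \<subseteq> G \<and> (\<forall>A\<in>G. \<forall>B\<in>U. A ** B ** matrix_inv A \<in> U)"

definition unipotent :: "(complex^'n^'n) set \<Rightarrow> bool" where
  "unipotent U \<longleftrightarrow> (\<forall>A\<in>U. nilpotent_mat (A - mat 1))"

text \<open>Reductive: the unipotent radical is trivial.\<close>

definition connected_reductive_group :: "(complex^'n^'n) set \<Rightarrow> bool" where
  "connected_reductive_group G \<longleftrightarrow> algebraic_group G \<and> connectedin mat_zariski G \<and>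
     (\<forall>U. algebraic_group U \<and> connectedin mat_zariski U \<and> normal_in U G \<and> unipotent U
        \<longrightarrow> U = {mat 1})"

text \<open>
  The tangent space of \<open>G\<close> at the identity: \<open>X\<close> such that \<open>1 + tX\<close> is a point of \<open>G\<close> over the dual
  numbers. As \<open>GL\<^sub>n\<close> is open in the space of matrices, polynomial functions of the matrix entries
  suffice.
\<close>

definition lie_algebra :: "(complex^'n^'n) set \<Rightarrow> (complex^'n^'n) set" where
  "lie_algebra G = {\<gamma> 1 | \<gamma>. \<gamma> \<in> jets_over 1 G {mat 1}}"

definition lie_bracket :: "complex^'n^'n \<Rightarrow> complex^'n^'n \<Rightarrow> complex^'n^'n" where
  "lie_bracket x y = x ** y - y ** x"

definition lie_ideal :: "(complex^'n^'n) set \<Rightarrow> (complex^'n^'n) set \<Rightarrow> bool" where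
  "lie_ideal I L \<longleftrightarrow> cmat.subspace I \<and> I \<subseteq> L \<and> (\<forall>x\<in>L. \<forall>y\<in>I. lie_bracket x y \<in> I)"

definition derived :: "(complex^'n^'n) set \<Rightarrow> (complex^'n^'n) set" where
  "derived L = cmat.span {lie_bracket x y | x y. x \<in> L \<and> y \<in> L}"

definition solvable :: "(complex^'n^'n) set \<Rightarrow> bool" where
  "solvable L \<longleftrightarrow> (\<exists>k. (derived ^^ k) L = {0})"

text \<open>Semisimple: the solvable radical is zero. In particular, the zero Lie algebra is semisimple.\<close>

definition semisimple :: "(complex^'n^'n) set \<Rightarrow> bool" where
  "semisimple L \<longleftrightarrow> (\<forall>I. lie_ideal I L \<and> solvable I \<longrightarrow> I = {0})"


section \<open>Nilpotent orbits\<close>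

text \<open>
  An element of the Lie algebra of a closed subgroup of \<open>GL\<^sub>n\<close> is nilpotent if it is nilpotent as a matrix.
\<close>

definition orbit :: "(complex^'n^'n) set \<Rightarrow> complex^'n^'n \<Rightarrow> (complex^'n^'n) set" where
  "orbit G x = {g ** x ** matrix_inv g | g. g \<in> G}"

definition nilpotent_orbit :: "(complex^'n^'n) set \<Rightarrow> (complex^'n^'n) set \<Rightarrow> bool" where
  "nilpotent_orbit G \<O> \<longleftrightarrow> (\<exists>x\<in>lie_algebra G. nilpotent_mat x \<and> \<O> = orbit G x)"

definition smallest_semisimple_ideal ::
    "(complex^'n^'n) set \<Rightarrow> (complex^'n^'n) set \<Rightarrow> (complex^'n^'n) set \<Rightarrow> bool" where
  "smallest_semisimple_ideal G \<O> I \<longleftrightarrow>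
     lie_ideal I (lie_algebra G) \<and> semisimple I \<and> \<O> \<subseteq> I \<and>
     (\<forall>J. lie_ideal J (lie_algebra G) \<and> semisimple J \<and> \<O> \<subseteq> J \<longrightarrow> I \<subseteq> J)"

definition little :: "(complex^'n^'n) set \<Rightarrow> (complex^'n^'n) set \<Rightarrow> bool" where
  "little G \<O> \<longleftrightarrow> (\<exists>I. smallest_semisimple_ideal G \<O> I \<and>
     0 < 2 * krull_dim (subtopology mat_zariski \<O>) \<and>
     2 * krull_dim (subtopology mat_zariski \<O>) \<le> enat (cmat.dim I))"

definition RC1 :: "(complex^'n^'n) set \<Rightarrow> bool" where
  "RC1 \<O> \<longleftrightarrow> (let X = mat_zariski closure_of \<O> in
     \<not> jets_over 1 X {0} \<subseteq> jet_zariski closure_of (jets_over 1 X \<O>))"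

definition RC2 :: "(complex^'n^'n) set \<Rightarrow> nat \<Rightarrow> (complex^'n^'n) set \<Rightarrow> bool" where
  "RC2 G m \<O> \<longleftrightarrow> (let X = mat_zariski closure_of \<O> in
     \<exists>\<O>'. nilpotent_orbit G \<O>' \<and> \<O>' \<subseteq> X - \<O> \<and>
       krull_dim (subtopology jet_zariski (jets_over m X \<O>'))
         \<ge> krull_dim (subtopology jet_zariski (jets_over m X \<O>)) \<and>
       krull_dim (subtopology jet_zariski (jets_over m X \<O>))
         = enat (m + 1) * krull_dim (subtopology mat_zariski \<O>))"

end

theory Submission
  imports Defs "HOL-Library.Function_Algebras" "HOL-Computational_Algebra.Fundamental_Theorem_Algebra"
begin

text \<open>
  Let \<open>x\<close> be a point of the orbit, \<open>e\<close> the dimension of the orbit and \<open>I\<close> the smallest semisimple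
  ideal containing it. By Cartan's criterion the trace form of matrices is nondegenerate on \<open>I\<close>.
  Hence brackets with elements of \<open>lie_algebra G\<close> and with elements of \<open>I\<close> have the same effect on
  \<open>I\<close>, the orbit spans \<open>I\<close> (its span is again a semisimple ideal), and \<open>x \<in> [I, x]\<close>, so that the
  closure of the orbit is a cone.

  For \<open>y\<close> in the orbit, conjugation by \<open>exp (\<tau> t^k y)\<close> acts polynomially on the \<open>m\<close>-jets of the
  closure. The lowest nonconstant coefficient of a jet over the orbit is tangent to the orbit, so
  these flows carry every such jet to a constant one. It follows that the jets over the orbit form an
  irreducible set with tangent spaces \<open>[I, z]^(m+1)\<close>, of dimension \<open>(m+1) e\<close>.

  Over \<open>0\<close>, start from the jet \<open>t x\<close>. The flows move it in the directions \<open>t^(k+1) [y, x]\<close>, and its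
  last coefficient may be translated by \<open>I\<close>, because functions vanishing on a cone that spans \<open>I\<close>
  have zero differential on \<open>I\<close> at \<open>0\<close>. The fibre has therefore dimension at least
  \<open>(m - 1) e + dim I\<close>, which is at least \<open>(m + 1) e\<close> for a little orbit. For \<open>m = 1\<close> the fibre is thus
  too large to be a proper closed part of the closure of the jets over the orbit.

  Krull dimensions are bounded from above by tangent spaces: the functions separating the members of
  a chain of irreducible closed sets are algebraically independent, and derivations extend along
  algebraic and transcendental functions at generic points. They are bounded from below by the
  velocities of the flows, whose successive orbits build a chain.
\<close>


subsection \<open>Point derivations\<close>

text \<open>Krull dimension is taken of sets that are not closed, such as the orbit and the jets
  over it, so it cannot be read off from equations: both bounds are obtained from points and curves.
  Characteristic 0 is decisive for the upper bound, because only there do derivations extend along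
  algebraic functions at generic points. The flows are restricted to \<open>y\<close> in the orbit
  because \<open>exp\<close> is polynomial there; that the orbit spans \<open>I\<close> makes these
  few directions sufficient. The factor 2 in the notion of a little orbit is a count of coordinates.
  Over the orbit each of the \<open>m + 1\<close> coordinates of a jet contributes \<open>e\<close>.
  Over 0, from \<open>t x\<close> on, coordinate 0 contributes nothing, coordinates 1 to
  \<open>m - 1\<close> contribute \<open>e\<close> each and coordinate \<open>m\<close> contributes
  \<open>dim I\<close>, which has to make up for two copies of \<open>e\<close>. The trace form of
  the ambient matrices takes the place of the Killing form, since one form then serves all ideals at
  once.\<close>

lemma poly_fun_mono:
  assumes "A \<subseteq> B" "f \<in> poly_fun A"
  shows "f \<in> poly_fun B"
  using assms(2,1) by induction (auto intro: poly_fun.intros)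

lemma poly_fun_sum: "(\<And>i. i \<in> S \<Longrightarrow> f i \<in> poly_fun A) \<Longrightarrow> (\<lambda>p. \<Sum>i\<in>S. f i p) \<in> poly_fun A"
  by (induction S rule: infinite_finite_induct) (auto intro: poly_fun.intros)

lemma poly_fun_prod: "(\<And>i. i \<in> S \<Longrightarrow> f i \<in> poly_fun A) \<Longrightarrow> (\<lambda>p. \<Prod>i\<in>S. f i p) \<in> poly_fun A"
  by (induction S rule: infinite_finite_induct) (auto intro: poly_fun.intros)

lemma poly_fun_power: "f \<in> poly_fun A \<Longrightarrow> (\<lambda>p. f p ^ n) \<in> poly_fun A"
  by (induction n) (auto intro: poly_fun.intros)

lemma poly_fun_cmult: "f \<in> poly_fun A \<Longrightarrow> (\<lambda>p. a * f p) \<in> poly_fun A"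
  by (rule poly_fun.mult[OF poly_fun.const])

lemma poly_fun_uminus: "f \<in> poly_fun A \<Longrightarrow> (\<lambda>p. - f p) \<in> poly_fun A"
  using poly_fun_cmult[of f A "-1"] by simp

lemma poly_fun_diff: "f \<in> poly_fun A \<Longrightarrow> g \<in> poly_fun A \<Longrightarrow> (\<lambda>p. f p - g p) \<in> poly_fun A"
  using poly_fun.add[OF _ poly_fun_uminus, of f A g] by simp

lemma poly_fun_subst:
  assumes "f \<in> poly_fun A" and "\<And>a. a \<in> A \<Longrightarrow> (\<lambda>q. a (\<phi> q)) \<in> poly_fun B"
  shows "(\<lambda>q. f (\<phi> q)) \<in> poly_fun B"
  using assms(1) by induction (auto intro: poly_fun.intros assms(2))

text \<open>This lets one algebra be presented as generated by finitely many coordinates over a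
  chosen subalgebra, the form in which derivations are extended later.\<close>

lemma poly_fun_absorb:
  assumes "B \<subseteq> poly_fun A"
  shows "poly_fun (B \<union> A) = poly_fun A"
proof
  show "poly_fun (B \<union> A) \<subseteq> poly_fun A"
  proof
    fix f assume "f \<in> poly_fun (B \<union> A)"
    from poly_fun_subst[OF this, of "\<lambda>q. q" A] show "f \<in> poly_fun A"
      using assms by (auto intro: poly_fun.coord)
  qed
qed (auto intro: poly_fun_mono[of A "B \<union> A"])

text \<open>The Leibniz rule is evaluated at \<open>p\<close>, so these are tangent vectors. Fixing
  the value 0 off \<open>poly_fun A\<close> makes a derivation, as a HOL function, determined by its
  values on generators; see \<open>pder_unique\<close>.\<close>

definition pder :: "('p \<Rightarrow> complex) set \<Rightarrow> 'p \<Rightarrow> (('p \<Rightarrow> complex) \<Rightarrow> complex) \<Rightarrow> bool" where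
  "pder A p \<xi> \<longleftrightarrow> (\<forall>f. f \<notin> poly_fun A \<longrightarrow> \<xi> f = 0) \<and> (\<forall>a. \<xi> (\<lambda>_. a) = 0) \<and>
     (\<forall>f\<in>poly_fun A. \<forall>g\<in>poly_fun A. \<xi> (\<lambda>q. f q + g q) = \<xi> f + \<xi> g \<and>
        \<xi> (\<lambda>q. f q * g q) = f p * \<xi> g + g p * \<xi> f)"

text \<open>The Zariski tangent space at \<open>p\<close> of the closure of \<open>P\<close>; the
  set \<open>P\<close> itself need not be closed.\<close>

definition tang :: "('p \<Rightarrow> complex) set \<Rightarrow> 'p set \<Rightarrow> 'p \<Rightarrow> (('p \<Rightarrow> complex) \<Rightarrow> complex) set" where
  "tang A P p = {\<xi>. pder A p \<xi> \<and> (\<forall>f\<in>poly_fun A. (\<forall>q\<in>P. f q = 0) \<longrightarrow> \<xi> f = 0)}"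

text \<open>Primality of the ideal of functions vanishing on \<open>P\<close>. The link with the
  topological notion is \<open>irreducible_space_iff_irr\<close>.\<close>

definition irr :: "('p \<Rightarrow> complex) set \<Rightarrow> 'p set \<Rightarrow> bool" where
  "irr A P \<longleftrightarrow> P \<noteq> {} \<and> (\<forall>f\<in>poly_fun A. \<forall>g\<in>poly_fun A. (\<forall>q\<in>P. f q * g q = 0) \<longrightarrow>
     (\<forall>q\<in>P. f q = 0) \<or> (\<forall>q\<in>P. g q = 0))"

context
  fixes A :: "('p \<Rightarrow> complex) set" and p :: 'p and \<xi>
  assumes pd: "pder A p \<xi>"
begin

lemma pder_out: "f \<notin> poly_fun A \<Longrightarrow> \<xi> f = 0"
  and pder_const: "\<xi> (\<lambda>_. a) = 0"
  and pder_add: "f \<in> poly_fun A \<Longrightarrow> g \<in> poly_fun A \<Longrightarrow> \<xi> (\<lambda>q. f q + g q) = \<xi> f + \<xi> g"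
  and pder_mult: "f \<in> poly_fun A \<Longrightarrow> g \<in> poly_fun A \<Longrightarrow> \<xi> (\<lambda>q. f q * g q) = f p * \<xi> g + g p * \<xi> f"
  using pd unfolding pder_def by blast+

lemma pder_cmult: "f \<in> poly_fun A \<Longrightarrow> \<xi> (\<lambda>q. a * f q) = a * \<xi> f"
  using pder_mult[OF poly_fun.const, of f a] by (simp add: pder_const)

lemma pder_diff: "f \<in> poly_fun A \<Longrightarrow> g \<in> poly_fun A \<Longrightarrow> \<xi> (\<lambda>q. f q - g q) = \<xi> f - \<xi> g"
  using pder_add[OF _ poly_fun_cmult, of f g "-1"] pder_cmult[of g "-1"] by simp

lemma pder_sum: "(\<And>i. i \<in> S \<Longrightarrow> f i \<in> poly_fun A) \<Longrightarrow> \<xi> (\<lambda>q. \<Sum>i\<in>S. f i q) = (\<Sum>i\<in>S. \<xi> (f i))"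
proof (induction S rule: infinite_finite_induct)
  case (insert x F)
  then show ?case
    using pder_add[of "f x" "\<lambda>q. \<Sum>i\<in>F. f i q"] by (simp add: poly_fun_sum)
qed (simp_all add: pder_const)

lemma pder_unique:
  assumes "pder A p \<eta>" and "\<And>a. a \<in> A \<Longrightarrow> \<xi> a = \<eta> a"
  shows "\<xi> = \<eta>"
proof
  fix f
  show "\<xi> f = \<eta> f"
  proof (cases "f \<in> poly_fun A")
    case True
    then show ?thesis
      by induction (use pd assms in \<open>auto simp: pder_def\<close>)
  next
    case False
    then show ?thesis using pd assms(1) by (simp add: pder_def)
  qed
qed

end

text \<open>
  A function and the value of a derivation on it, computed from an expansion in powers of \<open>c\<close>; \<open>w\<close> is
  the prescribed value on \<open>c\<close>.
\<close>

definition expansion where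
  "expansion A c \<xi> p w f z \<longleftrightarrow> (\<exists>n a. (\<forall>i. a i \<in> poly_fun A) \<and> (\<forall>i>n. a i = (\<lambda>_. 0)) \<and>
     f = (\<lambda>q. \<Sum>i\<le>n. a i q * c q ^ i) \<and>
     z = (\<Sum>i\<le>n. \<xi> (a i) * c p ^ i + of_nat i * a i p * c p ^ (i - 1) * (w::complex)))"

lemma sum_pad:
  fixes f :: "nat \<Rightarrow> 'a::comm_monoid_add"
  assumes "n \<le> N" "\<And>i. i > n \<Longrightarrow> f i = 0"
  shows "(\<Sum>i\<le>n. f i) = (\<Sum>i\<le>N. f i)"
  using assms by (intro sum.mono_neutral_left) auto

context
  fixes A :: "('p \<Rightarrow> complex) set" and p :: 'p and \<xi> and c :: "'p \<Rightarrow> complex" and w :: complex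
  assumes pd: "pder A p \<xi>"
begin

lemma expansion_add:
  assumes "expansion A c \<xi> p w f z" "expansion A c \<xi> p w g y"
  shows "expansion A c \<xi> p w (\<lambda>q. f q + g q) (z + y)"
proof -
  obtain n a where a: "\<And>i. a i \<in> poly_fun A" "\<And>i. i > n \<Longrightarrow> a i = (\<lambda>_. 0)"
     "f = (\<lambda>q. \<Sum>i\<le>n. a i q * c q ^ i)"
     "z = (\<Sum>i\<le>n. \<xi> (a i) * c p ^ i + of_nat i * a i p * c p ^ (i - 1) * w)"
    using assms(1) unfolding expansion_def by blast
  obtain m b where b: "\<And>i. b i \<in> poly_fun A" "\<And>i. i > m \<Longrightarrow> b i = (\<lambda>_. 0)"
     "g = (\<lambda>q. \<Sum>i\<le>m. b i q * c q ^ i)"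
     "y = (\<Sum>i\<le>m. \<xi> (b i) * c p ^ i + of_nat i * b i p * c p ^ (i - 1) * w)"
    using assms(2) unfolding expansion_def by blast
  define N where "N = max n m"
  have N: "n \<le> N" "m \<le> N" by (auto simp: N_def)
  have "f = (\<lambda>q. \<Sum>i\<le>N. a i q * c q ^ i)" "g = (\<lambda>q. \<Sum>i\<le>N. b i q * c q ^ i)"
    "z = (\<Sum>i\<le>N. \<xi> (a i) * c p ^ i + of_nat i * a i p * c p ^ (i - 1) * w)"
    "y = (\<Sum>i\<le>N. \<xi> (b i) * c p ^ i + of_nat i * b i p * c p ^ (i - 1) * w)"
    unfolding a(3,4) b(3,4)
    by (rule ext sum_pad N | simp add: a(2) b(2) pder_const[OF pd])+
  then show ?thesis
    unfolding expansion_def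
    by (intro exI[of _ N] exI[of _ "\<lambda>i q. a i q + b i q"])
       (use a b N in \<open>auto simp: pder_add[OF pd] sum.distrib[symmetric] algebra_simps intro: poly_fun.add intro!: ext sum.cong\<close>)
qed

lemma expansion_monom:
  assumes "b \<in> poly_fun A"
  shows "expansion A c \<xi> p w (\<lambda>q. b q * c q ^ k) (\<xi> b * c p ^ k + of_nat k * b p * c p ^ (k - 1) * w)"
  unfolding expansion_def
  by (intro exI[of _ k] exI[of _ "\<lambda>i. if i = k then b else (\<lambda>_. 0)"])
     (auto simp: assms pder_const[OF pd] if_distrib if_distribR sum.delta poly_fun.const cong: if_cong)

lemma expansion_sum:
  assumes "finite S" "\<And>i. i \<in> S \<Longrightarrow> expansion A c \<xi> p w (f i) (z i)"
  shows "expansion A c \<xi> p w (\<lambda>q. \<Sum>i\<in>S. f i q) (\<Sum>i\<in>S. z i)"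
  using assms
proof (induction S rule: finite_induct)
  case empty
  then show ?case using expansion_monom[OF poly_fun.const, of 0 0] by (simp add: pder_const[OF pd])
qed (auto intro: expansion_add)

lemma expansion_mult:
  assumes "expansion A c \<xi> p w f z" "expansion A c \<xi> p w g y"
  shows "expansion A c \<xi> p w (\<lambda>q. f q * g q) (f p * y + g p * z)"
proof -
  obtain n a where a: "\<And>i. a i \<in> poly_fun A" 
     "f = (\<lambda>q. \<Sum>i\<le>n. a i q * c q ^ i)"
     "z = (\<Sum>i\<le>n. \<xi> (a i) * c p ^ i + of_nat i * a i p * c p ^ (i - 1) * w)"
    using assms(1) unfolding expansion_def by blast
  obtain m b where b: "\<And>i. b i \<in> poly_fun A"
     "g = (\<lambda>q. \<Sum>i\<le>m. b i q * c q ^ i)"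
     "y = (\<Sum>i\<le>m. \<xi> (b i) * c p ^ i + of_nat i * b i p * c p ^ (i - 1) * w)"
    using assms(2) unfolding expansion_def by blast
  define T where "T i j = \<xi> (\<lambda>q. a i q * b j q) * c p ^ (i + j)
     + of_nat (i + j) * (a i p * b j p) * c p ^ (i + j - 1) * w" for i j
  have T: "T i j = (a i p * c p ^ i) * (\<xi> (b j) * c p ^ j + of_nat j * b j p * c p ^ (j - 1) * w)
     + (b j p * c p ^ j) * (\<xi> (a i) * c p ^ i + of_nat i * a i p * c p ^ (i - 1) * w)" for i j
  proof -
    \<comment> \<open>\<open>i - 1\<close> is truncated at \<open>i = 0\<close>; the factor
      \<open>of_nat i\<close> makes that case harmless.\<close>
    have 1: "of_nat i * c p ^ (i + j - 1) = of_nat i * (c p ^ (i-1) * c p ^ j)"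
      by (cases i) (auto simp: power_add)
    have 2: "of_nat j * c p ^ (i + j - 1) = of_nat j * (c p ^ i * c p ^ (j-1))"
      by (cases j) (auto simp: power_add)
    have "of_nat (i + j) * (a i p * b j p) * c p ^ (i + j - 1) * w =
      (a i p * b j p) * w * (of_nat i * c p ^ (i + j - 1)) + (a i p * b j p) * w * (of_nat j * c p ^ (i + j - 1))"
      by (simp add: algebra_simps)
    then show ?thesis
      unfolding T_def pder_mult[OF pd a(1) b(1)] 1 2
      by (simp add: power_add algebra_simps)
  qed
  have "expansion A c \<xi> p w (\<lambda>q. \<Sum>i\<le>n. \<Sum>j\<le>m. (a i q * b j q) * c q ^ (i + j)) (\<Sum>i\<le>n. \<Sum>j\<le>m. T i j)"
    unfolding T_def by (intro expansion_sum expansion_monom poly_fun.mult a b) auto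
  moreover have "(\<lambda>q. \<Sum>i\<le>n. \<Sum>j\<le>m. (a i q * b j q) * c q ^ (i + j)) = (\<lambda>q. f q * g q)"
    unfolding a(2) b(2) by (auto simp: sum_product power_add ac_simps intro!: ext sum.cong)
  moreover have "(\<Sum>i\<le>n. \<Sum>j\<le>m. T i j) = f p * y + g p * z"
  proof -
    have "(\<Sum>i\<le>n. \<Sum>j\<le>m. T i j) = f p * y + (\<Sum>i\<le>n. \<Sum>j\<le>m. (b j p * c p ^ j) * (\<xi> (a i) * c p ^ i + of_nat i * a i p * c p ^ (i - 1) * w))"
      unfolding T sum.distrib unfolding a(2) b(3) sum_product by (rule refl)
    also have "(\<Sum>i\<le>n. \<Sum>j\<le>m. (b j p * c p ^ j) * (\<xi> (a i) * c p ^ i + of_nat i * a i p * c p ^ (i - 1) * w)) = g p * z"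
      unfolding b(2) a(3) sum_product by (rule sum.swap)
    finally show ?thesis .
  qed
  ultimately show ?thesis by simp
qed

lemma expansion_ex:
  assumes "f \<in> poly_fun (insert c A)"
  shows "\<exists>z. expansion A c \<xi> p w f z"
  using assms
proof induction
  case (coord d)
  then show ?case
    using expansion_monom[OF poly_fun.const, of 1 1] expansion_monom[OF poly_fun.coord, of d 0] by auto
next
  case (const a)
  then show ?case using expansion_monom[OF poly_fun.const, of a 0] by auto
qed (blast intro: expansion_add expansion_mult)+

end

text \<open>Only the expansion itself is wanted, so \<open>expansion_ex\<close> is used with the
  zero derivation.\<close>

lemma poly_fun_insert_ex:
  assumes "f \<in> poly_fun (insert c A)"
  shows "\<exists>n a. (\<forall>i. a i \<in> poly_fun A) \<and> f = (\<lambda>q. \<Sum>i\<le>(n::nat). a i q * c q ^ i)"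
proof -
  have "pder A undefined (\<lambda>_. 0)" by (simp add: pder_def)
  from expansion_ex[OF this assms, of 0] show ?thesis
    unfolding expansion_def by (elim exE conjE) (rule exI conjI | assumption)+
qed

lemma poly_fun_insertI:
  assumes "\<And>i. i \<le> n \<Longrightarrow> a i \<in> poly_fun A"
  shows "(\<lambda>q. \<Sum>i\<le>(n::nat). a i q * c q ^ i) \<in> poly_fun (insert c A)"
  by (intro poly_fun_sum poly_fun.mult poly_fun_power poly_fun_mono[OF subset_insertI assms])
     (auto intro: poly_fun.coord)

text \<open>Expansions in powers of \<open>c\<close> are not unique. By \<open>rel\<close>, the
  product rule formula gives 0 on every relation that holds on \<open>P\<close>. Two expansions of
  one function differ by a relation, so the formula is well defined; functions vanishing on
  \<open>P\<close> are sent to 0 for the same reason.\<close>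

lemma tang_extend:
  assumes xi: "\<xi> \<in> tang A P p" and p: "p \<in> P"
    and rel: "\<And>n a. (\<And>i. a i \<in> poly_fun A) \<Longrightarrow> (\<And>q. q \<in> P \<Longrightarrow> (\<Sum>i\<le>(n::nat). a i q * c q ^ i) = 0) \<Longrightarrow>
      (\<Sum>i\<le>n. \<xi> (a i) * c p ^ i + of_nat i * a i p * c p ^ (i - 1) * w) = 0"
  shows "\<exists>\<xi>'\<in>tang (insert c A) P p. (\<forall>f\<in>poly_fun A. \<xi>' f = \<xi> f) \<and> \<xi>' c = w"
proof -
  have pd: "pder A p \<xi>" using xi by (simp add: tang_def)
  have zero: "z = 0" if "expansion A c \<xi> p w f z" "\<And>q. q \<in> P \<Longrightarrow> f q = 0" for f z
    using that rel unfolding expansion_def by blast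
  have neg: "expansion A c \<xi> p w (\<lambda>q. - f q) (- z)" if "expansion A c \<xi> p w f z" for f z
    using expansion_mult[OF pd expansion_monom[OF pd poly_fun.const, of c w "-1" 0] that]
    by (simp add: pder_const[OF pd])
  have uniq: "z = y" if "expansion A c \<xi> p w f z" "expansion A c \<xi> p w f y" for f z y
    using zero[OF expansion_add[OF pd that(1) neg[OF that(2)]]] by simp
  define \<xi>' where "\<xi>' f = (if f \<in> poly_fun (insert c A) then THE z. expansion A c \<xi> p w f z else 0)" for f
  have E: "expansion A c \<xi> p w f (\<xi>' f)" if "f \<in> poly_fun (insert c A)" for f
  proof -
    from expansion_ex[OF pd that] obtain z where "expansion A c \<xi> p w f z" by blast
    then show ?thesis using that uniq by (auto simp: \<xi>'_def intro: theI2)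
  qed
  have val: "\<xi>' f = z" if "expansion A c \<xi> p w f z" "f \<in> poly_fun (insert c A)" for f z
    using uniq E that by blast
  have in_A: "\<xi>' f = \<xi> f" if "f \<in> poly_fun A" for f
    using val[of f "\<xi> f"] expansion_monom[OF pd that, of c w 0] poly_fun_mono[OF subset_insertI that] by simp
  have "pder (insert c A) p \<xi>'"
    unfolding pder_def
  proof (intro conjI ballI allI impI)
    fix f g assume fg: "f \<in> poly_fun (insert c A)" "g \<in> poly_fun (insert c A)"
    show "\<xi>' (\<lambda>q. f q + g q) = \<xi>' f + \<xi>' g"
      by (rule val[OF expansion_add[OF pd]]) (auto intro: E fg poly_fun.add)
    show "\<xi>' (\<lambda>q. f q * g q) = f p * \<xi>' g + g p * \<xi>' f"
      by (rule val[OF expansion_mult[OF pd]]) (auto intro: E fg poly_fun.mult)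
  next
    fix a show "\<xi>' (\<lambda>_. a) = 0" using in_A[OF poly_fun.const] pder_const[OF pd] by simp
  qed (simp add: \<xi>'_def)
  moreover have "\<xi>' f = 0" if "f \<in> poly_fun (insert c A)" "\<And>q. q \<in> P \<Longrightarrow> f q = 0" for f
    using E zero that by blast
  moreover have "\<xi>' c = w"
    using val[of c w] expansion_monom[OF pd poly_fun.const, of c w 1 1]
    by (simp add: pder_const[OF pd] poly_fun.coord)
  ultimately show ?thesis using in_A by (auto simp: tang_def intro!: bexI[of _ \<xi>'])
qed

text \<open>\<open>c\<close> is transcendental over \<open>poly_fun A\<close>, all functions being
  restricted to \<open>P\<close>.\<close>

definition transc :: "('p \<Rightarrow> complex) set \<Rightarrow> ('p \<Rightarrow> complex) \<Rightarrow> 'p set \<Rightarrow> bool" where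
  "transc A c P \<longleftrightarrow> (\<forall>n a. (\<forall>i. a i \<in> poly_fun A) \<and> (\<forall>q\<in>P. (\<Sum>i\<le>(n::nat). a i q * c q ^ i) = 0) \<longrightarrow>
     (\<forall>i\<le>n. \<forall>q\<in>P. a i q = 0))"

lemma tang_extend_transc:
  assumes xi: "\<xi> \<in> tang A P p" and p: "p \<in> P" and "transc A c P"
  shows "\<exists>\<xi>'\<in>tang (insert c A) P p. (\<forall>f\<in>poly_fun A. \<xi>' f = \<xi> f) \<and> \<xi>' c = w"
proof (rule tang_extend[OF xi p])
  fix n and a :: "nat \<Rightarrow> 'a \<Rightarrow> complex"
  assume a: "\<And>i. a i \<in> poly_fun A" "\<And>q. q \<in> P \<Longrightarrow> (\<Sum>i\<le>n. a i q * c q ^ i) = 0"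
  then have "a i q = 0" if "i \<le> n" "q \<in> P" for i q using assms(3) that unfolding transc_def by blast
  then show "(\<Sum>i\<le>n. \<xi> (a i) * c p ^ i + of_nat i * a i p * c p ^ (i - 1) * w) = 0"
    using xi a(1) p by (intro sum.neutral) (auto simp: tang_def)
qed

lemma irr_nonempty: "irr A P \<Longrightarrow> P \<noteq> {}"
  by (simp add: irr_def)

lemma irrD:
  "irr C P \<Longrightarrow> f \<in> poly_fun C \<Longrightarrow> g \<in> poly_fun C \<Longrightarrow> \<forall>q\<in>P. f q * g q = 0 \<Longrightarrow> \<exists>q\<in>P. f q \<noteq> 0 \<Longrightarrow> \<forall>q\<in>P. g q = 0"
  unfolding irr_def by blast

lemma irr_mono: "irr B P \<Longrightarrow> poly_fun A \<subseteq> poly_fun B \<Longrightarrow> irr A P"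
  unfolding irr_def by blast

lemma sum_shift_if:
  fixes F :: "nat \<Rightarrow> 'a::comm_monoid_add"
  shows "(\<Sum>i\<le>n + k. if k \<le> i then F i else 0) = (\<Sum>j\<le>n. F (j + k))"
proof -
  have "(\<Sum>i\<le>n + k. if k \<le> i then F i else 0) = (\<Sum>i\<in>{k..n + k}. F i)"
    by (intro sum.mono_neutral_cong_right) auto
  also have "\<dots> = (\<Sum>j\<le>n. F (j + k))"
    by (rule sum.reindex_bij_witness[of _ "\<lambda>j. j + k" "\<lambda>i. i - k"]) auto
  finally show ?thesis .
qed

text \<open>In characteristic 0 a relation of least degree \<open>n\<close> is separable: its formal
  derivative \<open>D\<close> has lower degree and so does not vanish identically on
  \<open>P\<close>. Where \<open>D\<close> and the leading coefficient are nonzero, differentiating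
  the relation forces the value \<open>w\<close> on \<open>c\<close>, and pseudo-division shows that
  all other relations are respected too.\<close>

lemma tang_extend_alg:
  assumes irr: "irr (insert c A) P" and nt: "\<not> transc A c P"
  shows "\<exists>g\<in>poly_fun (insert c A). (\<exists>q\<in>P. g q \<noteq> 0) \<and>
    (\<forall>p\<in>P. g p \<noteq> 0 \<longrightarrow> (\<forall>\<xi>\<in>tang A P p. \<exists>\<xi>'\<in>tang (insert c A) P p. \<forall>f\<in>poly_fun A. \<xi>' f = \<xi> f))"
proof -
  define Rel where "Rel n a \<longleftrightarrow> (\<forall>i. a i \<in> poly_fun A) \<and> (\<forall>q\<in>P. (\<Sum>i\<le>n. a i q * c q ^ i) = 0)" for n a
  define Bad where "Bad n \<longleftrightarrow> (\<exists>a. Rel n a \<and> (\<exists>i\<le>n. \<exists>q\<in>P. a i q \<noteq> 0))" for n :: nat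
  have ex: "\<exists>n. Bad n" using nt unfolding transc_def Bad_def Rel_def by blast
  define n where "n = (LEAST n. Bad n)"
  have "Bad n" unfolding n_def using ex by (metis LeastI_ex)
  then obtain a where a: "Rel n a" "\<exists>i\<le>n. \<exists>q\<in>P. a i q \<noteq> 0" unfolding Bad_def by blast
  have min: "\<And>q. q \<in> P \<Longrightarrow> b i q = 0" if "Rel m b" "m < n" "i \<le> m" for m b i
    using that not_less_Least[of m Bad] unfolding n_def Bad_def by blast
  have aA: "a i \<in> poly_fun A" for i using a(1) by (simp add: Rel_def)
  have az: "(\<Sum>i\<le>n. a i q * c q ^ i) = 0" if "q \<in> P" for q using a(1) that by (simp add: Rel_def)
  have n0: "n > 0"
  proof (rule ccontr)
    assume "\<not> n > 0"
    then have "n = 0" by simp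
    then show False using az a(2) by auto
  qed
  have top: "\<exists>q\<in>P. a n q \<noteq> 0"
  proof (rule ccontr)
    assume "\<not> (\<exists>q\<in>P. a n q \<noteq> 0)"
    then have top0: "\<And>q. q \<in> P \<Longrightarrow> a n q = 0" by blast
    obtain k where k: "n = Suc k" using n0 gr0_implies_Suc by blast
    have "Rel k a" using aA az top0 unfolding Rel_def k by simp
    then have "\<And>i q. i \<le> k \<Longrightarrow> q \<in> P \<Longrightarrow> a i q = 0" using min[of k a] k by blast
    then show False using a(2) top0 k le_Suc_eq by metis
  qed
  define D where "D q = (\<Sum>i\<le>n. of_nat i * a i q * c q ^ (i - 1))" for q
  have D_eq: "D q = (\<Sum>j\<le>n - 1. (of_nat (Suc j) * a (Suc j) q) * c q ^ j)" for q
  proof -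
    obtain k where k: "n = Suc k" using n0 gr0_implies_Suc by blast
    show ?thesis unfolding D_def k by (subst sum.atMost_Suc_shift) simp
  qed
  have D_in: "D \<in> poly_fun (insert c A)"
  proof -
    have "(\<lambda>q. \<Sum>j\<le>n - 1. (of_nat (Suc j) * a (Suc j) q) * c q ^ j) \<in> poly_fun (insert c A)"
      by (rule poly_fun_insertI) (rule poly_fun_cmult[OF aA])
    moreover have "D = (\<lambda>q. \<Sum>j\<le>n - 1. (of_nat (Suc j) * a (Suc j) q) * c q ^ j)" using D_eq by blast
    ultimately show ?thesis by simp
  qed
  have D_nz: "\<exists>q\<in>P. D q \<noteq> 0"
  proof (rule ccontr)
    assume "\<not> (\<exists>q\<in>P. D q \<noteq> 0)"
    then have "Rel (n - 1) (\<lambda>j q. of_nat (Suc j) * a (Suc j) q)"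
      unfolding Rel_def using poly_fun_cmult[OF aA] D_eq by auto
    from min[OF this, of "n - 1"] have "\<And>q. q \<in> P \<Longrightarrow> of_nat n * a n q = 0" using n0 by simp
    then show False using top n0 by simp
  qed
  define g where "g q = a n q * D q" for q
  have an_in: "a n \<in> poly_fun (insert c A)" using poly_fun_mono[OF _ aA] by blast
  have "g \<in> poly_fun (insert c A)" unfolding g_def by (rule poly_fun.mult[OF an_in D_in])
  moreover have "\<exists>q\<in>P. g q \<noteq> 0"
    using irrD[OF irr an_in D_in] top D_nz unfolding g_def by blast
  moreover have "\<exists>\<xi>'\<in>tang (insert c A) P p. \<forall>f\<in>poly_fun A. \<xi>' f = \<xi> f"
    if p: "p \<in> P" "g p \<noteq> 0" and xi: "\<xi> \<in> tang A P p" for p \<xi>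
  proof -
    have pd: "pder A p \<xi>" using xi by (simp add: tang_def)
    have Dp: "D p \<noteq> 0" and anp: "a n p \<noteq> 0" using p(2) by (auto simp: g_def)
    \<comment> \<open>The unique solution of \<open>\<delta> n a = 0\<close>.\<close>
    define w where "w = - (\<Sum>i\<le>n. \<xi> (a i) * c p ^ i) / D p"
    define \<delta> where "\<delta> N b = (\<Sum>i\<le>N. \<xi> (b i) * c p ^ i + of_nat i * b i p * c p ^ (i - 1) * w)" for N :: nat and b
    have \<delta>a: "\<delta> n a = 0"
    proof -
      have "\<delta> n a = (\<Sum>i\<le>n. \<xi> (a i) * c p ^ i) + D p * w"
        by (simp add: \<delta>_def D_def sum.distrib sum_distrib_right)
      then show ?thesis using Dp by (simp add: w_def)
    qed
    have main: "\<delta> N b = 0" if "Rel N b" for N b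
      using that
    proof (induction N arbitrary: b rule: less_induct)
      case (less N)
      have bA: "b i \<in> poly_fun A" for i using less.prems by (simp add: Rel_def)
      have bz: "(\<Sum>i\<le>N. b i q * c q ^ i) = 0" if "q \<in> P" for q using less.prems that by (simp add: Rel_def)
      show ?case
      proof (cases "N < n")
        case True
        then have "b i q = 0" if "i \<le> N" "q \<in> P" for i q using min[OF less.prems] that by blast
        then show ?thesis unfolding \<delta>_def
          using xi bA p by (intro sum.neutral) (auto simp: tang_def)
      next
        case False
        define k where "k = N - n"
        have N: "N = n + k" using False by (simp add: k_def)
        \<comment> \<open>Pseudo-division: \<open>a n\<close> times the relation \<open>b\<close>,
          minus \<open>b N * c ^ k\<close> times the minimal relation. The coefficient of index
          \<open>N\<close> cancels, so the induction hypothesis applies to what remains.\<close>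
        define b' where "b' i q = a n q * b i q - (if k \<le> i then b N q * a (i - k) q else 0)" for i q
        have b'A: "b' i \<in> poly_fun A" for i
          unfolding b'_def by (cases "k \<le> i") (auto intro!: poly_fun_diff poly_fun.mult aA bA)
        have b'N: "b' N = (\<lambda>_. 0)" by (auto simp: b'_def N)
        have "(\<Sum>i\<le>N. b' i q * c q ^ i) = 0" if q: "q \<in> P" for q
        proof -
          have "(\<Sum>i\<le>N. b' i q * c q ^ i) = a n q * (\<Sum>i\<le>N. b i q * c q ^ i) -
              (\<Sum>i\<le>n + k. if k \<le> i then b N q * a (i - k) q * c q ^ i else 0)"
            unfolding b'_def N by (simp add: sum_distrib_left sum_subtractf[symmetric] algebra_simps if_distrib cong: if_cong)
              (auto intro!: sum.cong simp: algebra_simps)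
          also have "(\<Sum>i\<le>n + k. if k \<le> i then b N q * a (i - k) q * c q ^ i else 0) = b N q * c q ^ k * (\<Sum>j\<le>n. a j q * c q ^ j)"
            unfolding sum_shift_if by (simp add: power_add sum_distrib_left algebra_simps)
          finally show ?thesis using bz[OF q] az[OF q] by simp
        qed
        moreover obtain M where M: "N = Suc M" using False n0 not0_implies_Suc[of N] by auto
        ultimately have "Rel M b'" using b'A b'N unfolding Rel_def by simp
        then have "\<delta> M b' = 0" using less.IH M by blast
        then have "\<delta> N b' = 0" using b'N by (simp add: \<delta>_def M pder_const[OF pd])
        \<comment> \<open>The terms by which the two sides differ are multiples of the two relations
          at \<open>p\<close> and of \<open>\<delta> n a\<close>, all of which are 0.\<close>
        moreover have "\<delta> N b' = a n p * \<delta> N b"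
        proof -
          have x1: "\<xi> (b' i) = (a n p * \<xi> (b i) + b i p * \<xi> (a n)) -
              (if k \<le> i then b N p * \<xi> (a (i - k)) + a (i - k) p * \<xi> (b N) else 0)" for i
          proof (cases "k \<le> i")
            case True
            then have "b' i = (\<lambda>q. a n q * b i q - b N q * a (i - k) q)" by (auto simp: b'_def)
            then show ?thesis using True
              by (simp add: pder_diff[OF pd] pder_mult[OF pd] aA bA poly_fun.mult)
          next
            case False
            then have "b' i = (\<lambda>q. a n q * b i q)" by (auto simp: b'_def)
            then show ?thesis using False by (simp add: pder_mult[OF pd] aA bA)
          qed
          have "\<delta> N b' = (a n p * \<delta> N b + \<xi> (a n) * (\<Sum>i\<le>N. b i p * c p ^ i)) -
             (\<Sum>i\<le>n + k. if k \<le> i then (b N p * \<xi> (a (i - k)) + a (i - k) p * \<xi> (b N)) * c p ^ i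
                 + of_nat i * (b N p * a (i - k) p) * c p ^ (i - 1) * w else 0)"
            unfolding \<delta>_def x1 b'_def N sum_distrib_left sum.distrib[symmetric] sum_subtractf[symmetric]
            by (intro sum.cong) (auto simp: algebra_simps)
          also have "(\<Sum>i\<le>n + k. if k \<le> i then (b N p * \<xi> (a (i - k)) + a (i - k) p * \<xi> (b N)) * c p ^ i
                 + of_nat i * (b N p * a (i - k) p) * c p ^ (i - 1) * w else 0)
             = (\<Sum>j\<le>n. (b N p * \<xi> (a j) + a j p * \<xi> (b N)) * c p ^ (j + k)
                 + of_nat (j + k) * (b N p * a j p) * c p ^ (j + k - 1) * w)"
            unfolding sum_shift_if by simp
          also have "\<dots> = b N p * c p ^ k * \<delta> n a + (\<xi> (b N) * c p ^ k + of_nat k * b N p * c p ^ (k - 1) * w) * (\<Sum>j\<le>n. a j p * c p ^ j)"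
            unfolding \<delta>_def sum_distrib_left sum.distrib[symmetric]
          proof (intro sum.cong refl)
            fix j
            have 1: "of_nat j * c p ^ (j + k - 1) = of_nat j * (c p ^ (j-1) * c p ^ k)"
              by (cases j) (auto simp: power_add)
            have 2: "of_nat k * c p ^ (j + k - 1) = of_nat k * (c p ^ j * c p ^ (k-1))"
              by (cases k) (auto simp: power_add)
            have "of_nat (j + k) * (b N p * a j p) * c p ^ (j + k - 1) * w =
               b N p * a j p * w * (of_nat j * c p ^ (j + k - 1)) + b N p * a j p * w * (of_nat k * c p ^ (j + k - 1))"
              by (simp add: algebra_simps)
            then show "(b N p * \<xi> (a j) + a j p * \<xi> (b N)) * c p ^ (j + k)
                 + of_nat (j + k) * (b N p * a j p) * c p ^ (j + k - 1) * w =
              b N p * c p ^ k * (\<xi> (a j) * c p ^ j + of_nat j * a j p * c p ^ (j - 1) * w) +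
              (\<xi> (b N) * c p ^ k + of_nat k * b N p * c p ^ (k - 1) * w) * (a j p * c p ^ j)"
              unfolding 1 2 by (simp add: power_add algebra_simps)
          qed
          finally show ?thesis using bz[OF p(1)] az[OF p(1)] \<delta>a by simp
        qed
        ultimately show ?thesis using anp by simp
      qed
    qed
    have "\<exists>\<xi>'\<in>tang (insert c A) P p. (\<forall>f\<in>poly_fun A. \<xi>' f = \<xi> f) \<and> \<xi>' c = w"
      by (rule tang_extend[OF xi p(1)]) (use main in \<open>simp add: Rel_def \<delta>_def\<close>)
    then show ?thesis by blast
  qed
  ultimately show ?thesis by blast
qed

text \<open>The generators are adjoined one at a time. Each algebraic one costs a function that must
  not vanish; irreducibility keeps the product of these functions nonzero on \<open>P\<close>, so
  derivations extend on a nonempty open part of \<open>P\<close>.\<close>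

theorem tang_extend_finite:
  assumes "finite B" "irr (B \<union> A) P"
  shows "\<exists>g\<in>poly_fun (B \<union> A). (\<exists>q\<in>P. g q \<noteq> 0) \<and>
    (\<forall>p\<in>P. g p \<noteq> 0 \<longrightarrow> (\<forall>\<xi>\<in>tang A P p. \<exists>\<xi>'\<in>tang (B \<union> A) P p. \<forall>f\<in>poly_fun A. \<xi>' f = \<xi> f))"
  using assms
proof (induction B rule: finite_induct)
  case empty
  then have "P \<noteq> {}" by (simp add: irr_nonempty)
  then show ?case by (intro bexI[of _ "\<lambda>_. 1"]) (auto intro: poly_fun.const)
next
  case (insert c B)
  let ?A = "B \<union> A"
  have irr: "irr (insert c ?A) P" using insert.prems by simp
  have "irr ?A P" using irr by (rule irr_mono) (use poly_fun_mono in blast)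
  then obtain g where g: "g \<in> poly_fun ?A" "\<exists>q\<in>P. g q \<noteq> 0"
    "\<And>p \<xi>. p \<in> P \<Longrightarrow> g p \<noteq> 0 \<Longrightarrow> \<xi> \<in> tang A P p \<Longrightarrow> \<exists>\<xi>'\<in>tang ?A P p. \<forall>f\<in>poly_fun A. \<xi>' f = \<xi> f"
    using insert.IH by blast
  obtain h where h: "h \<in> poly_fun (insert c ?A)" "\<exists>q\<in>P. h q \<noteq> 0"
    "\<And>p \<xi>. p \<in> P \<Longrightarrow> h p \<noteq> 0 \<Longrightarrow> \<xi> \<in> tang ?A P p \<Longrightarrow> \<exists>\<xi>'\<in>tang (insert c ?A) P p. \<forall>f\<in>poly_fun ?A. \<xi>' f = \<xi> f"
  proof (cases "transc ?A c P")
    case True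
    show ?thesis
    proof (rule that[of "\<lambda>_. 1"])
      show "\<exists>q\<in>P. (1::complex) \<noteq> 0" using irr_nonempty[OF irr] by auto
      fix p \<xi> assume "p \<in> P" "\<xi> \<in> tang ?A P p"
      from tang_extend_transc[OF this(2,1) True, of 0]
      show "\<exists>\<xi>'\<in>tang (insert c ?A) P p. \<forall>f\<in>poly_fun ?A. \<xi>' f = \<xi> f" by blast
    qed (rule poly_fun.const)
  next
    case False
    then show ?thesis using tang_extend_alg[OF irr] that by blast
  qed
  have gi: "g \<in> poly_fun (insert c ?A)" using poly_fun_mono[OF subset_insertI g(1)] .
  have 1: "(\<lambda>q. g q * h q) \<in> poly_fun (insert c ?A)" by (rule poly_fun.mult[OF gi h(1)])
  have 2: "\<exists>q\<in>P. g q * h q \<noteq> 0" using irrD[OF irr gi h(1)] h(2) g(2) by blast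
  have 3: "\<exists>\<xi>'\<in>tang (insert c ?A) P p. \<forall>f\<in>poly_fun A. \<xi>' f = \<xi> f"
    if p: "p \<in> P" "g p * h p \<noteq> 0" "\<xi> \<in> tang A P p" for p \<xi>
  proof -
    obtain \<eta> where \<eta>: "\<eta> \<in> tang ?A P p" "\<forall>f\<in>poly_fun A. \<eta> f = \<xi> f" using g(3)[of p \<xi>] p by auto
    then obtain \<zeta> where \<zeta>: "\<zeta> \<in> tang (insert c ?A) P p" "\<forall>f\<in>poly_fun ?A. \<zeta> f = \<eta> f" using h(3)[of p \<eta>] p by auto
    have "poly_fun A \<subseteq> poly_fun ?A" using poly_fun_mono by blast
    then show ?thesis using \<eta> \<zeta> by (metis subsetD)
  qed
  show ?case unfolding Un_insert_left
    by (rule bexI[of _ "\<lambda>q. g q * h q"], rule conjI[OF 2], intro ballI impI, rule 3, assumption+, rule 1)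
qed

subsection \<open>Chains of irreducible closed sets\<close>

definition fscale :: "complex \<Rightarrow> ('a \<Rightarrow> complex) \<Rightarrow> 'a \<Rightarrow> complex" where
  "fscale a f = (\<lambda>x. a * f x)"

interpretation cfun: vector_space "fscale :: complex \<Rightarrow> ('a \<Rightarrow> complex) \<Rightarrow> 'a \<Rightarrow> complex"
  by unfold_locales (auto simp: fscale_def fun_eq_iff algebra_simps)

lemma sum_fun_apply: "(\<Sum>i\<in>S. f i) x = (\<Sum>i\<in>S. f i x)"
  by (induction S rule: infinite_finite_induct) auto

text \<open>Evaluation on the dual elements \<open>f i\<close> shows that the \<open>\<xi> j\<close>
  are independent, so their number is bounded by that of a spanning set.\<close>

lemma dual_family_card:
  assumes B: "finite B" and \<xi>: "\<And>j. j < n \<Longrightarrow> \<xi> j \<in> cfun.span B"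
    and dual: "\<And>i j. i < n \<Longrightarrow> j < n \<Longrightarrow> \<xi> j (f i) = (if i = j then 1 else 0)"
  shows "n \<le> card B"
proof -
  have inj: "inj_on \<xi> {..<n}"
  proof (rule inj_onI)
    fix i j assume "i \<in> {..<n}" "j \<in> {..<n}" "\<xi> i = \<xi> j"
    then show "i = j" using dual[of i i] dual[of i j] by (auto split: if_splits)
  qed
  have "cfun.independent (\<xi> ` {..<n})"
  proof
    assume "cfun.dependent (\<xi> ` {..<n})"
    then obtain u where u: "\<exists>v\<in>\<xi> ` {..<n}. u v \<noteq> 0" "(\<Sum>v\<in>\<xi> ` {..<n}. fscale (u v) v) = 0"
      by (subst (asm) cfun.dependent_finite) auto
    then obtain i where i: "i < n" "u (\<xi> i) \<noteq> 0" by auto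
    have "(\<Sum>j<n. fscale (u (\<xi> j)) (\<xi> j)) = 0"
      using u(2) by (simp add: sum.reindex[OF inj])
    then have "(\<Sum>j<n. fscale (u (\<xi> j)) (\<xi> j)) (f i) = 0" by simp
    then have "(\<Sum>j<n. u (\<xi> j) * \<xi> j (f i)) = 0" by (simp add: sum_fun_apply fscale_def)
    also have "(\<Sum>j<n. u (\<xi> j) * \<xi> j (f i)) = (\<Sum>j<n. if j = i then u (\<xi> j) else 0)"
      using dual i(1) by (intro sum.cong) auto
    finally show False using i by simp
  qed
  then have "card (\<xi> ` {..<n}) \<le> card B"
    using cfun.independent_span_bound[OF B] \<xi> by (metis (no_types, lifting) image_subsetI lessThan_iff)
  then show ?thesis by (simp add: card_image[OF inj])
qed

lemma closedin_sub_zariski: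
  "closedin (subtopology (zariski C) S) Z \<longleftrightarrow> (\<exists>F\<subseteq>poly_fun C. Z = {q\<in>S. \<forall>f\<in>F. f q = 0})"
proof -
  have eq: "zero_set F \<inter> S = {q\<in>S. \<forall>f\<in>F. f q = 0}" for F by (auto simp: zero_set_def)
  have "closedin (subtopology (zariski C) S) Z \<longleftrightarrow> (\<exists>F\<subseteq>poly_fun C. Z = zero_set F \<inter> S)"
    unfolding closedin_subtopology closedin_zariski by auto
  then show ?thesis by (simp only: eq)
qed

lemma irreducible_space_iff_irr: "irreducible_space (subtopology (zariski C) S) \<longleftrightarrow> irr C S"
proof
  assume L: "irreducible_space (subtopology (zariski C) S)"
  show "irr C S"
    unfolding irr_def
  proof (intro conjI ballI impI)
    show "S \<noteq> {}" using L by (simp add: irreducible_space_def)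
    fix f g assume fg: "f \<in> poly_fun C" "g \<in> poly_fun C" "\<forall>q\<in>S. f q * g q = 0"
    have "closedin (subtopology (zariski C) S) {q\<in>S. f q = 0}" "closedin (subtopology (zariski C) S) {q\<in>S. g q = 0}"
      unfolding closedin_sub_zariski using fg by (auto intro: exI[of _ "{f}"] exI[of _ "{g}"])
    moreover have "{q\<in>S. f q = 0} \<union> {q\<in>S. g q = 0} = S" using fg(3) by auto
    ultimately have "{q\<in>S. f q = 0} = S \<or> {q\<in>S. g q = 0} = S"
      using L unfolding irreducible_space_def by simp
    then show "(\<forall>q\<in>S. f q = 0) \<or> (\<forall>q\<in>S. g q = 0)" by blast
  qed
next
  assume R: "irr C S"
  show "irreducible_space (subtopology (zariski C) S)"
    unfolding irreducible_space_def
  proof (intro conjI allI impI)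
    show "topspace (subtopology (zariski C) S) \<noteq> {}" using R by (simp add: irr_def)
    fix A B
    assume AB: "closedin (subtopology (zariski C) S) A \<and> closedin (subtopology (zariski C) S) B
      \<and> A \<union> B = topspace (subtopology (zariski C) S)"
    obtain F where F: "F \<subseteq> poly_fun C" "A = {q\<in>S. \<forall>f\<in>F. f q = 0}"
      using AB[unfolded closedin_sub_zariski] by (elim conjE exE) (rule that)
    obtain H where H: "H \<subseteq> poly_fun C" "B = {q\<in>S. \<forall>f\<in>H. f q = 0}"
      using AB[unfolded closedin_sub_zariski] by (elim conjE exE) (rule that)
    have U: "A \<union> B = S" using AB by simp
    have "A = S \<or> B = S"
    proof (rule ccontr)
      assume "\<not> (A = S \<or> B = S)"
      then obtain f h a b where *: "f \<in> F" "h \<in> H" "a \<in> S" "b \<in> S" "f a \<noteq> 0" "h b \<noteq> 0"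
        using F(2) H(2) by blast
      have "\<forall>q\<in>S. f q * h q = 0" using U F(2) H(2) *(1,2) by auto
      moreover have "f \<in> poly_fun C" "h \<in> poly_fun C" using * F(1) H(1) by auto
      ultimately show False using irrD[OF R, of f h] *(3-6) by blast
    qed
    then show "A = topspace (subtopology (zariski C) S) \<or> B = topspace (subtopology (zariski C) S)" by simp
  qed
qed

text \<open>The chains in the definition of Krull dimension, with closedness and irreducibility
  spelled out by functions. The condition \<open>irr C (Z i)\<close> does not refer to the
  surrounding space \<open>S\<close>.\<close>

definition zchain :: "('p \<Rightarrow> complex) set \<Rightarrow> 'p set \<Rightarrow> nat \<Rightarrow> (nat \<Rightarrow> 'p set) \<Rightarrow> bool" where
  "zchain C S n Z \<longleftrightarrow> (\<forall>i\<le>n. irr C (Z i) \<and> (\<exists>F\<subseteq>poly_fun C. Z i = {q\<in>S. \<forall>f\<in>F. f q = 0})) \<and>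
     (\<forall>i<n. Z i \<subset> Z (Suc i))"

lemma krull_dim_zariski: "krull_dim (subtopology (zariski C) S) = Sup {enat n | n. \<exists>Z. zchain C S n Z}"
proof -
  have "(\<forall>i\<le>n. closedin (subtopology (zariski C) S) (Z i) \<and>
        irreducible_space (subtopology (subtopology (zariski C) S) (Z i))) \<and>
     (\<forall>i<n. Z i \<subset> Z (Suc i)) \<longleftrightarrow> zchain C S n Z" for n Z
  proof -
    have "closedin (subtopology (zariski C) S) A \<and> irreducible_space (subtopology (subtopology (zariski C) S) A) \<longleftrightarrow>
      irr C A \<and> (\<exists>F\<subseteq>poly_fun C. A = {q\<in>S. \<forall>f\<in>F. f q = 0})" for A
    proof (cases "A \<subseteq> S")
      case True
      then have "subtopology (subtopology (zariski C) S) A = subtopology (zariski C) A"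
        by (simp add: subtopology_subtopology inf.absorb2)
      then show ?thesis by (simp only: closedin_sub_zariski irreducible_space_iff_irr conj_commute)
    next
      case False
      then have "\<not> (\<exists>F\<subseteq>poly_fun C. A = {q\<in>S. \<forall>f\<in>F. f q = 0})" by blast
      then show ?thesis by (simp only: closedin_sub_zariski simp_thms)
    qed
    then show ?thesis unfolding zchain_def by (simp only:)
  qed
  then show ?thesis unfolding krull_dim_def by simp
qed

lemma krull_dim_geI: "zchain C S n Z \<Longrightarrow> enat n \<le> krull_dim (subtopology (zariski C) S)"
  unfolding krull_dim_zariski by (rule Sup_upper) blast

lemma krull_dim_leI: "(\<And>n Z. zchain C S n Z \<Longrightarrow> n \<le> e) \<Longrightarrow> krull_dim (subtopology (zariski C) S) \<le> enat e"
  unfolding krull_dim_zariski by (rule Sup_least) auto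

lemma tang_cong: "poly_fun A = poly_fun B \<Longrightarrow> tang A P p = tang B P p"
  by (simp add: tang_def pder_def)

text \<open>Choose \<open>f i\<close> zero on \<open>Z i\<close> but not on
  \<open>Z (Suc i)\<close>. A relation for \<open>f k\<close> on \<open>Z (Suc k)\<close> loses its
  constant coefficient on restriction to \<open>Z k\<close>, and irreducibility of
  \<open>Z (Suc k)\<close> allows division by \<open>f k\<close>; thus all coefficients vanish. The
  set \<open>P\<close> has to be dense in \<open>S\<close>, which later permits \<open>S\<close> to
  be larger than the set whose tangent spaces are known.\<close>

lemma chain_transc:
  assumes ch: "zchain C S n Z" and SP: "\<forall>f\<in>poly_fun C. (\<forall>p\<in>P. f p = 0) \<longrightarrow> (\<forall>q\<in>S. f q = 0)"
  shows "\<exists>f. \<forall>i<n. f i \<in> poly_fun C \<and> transc (f ` {..<i}) (f i) P"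
proof -
  have Zirr: "irr C (Z i)" if "i \<le> n" for i using ch that by (simp add: zchain_def)
  have Zcl: "\<exists>F\<subseteq>poly_fun C. Z i = {q\<in>S. \<forall>f\<in>F. f q = 0}" if "i \<le> n" for i using ch that unfolding zchain_def by blast
  have ZS: "Z i \<subseteq> S" if "i \<le> n" for i using Zcl[OF that] by blast
  have Zlt: "Z i \<subset> Z (Suc i)" if "i < n" for i using ch that unfolding zchain_def by blast
  have Zinc: "Z i \<subseteq> Z (Suc i)" if "i < n" for i using Zlt[OF that] by blast
  have "\<exists>f. f \<in> poly_fun C \<and> (\<forall>q\<in>Z i. f q = 0) \<and> (\<exists>q\<in>Z (Suc i). f q \<noteq> 0)" if i: "i < n" for i
  proof -
    obtain F where F: "F \<subseteq> poly_fun C" "Z i = {q\<in>S. \<forall>f\<in>F. f q = 0}" using Zcl[of i] i by auto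
    obtain q where q: "q \<in> Z (Suc i)" "q \<notin> Z i" using Zlt[OF i] by blast
    then have "q \<in> S" using ZS[of "Suc i"] i by auto
    then obtain f where "f \<in> F" "f q \<noteq> 0" using F(2) q(2) by blast
    then show ?thesis using F q(1) by blast
  qed
  then obtain f where f: "\<And>i. i < n \<Longrightarrow> f i \<in> poly_fun C" "\<And>i q. i < n \<Longrightarrow> q \<in> Z i \<Longrightarrow> f i q = 0"
     "\<And>i. i < n \<Longrightarrow> \<exists>q\<in>Z (Suc i). f i q \<noteq> 0" by metis
  have sub: "poly_fun (f ` {..<k}) \<subseteq> poly_fun C" if "k \<le> n" for k
    using poly_fun_absorb[of "f ` {..<k}" C] f(1) that poly_fun_mono[of "f ` {..<k}" "f ` {..<k} \<union> C"] by fastforce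
  \<comment> \<open>\<open>IH\<close> is passed as a premise because the argument serves twice:
    inside the induction for \<open>inj\<close>, and afterwards for the relations on
    \<open>P\<close>.\<close>
  have coef: "\<forall>j\<le>m. \<forall>q. a j q = 0"
    if k: "k < n" and IH: "\<And>a. a \<in> poly_fun (f ` {..<k}) \<Longrightarrow> (\<forall>q\<in>Z k. a q = 0) \<Longrightarrow> \<forall>q. a q = 0"
      and a: "\<And>j. a j \<in> poly_fun (f ` {..<k})" and z: "\<forall>q\<in>Z (Suc k). (\<Sum>j\<le>m. a j q * f k q ^ j) = 0"
    for k m and a :: "nat \<Rightarrow> 'a \<Rightarrow> complex"
    using a z
  proof (induction m arbitrary: a)
    case 0
    then have "\<forall>q\<in>Z k. a 0 q = 0" using Zinc[OF k] by auto
    then show ?case using IH[OF 0(1)] by simp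
  next
    case (Suc m)
    have split: "(\<Sum>j\<le>Suc m. a j q * f k q ^ j) = a 0 q + f k q * (\<Sum>j\<le>m. a (Suc j) q * f k q ^ j)" for q
      by (subst sum.atMost_Suc_shift) (simp add: sum_distrib_left algebra_simps)
    have "\<forall>q\<in>Z k. a 0 q = 0" using Suc.prems(2) Zinc[OF k] f(2)[OF k] unfolding split by fastforce
    then have a0: "\<forall>q. a 0 q = 0" using IH[OF Suc.prems(1)] by simp
    then have 1: "\<forall>q\<in>Z (Suc k). f k q * (\<Sum>j\<le>m. a (Suc j) q * f k q ^ j) = 0"
      using Suc.prems(2) unfolding split by simp
    have 2: "(\<lambda>q. \<Sum>j\<le>m. a (Suc j) q * f k q ^ j) \<in> poly_fun C"
      using sub[of k] k Suc.prems(1) f(1)[OF k] by (intro poly_fun_sum poly_fun.mult poly_fun_power) auto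
    have 3: "irr C (Z (Suc k))" using Zirr k by simp
    have "\<forall>q\<in>Z (Suc k). (\<Sum>j\<le>m. a (Suc j) q * f k q ^ j) = 0"
      by (rule irrD[OF 3 f(1)[OF k] 2 1 f(3)[OF k]])
    then have "\<forall>j\<le>m. \<forall>q. a (Suc j) q = 0" by (intro Suc.IH Suc.prems(1))
    with a0 have "a j q = 0" if "j \<le> Suc m" for j q using that by (cases j) simp_all
    then show ?case by blast
  qed
  have inj: "\<forall>q. a q = 0" if "k \<le> n" "a \<in> poly_fun (f ` {..<k})" "\<forall>q\<in>Z k. a q = 0" for k a
    using that
  proof (induction k arbitrary: a)
    case 0
    then have "a \<in> poly_fun {}" by simp
    then have "\<exists>b. a = (\<lambda>_. b)" by induction auto
    then show ?case using 0 Zirr[of 0] by (auto simp: irr_def)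
  next
    case (Suc k)
    have "a \<in> poly_fun (insert (f k) (f ` {..<k}))" using Suc.prems(2) by (simp add: lessThan_Suc)
    then obtain m b where b: "\<And>i. b i \<in> poly_fun (f ` {..<k})" "a = (\<lambda>q. \<Sum>i\<le>(m::nat). b i q * f k q ^ i)"
      using poly_fun_insert_ex by blast
    have z: "\<forall>q\<in>Z (Suc k). (\<Sum>j\<le>m. b j q * f k q ^ j) = 0" using Suc.prems(3) unfolding b(2) .
    have IH: "\<And>a. a \<in> poly_fun (f ` {..<k}) \<Longrightarrow> (\<forall>q\<in>Z k. a q = 0) \<Longrightarrow> \<forall>q. a q = 0"
      by (rule Suc.IH) (use Suc.prems(1) in auto)
    have k: "k < n" using Suc.prems(1) by simp
    have *: "\<forall>j\<le>m. \<forall>q. b j q = 0" by (rule coef[where k=k and a=b and m=m, OF k IH b(1) z])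
    show ?case unfolding b(2)
    proof
      fix q show "(\<Sum>i\<le>m. b i q * f k q ^ i) = 0" by (rule sum.neutral) (use * in simp)
    qed
  qed
  have "transc (f ` {..<k}) (f k) P" if k: "k < n" for k
    unfolding transc_def
  proof (intro allI impI, elim conjE)
    fix m a i assume a: "\<forall>i. a i \<in> poly_fun (f ` {..<k})" "\<forall>q\<in>P. (\<Sum>i\<le>m. a i q * f k q ^ i) = 0" and i: "i \<le> m"
    have aC: "a i \<in> poly_fun C" for i using sub[of k] k a(1) by auto
    have "(\<lambda>q. \<Sum>i\<le>m. a i q * f k q ^ i) \<in> poly_fun C"
      by (intro poly_fun_sum poly_fun.mult poly_fun_power aC f(1) k)
    from bspec[OF SP this] a(2) have "\<forall>q\<in>S. (\<Sum>i\<le>m. a i q * f k q ^ i) = 0" by blast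
    then have z: "\<forall>q\<in>Z (Suc k). (\<Sum>i\<le>m. a i q * f k q ^ i) = 0" using ZS[of "Suc k"] k by auto
    have IH: "\<And>a. a \<in> poly_fun (f ` {..<k}) \<Longrightarrow> (\<forall>q\<in>Z k. a q = 0) \<Longrightarrow> \<forall>q. a q = 0"
      by (rule inj) (use k in auto)
    have "\<forall>j\<le>m. \<forall>q. a j q = 0"
      by (rule coef[where k=k and a=a and m=m, OF k IH _ z]) (use a(1) in simp_all)
    then show "\<forall>q\<in>P. a i q = 0" using i by blast
  qed
  with f(1) show ?thesis by (intro exI[of _ f]) simp
qed

text \<open>Values on the independent functions \<open>f i\<close> can be prescribed freely for
  derivations of the algebra they generate. At a generic point of \<open>P\<close> such derivations
  extend to all coordinates, which gives \<open>n\<close> independent vectors in one tangent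
  space.\<close>

theorem chain_length_le:
  assumes C: "finite C" and P: "irr C P"
    and ch: "zchain C S n Z" and SP: "\<forall>f\<in>poly_fun C. (\<forall>p\<in>P. f p = 0) \<longrightarrow> (\<forall>q\<in>S. f q = 0)"
    and T: "\<And>p. p \<in> P \<Longrightarrow> \<exists>B. finite B \<and> card B \<le> e \<and> tang C P p \<subseteq> cfun.span B"
  shows "n \<le> e"
proof -
  obtain f where f: "\<And>i. i < n \<Longrightarrow> f i \<in> poly_fun C" "\<And>i. i < n \<Longrightarrow> transc (f ` {..<i}) (f i) P"
    using chain_transc[OF ch SP] by blast
  have ex: "\<exists>\<xi>\<in>tang (f ` {..<k}) P p. \<forall>i<k. \<xi> (f i) = w i" if p: "p \<in> P" and "k \<le> n" for p k w
    using that(2)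
  proof (induction k)
    case 0
    have "(\<lambda>_. 0) \<in> tang {} P p" by (simp add: tang_def pder_def)
    then show ?case by auto
  next
    case (Suc k)
    then obtain \<xi> where \<xi>: "\<xi> \<in> tang (f ` {..<k}) P p" "\<forall>i<k. \<xi> (f i) = w i" by auto
    obtain \<xi>' where \<xi>': "\<xi>' \<in> tang (insert (f k) (f ` {..<k})) P p" "\<forall>g\<in>poly_fun (f ` {..<k}). \<xi>' g = \<xi> g" "\<xi>' (f k) = w k"
      using tang_extend_transc[OF \<xi>(1) p f(2)[of k], where w="w k"] Suc.prems by auto
    have "f i \<in> poly_fun (f ` {..<k})" if "i < k" for i using that by (intro poly_fun.coord) auto
    then have "\<forall>i<Suc k. \<xi>' (f i) = w i" using \<xi>(2) \<xi>' by (auto simp: less_Suc_eq)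
    then show ?case using \<xi>'(1) by (auto simp: lessThan_Suc)
  qed
  have eq: "poly_fun (C \<union> f ` {..<n}) = poly_fun C"
    using poly_fun_absorb[of "f ` {..<n}" C] f(1) by (auto simp: Un_commute)
  then have "irr (C \<union> f ` {..<n}) P" using P by (simp add: irr_def)
  from tang_extend_finite[OF C this]
  obtain p where p: "p \<in> P" "\<And>\<xi>. \<xi> \<in> tang (f ` {..<n}) P p \<Longrightarrow> \<exists>\<xi>'\<in>tang (C \<union> f ` {..<n}) P p. \<forall>g\<in>poly_fun (f ` {..<n}). \<xi>' g = \<xi> g"
    by blast
  have "\<exists>\<xi>\<in>tang C P p. \<forall>i<n. \<xi> (f i) = w i" for w
  proof -
    obtain \<xi> where \<xi>: "\<xi>\<in>tang (f ` {..<n}) P p" "\<forall>i<n. \<xi> (f i) = w i" using ex[OF p(1), of n] by blast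
    obtain \<xi>' where \<xi>': "\<xi>'\<in>tang C P p" "\<forall>g\<in>poly_fun (f ` {..<n}). \<xi>' g = \<xi> g"
      using p(2)[OF \<xi>(1)] tang_cong[OF eq] by auto
    have "\<forall>i<n. \<xi>' (f i) = w i" using \<xi>'(2) \<xi>(2) by (simp add: poly_fun.coord)
    then show ?thesis using \<xi>'(1) by blast
  qed
  then have "\<forall>j. \<exists>\<xi>\<in>tang C P p. \<forall>i<n. \<xi> (f i) = (if i = j then 1 else 0)" by auto
  then obtain \<xi> where \<xi>: "\<And>j. \<xi> j \<in> tang C P p" "\<And>i j. i < n \<Longrightarrow> \<xi> j (f i) = (if i = j then 1 else 0)" by metis
  obtain B where B: "finite B" "card B \<le> e" "tang C P p \<subseteq> cfun.span B" using T[OF p(1)] by blast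
  have "n \<le> card B" by (rule dual_family_card[OF B(1), of n \<xi> f]) (use \<xi> B(3) in auto)
  then show ?thesis using B(2) by simp
qed

subsection \<open>Irreducible images and flows\<close>

lemma pder_scaled_sum:
  assumes "\<And>i. i \<in> S \<Longrightarrow> pder A p (\<xi> i)"
  shows "pder A p (\<Sum>i\<in>S. fscale (w i) (\<xi> i))"
  using assms
proof (induction S rule: infinite_finite_induct)
  case (insert i S)
  then show ?case
    by (simp add: pder_def fscale_def algebra_simps)
qed (simp_all add: pder_def)

lemma poly_fun_pullback:
  assumes "h \<in> poly_fun ((\<lambda>c r. c (\<Phi> r)) ` C)"
  shows "\<exists>f\<in>poly_fun C. h = (\<lambda>r. f (\<Phi> r))"
  using assms
proof induction
  case (coord c)
  then show ?case by (auto intro: poly_fun.coord)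
next
  case (const a)
  then show ?case by (intro bexI[of _ "\<lambda>_. a"]) (auto intro: poly_fun.const)
next
  case (add f g)
  then obtain f' g' where "f' \<in> poly_fun C" "g' \<in> poly_fun C" "f = (\<lambda>r. f' (\<Phi> r))" "g = (\<lambda>r. g' (\<Phi> r))" by blast
  then show ?case by (intro bexI[of _ "\<lambda>q. f' q + g' q"]) (auto intro: poly_fun.add)
next
  case (mult f g)
  then obtain f' g' where "f' \<in> poly_fun C" "g' \<in> poly_fun C" "f = (\<lambda>r. f' (\<Phi> r))" "g = (\<lambda>r. g' (\<Phi> r))" by blast
  then show ?case by (intro bexI[of _ "\<lambda>q. f' q * g' q"]) (auto intro: poly_fun.mult)
qed

lemma poly_fun_pushforward:
  "f \<in> poly_fun C \<Longrightarrow> (\<lambda>r. f (\<Phi> r)) \<in> poly_fun ((\<lambda>c r. c (\<Phi> r)) ` C)"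
  by (rule poly_fun_subst) (auto intro: poly_fun.coord)

text \<open>The differential of a map onto its image is surjective at a generic point in
  characteristic 0. Functions on the image are identified with the subalgebra of their pullbacks,
  and \<open>tang_extend_finite\<close> extends derivations from it.\<close>

theorem tang_pullback:
  assumes "finite B" "irr B P" and sub: "\<And>c. c \<in> C \<Longrightarrow> (\<lambda>q. c (\<Phi> q)) \<in> poly_fun B"
  shows "\<exists>q\<in>P. \<forall>\<xi>\<in>tang C (\<Phi> ` P) (\<Phi> q). \<exists>\<zeta>\<in>tang B P q. \<forall>f\<in>poly_fun C. \<zeta> (\<lambda>r. f (\<Phi> r)) = \<xi> f"
proof -
  define A where "A = (\<lambda>c r. c (\<Phi> r)) ` C"
  have eq: "poly_fun (B \<union> A) = poly_fun B"
    using poly_fun_absorb[of A B] sub by (auto simp: A_def Un_commute)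
  have "irr (B \<union> A) P" using assms(2) by (simp add: irr_def eq)
  from tang_extend_finite[OF assms(1) this]
  obtain q where q: "q \<in> P" "\<And>\<xi>. \<xi> \<in> tang A P q \<Longrightarrow> \<exists>\<xi>'\<in>tang (B \<union> A) P q. \<forall>f\<in>poly_fun A. \<xi>' f = \<xi> f"
    by blast
  have "\<exists>\<zeta>\<in>tang B P q. \<forall>f\<in>poly_fun C. \<zeta> (\<lambda>r. f (\<Phi> r)) = \<xi> f" if xi: "\<xi> \<in> tang C (\<Phi> ` P) (\<Phi> q)" for \<xi>
  proof -
    have pd: "pder C (\<Phi> q) \<xi>" using xi by (simp add: tang_def)
    \<comment> \<open>The choice of \<open>f\<close> is immaterial: two candidates agree on the
      image of \<open>P\<close>, and \<open>\<xi>\<close> kills their difference.\<close>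
    define \<eta> where "\<eta> h = (if h \<in> poly_fun A then \<xi> (SOME f. f \<in> poly_fun C \<and> h = (\<lambda>r. f (\<Phi> r))) else 0)" for h
    have agree: "\<xi> f = \<xi> g" if "f \<in> poly_fun C" "g \<in> poly_fun C" "\<And>r. r \<in> P \<Longrightarrow> f (\<Phi> r) = g (\<Phi> r)" for f g
    proof -
      have "(\<lambda>r. f r - g r) \<in> poly_fun C" using that by (intro poly_fun_diff)
      moreover have "\<forall>r\<in>\<Phi> ` P. f r - g r = 0" using that(3) by auto
      ultimately have "\<xi> (\<lambda>r. f r - g r) = 0" using xi by (simp add: tang_def)
      then show ?thesis using pder_diff[OF pd that(1,2)] by simp
    qed
    have \<eta>: "\<eta> (\<lambda>r. f (\<Phi> r)) = \<xi> f" if f: "f \<in> poly_fun C" for f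
    proof -
      let ?g = "SOME g. g \<in> poly_fun C \<and> (\<lambda>r. f (\<Phi> r)) = (\<lambda>r. g (\<Phi> r))"
      have "?g \<in> poly_fun C \<and> (\<lambda>r. f (\<Phi> r)) = (\<lambda>r. ?g (\<Phi> r))"
        by (rule someI[of _ f]) (simp add: f)
      then have "\<xi> f = \<xi> ?g" by (intro agree f) (auto dest: fun_cong)
      then show ?thesis using poly_fun_pushforward[OF f, of \<Phi>] by (simp add: \<eta>_def A_def)
    qed
    have "\<eta> \<in> tang A P q"
      unfolding tang_def pder_def
    proof (intro CollectI conjI ballI allI impI)
      show "\<And>a. \<eta> (\<lambda>_. a) = 0" using \<eta>[OF poly_fun.const] pder_const[OF pd] by simp
      fix f g assume "f \<in> poly_fun A" "g \<in> poly_fun A"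
      then obtain f' g' where fg: "f' \<in> poly_fun C" "g' \<in> poly_fun C" "f = (\<lambda>r. f' (\<Phi> r))" "g = (\<lambda>r. g' (\<Phi> r))"
        unfolding A_def using poly_fun_pullback[of _ \<Phi> C] by metis
      show "\<eta> (\<lambda>q. f q + g q) = \<eta> f + \<eta> g" "\<eta> (\<lambda>r. f r * g r) = f q * \<eta> g + g q * \<eta> f"
        using \<eta>[OF poly_fun.add[OF fg(1,2)]] \<eta>[OF poly_fun.mult[OF fg(1,2)]]
        by (simp_all add: fg \<eta> pder_add[OF pd] pder_mult[OF pd])
    next
      fix f assume "f \<in> poly_fun A" "\<forall>q\<in>P. f q = 0"
      then obtain f' where "f' \<in> poly_fun C" "f = (\<lambda>r. f' (\<Phi> r))" "\<And>r. r \<in> P \<Longrightarrow> f' (\<Phi> r) = 0"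
        unfolding A_def using poly_fun_pullback[of _ \<Phi> C] by metis
      then show "\<eta> f = 0" using \<eta>[of f'] agree[OF _ poly_fun.const, of f' 0] pder_const[OF pd] by simp
    qed (simp add: \<eta>_def)
    then obtain \<zeta> where \<zeta>: "\<zeta> \<in> tang (B \<union> A) P q" "\<forall>f\<in>poly_fun A. \<zeta> f = \<eta> f" using q(2)[of \<eta>] by auto
    have "\<zeta> (\<lambda>r. f (\<Phi> r)) = \<xi> f" if "f \<in> poly_fun C" for f
      using \<zeta>(2) \<eta>[OF that] poly_fun_pushforward[OF that, of \<Phi>] by (simp add: A_def)
    then show ?thesis using \<zeta>(1) tang_cong[OF eq] by auto
  qed
  with q(1) show ?thesis by auto
qed

definition vel :: "('p \<Rightarrow> complex) set \<Rightarrow> (complex \<Rightarrow> 'p) \<Rightarrow> ('p \<Rightarrow> complex) \<Rightarrow> complex" where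
  "vel C \<kappa> f = (if f \<in> poly_fun C then deriv (\<lambda>\<tau>. f (\<kappa> \<tau>)) 0 else 0)"

lemma poly_fun_curve_differentiable:
  assumes "f \<in> poly_fun C" "\<And>c. c \<in> C \<Longrightarrow> (\<lambda>\<tau>. c (\<kappa> \<tau>)) field_differentiable at 0"
  shows "(\<lambda>\<tau>. f (\<kappa> \<tau>)) field_differentiable at (0::complex)"
  using assms by (induction) (auto intro: derivative_intros field_differentiable_add field_differentiable_mult)

lemma pder_vel:
  assumes "\<And>c. c \<in> C \<Longrightarrow> (\<lambda>\<tau>. c (\<kappa> \<tau>)) field_differentiable at 0"
  shows "pder C (\<kappa> 0) (vel C \<kappa>)"
  unfolding pder_def
proof (intro conjI ballI allI impI)
  fix f g assume fg: "f \<in> poly_fun C" "g \<in> poly_fun C"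
  have d: "(\<lambda>\<tau>. f (\<kappa> \<tau>)) field_differentiable at 0" "(\<lambda>\<tau>. g (\<kappa> \<tau>)) field_differentiable at 0"
    using fg assms by (auto intro: poly_fun_curve_differentiable)
  show "vel C \<kappa> (\<lambda>q. f q + g q) = vel C \<kappa> f + vel C \<kappa> g"
    using fg d by (simp add: vel_def poly_fun.add)
  show "vel C \<kappa> (\<lambda>q. f q * g q) = f (\<kappa> 0) * vel C \<kappa> g + g (\<kappa> 0) * vel C \<kappa> f"
    using fg d by (simp add: vel_def poly_fun.mult)
qed (simp_all add: vel_def)

lemma irr_disj:
  "irr C P \<Longrightarrow> f \<in> poly_fun C \<Longrightarrow> g \<in> poly_fun C \<Longrightarrow> \<forall>q\<in>P. f q * g q = 0 \<Longrightarrow>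
    (\<forall>q\<in>P. f q = 0) \<or> (\<forall>q\<in>P. g q = 0)"
  by (simp only: irr_def)

lemma irr_image:
  assumes "irr B P" "\<And>c. c \<in> C \<Longrightarrow> \<exists>g\<in>poly_fun B. \<forall>q\<in>P. c (\<Phi> q) = g q"
  shows "irr C (\<Phi> ` P)"
proof -
  have pull: "\<exists>g\<in>poly_fun B. \<forall>q\<in>P. f (\<Phi> q) = g q" if "f \<in> poly_fun C" for f
    using that
  proof induction
    case (add f g)
    then obtain f' g' where "f' \<in> poly_fun B" "g' \<in> poly_fun B" "\<forall>q\<in>P. f (\<Phi> q) = f' q" "\<forall>q\<in>P. g (\<Phi> q) = g' q" by blast
    then show ?case by (intro bexI[of _ "\<lambda>q. f' q + g' q"]) (auto intro: poly_fun.add)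
  next
    case (mult f g)
    then obtain f' g' where "f' \<in> poly_fun B" "g' \<in> poly_fun B" "\<forall>q\<in>P. f (\<Phi> q) = f' q" "\<forall>q\<in>P. g (\<Phi> q) = g' q" by blast
    then show ?case by (intro bexI[of _ "\<lambda>q. f' q * g' q"]) (auto intro: poly_fun.mult)
  next
    case (const a)
    then show ?case by (intro bexI[of _ "\<lambda>_. a"]) (auto intro: poly_fun.const)
  qed (rule assms(2))
  show ?thesis
    unfolding irr_def
  proof (intro conjI ballI impI)
    show "\<Phi> ` P \<noteq> {}" using irr_nonempty[OF assms(1)] by simp
    fix f g assume fg: "f \<in> poly_fun C" "g \<in> poly_fun C" "\<forall>q\<in>\<Phi> ` P. f q * g q = 0"
    obtain f' where f': "f' \<in> poly_fun B" "\<forall>q\<in>P. f (\<Phi> q) = f' q" using pull[OF fg(1)] by (elim bexE)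
    obtain g' where g': "g' \<in> poly_fun B" "\<forall>q\<in>P. g (\<Phi> q) = g' q" using pull[OF fg(2)] by (elim bexE)
    have "\<forall>q\<in>P. f' q * g' q = 0" using fg(3) f'(2) g'(2) by auto
    then have "(\<exists>q\<in>P. f' q \<noteq> 0) \<Longrightarrow> \<forall>q\<in>P. g' q = 0" using irrD[OF assms(1) f'(1) g'(1)] by simp
    then show "(\<forall>q\<in>\<Phi> ` P. f q = 0) \<or> (\<forall>q\<in>\<Phi> ` P. g q = 0)" using f'(2) g'(2) by auto
  qed
qed

text \<open>The argument for products of irreducible sets, applied to the image of a map
  \<open>F\<close> that is polynomial in each variable separately. If \<open>f\<close> is nonzero at
  \<open>F b1 z1\<close> and \<open>g\<close> at \<open>F b2 z2\<close>, irreducibility of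
  \<open>S\<close> for each fixed \<open>b\<close> gives \<open>f (F b z1) * g (F b z2) = 0\<close>,
  and irreducibility of \<open>P\<close> decides between the factors.\<close>

lemma irr_product:
  assumes P: "irr B P" and S: "irr D S"
    and FP: "\<And>c z. c \<in> C \<Longrightarrow> z \<in> S \<Longrightarrow> (\<lambda>b. c (F b z)) \<in> poly_fun B"
    and FS: "\<And>c b. c \<in> C \<Longrightarrow> b \<in> P \<Longrightarrow> (\<lambda>z. c (F b z)) \<in> poly_fun D"
  shows "irr C {F b z | b z. b \<in> P \<and> z \<in> S}"
  unfolding irr_def
proof (intro conjI ballI impI)
  show "{F b z | b z. b \<in> P \<and> z \<in> S} \<noteq> {}" using irr_nonempty[OF P] irr_nonempty[OF S] by blast
  fix f g assume fg: "f \<in> poly_fun C" "g \<in> poly_fun C" "\<forall>q\<in>{F b z | b z. b \<in> P \<and> z \<in> S}. f q * g q = 0"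
  have inP: "(\<lambda>b. h (F b z)) \<in> poly_fun B" if "h \<in> poly_fun C" "z \<in> S" for h z
    by (rule poly_fun_subst[OF that(1)]) (rule FP[OF _ that(2)])
  have inS: "(\<lambda>z. h (F b z)) \<in> poly_fun D" if "h \<in> poly_fun C" "b \<in> P" for h b
    by (rule poly_fun_subst[OF that(1)]) (rule FS[OF _ that(2)])
  have zero: "f (F b z) * g (F b z) = 0" if "b \<in> P" "z \<in> S" for b z using fg(3) that by blast
  show "(\<forall>q\<in>{F b z | b z. b \<in> P \<and> z \<in> S}. f q = 0) \<or> (\<forall>q\<in>{F b z | b z. b \<in> P \<and> z \<in> S}. g q = 0)"
  proof (rule ccontr)
    assume "\<not> ?thesis"
    then obtain b1 z1 b2 z2 where bz: "b1 \<in> P" "z1 \<in> S" "f (F b1 z1) \<noteq> 0" "b2 \<in> P" "z2 \<in> S" "g (F b2 z2) \<noteq> 0"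
      by auto
    have "f (F b z1) * g (F b z2) = 0" if b: "b \<in> P" for b
    proof (rule ccontr)
      assume nz: "f (F b z1) * g (F b z2) \<noteq> 0"
      have "\<forall>z\<in>S. f (F b z) * g (F b z) = 0" using zero b by simp
      from irrD[OF S inS[OF fg(1) b] inS[OF fg(2) b] this] show False
        using nz bz(2,5) by auto
    qed
    then have "\<forall>b\<in>P. f (F b z1) * g (F b z2) = 0" by simp
    from irrD[OF P inP[OF fg(1) bz(2)] inP[OF fg(2) bz(5)] this] show False
      using bz by auto
  qed
qed

section \<open>Affine spaces as sources of parametrizations\<close>

lemma poly_fun_id: "f \<in> poly_fun {\<lambda>x. x} \<Longrightarrow> \<exists>p. f = poly p"
proof (induction rule: poly_fun.induct)
  case (coord c)
  then show ?case by (intro exI[of _ "[:0, 1:]"]) auto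
next
  case (const a)
  then show ?case by (intro exI[of _ "[:a:]"]) auto
next
  case (add f g)
  then obtain p q where "f = poly p" "g = poly q" by blast
  then show ?case by (intro exI[of _ "p + q"]) auto
next
  case (mult f g)
  then obtain p q where "f = poly p" "g = poly q" by blast
  then show ?case by (intro exI[of _ "p * q"]) auto
qed

lemma irr_line: "irr {\<lambda>x. x} UNIV"
  unfolding irr_def
proof (intro conjI ballI impI)
  fix f g :: "complex \<Rightarrow> complex" assume fg: "f \<in> poly_fun {\<lambda>x. x}" "g \<in> poly_fun {\<lambda>x. x}" "\<forall>q\<in>UNIV. f q * g q = 0"
  obtain p where p: "f = poly p" using poly_fun_id[OF fg(1)] by blast
  obtain q where q: "g = poly q" using poly_fun_id[OF fg(2)] by blast
  have "poly (p * q) = poly 0" using fg(3) by (auto simp: p q)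
  then have "p * q = 0" by (simp only: poly_eq_poly_eq_iff)
  then show "(\<forall>q\<in>UNIV. f q = 0) \<or> (\<forall>q\<in>UNIV. g q = 0)" by (auto simp: p q)
qed simp

text \<open>Affine \<open>n\<close>-space is modelled on all sequences, with only the first
  \<open>n\<close> entries as coordinates, so that adding a parameter does not change the
  type.\<close>

definition aff :: "nat \<Rightarrow> ((nat \<Rightarrow> complex) \<Rightarrow> complex) set" where
  "aff n = (\<lambda>i s. s i) ` {..<n}"

lemma aff_coord: "i < n \<Longrightarrow> (\<lambda>s. s i) \<in> aff n"
  by (auto simp: aff_def)

lemma irr_aff: "irr (aff n) UNIV"
proof (induction n)
  case 0
  have "\<exists>a. f = (\<lambda>_. a)" if "f \<in> poly_fun (aff 0)" for f
    using that by induction (auto simp: aff_def)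
  then show ?case unfolding irr_def by fastforce
next
  case (Suc n)
  have "irr (aff (Suc n)) {(\<lambda>\<tau> s. s(n := \<tau>)) b z | b z. b \<in> UNIV \<and> z \<in> UNIV}"
  proof (rule irr_product[OF irr_line Suc])
    fix c z b assume "c \<in> aff (Suc n)"
    then obtain i where i: "c = (\<lambda>s. s i)" "i < Suc n" by (auto simp: aff_def)
    show "(\<lambda>b. c (z(n := b))) \<in> poly_fun {\<lambda>x. x}"
      using i by (cases "i = n") (auto intro: poly_fun.coord poly_fun.const)
    show "(\<lambda>z. c (z(n := b))) \<in> poly_fun (aff n)"
      using i by (cases "i = n") (auto intro!: poly_fun.const poly_fun.coord aff_coord)
  qed
  moreover have "{(\<lambda>\<tau> s. s(n := \<tau>)) b z | b z. b \<in> UNIV \<and> z \<in> UNIV} = (UNIV :: (nat \<Rightarrow> complex) set)"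
    by (auto intro: exI[of _ "_ n"] simp: fun_upd_triv) (metis fun_upd_triv)
  ultimately show ?case by simp
qed

lemma aff_update: "f \<in> poly_fun (aff n) \<Longrightarrow> f (s(n := \<tau>)) = f s"
  by (induction rule: poly_fun.induct) (auto simp: aff_def)

lemma pder_aff:
  assumes "pder (aff n) p \<zeta>"
  shows "\<zeta> = (\<Sum>i<n. fscale (\<zeta> (\<lambda>s. s i)) (vel (aff n) (\<lambda>\<tau>. p(i := p i + \<tau>))))"
proof (rule pder_unique[OF assms])
  have diff: "(\<lambda>\<tau>. c ((p(i := p i + \<tau>)))) field_differentiable at 0" if c: "c \<in> aff n" for c i
  proof -
    obtain j where "c = (\<lambda>s. s j)" using c by (auto simp: aff_def)
    then show ?thesis by (cases "j = i") (auto intro: derivative_intros)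
  qed
  have "pder (aff n) p (vel (aff n) (\<lambda>\<tau>. p(i := p i + \<tau>)))" for i
    using pder_vel[of "aff n" "\<lambda>\<tau>. p(i := p i + \<tau>)", OF diff] by simp
  then show "pder (aff n) p (\<Sum>i<n. fscale (\<zeta> (\<lambda>s. s i)) (vel (aff n) (\<lambda>\<tau>. p(i := p i + \<tau>))))"
    by (intro pder_scaled_sum)
  fix a assume "a \<in> aff n"
  then obtain j where j: "a = (\<lambda>s. s j)" "j < n" by (auto simp: aff_def)
  have "vel (aff n) (\<lambda>\<tau>. p(i := p i + \<tau>)) a = (if i = j then 1 else 0)" for i
  proof -
    have "a \<in> poly_fun (aff n)" using j by (auto intro: poly_fun.coord aff_coord)
    then show ?thesis by (auto simp: vel_def j(1))
  qed
  then have "(\<Sum>i<n. fscale (\<zeta> (\<lambda>s. s i)) (vel (aff n) (\<lambda>\<tau>. p(i := p i + \<tau>)))) a = (\<Sum>i<n. if i = j then \<zeta> (\<lambda>s. s i) else 0)"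
    unfolding sum_fun_apply fscale_def by (intro sum.cong) auto
  then show "\<zeta> a = (\<Sum>i<n. fscale (\<zeta> (\<lambda>s. s i)) (vel (aff n) (\<lambda>\<tau>. p(i := p i + \<tau>)))) a"
    using j by simp
qed


section \<open>Polynomial flows and the chains they generate\<close>

definition flow :: "('p \<Rightarrow> complex) set \<Rightarrow> (complex \<Rightarrow> 'p \<Rightarrow> 'p) \<Rightarrow> bool" where
  "flow C E \<longleftrightarrow> (\<forall>c\<in>C. (\<lambda>x. c (E (fst x) (snd x))) \<in> poly_fun (insert fst ((\<lambda>c x. c (snd x)) ` C)))"

lemma flow_poly:
  assumes "flow C E" "f \<in> poly_fun C" "g \<in> poly_fun D" "\<And>c. c \<in> C \<Longrightarrow> (\<lambda>r. c (k r)) \<in> poly_fun D"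
  shows "(\<lambda>r. f (E (g r) (k r))) \<in> poly_fun D"
proof -
  have "(\<lambda>x. f (E (fst x) (snd x))) \<in> poly_fun (insert fst ((\<lambda>c x. c (snd x)) ` C))"
    by (rule poly_fun_subst[OF assms(2)]) (use assms(1) in \<open>simp add: flow_def\<close>)
  then have "(\<lambda>r. (\<lambda>x. f (E (fst x) (snd x))) (g r, k r)) \<in> poly_fun D"
  proof (rule poly_fun_subst)
    fix a assume "a \<in> insert fst ((\<lambda>c x. c (snd x)) ` C)"
    then show "(\<lambda>q. a (g q, k q)) \<in> poly_fun D" using assms(3,4) by auto
  qed
  then show ?thesis by simp
qed

lemma flow_at: "flow C E \<Longrightarrow> f \<in> poly_fun C \<Longrightarrow> (\<lambda>z. f (E \<tau> z)) \<in> poly_fun C"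
  by (rule flow_poly[of C E f "\<lambda>_. \<tau>" C "\<lambda>z. z"]) (auto intro: poly_fun.const poly_fun.coord)

lemma flow_curve: "flow C E \<Longrightarrow> f \<in> poly_fun C \<Longrightarrow> (\<lambda>\<tau>. f (E \<tau> z)) \<in> poly_fun {\<lambda>x. x}"
  by (rule flow_poly[of C E f "\<lambda>\<tau>. \<tau>" _ "\<lambda>_. z"]) (auto intro: poly_fun.const poly_fun.coord)

lemma poly_fun_id_differentiable: "f \<in> poly_fun {\<lambda>x. x} \<Longrightarrow> f field_differentiable at x"
  using poly_fun_id poly_DERIV field_differentiable_def by metis

text \<open>A family of flows on \<open>Y\<close>, polynomial in time and point jointly, each
  inverted by reversing time. The span of their velocities at one point bounds the dimension of
  \<open>Y\<close> from below.\<close>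

context
  fixes C :: "('p \<Rightarrow> complex) set" and \<Lambda> :: "'l set" and E :: "'l \<Rightarrow> complex \<Rightarrow> 'p \<Rightarrow> 'p" and Y :: "'p set"
  assumes flow: "\<And>a. a \<in> \<Lambda> \<Longrightarrow> flow C (E a)"
    and inY: "\<And>a \<tau> z. a \<in> \<Lambda> \<Longrightarrow> z \<in> Y \<Longrightarrow> E a \<tau> z \<in> Y"
    and E0: "\<And>a z. a \<in> \<Lambda> \<Longrightarrow> z \<in> Y \<Longrightarrow> E a 0 z = z"
    and inv: "\<And>a \<tau> z. a \<in> \<Lambda> \<Longrightarrow> z \<in> Y \<Longrightarrow> E a (- \<tau>) (E a \<tau> z) = z"
begin

definition word :: "('l \<times> complex) list \<Rightarrow> 'p \<Rightarrow> 'p" where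
  "word ws z = foldr (\<lambda>(a, \<tau>). E a \<tau>) ws z"

definition wordinv :: "('l \<times> complex) list \<Rightarrow> ('l \<times> complex) list" where
  "wordinv ws = rev (map (\<lambda>(a, \<tau>). (a, - \<tau>)) ws)"

lemma word_in: "set ws \<subseteq> \<Lambda> \<times> UNIV \<Longrightarrow> z \<in> Y \<Longrightarrow> word ws z \<in> Y"
  by (induction ws) (auto simp: word_def inY)

lemma wordinv_in: "set ws \<subseteq> \<Lambda> \<times> UNIV \<Longrightarrow> set (wordinv ws) \<subseteq> \<Lambda> \<times> UNIV"
  by (auto simp: wordinv_def)

lemma wordinv_word: "set ws \<subseteq> \<Lambda> \<times> UNIV \<Longrightarrow> z \<in> Y \<Longrightarrow> word (wordinv ws) (word ws z) = z"
proof (induction ws)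
  case (Cons x ws)
  obtain a \<tau> where x: "x = (a, \<tau>)" by (cases x)
  have "word (wordinv (x # ws)) (word (x # ws) z) = word (wordinv ws) (E a (- \<tau>) (E a \<tau> (word ws z)))"
    unfolding x wordinv_def by (simp add: word_def)
  also have "E a (- \<tau>) (E a \<tau> (word ws z)) = word ws z"
    using Cons.prems by (intro inv word_in) (auto simp: x)
  finally show ?case using Cons by simp
qed (simp add: word_def wordinv_def)

lemma word_poly: "set ws \<subseteq> \<Lambda> \<times> UNIV \<Longrightarrow> f \<in> poly_fun C \<Longrightarrow> (\<lambda>z. f (word ws z)) \<in> poly_fun C"
proof (induction ws arbitrary: f)
  case (Cons x ws)
  obtain a \<tau> where x: "x = (a, \<tau>)" by (cases x)
  have "(\<lambda>z. (\<lambda>y. f (E a \<tau> y)) (word ws z)) \<in> poly_fun C"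
  proof (rule Cons.IH)
    show "set ws \<subseteq> \<Lambda> \<times> UNIV" using Cons.prems by simp
    have "a \<in> \<Lambda>" using Cons.prems x by simp
    then show "(\<lambda>y. f (E a \<tau> y)) \<in> poly_fun C" by (rule flow_at[OF flow Cons.prems(2)])
  qed
  then show ?case by (simp add: x word_def)
qed (simp add: word_def)

text \<open>The closure in \<open>Y\<close> of the image of \<open>\<Phi>\<close>.\<close>

definition covers :: "((nat \<Rightarrow> complex) \<Rightarrow> 'p) \<Rightarrow> 'p set" where
  "covers \<Phi> = {y\<in>Y. \<forall>f\<in>{f\<in>poly_fun C. \<forall>s. f (\<Phi> s) = 0}. f y = 0}"

lemma irr_covers:
  assumes "\<And>c. c \<in> C \<Longrightarrow> (\<lambda>s. c (\<Phi> s)) \<in> poly_fun (aff n)" "range \<Phi> \<subseteq> Y"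
  shows "irr C (covers \<Phi>)"
proof -
  have R: "irr C (\<Phi> ` UNIV)" by (rule irr_image[OF irr_aff[of n]]) (use assms(1) in auto)
  have sub: "range \<Phi> \<subseteq> covers \<Phi>" using assms(2) by (auto simp: covers_def)
  have ext: "\<forall>q\<in>covers \<Phi>. f q = 0" if "f \<in> poly_fun C" "\<forall>q\<in>range \<Phi>. f q = 0" for f
    using that by (auto simp: covers_def)
  show ?thesis
    unfolding irr_def
  proof (intro conjI ballI impI)
    show "covers \<Phi> \<noteq> {}" using sub by auto
    fix f g assume fg: "f \<in> poly_fun C" "g \<in> poly_fun C" "\<forall>q\<in>covers \<Phi>. f q * g q = 0"
    have "\<forall>q\<in>range \<Phi>. f q * g q = 0" using fg(3) sub by auto
    from irr_disj[OF R fg(1,2) this]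
    show "(\<forall>q\<in>covers \<Phi>. f q = 0) \<or> (\<forall>q\<in>covers \<Phi>. g q = 0)"
    proof
      assume "\<forall>q\<in>range \<Phi>. f q = 0"
      from ext[OF fg(1) this] show ?thesis ..
    next
      assume "\<forall>q\<in>range \<Phi>. g q = 0"
      from ext[OF fg(2) this] show ?thesis ..
    qed
  qed
qed

text \<open>If the closure of an \<open>n\<close>-parameter image is stable under all flows, each
  velocity at \<open>x\<close>, carried by a word to a generic point \<open>\<Phi> p\<close>, is
  tangent to the image and hence comes from the \<open>n\<close> parameter directions. The inverse
  word brings these back to \<open>x\<close>, so \<open>n\<close> vectors span all velocities. In
  \<open>flows_chain\<close> this contradicts \<open>n < e\<close>.\<close>

lemma covers_not_stable:
  assumes \<Phi>: "\<And>c. c \<in> C \<Longrightarrow> (\<lambda>s. c (\<Phi> s)) \<in> poly_fun (aff n)"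
    and words: "\<And>s. \<exists>ws. set ws \<subseteq> \<Lambda> \<times> UNIV \<and> \<Phi> s = word ws x" and x: "x \<in> Y"
    and stable: "\<forall>a\<in>\<Lambda>. \<forall>f\<in>poly_fun C. (\<forall>s. f (\<Phi> s) = 0) \<longrightarrow> (\<forall>\<tau> s. f (E a \<tau> (\<Phi> s)) = 0)"
  shows "\<exists>B. finite B \<and> card B \<le> n \<and> (\<forall>a\<in>\<Lambda>. vel C (\<lambda>\<tau>. E a \<tau> x) \<in> cfun.span B)"
proof -
  have fin: "finite (aff n)" by (simp add: aff_def)
  obtain p where p: "\<forall>\<xi>\<in>tang C (range \<Phi>) (\<Phi> p). \<exists>\<zeta>\<in>tang (aff n) UNIV p. \<forall>f\<in>poly_fun C. \<zeta> (\<lambda>r. f (\<Phi> r)) = \<xi> f"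
  proof -
    have "\<exists>p\<in>UNIV. \<forall>\<xi>\<in>tang C (\<Phi> ` UNIV) (\<Phi> p). \<exists>\<zeta>\<in>tang (aff n) UNIV p. \<forall>f\<in>poly_fun C. \<zeta> (\<lambda>r. f (\<Phi> r)) = \<xi> f"
      by (rule tang_pullback[OF fin irr_aff]) (rule \<Phi>)
    then show ?thesis by (elim bexE) (rule that)
  qed
  obtain ws where ws: "set ws \<subseteq> \<Lambda> \<times> UNIV" "\<Phi> p = word ws x" using words by blast
  let ?v = "wordinv ws"
  have v: "set ?v \<subseteq> \<Lambda> \<times> UNIV" by (rule wordinv_in[OF ws(1)])
  have xv: "word ?v (\<Phi> p) = x" using wordinv_word[OF ws(1) x] ws(2) by simp
  have PhiY: "\<Phi> s \<in> Y" for s using words[of s] word_in[OF _ x] by auto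
  have stable_word: "f (word us (\<Phi> s)) = 0"
    if "set us \<subseteq> \<Lambda> \<times> UNIV" "f \<in> poly_fun C" "\<forall>s. f (\<Phi> s) = 0" for us f s
    using that
  proof (induction us arbitrary: f)
    case (Cons u us)
    obtain a \<tau> where u: "u = (a, \<tau>)" by (cases u)
    have a: "a \<in> \<Lambda>" using Cons.prems u by auto
    have "(\<lambda>y. f (E a \<tau> y)) (word us (\<Phi> s)) = 0"
    proof (rule Cons.IH)
      have f: "f \<in> poly_fun C" "\<forall>s. f (\<Phi> s) = 0" using Cons.prems by auto
      show "set us \<subseteq> \<Lambda> \<times> UNIV" using Cons.prems by auto
      show "(\<lambda>y. f (E a \<tau> y)) \<in> poly_fun C" by (rule flow_at[OF flow[OF a] f(1)])
      from bspec[OF bspec[OF stable a] f(1)] f(2) show "\<forall>s. f (E a \<tau> (\<Phi> s)) = 0" by simp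
    qed
    then show ?case by (simp add: u word_def)
  qed (simp add: word_def)
  define d where "d i = vel (aff n) (\<lambda>\<tau>. p(i := p i + \<tau>))" for i
  define D where "D i f = (if f \<in> poly_fun C then d i (\<lambda>s. f (word ?v (\<Phi> s))) else 0)" for i f
  have "vel C (\<lambda>\<tau>. E a \<tau> x) \<in> cfun.span (D ` {..<n})" if a: "a \<in> \<Lambda>" for a
  proof -
    \<comment> \<open>This curve consists of the images of \<open>\<Phi> p\<close> under the words
      \<open>ws @ (a, \<tau>) # ?v\<close>, so it stays in the closure of the image of
      \<open>\<Phi>\<close>.\<close>
    define \<xi> where "\<xi> = vel C (\<lambda>\<tau>. word ws (E a \<tau> x))"
    have diff: "(\<lambda>\<tau>. f (word ws (E a \<tau> x))) field_differentiable at 0" if "f \<in> poly_fun C" for f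
    proof -
      have "(\<lambda>\<tau>. (\<lambda>y. f (word ws y)) (E a \<tau> x)) \<in> poly_fun {\<lambda>x. x}"
        by (rule flow_curve[OF flow[OF a] word_poly[OF ws(1) that]])
      then show ?thesis by (rule poly_fun_id_differentiable)
    qed
    have pd: "pder C (\<Phi> p) \<xi>"
      using pder_vel[of C "\<lambda>\<tau>. word ws (E a \<tau> x)", OF diff[OF poly_fun.coord]]
      by (simp add: \<xi>_def E0[OF a x] ws(2))
    have "\<xi> f = 0" if f: "f \<in> poly_fun C" "\<forall>s. f (\<Phi> s) = 0" for f
    proof -
      have "f (word ws (E a \<tau> x)) = 0" for \<tau>
        using stable_word[of "ws @ (a, \<tau>) # ?v" f p] ws(1) v a f
        by (simp add: word_def xv[unfolded word_def])
      then show ?thesis by (simp add: \<xi>_def vel_def)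
    qed
    then have "\<xi> \<in> tang C (range \<Phi>) (\<Phi> p)" using pd by (auto simp: tang_def)
    from bspec[OF p this] obtain \<zeta> where \<zeta>: "\<zeta> \<in> tang (aff n) UNIV p" "\<forall>f\<in>poly_fun C. \<zeta> (\<lambda>r. f (\<Phi> r)) = \<xi> f"
      by (elim bexE)
    have "pder (aff n) p \<zeta>" using \<zeta>(1) by (simp add: tang_def)
    then have ze: "\<zeta> = (\<Sum>i<n. fscale (\<zeta> (\<lambda>s. s i)) (d i))" unfolding d_def by (rule pder_aff)
    have "vel C (\<lambda>\<tau>. E a \<tau> x) = (\<Sum>i<n. fscale (\<zeta> (\<lambda>s. s i)) (D i))"
    proof
      fix f
      show "vel C (\<lambda>\<tau>. E a \<tau> x) f = (\<Sum>i<n. fscale (\<zeta> (\<lambda>s. s i)) (D i)) f"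
      proof (cases "f \<in> poly_fun C")
        case True
        have fv: "(\<lambda>y. f (word ?v y)) \<in> poly_fun C" by (rule word_poly[OF v True])
        have "vel C (\<lambda>\<tau>. E a \<tau> x) f = \<xi> (\<lambda>y. f (word ?v y))"
          using True fv by (simp add: \<xi>_def vel_def wordinv_word[OF ws(1) inY[OF a x]])
        also have "\<dots> = \<zeta> (\<lambda>r. f (word ?v (\<Phi> r)))" by (rule bspec[OF \<zeta>(2) fv, symmetric])
        also have "\<dots> = (\<Sum>i<n. fscale (\<zeta> (\<lambda>s. s i)) (d i)) (\<lambda>r. f (word ?v (\<Phi> r)))"
          using ze by (rule fun_cong)
        also have "\<dots> = (\<Sum>i<n. fscale (\<zeta> (\<lambda>s. s i)) (D i)) f"
          using True by (simp add: sum_fun_apply fscale_def D_def)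
        finally show ?thesis .
      qed (simp add: vel_def sum_fun_apply fscale_def D_def)
    qed
    moreover have "(\<Sum>i<n. fscale (\<zeta> (\<lambda>s. s i)) (D i)) \<in> cfun.span (D ` {..<n})"
      by (rule cfun.span_sum) (rule cfun.span_scale, rule cfun.span_base, simp)
    ultimately show ?thesis by simp
  qed
  moreover have "card (D ` {..<n}) \<le> n" using card_image_le[of "{..<n}" D] by simp
  ultimately show ?thesis by (intro exI[of _ "D ` {..<n}"]) simp
qed

text \<open>A parametrized family is grown from the constant map to \<open>x\<close>. While it has
  fewer than \<open>e\<close> parameters its closure is not stable, so some flow leads out of it;
  the time of that flow becomes the next parameter, and the closure grows strictly.\<close>

theorem flows_chain:
  assumes x: "x \<in> Y"
    and dim: "\<And>B. finite B \<Longrightarrow> \<forall>a\<in>\<Lambda>. vel C (\<lambda>\<tau>. E a \<tau> x) \<in> cfun.span B \<Longrightarrow> e \<le> card B"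
    and "n \<le> e"
  shows "\<exists>Z. zchain C Y n Z"
proof -
  have "\<exists>\<Phi> Z. (\<forall>c\<in>C. (\<lambda>s. c (\<Phi> s)) \<in> poly_fun (aff n)) \<and>
     (\<forall>s. \<exists>ws. set ws \<subseteq> \<Lambda> \<times> UNIV \<and> \<Phi> s = word ws x) \<and> zchain C Y n Z \<and> Z n = covers \<Phi>"
    using \<open>n \<le> e\<close>
  proof (induction n)
    case 0
    have cl: "\<exists>F\<subseteq>poly_fun C. covers (\<lambda>_. x) = {q\<in>Y. \<forall>f\<in>F. f q = 0}"
      unfolding covers_def by (rule exI[of _ "{f\<in>poly_fun C. \<forall>s. f x = 0}"]) auto
    show ?case
    proof (intro exI[of _ "\<lambda>_. x"] exI[of _ "\<lambda>_. covers (\<lambda>_. x)"] conjI ballI allI)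
      show "zchain C Y 0 (\<lambda>_. covers (\<lambda>_. x))"
        using cl irr_covers[of "\<lambda>_. x" 0] x by (auto simp: zchain_def poly_fun.const)
      show "\<exists>ws. set ws \<subseteq> \<Lambda> \<times> UNIV \<and> x = word ws x" by (rule exI[of _ "[]"]) (simp add: word_def)
    qed (auto intro: poly_fun.const)
  next
    case (Suc n)
    then obtain \<Phi> Z where \<Phi>: "\<And>c. c \<in> C \<Longrightarrow> (\<lambda>s. c (\<Phi> s)) \<in> poly_fun (aff n)"
      and words: "\<And>s. \<exists>ws. set ws \<subseteq> \<Lambda> \<times> UNIV \<and> \<Phi> s = word ws x"
      and Z: "zchain C Y n Z" "Z n = covers \<Phi>" by auto
    have PhiC: "(\<lambda>s. f (\<Phi> s)) \<in> poly_fun (aff n)" if "f \<in> poly_fun C" for f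
      by (rule poly_fun_subst[OF that \<Phi>])
    have "\<not> (\<forall>a\<in>\<Lambda>. \<forall>f\<in>poly_fun C. (\<forall>s. f (\<Phi> s) = 0) \<longrightarrow> (\<forall>\<tau> s. f (E a \<tau> (\<Phi> s)) = 0))"
    proof
      assume "\<forall>a\<in>\<Lambda>. \<forall>f\<in>poly_fun C. (\<forall>s. f (\<Phi> s) = 0) \<longrightarrow> (\<forall>\<tau> s. f (E a \<tau> (\<Phi> s)) = 0)"
      from covers_not_stable[where \<Phi>=\<Phi> and n=n and x=x, OF \<Phi> words x this] obtain B
        where "finite B" "card B \<le> n" "\<forall>a\<in>\<Lambda>. vel C (\<lambda>\<tau>. E a \<tau> x) \<in> cfun.span B" by blast
      then show False using dim[of B] Suc.prems by simp
    qed
    then obtain a f0 \<tau>0 s0 where a: "a \<in> \<Lambda>" and f0: "f0 \<in> poly_fun C" "\<forall>s. f0 (\<Phi> s) = 0" "f0 (E a \<tau>0 (\<Phi> s0)) \<noteq> 0"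
      unfolding Ball_def not_all not_imp by (elim exE conjE) (rule that)
    define \<Psi> where "\<Psi> s = E a (s n) (\<Phi> s)" for s
    have Psi: "(\<lambda>s. c (\<Psi> s)) \<in> poly_fun (aff (Suc n))" if "c \<in> C" for c
      unfolding \<Psi>_def
    proof (rule flow_poly[OF flow[OF a] poly_fun.coord[OF that]])
      show "(\<lambda>s. s n) \<in> poly_fun (aff (Suc n))" by (auto intro: poly_fun.coord aff_coord)
      show "(\<lambda>r. c (\<Phi> r)) \<in> poly_fun (aff (Suc n))" if "c \<in> C" for c
        by (rule poly_fun_mono[OF _ \<Phi>[OF that]]) (auto simp: aff_def)
    qed
    have wordsP: "\<exists>ws. set ws \<subseteq> \<Lambda> \<times> UNIV \<and> \<Psi> s = word ws x" for s
    proof -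
      obtain ws where "set ws \<subseteq> \<Lambda> \<times> UNIV" "\<Phi> s = word ws x" using words by blast
      then show ?thesis using a by (intro exI[of _ "(a, s n) # ws"]) (auto simp: \<Psi>_def word_def)
    qed
    have PsiY: "range \<Psi> \<subseteq> Y" using wordsP word_in[OF _ x] by (metis (full_types) image_subsetI)
    have PhiY: "\<Phi> s \<in> Y" for s using words[of s] word_in[OF _ x] by auto
    \<comment> \<open>As far as polynomial functions can tell, \<open>\<Phi> s\<close> depends only
      on the first \<open>n\<close> entries of \<open>s\<close>, so entry \<open>n\<close> may be
      set to any time \<open>\<tau>\<close>; time 0 recovers the old image.\<close>
    have upd: "f (\<Psi> (s(n := \<tau>))) = f (E a \<tau> (\<Phi> s))" if "f \<in> poly_fun C" for f s \<tau>
    proof -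
      have "(\<lambda>s. (\<lambda>y. f (E a \<tau> y)) (\<Phi> s)) \<in> poly_fun (aff n)" by (rule PhiC[OF flow_at[OF flow[OF a] that]])
      from aff_update[OF this, of s \<tau>] show ?thesis by (simp add: \<Psi>_def)
    qed
    have sub: "covers \<Phi> \<subseteq> covers \<Psi>"
    proof
      fix y assume y: "y \<in> covers \<Phi>"
      have "f y = 0" if "f \<in> poly_fun C" "\<forall>s. f (\<Psi> s) = 0" for f
      proof -
        have "f (\<Phi> s) = 0" for s using upd[OF that(1), of s 0] that(2) E0[OF a PhiY, of s] by simp
        then show ?thesis using y that(1) by (auto simp: covers_def)
      qed
      then show "y \<in> covers \<Psi>" using y by (auto simp: covers_def)
    qed
    have "\<Psi> (s0(n := \<tau>0)) \<in> covers \<Psi>" using PsiY by (auto simp: covers_def)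
    moreover have "\<Psi> (s0(n := \<tau>0)) \<notin> covers \<Phi>" using upd[OF f0(1), of s0 \<tau>0] f0 by (auto simp: covers_def)
    ultimately have lt: "covers \<Phi> \<subset> covers \<Psi>" using sub by blast
    have cl: "\<exists>F\<subseteq>poly_fun C. covers \<Psi> = {q\<in>Y. \<forall>f\<in>F. f q = 0}"
      unfolding covers_def by (rule exI[of _ "{f\<in>poly_fun C. \<forall>s. f (\<Psi> s) = 0}"]) auto
    have "zchain C Y (Suc n) (Z(Suc n := covers \<Psi>))"
      using Z lt cl irr_covers[OF Psi PsiY] by (simp add: zchain_def less_Suc_eq le_Suc_eq)
    then show ?case
      using Psi wordsP by (intro exI[of _ \<Psi>] exI[of _ "Z(Suc n := covers \<Psi>)"]) (simp del: fun_upd_apply, simp)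
  qed
  then show ?thesis by (elim exE conjE) (rule exI)
qed

end

subsection \<open>Noetherian function algebras and connected homogeneous sets\<close>

definition fun_ideal :: "('p \<Rightarrow> complex) set \<Rightarrow> ('p \<Rightarrow> complex) set \<Rightarrow> bool" where
  "fun_ideal A J \<longleftrightarrow> J \<subseteq> poly_fun A \<and> (\<lambda>_. 0) \<in> J \<and> (\<forall>f\<in>J. \<forall>g\<in>J. (\<lambda>q. f q + g q) \<in> J) \<and>
     (\<forall>f\<in>poly_fun A. \<forall>g\<in>J. (\<lambda>q. f q * g q) \<in> J)"

definition noeth :: "('p \<Rightarrow> complex) set \<Rightarrow> bool" where
  "noeth A \<longleftrightarrow> (\<forall>J. (\<forall>n::nat. fun_ideal A (J n)) \<and> (\<forall>n. J n \<subseteq> J (Suc n)) \<longrightarrow> (\<exists>N. \<forall>n\<ge>N. J n = J N))"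

lemma fun_idealD:
  assumes "fun_ideal A J"
  shows "f \<in> J \<Longrightarrow> f \<in> poly_fun A" "(\<lambda>_. 0) \<in> J" "f \<in> J \<Longrightarrow> g \<in> J \<Longrightarrow> (\<lambda>q. f q + g q) \<in> J"
    "f \<in> poly_fun A \<Longrightarrow> g \<in> J \<Longrightarrow> (\<lambda>q. f q * g q) \<in> J"
  using assms by (auto simp: fun_ideal_def)

lemma fun_ideal_diff: "fun_ideal A J \<Longrightarrow> f \<in> J \<Longrightarrow> g \<in> J \<Longrightarrow> (\<lambda>q. f q - g q) \<in> J"
  using fun_idealD(3)[of A J f "\<lambda>q. - 1 * g q"] fun_idealD(4)[of A J "\<lambda>_. - 1" g] by (simp add: poly_fun.const)

lemma noeth_empty: "noeth {}"
  unfolding noeth_def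
proof (intro allI impI, elim conjE)
  fix J :: "nat \<Rightarrow> ('a \<Rightarrow> complex) set"
  assume J: "\<forall>n. fun_ideal {} (J n)" "\<forall>n. J n \<subseteq> J (Suc n)"
  have mono: "J m \<subseteq> J n" if "m \<le> n" for m n using lift_Suc_mono_le[of J m n] J(2) that by simp
  have const: "\<exists>a. f = (\<lambda>_. a)" if "f \<in> poly_fun {}" for f :: "'a \<Rightarrow> complex"
    using that by induction auto
  show "\<exists>N. \<forall>n\<ge>N. J n = J N"
  proof (cases "\<exists>N a. a \<noteq> 0 \<and> (\<lambda>_. a) \<in> J N")
    case True
    then obtain N a where a: "a \<noteq> 0" "(\<lambda>_. a) \<in> J N" by blast
    have "f \<in> J N" if f: "f \<in> J n" for f n
    proof -
      obtain b where b: "f = (\<lambda>_. b)" using const fun_idealD(1)[OF J(1)[rule_format] f] by blast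
      have "(\<lambda>q. b / a * a) \<in> J N"
        by (rule fun_idealD(4)[OF J(1)[rule_format] poly_fun.const a(2)])
      then show ?thesis using a(1) b by simp
    qed
    then show ?thesis using mono by (intro exI[of _ N]) blast
  next
    case False
    have "J n = {\<lambda>_. 0}" for n
    proof
      show "{\<lambda>_. 0} \<subseteq> J n" using fun_idealD(2)[OF J(1)[rule_format]] by simp
      show "J n \<subseteq> {\<lambda>_. 0}"
      proof
        fix f assume f: "f \<in> J n"
        then obtain b where "f = (\<lambda>_. b)" using const fun_idealD(1)[OF J(1)[rule_format] f] by blast
        then show "f \<in> {\<lambda>_. 0}" using False f by auto
      qed
    qed
    then show ?thesis by simp
  qed
qed

definition lead :: "('p \<Rightarrow> complex) set \<Rightarrow> ('p \<Rightarrow> complex) \<Rightarrow> ('p \<Rightarrow> complex) set \<Rightarrow> nat \<Rightarrow> ('p \<Rightarrow> complex) set" where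
  "lead A c J d = {a\<in>poly_fun A. \<exists>b. (\<forall>i. b i \<in> poly_fun A) \<and> (\<lambda>q. a q * c q ^ d + (\<Sum>i<d. b i q * c q ^ i)) \<in> J}"

lemma leadI:
  "a \<in> poly_fun A \<Longrightarrow> (\<And>i. b i \<in> poly_fun A) \<Longrightarrow> (\<lambda>q. a q * c q ^ d + (\<Sum>i<d. b i q * c q ^ i)) \<in> J \<Longrightarrow> a \<in> lead A c J d"
  by (auto simp: lead_def)

lemma leadD:
  assumes "a \<in> lead A c J d"
  shows "\<exists>b. a \<in> poly_fun A \<and> (\<forall>i. b i \<in> poly_fun A) \<and> (\<lambda>q. a q * c q ^ d + (\<Sum>i<d. b i q * c q ^ i)) \<in> J"
  using assms by (simp add: lead_def)

lemma lead_ideal: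
  assumes J: "fun_ideal (insert c A) J"
  shows "fun_ideal A (lead A c J d)"
  unfolding fun_ideal_def
proof (intro conjI ballI)
  show "lead A c J d \<subseteq> poly_fun A" by (auto simp: lead_def)
  show "(\<lambda>_. 0) \<in> lead A c J d"
    by (rule leadI[where b="\<lambda>_ _. 0"]) (auto intro: poly_fun.const fun_idealD(2)[OF J])
  fix f g assume f: "f \<in> lead A c J d" and g: "g \<in> lead A c J d"
  obtain b where b: "f \<in> poly_fun A" "\<forall>i. b i \<in> poly_fun A" "(\<lambda>q. f q * c q ^ d + (\<Sum>i<d. b i q * c q ^ i)) \<in> J"
    using leadD[OF f] by (elim exE conjE)
  obtain b' where b': "g \<in> poly_fun A" "\<forall>i. b' i \<in> poly_fun A" "(\<lambda>q. g q * c q ^ d + (\<Sum>i<d. b' i q * c q ^ i)) \<in> J"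
    using leadD[OF g] by (elim exE conjE)
  show "(\<lambda>q. f q + g q) \<in> lead A c J d"
  proof (rule leadI)
    show "(\<lambda>q. f q + g q) \<in> poly_fun A" by (rule poly_fun.add[OF b(1) b'(1)])
    show "(\<lambda>q. b i q + b' i q) \<in> poly_fun A" for i by (rule poly_fun.add[OF b(2)[rule_format] b'(2)[rule_format]])
    show "(\<lambda>q. (f q + g q) * c q ^ d + (\<Sum>i<d. (b i q + b' i q) * c q ^ i)) \<in> J"
      using fun_idealD(3)[OF J b(3) b'(3)] by (simp add: sum.distrib algebra_simps)
  qed
next
  fix f g assume f: "f \<in> poly_fun A" and g: "g \<in> lead A c J d"
  obtain b where b: "g \<in> poly_fun A" "\<forall>i. b i \<in> poly_fun A" "(\<lambda>q. g q * c q ^ d + (\<Sum>i<d. b i q * c q ^ i)) \<in> J"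
    using leadD[OF g] by (elim exE conjE)
  show "(\<lambda>q. f q * g q) \<in> lead A c J d"
  proof (rule leadI)
    show "(\<lambda>q. f q * g q) \<in> poly_fun A" by (rule poly_fun.mult[OF f b(1)])
    show "(\<lambda>q. f q * b i q) \<in> poly_fun A" for i by (rule poly_fun.mult[OF f b(2)[rule_format]])
    show "(\<lambda>q. f q * g q * c q ^ d + (\<Sum>i<d. f q * b i q * c q ^ i)) \<in> J"
      using fun_idealD(4)[OF J poly_fun_mono[OF subset_insertI f] b(3)]
      by (simp add: sum_distrib_left algebra_simps)
  qed
qed

lemma lead_mono: "J \<subseteq> J' \<Longrightarrow> lead A c J d \<subseteq> lead A c J' d"
  by (auto simp: lead_def)

lemma lead_Suc:
  assumes J: "fun_ideal (insert c A) J"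
  shows "lead A c J d \<subseteq> lead A c J (Suc d)"
proof
  fix f assume f: "f \<in> lead A c J d"
  obtain b where b: "f \<in> poly_fun A" "\<forall>i. b i \<in> poly_fun A" "(\<lambda>q. f q * c q ^ d + (\<Sum>i<d. b i q * c q ^ i)) \<in> J"
    using leadD[OF f] by (elim exE conjE)
  define b' where "b' i = (case i of 0 \<Rightarrow> (\<lambda>_. 0) | Suc j \<Rightarrow> b j)" for i
  show "f \<in> lead A c J (Suc d)"
  proof (rule leadI)
    show "f \<in> poly_fun A" by fact
    show "b' i \<in> poly_fun A" for i by (cases i) (auto simp: b'_def b poly_fun.const)
    have "c \<in> poly_fun (insert c A)" by (auto intro: poly_fun.coord)
    from fun_idealD(4)[OF J this b(3)]
    have "(\<lambda>q. c q * (f q * c q ^ d + (\<Sum>i<d. b i q * c q ^ i))) \<in> J" .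
    moreover have "c q * (f q * c q ^ d + (\<Sum>i<d. b i q * c q ^ i)) = f q * c q ^ Suc d + (\<Sum>i<Suc d. b' i q * c q ^ i)" for q
      by (subst sum.lessThan_Suc_shift) (simp add: b'_def sum_distrib_left algebra_simps)
    ultimately show "(\<lambda>q. f q * c q ^ Suc d + (\<Sum>i<Suc d. b' i q * c q ^ i)) \<in> J" by simp
  qed
qed

text \<open>From an element of \<open>J'\<close> subtract an element of \<open>J\<close> with the
  same leading coefficient and descend in the length of the expansion.\<close>

lemma lead_eq_imp_eq:
  assumes J: "fun_ideal (insert c A) J" and J': "fun_ideal (insert c A) J'" and sub: "J \<subseteq> J'"
    and eq: "\<And>d. lead A c J d = lead A c J' d"
  shows "J = J'"
proof -
  have claim: "f \<in> J" if "f \<in> J'" "f = (\<lambda>q. \<Sum>i<d. b i q * c q ^ i)" "\<And>i. b i \<in> poly_fun A" for f d b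
    using that
  proof (induction d arbitrary: f b)
    case 0
    then show ?case using fun_idealD(2)[OF J] by simp
  next
    case (Suc d)
    have "(\<lambda>q. b d q * c q ^ d + (\<Sum>i<d. b i q * c q ^ i)) \<in> J'" using Suc.prems(1,2) by (simp add: add.commute)
    then have "b d \<in> lead A c J d" using eq leadI[OF Suc.prems(3) Suc.prems(3)] by simp
    from leadD[OF this] obtain b' where b': "\<forall>i. b' i \<in> poly_fun A" "(\<lambda>q. b d q * c q ^ d + (\<Sum>i<d. b' i q * c q ^ i)) \<in> J"
      by (elim exE conjE)
    define g where "g = (\<lambda>q. b d q * c q ^ d + (\<Sum>i<d. b' i q * c q ^ i))"
    have g: "g \<in> J" using b'(2) by (simp add: g_def)
    have "(\<lambda>q. f q - g q) \<in> J"
    proof (rule Suc.IH)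
      show "(\<lambda>q. f q - g q) \<in> J'" using fun_ideal_diff[OF J' Suc.prems(1)] g sub by blast
      show "(\<lambda>q. f q - g q) = (\<lambda>q. \<Sum>i<d. (b i q - b' i q) * c q ^ i)"
        unfolding Suc.prems(2) g_def by (simp add: sum_subtractf left_diff_distrib)
      show "(\<lambda>q. b i q - b' i q) \<in> poly_fun A" for i by (rule poly_fun_diff[OF Suc.prems(3) b'(1)[rule_format]])
    qed
    from fun_idealD(3)[OF J this g] show ?case by simp
  qed
  have "J' \<subseteq> J"
  proof
    fix f assume f: "f \<in> J'"
    obtain n a where "\<And>i. a i \<in> poly_fun A" "f = (\<lambda>q. \<Sum>i\<le>(n::nat). a i q * c q ^ i)"
      using poly_fun_insert_ex[OF fun_idealD(1)[OF J' f]] by (elim exE conjE) (rule that, erule spec, assumption)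
    then show "f \<in> J" using claim[OF f, of a "Suc n"] by (simp only: lessThan_Suc_atMost)
  qed
  then show ?thesis using sub by blast
qed

text \<open>Hilbert's argument. The ideals \<open>L n d\<close> increase in \<open>n\<close> and in
  \<open>d\<close>. The diagonal \<open>L n n\<close> becomes stationary at some \<open>N\<close>,
  which settles all \<open>d > N\<close>; the finitely many \<open>d \<le> N\<close> become
  stationary one by one.\<close>

theorem noeth_insert:
  assumes "noeth A"
  shows "noeth (insert c A)"
  unfolding noeth_def
proof (intro allI impI, elim conjE)
  fix J :: "nat \<Rightarrow> ('a \<Rightarrow> complex) set"
  assume J: "\<forall>n. fun_ideal (insert c A) (J n)" "\<forall>n. J n \<subseteq> J (Suc n)"
  have mono: "J m \<subseteq> J n" if "m \<le> n" for m n using lift_Suc_mono_le[of J m n] J(2) that by simp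
  define L where "L n d = lead A c (J n) d" for n d
  have Li: "fun_ideal A (L n d)" for n d unfolding L_def by (rule lead_ideal[OF J(1)[rule_format]])
  have Ld: "L n d \<subseteq> L n e" if "d \<le> e" for n d e
    using lift_Suc_mono_le[of "L n" d e] lead_Suc[OF J(1)[rule_format]] that by (simp add: L_def)
  have Ln: "L m d \<subseteq> L n d" if "m \<le> n" for m n d
    unfolding L_def by (rule lead_mono[OF mono[OF that]])
  have stab: "\<exists>N. \<forall>n\<ge>N. K n = K N" if "\<And>n. fun_ideal A (K n)" "\<And>n. K n \<subseteq> K (Suc n)" for K
    using assms that unfolding noeth_def by simp
  have "L n n \<subseteq> L (Suc n) (Suc n)" for n
    using Ln[of n "Suc n" n] Ld[of n "Suc n" "Suc n"] by auto
  then obtain N where N: "\<forall>n\<ge>N. L n n = L N N" using stab[of "\<lambda>n. L n n"] Li by blast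
  have "\<exists>N. \<forall>n\<ge>N. L n d = L N d" for d
    by (rule stab) (use Li Ln in auto)
  then obtain M where M: "\<And>d n. n \<ge> M d \<Longrightarrow> L n d = L (M d) d" by metis
  define K where "K = Max (insert N (M ` {..N}))"
  have K: "N \<le> K" "\<And>d. d \<le> N \<Longrightarrow> M d \<le> K" unfolding K_def by (auto intro!: Max_ge simp del: Max_insert)
  have same: "L n d = L K d" if "n \<ge> K" for n d
  proof (cases "d \<le> N")
    case True
    then have "M d \<le> K" "M d \<le> n" using K(2)[OF True] that by auto
    then show ?thesis using M[of d n] M[of d K] by simp
  next
    case False
    \<comment> \<open>\<open>L n d\<close> lies between \<open>L N N\<close> and the diagonal entry
      at \<open>max n d\<close>, and these two are equal.\<close>
    have up: "L n d = L N N" if "n \<ge> N" for n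
    proof
      have "L n d \<subseteq> L (max n d) (max n d)" using Ln[of n "max n d" d] Ld[of d "max n d" "max n d"] by auto
      moreover have "N \<le> max n d" using that by simp
      ultimately show "L n d \<subseteq> L N N" using N by metis
      show "L N N \<subseteq> L n d" using Ln[of N n N] Ld[of N d n] that False by auto
    qed
    show ?thesis using up[of n] up[of K] that K(1) by simp
  qed
  have "J n = J K" if "n \<ge> K" for n
    by (rule lead_eq_imp_eq[OF J(1)[rule_format] J(1)[rule_format] mono[OF that], symmetric])
       (use same[OF that] in \<open>simp add: L_def\<close>)
  then show "\<exists>N. \<forall>n\<ge>N. J n = J N" by blast
qed

theorem Hilbert_basis: "finite A \<Longrightarrow> noeth A"
  by (induction A rule: finite_induct) (auto intro: noeth_empty noeth_insert)

section \<open>Irreducible components\<close>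

definition relclosed :: "('p \<Rightarrow> complex) set \<Rightarrow> 'p set \<Rightarrow> 'p set \<Rightarrow> bool" where
  "relclosed C S V \<longleftrightarrow> (\<exists>F\<subseteq>poly_fun C. V = {q\<in>S. \<forall>f\<in>F. f q = 0})"

lemma relclosed_inter: "relclosed C S V \<Longrightarrow> f \<in> poly_fun C \<Longrightarrow> relclosed C S {q\<in>V. f q = 0}"
  unfolding relclosed_def by (elim exE conjE) (rule_tac x="insert f F" in exI, auto)

lemma relclosed_wf:
  assumes "finite C"
  shows "wf {(V, W). relclosed C S V \<and> relclosed C S W \<and> V \<subset> W}"
  unfolding wf_iff_no_infinite_down_chain
proof
  assume "\<exists>V. \<forall>i. (V (Suc i), V i) \<in> {(V, W). relclosed C S V \<and> relclosed C S W \<and> V \<subset> W}"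
  then obtain V where "\<forall>i. (V (Suc i), V i) \<in> {(V, W). relclosed C S V \<and> relclosed C S W \<and> V \<subset> W}" by (elim exE)
  then have V: "relclosed C S (V i)" "V (Suc i) \<subset> V i" for i by auto
  define I where "I n = {f\<in>poly_fun C. \<forall>q\<in>V n. f q = 0}" for n :: nat
  have "fun_ideal C (I n)" for n
    unfolding fun_ideal_def I_def by (auto intro: poly_fun.intros)
  moreover have "I n \<subseteq> I (Suc n)" for n using V(2)[of n] by (auto simp: I_def)
  ultimately obtain N where N: "\<forall>n\<ge>N. I n = I N"
    using Hilbert_basis[OF assms] unfolding noeth_def by presburger
  have eq: "V n = {q\<in>S. \<forall>f\<in>I n. f q = 0}" for n
  proof -
    obtain F where F: "F \<subseteq> poly_fun C" "V n = {q\<in>S. \<forall>f\<in>F. f q = 0}"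
      using V(1)[of n] unfolding relclosed_def by (elim exE conjE)
    then have "F \<subseteq> I n" by (auto simp: I_def)
    then show ?thesis using F(2) by (auto simp: I_def)
  qed
  have "V (Suc N) = V N" using eq[of N] eq[of "Suc N"] N[rule_format, of "Suc N"] by simp
  then show False using V(2)[of N] by simp
qed

lemma irreducible_decomposition:
  assumes "finite C" "relclosed C S V"
  shows "\<exists>\<V>. finite \<V> \<and> (\<forall>W\<in>\<V>. relclosed C S W \<and> irr C W) \<and> \<Union>\<V> = V"
  using assms(2)
proof (induction V rule: wf_induct_rule[OF relclosed_wf[OF assms(1), of S]])
  case (1 V)
  show ?case
  proof (cases "V = {} \<or> irr C V")
    case True
    then show ?thesis
    proof
      assume "V = {}"
      then show ?thesis by (intro exI[of _ "{}"]) simp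
    next
      assume "irr C V"
      then show ?thesis using 1(2) by (intro exI[of _ "{V}"]) simp
    qed
  next
    case False
    then have "\<not> (\<forall>f\<in>poly_fun C. \<forall>g\<in>poly_fun C. (\<forall>q\<in>V. f q * g q = 0) \<longrightarrow> (\<forall>q\<in>V. f q = 0) \<or> (\<forall>q\<in>V. g q = 0))"
      unfolding irr_def by satx
    then obtain f g where fg: "f \<in> poly_fun C" "g \<in> poly_fun C" "\<forall>q\<in>V. f q * g q = 0"
      "\<not> (\<forall>q\<in>V. f q = 0)" "\<not> (\<forall>q\<in>V. g q = 0)"
      unfolding Ball_def[of "poly_fun C"] not_all not_imp de_Morgan_disj by (elim exE conjE) (rule that)
    have c: "relclosed C S {q\<in>V. f q = 0}" "relclosed C S {q\<in>V. g q = 0}"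
      by (rule relclosed_inter[OF 1(2) fg(1)], rule relclosed_inter[OF 1(2) fg(2)])
    have "{q\<in>V. f q = 0} \<subset> V" "{q\<in>V. g q = 0} \<subset> V" using fg(4,5) by auto
    with 1 c obtain \<V> \<W> where "finite \<V>" "\<forall>W\<in>\<V>. relclosed C S W \<and> irr C W" "\<Union>\<V> = {q\<in>V. f q = 0}"
      "finite \<W>" "\<forall>W\<in>\<W>. relclosed C S W \<and> irr C W" "\<Union>\<W> = {q\<in>V. g q = 0}"
      by (metis (no_types, lifting) case_prodI mem_Collect_eq)
    then show ?thesis using fg(3) by (intro exI[of _ "\<V> \<union> \<W>"]) auto
  qed
qed

text \<open>Otherwise each \<open>V\<close> has a function that is 0 on \<open>V\<close> but not on
  \<open>W\<close>. The product of these functions is nonzero somewhere on the irreducible set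
  \<open>W\<close>, yet it vanishes on the union.\<close>

lemma irr_finite_union:
  assumes "finite \<V>" "irr C W" "W \<subseteq> \<Union>\<V>" "\<forall>V\<in>\<V>. relclosed C S V" "W \<subseteq> S"
  shows "\<exists>V\<in>\<V>. W \<subseteq> V"
proof (rule ccontr)
  assume neg: "\<not> ?thesis"
  have "\<exists>f. f \<in> poly_fun C \<and> (\<forall>q\<in>V. f q = 0) \<and> (\<exists>q\<in>W. f q \<noteq> 0)" if V: "V \<in> \<V>" for V
  proof -
    obtain F where F: "F \<subseteq> poly_fun C" "V = {q\<in>S. \<forall>f\<in>F. f q = 0}"
      using assms(4) V unfolding relclosed_def by meson
    obtain w where "w \<in> W" "w \<notin> V" using neg V by blast
    then obtain f where "f \<in> F" "f w \<noteq> 0" using F(2) assms(5) by blast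
    then show ?thesis using F \<open>w \<in> W\<close> by (intro exI[of _ f]) auto
  qed
  then obtain f where f: "\<And>V. V \<in> \<V> \<Longrightarrow> f V \<in> poly_fun C" "\<And>V q. V \<in> \<V> \<Longrightarrow> q \<in> V \<Longrightarrow> f V q = 0"
    "\<And>V. V \<in> \<V> \<Longrightarrow> \<exists>q\<in>W. f V q \<noteq> 0" by metis
  have "\<exists>q\<in>W. (\<Prod>V\<in>\<U>. f V q) \<noteq> 0" if "finite \<U>" "\<U> \<subseteq> \<V>" for \<U>
    using that
  proof (induction \<U> rule: finite_induct)
    case empty
    then show ?case using irr_nonempty[OF assms(2)] by auto
  next
    case (insert V \<U>)
    have 1: "(\<lambda>q. \<Prod>V\<in>\<U>. f V q) \<in> poly_fun C" by (rule poly_fun_prod) (use f insert.prems in auto)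
    have 2: "f V \<in> poly_fun C" using f(1) insert.prems by simp
    show ?case
    proof (rule ccontr)
      assume "\<not> ?thesis"
      then have "\<forall>q\<in>W. f V q * (\<Prod>V\<in>\<U>. f V q) = 0" using insert by auto
      from irr_disj[OF assms(2) 2 1 this] show False
        using f(3)[of V] insert by auto
    qed
  qed
  from this[OF assms(1) order.refl] obtain q where q: "q \<in> W" "(\<Prod>V\<in>\<V>. f V q) \<noteq> 0" by blast
  then obtain V where "V \<in> \<V>" "q \<in> V" using assms(3) by blast
  then show False using q(2) f(2) assms(1) by (auto simp: prod_zero_iff)
qed

lemma relclosed_Union:
  assumes "finite \<V>" "\<forall>V\<in>\<V>. relclosed C S V"
  shows "closedin (subtopology (zariski C) S) (\<Union>\<V>)"
  using assms by (intro closedin_Union) (auto simp: relclosed_def closedin_sub_zariski)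

text \<open>In a cover by the least number of irreducible closed pieces each piece owns a point that
  lies in no other. Homogeneity carries such a point to any given point, so no point lies in two
  pieces; connectedness leaves room for only one of finitely many disjoint closed pieces.\<close>

theorem irr_if_connected_homogeneous:
  assumes C: "finite C" and S: "S \<noteq> {}" "connectedin (zariski C) S"
    and hom: "\<And>p q. p \<in> S \<Longrightarrow> q \<in> S \<Longrightarrow> \<exists>\<phi> \<psi>. \<phi> p = q \<and> (\<forall>r\<in>S. \<phi> r \<in> S \<and> \<psi> r \<in> S \<and> \<phi> (\<psi> r) = r \<and> \<psi> (\<phi> r) = r) \<and>
      (\<forall>c\<in>C. (\<lambda>r. c (\<phi> r)) \<in> poly_fun C \<and> (\<lambda>r. c (\<psi> r)) \<in> poly_fun C)"
  shows "irr C S"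
proof -
  define cov where "cov \<V> \<longleftrightarrow> finite \<V> \<and> (\<forall>W\<in>\<V>. relclosed C S W \<and> irr C W) \<and> \<Union>\<V> = S" for \<V>
  have "relclosed C S S" unfolding relclosed_def by (rule exI[of _ "{}"]) simp
  from irreducible_decomposition[OF C this] have "\<exists>\<V>. cov \<V>" unfolding cov_def .
  then obtain \<V> where \<V>: "cov \<V>" and min: "\<And>\<W>. cov \<W> \<Longrightarrow> card \<V> \<le> card \<W>"
    using ex_has_least_nat[of cov _ card] by metis
  have fin: "finite \<V>" and cl: "\<And>V. V \<in> \<V> \<Longrightarrow> relclosed C S V" and ir: "\<And>V. V \<in> \<V> \<Longrightarrow> irr C V" and un: "\<Union>\<V> = S"
    using \<V> by (auto simp: cov_def)
  have own: "\<exists>p\<in>V. \<forall>W\<in>\<V>. p \<in> W \<longrightarrow> W = V" if V: "V \<in> \<V>" for V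
  proof (rule ccontr)
    assume "\<not> ?thesis"
    then have "\<Union>(\<V> - {V}) = S" using un V by blast
    then have "cov (\<V> - {V})" using \<V> by (auto simp: cov_def)
    then show False using min fin V by (metis card_Diff1_less not_less)
  qed
  have incl: "V = W" if "V \<in> \<V>" "W \<in> \<V>" "V \<subseteq> W" for V W
    using own[OF that(1)] that by blast
  have disj: "V1 = V2" if V12: "V1 \<in> \<V>" "V2 \<in> \<V>" "q \<in> V1" "q \<in> V2" for V1 V2 q
  proof -
    obtain V where V: "V \<in> \<V>" using un S(1) by blast
    obtain p where p: "p \<in> V" "\<forall>W\<in>\<V>. p \<in> W \<longrightarrow> W = V" using own[OF V] by blast
    have pS: "p \<in> S" and qS: "q \<in> S" using p(1) V V12 un by auto
    obtain \<phi> \<psi> where ps0: "\<phi> p = q" "\<forall>r\<in>S. \<phi> r \<in> S \<and> \<psi> r \<in> S \<and> \<phi> (\<psi> r) = r \<and> \<psi> (\<phi> r) = r"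
      "\<forall>c\<in>C. (\<lambda>r. c (\<phi> r)) \<in> poly_fun C \<and> (\<lambda>r. c (\<psi> r)) \<in> poly_fun C"
      using hom[OF pS qS] by (elim exE conjE)
    have ps: "\<phi> p = q" "\<And>r. r \<in> S \<Longrightarrow> \<phi> r \<in> S" "\<And>r. r \<in> S \<Longrightarrow> \<psi> r \<in> S" "\<And>r. r \<in> S \<Longrightarrow> \<phi> (\<psi> r) = r"
      "\<And>r. r \<in> S \<Longrightarrow> \<psi> (\<phi> r) = r" "\<forall>c\<in>C. (\<lambda>r. c (\<phi> r)) \<in> poly_fun C" "\<forall>c\<in>C. (\<lambda>r. c (\<psi> r)) \<in> poly_fun C"
      using ps0 by simp_all
    have VS: "V \<subseteq> S" if "V \<in> \<V>" for V using un that by blast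
    \<comment> \<open>The image of \<open>W\<close> under \<open>\<psi>\<close> is irreducible, so a
      single piece contains it; as it passes through \<open>p\<close>, that piece is
      \<open>V\<close>.\<close>
    have in_V: "\<psi> ` W \<subseteq> V" if W: "W \<in> \<V>" "q \<in> W" for W
    proof -
      have "irr C (\<psi> ` W)" by (rule irr_image[OF ir[OF W(1)]]) (use ps(7) in auto)
      moreover have "\<psi> ` W \<subseteq> S" using ps(3) VS[OF W(1)] by auto
      ultimately obtain U where U: "U \<in> \<V>" "\<psi> ` W \<subseteq> U"
        using irr_finite_union[OF fin, of C "\<psi> ` W" S] cl un by auto
      have "\<psi> q = p" using ps(5)[OF pS] ps(1) by simp
      then have "p \<in> U" using U(2) W(2) by auto
      then show ?thesis using p(2) U by auto
    qed
    have "irr C (\<phi> ` V)" by (rule irr_image[OF ir[OF V]]) (use ps(6) in auto)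
    moreover have "\<phi> ` V \<subseteq> S" using ps(2) VS[OF V] by auto
    ultimately obtain U where U: "U \<in> \<V>" "\<phi> ` V \<subseteq> U"
      using irr_finite_union[OF fin, of C "\<phi> ` V" S] cl un by auto
    have "W \<subseteq> U" if W: "W \<in> \<V>" "q \<in> W" for W
    proof
      fix r assume r: "r \<in> W"
      then have "\<psi> r \<in> V" using in_V[OF W] by auto
      then have "\<phi> (\<psi> r) \<in> U" using U(2) by auto
      then show "r \<in> U" using ps(4) r VS[OF W(1)] by auto
    qed
    then show ?thesis using incl[of V1 U] incl[of V2 U] V12 U(1) by simp
  qed
  obtain V where V: "V \<in> \<V>" using un S(1) by blast
  have "\<Union>(\<V> - {V}) = {}"
  proof (rule ccontr)
    assume ne: "\<Union>(\<V> - {V}) \<noteq> {}"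
    have "closedin (subtopology (zariski C) S) (\<Union>(\<V> - {V}))" "closedin (subtopology (zariski C) S) (\<Union>{V})"
      using fin cl V by (auto intro!: relclosed_Union[of "\<V> - {V}"] relclosed_Union[of "{V}", simplified])
    moreover have "\<Union>{V} \<union> \<Union>(\<V> - {V}) = S" using un V by blast
    moreover have "\<Union>{V} \<inter> \<Union>(\<V> - {V}) = {}" using disj[OF V] by auto
    moreover have "\<Union>{V} \<noteq> {}" using irr_nonempty[OF ir[OF V]] by simp
    ultimately show False
      using S(2) ne unfolding connectedin_def connected_space_closedin_eq by (metis topspace_subtopology_subset topspace_zariski subset_UNIV)
  qed
  then have "V = S" using un V by blast
  then show ?thesis using ir[OF V] by simp
qed

subsection \<open>Matrices, traces and nilpotency\<close>

lemma cscale_nth [simp]: "(c *\<^sub>C A) $ i $ j = c * A $ i $ j"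
  by (simp add: cscale_def)

lemma mat_eqI: "(\<And>i j. A $ i $ j = B $ i $ j) \<Longrightarrow> A = B"
  by (simp add: vec_eq_iff)

lemma matmul_nth: "(A ** B) $ i $ j = (\<Sum>k\<in>UNIV. A $ i $ k * B $ k $ j)"
  by (simp add: matrix_matrix_mult_def)

lemma mm_add_left: "(A + B) ** C = A ** C + B ** (C :: complex^'n^'n)"
  and mm_add_right: "A ** (B + C) = A ** B + A ** (C :: complex^'n^'n)"
  and mm_diff_left: "(A - B) ** C = A ** C - B ** (C :: complex^'n^'n)"
  and mm_diff_right: "A ** (B - C) = A ** B - A ** (C :: complex^'n^'n)"
  and mm_scale_left: "(c *\<^sub>C A) ** C = c *\<^sub>C (A ** C)"
  and mm_scale_right: "A ** (c *\<^sub>C C) = c *\<^sub>C (A ** C)"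
  for A B C :: "complex^'n^'n"
  by (rule mat_eqI, simp add: matmul_nth algebra_simps sum.distrib sum_subtractf sum_distrib_left)+

lemma mm_zero_right [simp]: "(A :: complex^'n^'n) ** 0 = 0"
  by (rule mat_eqI) (simp add: matmul_nth)

lemma mm_minus_left: "(- A) ** B = - (A ** (B :: complex^'n^'n))"
  and mm_minus_right: "A ** (- B) = - (A ** (B :: complex^'n^'n))"
  by (rule mat_eqI, simp add: matmul_nth sum_negf)+

lemma mm_sum_left: "(\<Sum>i\<in>S. f i :: complex^'n^'n) ** (B :: complex^'n^'n) = (\<Sum>i\<in>S. f i ** B)"
  by (induction S rule: infinite_finite_induct) (auto simp: mm_add_left)

lemma mm_sum_right: "(B :: complex^'n^'n) ** (\<Sum>i\<in>S. f i :: complex^'n^'n) = (\<Sum>i\<in>S. B ** f i)"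
  by (induction S rule: infinite_finite_induct) (auto simp: mm_add_right)

lemmas mm_simps = mm_add_left mm_add_right mm_diff_left mm_diff_right mm_scale_left mm_scale_right
  mm_minus_left mm_minus_right matrix_mul_assoc

lemma trace_mul_commute: "trace (A ** B) = trace (B ** (A :: complex^'n^'n))"
  unfolding trace_def matmul_nth by (subst sum.swap) (simp add: mult.commute)

lemma trace_scale: "trace (c *\<^sub>C A) = c * trace A"
  by (simp add: trace_def sum_distrib_left)

lemma trace_zero [simp]: "trace (0 :: complex^'n^'n) = 0"
  by (simp add: trace_def)

lemma trace_sum: "trace (\<Sum>i\<in>S. f i) = (\<Sum>i\<in>S. trace (f i :: complex^'n^'n))"
  by (induction S rule: infinite_finite_induct) (auto simp: trace_add)

lemma trace_bracket: "trace (lie_bracket a b ** c) = trace (a ** lie_bracket b c)"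
proof -
  have "trace (b ** a ** c) = trace (a ** c ** b)"
    using trace_mul_commute[of b "a ** c"] by (simp add: matrix_mul_assoc)
  then show ?thesis by (simp add: lie_bracket_def mm_simps trace_sub)
qed

definition mpow :: "complex^'n^'n \<Rightarrow> nat \<Rightarrow> complex^'n^'n" where
  "mpow A k = (((**) A) ^^ k) (mat 1)"

lemma mpow_0 [simp]: "mpow A 0 = mat 1"
  and mpow_Suc: "mpow A (Suc k) = A ** mpow A k"
  by (simp_all add: mpow_def)

lemma mpow_add: "mpow A (j + k) = mpow A j ** mpow A k"
  by (induction j) (auto simp: mpow_Suc matrix_mul_assoc)

lemma mpow_1 [simp]: "mpow A (Suc 0) = A"
  by (simp add: mpow_Suc)

lemma mpow_Suc_right: "mpow A (Suc k) = mpow A k ** A"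
  using mpow_add[of A k 1] by simp

lemma nilpotent_mat_iff: "nilpotent_mat A \<longleftrightarrow> (\<exists>k. mpow A k = 0)"
  by (simp add: nilpotent_mat_def mpow_def)

lemma poly_fun_det:
  assumes "\<And>i j. (\<lambda>t. A t $ i $ j) \<in> poly_fun C"
  shows "(\<lambda>t. det (A t :: complex^'n^'n)) \<in> poly_fun C"
  unfolding det_def by (intro poly_fun_sum poly_fun_cmult poly_fun_prod assms)

lemma DERIV_det_one_plus:
  "((\<lambda>t. det (mat 1 + t *\<^sub>C A)) has_field_derivative trace (A :: complex^'n^'n)) (at 0)"
proof -
  have e: "(mat 1 + t *\<^sub>C A) $ i $ j = (if i = j then 1 else 0) + t * A $ i $ j" for t i j
    by (simp add: mat_def)
  have d: "((\<lambda>t. \<Prod>i\<in>UNIV. (mat 1 + t *\<^sub>C A) $ i $ p i) has_field_derivative (if p = id then trace A else 0)) (at 0)"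
    if p: "p permutes (UNIV :: 'n set)" for p
  proof -
    have "((\<lambda>t. \<Prod>i\<in>UNIV. (mat 1 + t *\<^sub>C A) $ i $ p i) has_field_derivative
        (\<Sum>i\<in>UNIV. A $ i $ p i * (\<Prod>j\<in>UNIV - {i}. (mat 1 + 0 *\<^sub>C A) $ j $ p j))) (at 0)"
      unfolding e by (rule has_field_derivative_prod) (auto intro!: derivative_eq_intros)
    moreover have "(\<Sum>i\<in>UNIV. A $ i $ p i * (\<Prod>j\<in>UNIV - {i}. (mat 1 + 0 *\<^sub>C A) $ j $ p j)) = (if p = id then trace A else 0)"
    proof (cases "p = id")
      case True
      then show ?thesis unfolding e by (simp add: trace_def)
    next
      case False
      \<comment> \<open>A permutation that moves one point moves at least two. After the factor
        \<open>i\<close> is removed, an off-diagonal factor remains, and it is 0 at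
        \<open>t = 0\<close>.\<close>
      have z: "(\<Prod>j\<in>UNIV - {i}. (mat 1 + 0 *\<^sub>C A) $ j $ p j) = 0" for i
      proof -
        obtain k where k: "p k \<noteq> k" using False by (auto simp: fun_eq_iff)
        have "inj p" using p by (rule permutes_inj)
        then have "p (p k) \<noteq> p k" using k by (simp add: inj_eq)
        then obtain j where "j \<noteq> i" "p j \<noteq> j" using k by metis
        then show ?thesis unfolding e by (intro prod_zero) (auto intro!: bexI[of _ j])
      qed
      show ?thesis using False by (simp only: z mult_zero_right sum.neutral_const if_False)
    qed
    ultimately show ?thesis by simp
  qed
  have "((\<lambda>t. det (mat 1 + t *\<^sub>C A)) has_field_derivative
     (\<Sum>p\<in>{p. p permutes (UNIV :: 'n set)}. of_int (sign p) * (if p = id then trace A else 0))) (at 0)"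
    unfolding det_def by (rule DERIV_sum) (rule DERIV_cmult, rule d, simp)
  moreover have "(\<Sum>p\<in>{p. p permutes (UNIV :: 'n set)}. of_int (sign p) * (if p = id then trace A else 0)) = trace A"
  proof -
    have "(\<Sum>p\<in>{p. p permutes (UNIV :: 'n set)}. of_int (sign p) * (if p = id then trace A else 0)) =
       (\<Sum>p\<in>{p. p permutes (UNIV :: 'n set)}. if p = id then trace A else 0)"
      by (intro sum.cong) (auto simp: sign_id)
    also have "\<dots> = trace A" by (simp add: sum.delta permutes_id finite_permutations)
    finally show ?thesis .
  qed
  ultimately show ?thesis by simp
qed

lemma poly_fun_var: "(\<lambda>t. t) \<in> poly_fun {\<lambda>x. x}"
  by (rule poly_fun.coord) simp

lemma geometric_inverse:
  fixes N :: "complex^'n^'n"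
  assumes "mpow N k = 0"
  shows "(mat 1 + t *\<^sub>C N) ** (\<Sum>j<k. (- t) ^ j *\<^sub>C mpow N j) = mat 1"
proof -
  have "(mat 1 + t *\<^sub>C N) ** (\<Sum>j<k. (- t) ^ j *\<^sub>C mpow N j) = mat 1 - (- t) ^ k *\<^sub>C mpow N k" for k
  proof (induction k)
    case 0
    show ?case by (rule mat_eqI) simp
  next
    case (Suc k)
    have "(mat 1 + t *\<^sub>C N) ** ((- t) ^ k *\<^sub>C mpow N k) = (- t) ^ k *\<^sub>C mpow N k - (- t) ^ Suc k *\<^sub>C mpow N (Suc k)"
      by (rule mat_eqI) (simp add: mm_simps mpow_Suc algebra_simps)
    then show ?case using Suc by (simp add: mm_add_right)
  qed
  then show ?thesis using assms by (simp add: cmat.scale_zero_right)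
qed

text \<open>The determinant of \<open>1 + t N\<close> is a polynomial in \<open>t\<close> whose
  inverse, the determinant of a finite geometric series, is also a polynomial. So it is constant,
  and its derivative at 0 is the trace.\<close>

theorem trace_nilpotent:
  assumes "nilpotent_mat (N :: complex^'n^'n)"
  shows "trace N = 0"
proof -
  obtain k where k: "mpow N k = 0" using assms by (auto simp: nilpotent_mat_iff)
  have "(\<lambda>t. det (mat 1 + t *\<^sub>C N)) \<in> poly_fun {\<lambda>x. x}"
    by (rule poly_fun_det, simp, rule poly_fun.add[OF poly_fun.const poly_fun.mult[OF poly_fun_var poly_fun.const]])
  then obtain p where p: "\<And>t. det (mat 1 + t *\<^sub>C N) = poly p t" using poly_fun_id by metis
  have "(\<lambda>t. det (\<Sum>j<k. (- t) ^ j *\<^sub>C mpow N j)) \<in> poly_fun {\<lambda>x. x}"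
    by (rule poly_fun_det, unfold sum_component cscale_nth, rule poly_fun_sum,
        rule poly_fun.mult[OF poly_fun_power[OF poly_fun_uminus[OF poly_fun_var]] poly_fun.const])
  from poly_fun_id[OF this] obtain q where "(\<lambda>t. det (\<Sum>j<k. (- t) ^ j *\<^sub>C mpow N j)) = poly q" ..
  then have q: "det (\<Sum>j<k. (- t) ^ j *\<^sub>C mpow N j) = poly q t" for t by (rule fun_cong)
  have "poly (p * q) t = poly 1 t" for t
    using arg_cong[OF geometric_inverse[OF k, of t], of det] by (simp add: det_mul p q)
  then have "p * q = 1" by (simp add: poly_eq_poly_eq_iff[symmetric] fun_eq_iff)
  then have "p dvd 1" by (metis dvd_triv_left)
  then obtain c where "p = [:c:]" by (metis is_unit_polyE)
  then have "((\<lambda>t. det (mat 1 + t *\<^sub>C N)) has_field_derivative 0) (at 0)" by (simp add: p)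
  then show ?thesis using DERIV_det_one_plus DERIV_unique by blast
qed

text \<open>The polynomial \<open>det (1 + (u - 1) e)\<close> is multiplicative in \<open>u\<close>,
  hence equal to \<open>u ^ r\<close>, and its derivative at \<open>u = 1\<close> is the trace. If
  \<open>r = 0\<close>, its value at \<open>u = 0\<close> makes \<open>1 - e\<close> invertible,
  while \<open>(1 - e) e = 0\<close>.\<close>

theorem trace_idempotent:
  fixes e :: "complex^'n^'n"
  assumes e: "e ** e = e"
  obtains r where "trace e = of_nat r" "r = 0 \<Longrightarrow> e = 0"
proof -
  have "(\<lambda>u. det (mat 1 + (u - 1) *\<^sub>C e)) \<in> poly_fun {\<lambda>x. x}"
    by (rule poly_fun_det, simp, rule poly_fun.add[OF poly_fun.const
          poly_fun.mult[OF poly_fun_diff[OF poly_fun_var poly_fun.const] poly_fun.const]])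
  then obtain q where q: "\<And>u. det (mat 1 + (u - 1) *\<^sub>C e) = poly q u" using poly_fun_id by metis
  have mult: "poly q (u * v) = poly q u * poly q v" for u v
  proof -
    have "(mat 1 + (u - 1) *\<^sub>C e) ** (mat 1 + (v - 1) *\<^sub>C e) = mat 1 + (u * v - 1) *\<^sub>C e"
      by (rule mat_eqI) (simp add: mm_simps e algebra_simps)
    from arg_cong[OF this, of det] show ?thesis by (simp add: det_mul q)
  qed
  have q1: "poly q 1 = 1" using q[of 1] by (simp add: cmat.scale_zero_left)
  then have q0: "q \<noteq> 0" by auto
  define r where "r = degree q"
  have qu: "poly q u = u ^ r" for u
  proof -
    have "poly (pcompose q [:0, u:]) v = poly (smult (poly q u) q) v" for v
      by (simp add: poly_pcompose mult[symmetric] mult.commute)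
    then have "pcompose q [:0, u:] = smult (poly q u) q" by (simp add: poly_eq_poly_eq_iff[symmetric] fun_eq_iff)
    then have "coeff (pcompose q [:0, u:]) r = coeff (smult (poly q u) q) r" by simp
    then have "u ^ r * coeff q r = poly q u * coeff q r" by (simp add: coeff_pcompose_linear)
    then show ?thesis using q0 by (simp add: r_def)
  qed
  have "det (mat 1 + t *\<^sub>C e) = (t + 1) ^ r" for t using q[of "t + 1"] qu[of "t + 1"] by simp
  then have "((\<lambda>t. (t + 1) ^ r) has_field_derivative trace e) (at 0)"
    using DERIV_det_one_plus[of e] by simp
  moreover have "((\<lambda>t. (t + 1) ^ r) has_field_derivative of_nat r) (at (0::complex))"
    by (auto intro!: derivative_eq_intros)
  ultimately have "trace e = of_nat r" by (rule DERIV_unique)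
  moreover have "e = 0" if "r = 0"
  proof -
    have "det (mat 1 + (0 - 1) *\<^sub>C e) = 1" unfolding q qu that by simp
    then have "invertible (mat 1 + (0 - 1) *\<^sub>C e)" by (simp add: invertible_det_nz)
    then obtain B where B: "B ** (mat 1 + (0 - 1) *\<^sub>C e) = mat 1" by (auto simp: invertible_def)
    have "(mat 1 + (0 - 1) *\<^sub>C e) ** e = 0" by (rule mat_eqI) (simp add: mm_simps e)
    then have "B ** ((mat 1 + (0 - 1) *\<^sub>C e) ** e) = 0" by simp
    then show ?thesis unfolding matrix_mul_assoc B by simp
  qed
  ultimately show ?thesis using that by blast
qed

section \<open>Polynomials in a linear operator and generalized eigenspaces\<close>

definition clin :: "(complex^'n^'n \<Rightarrow> complex^'n^'n) \<Rightarrow> bool" where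
  "clin T \<longleftrightarrow> (\<forall>a b. T (a + b) = T a + T b) \<and> (\<forall>c a. T (c *\<^sub>C a) = c *\<^sub>C T a)"

lemma clin_add: "clin T \<Longrightarrow> T (a + b) = T a + T b"
  and clin_scale: "clin T \<Longrightarrow> T (c *\<^sub>C a) = c *\<^sub>C T a"
  by (simp_all add: clin_def)

lemma clin_0: "clin T \<Longrightarrow> T 0 = 0"
  using clin_scale[of T 0 0] by (simp add: cmat.scale_zero_left)

lemma clin_diff: "clin T \<Longrightarrow> T (a - b) = T a - T b"
  using clin_add[of T "a - b" b] by (simp add: algebra_simps)

lemma clin_sum: "clin T \<Longrightarrow> T (\<Sum>i\<in>S. f i) = (\<Sum>i\<in>S. T (f i))"
  by (induction S rule: infinite_finite_induct) (auto simp: clin_0 clin_add)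

definition pol :: "complex poly \<Rightarrow> (complex^'n^'n \<Rightarrow> complex^'n^'n) \<Rightarrow> complex^'n^'n \<Rightarrow> complex^'n^'n" where
  "pol p T v = fold_coeffs (\<lambda>a w. a *\<^sub>C v + T w) p 0"

lemma pol_0 [simp]: "pol 0 T v = 0"
  by (simp add: pol_def)

lemma pol_pCons: "clin T \<Longrightarrow> pol (pCons a p) T v = a *\<^sub>C v + T (pol p T v)"
  by (cases "a = 0 \<and> p = 0") (auto simp: pol_def cmat.scale_zero_left clin_0)

lemma pol_1: "clin T \<Longrightarrow> pol 1 T v = v"
  by (simp add: one_pCons pol_pCons clin_0 cmat.scale_one)

lemma pol_add: "clin T \<Longrightarrow> pol (p + q) T v = pol p T v + pol q T v"
  by (induction p q rule: poly_induct2) (auto simp: pol_pCons clin_add cmat.scale_left_distrib)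

lemma pol_smult: "clin T \<Longrightarrow> pol (smult c p) T v = c *\<^sub>C pol p T v"
  by (induction p) (auto simp: pol_pCons clin_scale cmat.scale_right_distrib cmat.scale_zero_right)

lemma pol_mult: "clin T \<Longrightarrow> pol (p * q) T v = pol p T (pol q T v)"
  by (induction p) (auto simp: pol_pCons pol_add pol_smult cmat.scale_zero_left)

lemma pol_sum: "clin T \<Longrightarrow> pol (\<Sum>i\<in>S. f i) T v = (\<Sum>i\<in>S. pol (f i) T v)"
  by (induction S rule: infinite_finite_induct) (auto simp: pol_add)

lemma clin_pol: "clin T \<Longrightarrow> clin (pol p T)"
proof (induction p)
  case 0
  then show ?case by (simp add: clin_def cmat.scale_zero_right)
next
  case (pCons a p)
  then show ?case
    by (simp add: clin_def pol_pCons cmat.scale_right_distrib cmat.scale_left_commute)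
qed

lemma pol_monom: "clin T \<Longrightarrow> pol (monom c n) T v = c *\<^sub>C (T ^^ n) v"
  by (induction n) (auto simp: monom_0 monom_Suc pol_pCons clin_0 clin_scale cmat.scale_zero_left)

lemma pol_dvd: "clin T \<Longrightarrow> p dvd q \<Longrightarrow> pol p T v = 0 \<Longrightarrow> pol q T v = 0"
  by (auto elim!: dvdE simp: mult.commute[of p] pol_mult clin_0[OF clin_pol])

lemma pol_linear_factor: "clin T \<Longrightarrow> pol [:- l, 1:] T v = T v - l *\<^sub>C v"
  by (simp add: pol_pCons clin_0 cmat.scale_one)

lemma pol_in_subspace:
  assumes "clin T" "cmat.subspace S" "\<And>v. v \<in> S \<Longrightarrow> T v \<in> S" "v \<in> S"
  shows "pol p T v \<in> S"
  using assms by (induction p) (auto simp: pol_pCons cmat.subspace_0 intro!: cmat.subspace_add cmat.subspace_scale)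

definition lpow :: "nat \<Rightarrow> complex \<Rightarrow> complex poly" where
  "lpow N l = [:- l, 1:] ^ N"

text \<open>\<open>R\<close> is invertible modulo \<open>X - m\<close>: there is
  \<open>1 = R s + t\<close> with \<open>t\<close> divisible by \<open>X - m\<close>. Since
  \<open>R s = 1 - t\<close> divides \<open>1 - t ^ N\<close>, it is invertible modulo the
  \<open>N\<close>-th power as well.\<close>

lemma bezout_lpow:
  assumes "poly R m \<noteq> 0"
  shows "\<exists>a b. a * lpow N m + b * R = 1"
proof -
  let ?X = "[:- m, 1:]" and ?c = "poly R m"
  have "?X dvd R - [:?c:]" by (simp add: poly_eq_0_iff_dvd[symmetric])
  then obtain r where r: "R - [:?c:] = ?X * r" by (elim dvdE)
  define s where "s = [:1 / ?c:]"
  have one: "1 = R * s + ?X * (- r * s)"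
  proof -
    have "R * s + ?X * (- r * s) = (R - ?X * r) * s" by (simp add: algebra_simps)
    also have "\<dots> = [:?c:] * s" unfolding r[symmetric] by simp
    also have "\<dots> = 1" using assms by (simp add: s_def one_pCons)
    finally show ?thesis by simp
  qed
  define t where "t = ?X * (- r * s)"
  have "(R * s + t) - t dvd (R * s + t) ^ N - t ^ N"
    unfolding power_diff_sumr2[of _ N] by (rule dvd_triv_left)
  then have "R * s dvd 1 - t ^ N" using one by (simp add: t_def)
  then obtain u where u: "1 - t ^ N = R * s * u" by (elim dvdE)
  have "t ^ N = (- r * s) ^ N * lpow N m" unfolding t_def lpow_def power_mult_distrib by (simp add: mult.commute)
  then have "(- r * s) ^ N * lpow N m + (s * u) * R = 1" using u by (simp add: algebra_simps)
  then show ?thesis by blast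
qed

text \<open>At an operator killed by the product of all \<open>lpow N l\<close>, the polynomials
  \<open>E l\<close> become the projections onto the generalized eigenspaces.\<close>

lemma partition_of_unity:
  assumes "finite \<Lambda>" "\<Lambda> \<noteq> {}"
  shows "\<exists>E. (\<Sum>l\<in>\<Lambda>. E l) = 1 \<and> (\<forall>l\<in>\<Lambda>. (\<Prod>m\<in>\<Lambda> - {l}. lpow N m) dvd E l)"
  using assms
proof (induction \<Lambda> rule: finite_ne_induct)
  case (singleton x)
  then show ?case by (intro exI[of _ "\<lambda>_. 1"]) simp
next
  case (insert m \<Lambda>)
  then obtain E where E: "(\<Sum>l\<in>\<Lambda>. E l) = 1" "\<And>l. l \<in> \<Lambda> \<Longrightarrow> (\<Prod>m\<in>\<Lambda> - {l}. lpow N m) dvd E l" by auto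
  define R where "R = (\<Prod>l\<in>\<Lambda>. lpow N l)"
  have "poly R m \<noteq> 0" using insert.hyps by (auto simp: R_def lpow_def poly_prod prod_zero_iff)
  from bezout_lpow[OF this] obtain a b where ab: "a * lpow N m + b * R = 1" by blast
  define E' where "E' l = (if l = m then b * R else E l * (a * lpow N m))" for l
  have "(\<Sum>l\<in>insert m \<Lambda>. E' l) = b * R + (\<Sum>l\<in>\<Lambda>. E l * (a * lpow N m))"
  proof -
    have "(\<Sum>l\<in>\<Lambda>. E' l) = (\<Sum>l\<in>\<Lambda>. E l * (a * lpow N m))"
      by (rule sum.cong) (use insert.hyps in \<open>auto simp: E'_def\<close>)
    then show ?thesis using insert.hyps by (simp add: E'_def[of m])
  qed
  also have "\<dots> = 1" using ab E(1) by (simp add: sum_distrib_right[symmetric] add.commute)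
  finally have s: "(\<Sum>l\<in>insert m \<Lambda>. E' l) = 1" .
  have "(\<Prod>k\<in>insert m \<Lambda> - {l}. lpow N k) dvd E' l" if l: "l \<in> insert m \<Lambda>" for l
  proof (cases "l = m")
    case True
    then have "insert m \<Lambda> - {l} = \<Lambda>" using insert.hyps by auto
    then show ?thesis using True by (simp add: E'_def R_def)
  next
    case False
    then have "insert m \<Lambda> - {l} = insert m (\<Lambda> - {l})" by auto
    then have "(\<Prod>k\<in>insert m \<Lambda> - {l}. lpow N k) = lpow N m * (\<Prod>k\<in>\<Lambda> - {l}. lpow N k)"
      using insert.hyps by simp
    also have "\<dots> dvd (a * lpow N m) * E l"
      using E(2)[of l] l False by (intro mult_dvd_mono) auto
    finally show ?thesis using False by (simp add: E'_def mult.commute)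
  qed
  then show ?case using s by blast
qed

section \<open>Finite dimension of the matrix space and annihilating polynomials\<close>

definition mat_units :: "(complex^'n^'n) set" where
  "mat_units = (\<lambda>(k, l). (\<chi> i j. if i = k \<and> j = l then 1 else 0)) ` UNIV"

lemma mat_units_expand:
  "A = (\<Sum>(k, l)\<in>UNIV. A $ k $ l *\<^sub>C ((\<chi> i j. if i = k \<and> j = l then 1 else 0) :: complex^'n^'n))"
proof (rule mat_eqI)
  fix i j
  have "(\<Sum>(k, l)\<in>UNIV. A $ k $ l *\<^sub>C ((\<chi> i j. if i = k \<and> j = l then 1 else 0) :: complex^'n^'n)) $ i $ j
     = (\<Sum>x\<in>UNIV. A $ fst x $ snd x * (if i = fst x \<and> j = snd x then 1 else 0))"
    by (simp add: sum_component case_prod_beta)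
  also have "\<dots> = (\<Sum>x\<in>UNIV. if x = (i, j) then A $ i $ j else 0)"
    by (rule sum.cong) (auto simp: prod_eq_iff)
  finally show "A $ i $ j = (\<Sum>(k, l)\<in>UNIV. A $ k $ l *\<^sub>C ((\<chi> i j. if i = k \<and> j = l then 1 else 0) :: complex^'n^'n)) $ i $ j"
    by simp
qed

lemma span_mat_units: "cmat.span (mat_units :: (complex^'n^'n) set) = UNIV"
proof -
  have "A \<in> cmat.span mat_units" for A :: "complex^'n^'n"
    by (subst mat_units_expand[of A], unfold case_prod_beta, rule cmat.span_sum, rule cmat.span_scale,
        rule cmat.span_base) (force simp: mat_units_def)
  then show ?thesis by blast
qed

lemma independent_mat_units: "cmat.independent (mat_units :: (complex^'n^'n) set)"
proof
  let ?e = "\<lambda>(k, l). (\<chi> i j. if i = k \<and> j = l then 1 else 0) :: complex^'n^'n"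
  have inj: "inj ?e"
  proof (rule injI)
    fix x y :: "'n \<times> 'n" assume "?e x = ?e y"
    then have "?e x $ fst x $ snd x = ?e y $ fst x $ snd x" by simp
    then show "x = y" by (auto simp: case_prod_beta prod_eq_iff split: if_splits)
  qed
  assume "cmat.dependent (mat_units :: (complex^'n^'n) set)"
  then obtain u where u: "\<exists>v\<in>mat_units. u v \<noteq> 0" "(\<Sum>v\<in>mat_units. u v *\<^sub>C (v :: complex^'n^'n)) = 0"
    by (subst (asm) cmat.dependent_finite) (auto simp: mat_units_def)
  have "u (?e (i, j)) = 0" for i j
  proof -
    have "(\<Sum>x\<in>UNIV. u (?e x) *\<^sub>C ?e x) = 0"
      using u(2) unfolding mat_units_def by (simp add: sum.reindex[OF inj])
    then have "(\<Sum>x\<in>UNIV. u (?e x) *\<^sub>C ?e x) $ i $ j = 0" by simp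
    also have "(\<Sum>x\<in>UNIV. u (?e x) *\<^sub>C ?e x) $ i $ j = (\<Sum>x\<in>UNIV. u (?e x) * (if i = fst x \<and> j = snd x then 1 else 0))"
      by (simp add: sum_component case_prod_beta)
    also have "\<dots> = (\<Sum>x\<in>UNIV. if x = (i, j) then u (?e (i, j)) else 0)"
      by (rule sum.cong) (auto simp: prod_eq_iff)
    finally show ?thesis by simp
  qed
  then show False using u(1) by (auto simp: mat_units_def)
qed

interpretation cmat: finite_dimensional_vector_space "cscale :: complex \<Rightarrow> complex^'n^'n \<Rightarrow> complex^'n^'n" mat_units
  by unfold_locales (auto simp: independent_mat_units span_mat_units, simp add: mat_units_def)

text \<open>The iterates of \<open>T\<close> on \<open>v\<close> are too many to be independent. Two
  coinciding iterates are treated apart, as a set of vectors does not record repetitions; there a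
  difference of two monomials serves.\<close>

lemma annihilating_poly:
  assumes T: "clin (T :: complex^'n^'n \<Rightarrow> complex^'n^'n)"
  obtains p where "p \<noteq> 0" "pol p T v = 0"
proof -
  let ?n = "card (mat_units :: (complex^'n^'n) set)"
  define w where "w i = (T ^^ i) v" for i
  show ?thesis
  proof (cases "inj_on w {..?n}")
    case False
    then obtain i j where ij: "i \<noteq> j" "w i = w j" by (auto simp: inj_on_def)
    have "pol (monom 1 i - monom 1 j) T v = 0"
      using pol_add[OF T, of "monom 1 i" "- monom 1 j" v] ij(2) pol_smult[OF T, of "-1" "monom 1 j" v]
      by (simp add: pol_monom[OF T] w_def cmat.scale_one)
    moreover have "monom (1::complex) i - monom 1 j \<noteq> 0"
      using ij(1) by (simp add: monom_eq_iff')
    ultimately show ?thesis using that by blast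
  next
    case True
    have "cmat.dependent (w ` {..?n})"
    proof (rule ccontr)
      assume "cmat.independent (w ` {..?n})"
      then have "card (w ` {..?n}) \<le> ?n"
        using cmat.independent_span_bound[of mat_units "w ` {..?n}"] cmat.finite_Basis span_mat_units by blast
      then show False using card_image[OF True] by simp
    qed
    then obtain u where u: "\<exists>x\<in>w ` {..?n}. u x \<noteq> 0" "(\<Sum>x\<in>w ` {..?n}. u x *\<^sub>C x) = 0"
      by (subst (asm) cmat.dependent_finite) auto
    define p where "p = (\<Sum>i\<le>?n. monom (u (w i)) i)"
    have "pol p T v = 0"
      using u(2) unfolding p_def sum.reindex[OF True] by (simp add: pol_sum[OF T] pol_monom[OF T] w_def)
    moreover obtain i where "i \<le> ?n" "u (w i) \<noteq> 0" using u(1) by auto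
    then have "coeff p i \<noteq> 0" by (simp add: p_def coeff_sum)
    then have "p \<noteq> 0" by auto
    ultimately show ?thesis using that by blast
  qed
qed

text \<open>The point 0 is added to the roots so that the eigenvalue 0 always has a projection,
  possibly zero; \<open>Suc\<close> in the exponent keeps \<open>N\<close> positive.\<close>

lemma dvd_prod_lpow:
  assumes "p \<noteq> 0"
  obtains \<Lambda> N where "finite \<Lambda>" "0 \<in> \<Lambda>" "N > 0" "p dvd (\<Prod>l\<in>\<Lambda>. lpow N l)"
proof -
  define Z where "Z = {z. poly p z = 0}"
  have fin: "finite Z" unfolding Z_def by (rule poly_roots_finite[OF assms])
  define N where "N = Suc (degree p)"
  have "p = smult (lead_coeff p) (\<Prod>z\<in>Z. [:-z, 1:] ^ order z p)"
    unfolding Z_def by (rule complex_poly_decompose[symmetric])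
  also have "\<dots> dvd (\<Prod>z\<in>Z. [:-z, 1:] ^ order z p)" using assms by (simp add: smult_dvd_iff)
  also have "\<dots> dvd (\<Prod>z\<in>Z. lpow N z)"
    unfolding lpow_def N_def by (intro prod_dvd_prod le_imp_power_dvd) (use order_degree[OF assms] le_SucI in blast)
  also have "\<dots> dvd (\<Prod>z\<in>insert 0 Z. lpow N z)"
    by (rule prod_dvd_prod_subset) (use fin in auto)
  finally show ?thesis using fin by (intro that[of "insert 0 Z" N]) (auto simp: N_def)
qed

abbreviation (input) lmul :: "complex^'n^'n \<Rightarrow> complex^'n^'n \<Rightarrow> complex^'n^'n" where
  "lmul x \<equiv> (\<lambda>v. x ** v)"

lemma clin_lmul: "clin (lmul x)"
  by (simp add: clin_def mm_simps)

definition mp :: "complex poly \<Rightarrow> complex^'n^'n \<Rightarrow> complex^'n^'n" where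
  "mp p x = pol p (lmul x) (mat 1)"

lemma pol_lmul: "pol p (lmul x) v = mp p x ** v"
  unfolding mp_def by (induction p) (auto simp: pol_pCons[OF clin_lmul] mm_simps)

lemma mp_mult: "mp (p * q) x = mp p x ** mp q x"
proof -
  have "mp (p * q) x = pol p (lmul x) (mp q x)" by (simp add: mp_def pol_mult[OF clin_lmul])
  then show ?thesis by (simp only: pol_lmul)
qed

lemma mp_commute: "mp p x ** mp q x = mp q x ** mp p x"
  by (simp add: mp_mult[symmetric] mult.commute)

lemma mp_1: "mp 1 x = mat 1"
  by (simp add: mp_def pol_1[OF clin_lmul])

lemma mp_X: "mp [:- l, 1:] x = x - l *\<^sub>C mat 1"
  by (simp add: mp_def pol_linear_factor[OF clin_lmul])

lemma mp_power: "mp (p ^ k) x = mpow (mp p x) k"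
  by (induction k) (auto simp: mp_1 mp_mult mpow_Suc)

lemma mp_dvd: "p dvd q \<Longrightarrow> mp p x = 0 \<Longrightarrow> mp q x = 0"
  unfolding mp_def by (rule pol_dvd[OF clin_lmul])

text \<open>The binomial argument as an induction on \<open>i + j\<close>: one application of the
  difference lowers the exponent of \<open>A\<close> or that of \<open>B\<close>.\<close>

lemma commuting_difference_nilpotent:
  assumes "clin A" "clin B" and AB: "\<And>v. A (B v) = B (A v)"
  shows "(A ^^ i) v = 0 \<Longrightarrow> (B ^^ j) v = 0 \<Longrightarrow> ((\<lambda>v. A v - B v) ^^ (i + j)) v = 0"
proof (induction "i + j" arbitrary: i j v)
  case 0
  then show ?case by simp
next
  case (Suc n)
  let ?D = "\<lambda>v. A v - B v"
  have D: "clin ?D" using assms by (simp add: clin_def cmat.scale_right_diff_distrib)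
  have Dk: "clin (?D ^^ k)" for k by (induction k) (use D in \<open>auto simp: clin_def\<close>)
  have comm: "(A ^^ k) (B v) = B ((A ^^ k) v)" "(B ^^ k) (A v) = A ((B ^^ k) v)" for k v
    by (induction k) (auto simp: AB)
  show ?case
  proof (cases "i = 0 \<or> j = 0")
    case True
    then have "v = 0" using Suc.prems by auto
    then show ?thesis by (simp add: clin_0[OF Dk])
  next
    case False
    then obtain i' j' where ij: "i = Suc i'" "j = Suc j'" by (metis not0_implies_Suc)
    have "(?D ^^ (i' + j)) (A v) = 0"
    proof (rule Suc.hyps(1))
      show "n = i' + j" using Suc.hyps(2) ij by linarith
      show "(A ^^ i') (A v) = 0" using Suc.prems(1) ij by (simp add: funpow_swap1)
      show "(B ^^ j) (A v) = 0" using Suc.prems(2) by (simp add: comm clin_0[OF assms(1)])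
    qed
    moreover have "(?D ^^ (i + j')) (B v) = 0"
    proof (rule Suc.hyps(1))
      show "n = i + j'" using Suc.hyps(2) ij by linarith
      show "(B ^^ j') (B v) = 0" using Suc.prems(2) ij by (simp add: funpow_swap1)
      show "(A ^^ i) (B v) = 0" using Suc.prems(1) by (simp add: comm clin_0[OF assms(2)])
    qed
    moreover have "(?D ^^ (i + j)) v = (?D ^^ n) (?D v)" unfolding Suc.hyps(2)[symmetric] funpow_Suc_right comp_apply by (rule refl)
    moreover have "n = i' + j" "n = i + j'" using Suc.hyps(2) ij by linarith+
    ultimately show ?thesis using clin_diff[OF Dk] by simp
  qed
qed

lemma bracket_add_left: "lie_bracket (a + b) c = lie_bracket a c + lie_bracket b c"
  and bracket_add_right: "lie_bracket a (b + c) = lie_bracket a b + lie_bracket a c"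
  and bracket_scale_left: "lie_bracket (k *\<^sub>C a) c = k *\<^sub>C lie_bracket a c"
  and bracket_scale_right: "lie_bracket a (k *\<^sub>C c) = k *\<^sub>C lie_bracket a c"
  and bracket_anti: "lie_bracket a b = - lie_bracket b a"
  and bracket_self [simp]: "lie_bracket a a = 0"
  and bracket_zero_left [simp]: "lie_bracket 0 a = 0"
  and bracket_zero_right [simp]: "lie_bracket a 0 = 0"
  and bracket_diff_left: "lie_bracket (a - b) c = lie_bracket a c - lie_bracket b c"
  by (simp_all add: lie_bracket_def mm_simps cmat.scale_right_diff_distrib)

lemma clin_bracket: "clin (lie_bracket x)"
  by (simp add: clin_def bracket_add_right bracket_scale_right)

lemma neg_in_subspace: "cmat.subspace S \<Longrightarrow> x \<in> S \<Longrightarrow> - x \<in> S"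
  using cmat.subspace_scale[of S x "-1"] by (simp add: cmat.scale_minus_left cmat.scale_one)

lemma subspace_derived [simp]: "cmat.subspace (derived L)"
  by (simp add: derived_def)

lemma derivedI: "a \<in> L \<Longrightarrow> b \<in> L \<Longrightarrow> lie_bracket a b \<in> derived L"
  unfolding derived_def by (rule cmat.span_base) blast

lemma derived_induct:
  assumes "z \<in> derived L" "cmat.subspace S" "\<And>a b. a \<in> L \<Longrightarrow> b \<in> L \<Longrightarrow> lie_bracket a b \<in> S"
  shows "z \<in> S"
proof -
  have "derived L \<subseteq> S" unfolding derived_def by (rule cmat.span_minimal) (use assms in auto)
  then show ?thesis using assms(1) by blast
qed

lemma subspace_trace_zero: "cmat.subspace {z. trace (z ** s) = 0}"
  by (simp add: cmat.subspace_def mm_simps trace_add trace_scale)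

lemma pol_lpow: "clin T \<Longrightarrow> pol (lpow n l) T v = ((\<lambda>v. T v - l *\<^sub>C v) ^^ n) v"
proof (induction n)
  case 0
  then show ?case by (simp add: lpow_def pol_1)
next
  case (Suc n)
  have "pol (lpow (Suc n) l) T v = pol [:- l, 1:] T (pol (lpow n l) T v)"
    unfolding lpow_def power_Suc by (rule pol_mult[OF Suc.prems])
  then show ?case using Suc by (simp add: pol_linear_factor)
qed

lemma mp_pCons: "mp (pCons a p) x = a *\<^sub>C mat 1 + x ** mp p x"
  by (simp add: mp_def pol_pCons[OF clin_lmul])

lemma mp_self_commute: "mp p x ** x = x ** mp p x"
  using mp_commute[of p x "[:- 0, 1:]"] by (simp only: mp_X) (simp add: cmat.scale_zero_left)

lemma clin_rmul: "clin (\<lambda>v. v ** x)"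
  by (simp add: clin_def mm_simps)

lemma pol_rmul: "pol p (\<lambda>v. v ** x) v = v ** mp p x"
proof (induction p)
  case 0
  then show ?case by (simp add: mp_def)
next
  case (pCons a p)
  have "v ** mp p x ** x = v ** x ** mp p x"
    by (simp only: matrix_mul_assoc[symmetric] mp_self_commute)
  then show ?case using pCons by (simp add: pol_pCons[OF clin_rmul] mp_pCons mm_simps)
qed

lemma mp_sum: "mp (\<Sum>i\<in>S. f i) x = (\<Sum>i\<in>S. mp (f i) x)"
  unfolding mp_def by (rule pol_sum[OF clin_lmul])

text \<open>
  The matrix \<open>s = \<Sum>\<^sub>l cnj l e\<^sub>l\<close>, with \<open>e\<^sub>l\<close> the spectral projections of \<open>x\<close>, satisfies
  \<open>ad s = Q (ad x)\<close> for a polynomial \<open>Q\<close> without constant term and \<open>tr (x s) = \<Sum>\<^sub>l |l|\<^sup>2 rank e\<^sub>l\<close>.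
\<close>

lemma nilpotent_derived:
  fixes R :: "(complex^'n^'n) set"
  assumes R: "cmat.subspace R" and br: "\<And>a b. a \<in> R \<Longrightarrow> b \<in> R \<Longrightarrow> lie_bracket a b \<in> R"
    and tr: "\<And>a b. a \<in> R \<Longrightarrow> b \<in> R \<Longrightarrow> trace (a ** b) = 0"
    and x: "x \<in> derived R"
  shows "nilpotent_mat x"
proof -
  obtain p where p: "p \<noteq> 0" "mp p x = 0" unfolding mp_def by (rule annihilating_poly[OF clin_lmul])
  obtain \<Lambda> N where L: "finite \<Lambda>" "0 \<in> \<Lambda>" "N > 0" "p dvd (\<Prod>l\<in>\<Lambda>. lpow N l)" by (rule dvd_prod_lpow[OF p(1)])
  define ch where "ch = (\<Prod>l\<in>\<Lambda>. lpow N l)"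
  have chi: "mp ch x = 0" unfolding ch_def by (rule mp_dvd[OF L(4) p(2)])
  have chi_split: "ch = lpow N l * (\<Prod>m\<in>\<Lambda> - {l}. lpow N m)" if "l \<in> \<Lambda>" for l
    unfolding ch_def by (rule prod.remove[OF L(1) that])
  obtain E where E: "(\<Sum>l\<in>\<Lambda>. E l) = 1" "\<And>l. l \<in> \<Lambda> \<Longrightarrow> (\<Prod>m\<in>\<Lambda> - {l}. lpow N m) dvd E l"
    using partition_of_unity[OF L(1), of N] L(2) by blast
  define e where "e l = mp (E l) x" for l
  have sum_e: "(\<Sum>l\<in>\<Lambda>. e l) = mat 1" unfolding e_def mp_sum[symmetric] E(1) by (rule mp_1)
  have orth: "e l ** e m = 0" if "l \<in> \<Lambda>" "m \<in> \<Lambda>" "l \<noteq> m" for l m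
  proof -
    have "lpow N l dvd (\<Prod>k\<in>\<Lambda> - {m}. lpow N k)" using that L(1) by (intro dvd_prodI) auto
    then have "lpow N l dvd E m" using E(2)[OF that(2)] dvd_trans by blast
    then have "lpow N l * (\<Prod>k\<in>\<Lambda> - {l}. lpow N k) dvd E m * E l" using E(2)[OF that(1)] by (rule mult_dvd_mono)
    then have "ch dvd E l * E m" using chi_split[OF that(1)] by (simp add: mult.commute)
    from mp_dvd[OF this chi] show ?thesis by (simp add: e_def mp_mult)
  qed
  have kill_dvd: "ch dvd lpow N l * E l" if "l \<in> \<Lambda>" for l
    unfolding chi_split[OF that] by (rule mult_dvd_mono[OF dvd_refl E(2)[OF that]])
  have kill: "mp (lpow N l) x ** e l = 0" if "l \<in> \<Lambda>" for l
    using mp_dvd[OF kill_dvd[OF that] chi] by (simp add: e_def mp_mult)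
  have kill': "e l ** mp (lpow N l) x = 0" if "l \<in> \<Lambda>" for l
    using kill[OF that] by (simp add: e_def mp_commute)
  have idem: "e l ** e l = e l" if l: "l \<in> \<Lambda>" for l
  proof -
    have "e l = (\<Sum>m\<in>\<Lambda>. e l ** e m)" using sum_e by (simp add: mm_sum_right[symmetric])
    also have "\<dots> = (\<Sum>m\<in>\<Lambda>. if m = l then e l ** e l else 0)" by (rule sum.cong) (use orth l in auto)
    also have "\<dots> = e l ** e l" using L(1) l by simp
    finally show ?thesis by simp
  qed
  define s where "s = (\<Sum>l\<in>\<Lambda>. cnj l *\<^sub>C e l)"
  have se: "s ** e l = cnj l *\<^sub>C e l" and es: "e l ** s = cnj l *\<^sub>C e l" if l: "l \<in> \<Lambda>" for l
  proof -
    have "s ** e l = (\<Sum>m\<in>\<Lambda>. if m = l then cnj l *\<^sub>C e l else 0)"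
      unfolding s_def mm_sum_left by (rule sum.cong) (use orth idem l in \<open>auto simp: mm_simps cmat.scale_zero_right\<close>)
    then show "s ** e l = cnj l *\<^sub>C e l" using L(1) l by simp
    have "e l ** s = (\<Sum>m\<in>\<Lambda>. if m = l then cnj l *\<^sub>C e l else 0)"
      unfolding s_def mm_sum_right by (rule sum.cong) (use orth idem l in \<open>auto simp: mm_simps cmat.scale_zero_right\<close>)
    then show "e l ** s = cnj l *\<^sub>C e l" using L(1) l by simp
  qed
  \<comment> \<open>The possible eigenvalues of \<open>ad x\<close>. The exponent
    \<open>N + N\<close> below arises because \<open>ad x - (l - m)\<close> is the difference of two
    commuting operators, left multiplication by \<open>x - l\<close> and right multiplication by
    \<open>x - m\<close>.\<close>
  define \<Lambda>' where "\<Lambda>' = (\<lambda>(l, m). l - m) ` (\<Lambda> \<times> \<Lambda>)"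
  have L': "finite \<Lambda>'" "0 \<in> \<Lambda>'" "\<And>l m. l \<in> \<Lambda> \<Longrightarrow> m \<in> \<Lambda> \<Longrightarrow> l - m \<in> \<Lambda>'"
    using L(1,2) by (force simp: \<Lambda>'_def)+
  obtain E' where E': "(\<Sum>l\<in>\<Lambda>'. E' l) = 1" "\<And>l. l \<in> \<Lambda>' \<Longrightarrow> (\<Prod>m\<in>\<Lambda>' - {l}. lpow (N + N) m) dvd E' l"
    using partition_of_unity[OF L'(1), of "N + N"] L'(2) by blast
  let ?D = "lie_bracket x"
  \<comment> \<open>\<open>Q\<close> represents complex conjugation on the eigenvalues of
    \<open>ad x\<close>. As conjugation is additive, \<open>Q (ad x)\<close> acts by
    \<open>cnj l - cnj m\<close> where \<open>ad x\<close> has the eigenvalue \<open>l - m\<close>,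
    and so does \<open>ad s\<close>.\<close>
  define Q where "Q = (\<Sum>\<nu>\<in>\<Lambda>'. smult (cnj \<nu>) (E' \<nu>))"
  have dvdE': "lpow (N + N) \<nu> dvd E' \<kappa>" if "\<nu> \<in> \<Lambda>'" "\<kappa> \<in> \<Lambda>'" "\<kappa> \<noteq> \<nu>" for \<nu> \<kappa>
  proof -
    have "lpow (N + N) \<nu> dvd (\<Prod>m\<in>\<Lambda>' - {\<kappa>}. lpow (N + N) m)" using that L'(1) by (intro dvd_prodI) auto
    then show ?thesis using E'(2)[OF that(2)] dvd_trans by blast
  qed
  have Qv: "pol Q ?D v = cnj (l - m) *\<^sub>C v" if l: "l \<in> \<Lambda>" and m: "m \<in> \<Lambda>" and v: "v = e l ** b ** e m" for l m b v
  proof -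
    define A where "A w = x ** w - l *\<^sub>C w" for w
    define B where "B w = w ** x - m *\<^sub>C w" for w
    have AB: "clin A" "clin B" "\<And>w. A (B w) = B (A w)"
      by (simp_all add: A_def B_def clin_def mm_simps cmat.scale_right_diff_distrib cmat.scale_right_distrib cmat.scale_left_commute)
    have "(A ^^ N) v = mp (lpow N l) x ** v"
      using pol_lpow[OF clin_lmul, of N l x v] by (simp add: pol_lmul A_def[abs_def])
    also have "\<dots> = 0" unfolding v by (simp add: matrix_mul_assoc kill[OF l])
    finally have 1: "(A ^^ N) v = 0" .
    have "(B ^^ N) v = v ** mp (lpow N m) x"
      using pol_lpow[OF clin_rmul, of N m x v] by (simp add: pol_rmul B_def[abs_def])
    also have "\<dots> = 0" unfolding v using kill'[OF m] by (simp flip: matrix_mul_assoc)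
    finally have 2: "(B ^^ N) v = 0" .
    have "(\<lambda>w. A w - B w) = (\<lambda>w. ?D w - (l - m) *\<^sub>C w)"
      by (rule ext) (simp add: A_def B_def lie_bracket_def cmat.scale_left_diff_distrib)
    then have 3: "pol (lpow (N + N) (l - m)) ?D v = 0"
      using commuting_difference_nilpotent[OF AB 1 2] by (simp add: pol_lpow[OF clin_bracket])
    have zero: "pol (E' \<kappa>) ?D v = 0" if "\<kappa> \<in> \<Lambda>'" "\<kappa> \<noteq> l - m" for \<kappa>
      by (rule pol_dvd[OF clin_bracket dvdE'[OF L'(3)[OF l m] that] 3])
    have "v = pol (\<Sum>\<kappa>\<in>\<Lambda>'. E' \<kappa>) ?D v" unfolding E'(1) by (simp add: pol_1[OF clin_bracket])
    also have "\<dots> = (\<Sum>\<kappa>\<in>\<Lambda>'. if \<kappa> = l - m then pol (E' \<kappa>) ?D v else 0)"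
      unfolding pol_sum[OF clin_bracket] by (rule sum.cong) (use zero in auto)
    also have "\<dots> = pol (E' (l - m)) ?D v" using L'(1) L'(3)[OF l m] by simp
    finally have 4: "pol (E' (l - m)) ?D v = v" by simp
    have "pol Q ?D v = (\<Sum>\<kappa>\<in>\<Lambda>'. if \<kappa> = l - m then cnj (l - m) *\<^sub>C pol (E' \<kappa>) ?D v else 0)"
      unfolding Q_def pol_sum[OF clin_bracket] pol_smult[OF clin_bracket]
      by (rule sum.cong) (use zero in \<open>auto simp: cmat.scale_zero_right\<close>)
    also have "\<dots> = cnj (l - m) *\<^sub>C v" using L'(1) L'(3)[OF l m] 4 by simp
    finally show ?thesis .
  qed
  have Qb: "pol Q ?D b = lie_bracket s b" for b
  proof -
    have b: "b = (\<Sum>l\<in>\<Lambda>. \<Sum>m\<in>\<Lambda>. e l ** b ** e m)"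
    proof -
      have "(\<Sum>l\<in>\<Lambda>. \<Sum>m\<in>\<Lambda>. e l ** b ** e m) = mat 1 ** b ** mat 1"
        unfolding sum_e[symmetric] mm_sum_left mm_sum_right by (rule sum.swap)
      then show ?thesis by simp
    qed
    have "pol Q ?D (e l ** b ** e m) = lie_bracket s (e l ** b ** e m)" if "l \<in> \<Lambda>" "m \<in> \<Lambda>" for l m
    proof -
      have "lie_bracket s (e l ** b ** e m) = (s ** e l) ** b ** e m - e l ** b ** (e m ** s)"
        by (simp add: lie_bracket_def matrix_mul_assoc)
      also have "\<dots> = cnj (l - m) *\<^sub>C (e l ** b ** e m)"
        unfolding se[OF that(1)] es[OF that(2)] by (simp add: mm_simps cmat.scale_left_diff_distrib)
      finally show ?thesis using Qv[OF that refl] by simp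
    qed
    then have "(\<Sum>l\<in>\<Lambda>. \<Sum>m\<in>\<Lambda>. pol Q ?D (e l ** b ** e m)) = (\<Sum>l\<in>\<Lambda>. \<Sum>m\<in>\<Lambda>. lie_bracket s (e l ** b ** e m))"
      by simp
    then have "pol Q ?D (\<Sum>l\<in>\<Lambda>. \<Sum>m\<in>\<Lambda>. e l ** b ** e m) = lie_bracket s (\<Sum>l\<in>\<Lambda>. \<Sum>m\<in>\<Lambda>. e l ** b ** e m)"
      by (simp add: clin_sum[OF clin_pol[OF clin_bracket]] clin_sum[OF clin_bracket])
    then show ?thesis using b by simp
  qed
  \<comment> \<open>Without constant term, \<open>Q (ad x)\<close> is a polynomial in
    \<open>ad x\<close> followed by \<open>ad x\<close>. Hence \<open>ad s\<close> maps
    \<open>R\<close> into \<open>R\<close>, although \<open>s\<close> itself need not lie in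
    \<open>R\<close>.\<close>
  have "poly Q 0 = 0"
  proof -
    have "cnj \<nu> * poly (E' \<nu>) 0 = 0" if "\<nu> \<in> \<Lambda>'" for \<nu>
    proof (cases "\<nu> = 0")
      case False
      have "lpow (N + N) 0 dvd E' \<nu>" by (rule dvdE'[OF L'(2) that False])
      moreover have "[:- 0, 1:] dvd lpow (N + N) 0" unfolding lpow_def using L(3) by (intro dvd_power) simp
      ultimately have "[:- 0, 1:] dvd E' \<nu>" using dvd_trans by blast
      then show ?thesis by (simp only: poly_eq_0_iff_dvd[symmetric] mult_zero_right)
    qed simp
    then show ?thesis unfolding Q_def poly_sum poly_smult by (rule sum.neutral[OF ballI])
  qed
  then obtain Q1 where Q1: "Q = pCons 0 Q1" by (cases Q) auto
  have xR: "x \<in> R" by (rule derived_induct[OF x R br])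
  have sR: "lie_bracket s b \<in> R" if b: "b \<in> R" for b
  proof -
    have "pol Q1 ?D b \<in> R" by (rule pol_in_subspace[OF clin_bracket R br[OF xR] b])
    then have "?D (pol Q1 ?D b) \<in> R" by (rule br[OF xR])
    then show ?thesis using Qb[of b] by (simp add: Q1 pol_pCons[OF clin_bracket] cmat.scale_zero_left)
  qed
  \<comment> \<open>On a bracket, \<open>tr ([a, b] s) = tr (a [b, s])\<close>, and this is 0
    because \<open>[b, s]\<close> lies in \<open>R\<close>; that is why \<open>x\<close> is taken
    from the derived algebra.\<close>
  have "x \<in> {z. trace (z ** s) = 0}"
  proof (rule derived_induct[OF x subspace_trace_zero])
    fix a b assume ab: "a \<in> R" "b \<in> R"
    have "lie_bracket b s \<in> R" using neg_in_subspace[OF R sR[OF ab(2)]] bracket_anti[of b s] by simp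
    then show "lie_bracket a b \<in> {z. trace (z ** s) = 0}" by (simp add: trace_bracket tr ab)
  qed
  then have trxs: "trace (x ** s) = 0" by simp
  \<comment> \<open>\<open>(x - l) e l\<close> is nilpotent, so its trace vanishes.\<close>
  have trxe: "trace (x ** e l) = l * trace (e l)" if l: "l \<in> \<Lambda>" for l
  proof -
    have "ch dvd ([:- l, 1:] * E l) ^ N"
    proof -
      have "lpow N l * E l dvd lpow N l * E l ^ N" by (intro mult_dvd_mono dvd_refl dvd_power) (use L(3) in simp)
      then show ?thesis using kill_dvd[OF l] dvd_trans unfolding power_mult_distrib lpow_def[symmetric] by blast
    qed
    then have "mpow (mp ([:- l, 1:] * E l) x) N = 0" using mp_dvd[OF _ chi] by (simp only: mp_power[symmetric])
    then have "trace (mp ([:- l, 1:] * E l) x) = 0" by (intro trace_nilpotent) (auto simp: nilpotent_mat_iff)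
    then have "trace (x ** e l - l *\<^sub>C e l) = 0" unfolding mp_mult mp_X e_def[symmetric] by (simp add: mm_simps)
    then show ?thesis by (simp add: trace_sub trace_scale)
  qed
  have "\<forall>l. \<exists>r. l \<in> \<Lambda> \<longrightarrow> trace (e l) = of_nat r \<and> (r = 0 \<longrightarrow> e l = 0)"
    using trace_idempotent[OF idem] by metis
  then obtain r where r: "\<And>l. l \<in> \<Lambda> \<Longrightarrow> trace (e l) = of_nat (r l)" "\<And>l. l \<in> \<Lambda> \<Longrightarrow> r l = 0 \<Longrightarrow> e l = 0" by metis
  \<comment> \<open>The trace of \<open>x s\<close> becomes a sum of nonnegative reals, so no
    eigenvalue other than 0 has a nonzero projection.\<close>
  have "0 = (\<Sum>l\<in>\<Lambda>. cnj l * (l * of_nat (r l)))"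
    using trxs unfolding s_def mm_sum_right mm_scale_right trace_sum trace_scale by (simp add: trxe r(1))
  also have "\<dots> = of_real (\<Sum>l\<in>\<Lambda>. (cmod l)\<^sup>2 * real (r l))"
  proof -
    have "cnj l * (l * of_nat k) = of_real ((cmod l)\<^sup>2 * real k)" for l k
      using complex_norm_square[of l] by (simp add: algebra_simps)
    then show ?thesis unfolding of_real_sum by (intro sum.cong) blast+
  qed
  finally have "(\<Sum>l\<in>\<Lambda>. (cmod l)\<^sup>2 * real (r l)) = 0" by (metis of_real_eq_0_iff)
  then have "(cmod l)\<^sup>2 * real (r l) = 0" if "l \<in> \<Lambda>" for l
    using that L(1) by (subst (asm) sum_nonneg_eq_0_iff) auto
  then have "e l = 0" if "l \<in> \<Lambda>" "l \<noteq> 0" for l using that r(2) by fastforce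
  then have "(\<Sum>l\<in>\<Lambda>. e l) = (\<Sum>l\<in>\<Lambda>. if l = 0 then e 0 else 0)" by (intro sum.cong) auto
  then have "e 0 = mat 1" using sum_e L(1,2) by simp
  then have "mp (lpow N 0) x = 0" using kill[OF L(2)] by simp
  then have "mpow x N = 0" unfolding lpow_def mp_power mp_X by (simp add: cmat.scale_zero_left)
  then show ?thesis by (auto simp: nilpotent_mat_iff)
qed

subsection \<open>Cartan's criterion\<close>

definition mprod :: "(complex^'n^'n) list \<Rightarrow> complex^'n^'n" where
  "mprod ws = foldr (**) ws (mat 1)"

lemma mprod_Nil [simp]: "mprod [] = mat 1"
  and mprod_Cons [simp]: "mprod (w # ws) = w ** mprod ws"
  by (simp_all add: mprod_def)

lemma mprod_append [simp]: "mprod (us @ ws) = mprod us ** mprod ws"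
  by (induction us) (auto simp: matrix_mul_assoc)

text \<open>Nilpotency of the associative algebra without unit generated by \<open>K\<close>.
  Engel's theorem is proved in this form because solvability then follows by counting
  letters.\<close>

definition annih :: "(complex^'n^'n) set \<Rightarrow> nat \<Rightarrow> bool" where
  "annih K N \<longleftrightarrow> (\<forall>ws. set ws \<subseteq> K \<and> length ws = N \<longrightarrow> mprod ws = 0)"

lemma annih_ge:
  assumes "annih K N" "set ws \<subseteq> K" "length ws \<ge> N"
  shows "mprod ws = 0"
proof -
  have "mprod (take N ws) = 0"
    using assms set_take_subset[of N ws] unfolding annih_def by (metis length_take min.absorb2 order_trans)
  then show ?thesis using mprod_append[of "take N ws" "drop N ws"] by simp
qed

lemma subspace_mul_preimage:
  fixes a b :: "complex^'n^'n"
  shows "cmat.subspace S \<Longrightarrow> cmat.subspace {v. a ** v ** b \<in> S}"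
  by (auto simp: cmat.subspace_def mm_simps)

lemma span_mul:
  fixes a b :: "complex^'n^'n"
  assumes "z \<in> cmat.span S" "\<And>v. v \<in> S \<Longrightarrow> a ** v ** b \<in> cmat.span T"
  shows "a ** z ** b \<in> cmat.span T"
proof -
  have "cmat.span S \<subseteq> {v. a ** v ** b \<in> cmat.span T}"
    by (rule cmat.span_minimal) (auto intro: assms(2) subspace_mul_preimage)
  then show ?thesis using assms(1) by blast
qed

lemma span_mul_left:
  fixes a :: "complex^'n^'n"
  shows "z \<in> cmat.span S \<Longrightarrow> (\<And>v. v \<in> S \<Longrightarrow> a ** v \<in> cmat.span T) \<Longrightarrow> a ** z \<in> cmat.span T"
  using span_mul[of z S a "mat 1" T] by simp

lemma span_mul_right:
  fixes b :: "complex^'n^'n"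
  shows "z \<in> cmat.span S \<Longrightarrow> (\<And>v. v \<in> S \<Longrightarrow> v ** b \<in> cmat.span T) \<Longrightarrow> z ** b \<in> cmat.span T"
  using span_mul[of z S "mat 1" b T] by simp

lemma annih_span:
  assumes "annih S n"
  shows "annih (cmat.span S) n"
proof -
  have "mprod (us @ vs) = 0" if "set us \<subseteq> S" "set vs \<subseteq> cmat.span S" "length us + length vs = n" for us vs
    using that
  proof (induction vs arbitrary: us)
    case Nil
    then show ?case using assms by (simp add: annih_def)
  next
    case (Cons v vs)
    have "cmat.span S \<subseteq> {v. mprod us ** v ** mprod vs \<in> {0}}"
    proof (rule cmat.span_minimal)
      show "S \<subseteq> {v. mprod us ** v ** mprod vs \<in> {0}}"
      proof
        fix w assume w: "w \<in> S"
        have "mprod ((us @ [w]) @ vs) = 0" by (rule Cons.IH) (use Cons.prems w in auto)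
        then show "w \<in> {v. mprod us ** v ** mprod vs \<in> {0}}" by (simp add: matrix_mul_assoc)
      qed
      show "cmat.subspace {v. mprod us ** v ** mprod vs \<in> {0}}"
        by (rule subspace_mul_preimage) (simp add: cmat.subspace_0)
    qed
    then have "mprod us ** v ** mprod vs = 0" using Cons.prems(2) by auto
    then show ?case by (simp add: matrix_mul_assoc)
  qed
  from this[of "[]"] show ?thesis by (simp add: annih_def)
qed

lemma bracket_words:
  "foldr lie_bracket ks y \<in> cmat.span {mprod us ** y ** mprod vs | us vs. set us \<subseteq> set ks \<and> set vs \<subseteq> set ks \<and> length us + length vs = length ks}"
proof (induction ks)
  case Nil
  have "y = mprod [] ** y ** mprod []" by simp
  then show ?case by (intro cmat.span_base) force
next
  case (Cons k ks)
  let ?S = "\<lambda>ks. {mprod us ** y ** mprod vs | us vs. set us \<subseteq> set ks \<and> set vs \<subseteq> set ks \<and> length us + length vs = length ks}"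
  have l: "k ** foldr lie_bracket ks y \<in> cmat.span (?S (k # ks))"
  proof (rule span_mul_left[OF Cons.IH])
    fix v assume "v \<in> ?S ks"
    then obtain us vs where uv: "v = mprod us ** y ** mprod vs" "set us \<subseteq> set ks" "set vs \<subseteq> set ks" "length us + length vs = length ks"
      by blast
    then have "k ** v = mprod (k # us) ** y ** mprod vs" by (simp add: matrix_mul_assoc)
    then show "k ** v \<in> cmat.span (?S (k # ks))"
      using uv by (intro cmat.span_base CollectI exI[of _ "k # us"] exI[of _ vs]) auto
  qed
  have r: "foldr lie_bracket ks y ** k \<in> cmat.span (?S (k # ks))"
  proof (rule span_mul_right[OF Cons.IH])
    fix v assume "v \<in> ?S ks"
    then obtain us vs where uv: "v = mprod us ** y ** mprod vs" "set us \<subseteq> set ks" "set vs \<subseteq> set ks" "length us + length vs = length ks"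
      by blast
    then have "v ** k = mprod us ** y ** mprod (vs @ [k])" by (simp add: matrix_mul_assoc)
    then show "v ** k \<in> cmat.span (?S (k # ks))"
      using uv by (intro cmat.span_base CollectI exI[of _ "us"] exI[of _ "vs @ [k]"]) auto
  qed
  show ?case using cmat.span_diff[OF l r] by (simp add: lie_bracket_def[of k "foldr lie_bracket ks y"])
qed

text \<open>Of the \<open>2 * N\<close> letters at least \<open>N\<close> stand on the same side of
  \<open>y\<close>.\<close>

lemma bracket_words_zero:
  assumes "annih K N" "set ks \<subseteq> K" "length ks = 2 * N"
  shows "foldr lie_bracket ks y = 0"
proof -
  have "cmat.span {mprod us ** y ** mprod vs | us vs. set us \<subseteq> set ks \<and> set vs \<subseteq> set ks \<and> length us + length vs = length ks} \<subseteq> {0}"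
  proof (rule cmat.span_minimal)
    show "{mprod us ** y ** mprod vs | us vs. set us \<subseteq> set ks \<and> set vs \<subseteq> set ks \<and> length us + length vs = length ks} \<subseteq> {0}"
    proof clarify
      fix us vs assume uv: "set us \<subseteq> set ks" "set vs \<subseteq> set ks" "length us + length vs = length ks"
      then have "length us \<ge> N \<or> length vs \<ge> N" using assms(3) by linarith
      moreover have "set us \<subseteq> K" "set vs \<subseteq> K" using uv assms(2) by auto
      ultimately have "mprod us = 0 \<or> mprod vs = 0" using annih_ge[OF assms(1)] by blast
      then show "mprod us ** y ** mprod vs = 0" by auto
    qed
  qed (simp add: cmat.subspace_0)
  then show ?thesis using bracket_words by blast
qed

context
  fixes K :: "(complex^'n^'n) set" and y and N M :: nat
  assumes K: "cmat.subspace K" and yK: "\<And>k. k \<in> K \<Longrightarrow> lie_bracket k y \<in> K" and ynot: "y \<notin> K"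
    and N: "annih K N" and M: "mpow y M = 0"
begin

text \<open>Words in normal form, with the powers of \<open>y\<close> collected on the left. Right
  multiplication by \<open>y\<close> preserves the count \<open>b\<close>, since
  \<open>k y = y k + [k, y]\<close> with \<open>[k, y]\<close> again in \<open>K\<close>.\<close>

definition kspan :: "nat \<Rightarrow> (complex^'n^'n) set" where
  "kspan b = cmat.span {mpow y a ** mprod ks | a ks. set ks \<subseteq> K \<and> length ks = b}"

lemma kspanI: "set ks \<subseteq> K \<Longrightarrow> length ks = b \<Longrightarrow> mpow y a ** mprod ks \<in> kspan b"
  unfolding kspan_def by (intro cmat.span_base) blast

lemma commute_past:
  "set ks \<subseteq> K \<Longrightarrow> mprod ks ** y - y ** mprod ks \<in> cmat.span {mprod ks' | ks'. set ks' \<subseteq> K \<and> length ks' = length ks}"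
proof (induction ks)
  case Nil
  then show ?case by (simp add: cmat.span_zero)
next
  case (Cons k ks)
  let ?S = "\<lambda>b. {mprod ks' | ks'. set ks' \<subseteq> K \<and> length ks' = b}"
  have eq: "mprod (k # ks) ** y - y ** mprod (k # ks) = k ** (mprod ks ** y - y ** mprod ks) + mprod (lie_bracket k y # ks)"
    by (simp add: lie_bracket_def mm_simps)
  have "k ** (mprod ks ** y - y ** mprod ks) \<in> cmat.span (?S (length (k # ks)))"
  proof (rule span_mul_left[OF Cons.IH])
    show "set ks \<subseteq> K" using Cons.prems by simp
    fix v assume "v \<in> ?S (length ks)"
    then obtain ks' where "v = mprod ks'" "set ks' \<subseteq> K" "length ks' = length ks" by blast
    then show "k ** v \<in> cmat.span (?S (length (k # ks)))"
      using Cons.prems by (intro cmat.span_base CollectI exI[of _ "k # ks'"]) auto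
  qed
  moreover have "mprod (lie_bracket k y # ks) \<in> cmat.span (?S (length (k # ks)))"
    using Cons.prems yK by (intro cmat.span_base CollectI exI[of _ "lie_bracket k y # ks"]) auto
  ultimately show ?case unfolding eq by (rule cmat.span_add)
qed

lemma kspan_letter:
  assumes "z \<in> kspan b"
  shows "k \<in> K \<Longrightarrow> z ** k \<in> kspan (Suc b)" and "z ** y \<in> kspan b"
proof -
  assume k: "k \<in> K"
  show "z ** k \<in> kspan (Suc b)"
    unfolding kspan_def
  proof (rule span_mul_right[OF assms[unfolded kspan_def]])
    fix v assume "v \<in> {mpow y a ** mprod ks | a ks. set ks \<subseteq> K \<and> length ks = b}"
    then obtain a ks where v: "v = mpow y a ** mprod ks" "set ks \<subseteq> K" "length ks = b" by blast
    have "v ** k = mpow y a ** mprod (ks @ [k])" by (simp add: v(1) matrix_mul_assoc)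
    then show "v ** k \<in> cmat.span {mpow y a ** mprod ks | a ks. set ks \<subseteq> K \<and> length ks = Suc b}"
      using kspanI[of "ks @ [k]" "Suc b" a] v k unfolding kspan_def by simp
  qed
next
  show "z ** y \<in> kspan b"
    unfolding kspan_def
  proof (rule span_mul_right[OF assms[unfolded kspan_def]])
    fix v assume "v \<in> {mpow y a ** mprod ks | a ks. set ks \<subseteq> K \<and> length ks = b}"
    then obtain a ks where v: "v = mpow y a ** mprod ks" "set ks \<subseteq> K" "length ks = b" by blast
    have "mpow y a ** (mprod ks ** y - y ** mprod ks) \<in> kspan b"
      unfolding kspan_def
    proof (rule span_mul_left[OF commute_past[OF v(2)]])
      fix w assume "w \<in> {mprod ks' | ks'. set ks' \<subseteq> K \<and> length ks' = length ks}"
      then show "mpow y a ** w \<in> cmat.span {mpow y a ** mprod ks | a ks. set ks \<subseteq> K \<and> length ks = b}"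
        using kspanI[of _ b a] v(3) unfolding kspan_def by auto
    qed
    moreover have "mpow y (Suc a) ** mprod ks \<in> kspan b" by (rule kspanI[OF v(2,3)])
    moreover have "v ** y = mpow y a ** (mprod ks ** y - y ** mprod ks) + mpow y (Suc a) ** mprod ks"
      by (simp add: v(1) mpow_Suc_right mm_simps)
    ultimately show "v ** y \<in> cmat.span {mpow y a ** mprod ks | a ks. set ks \<subseteq> K \<and> length ks = b}"
      unfolding kspan_def by (simp only: cmat.span_add)
  qed
qed

lemma word_in_kspan: "set ws \<subseteq> insert y K \<Longrightarrow> mprod ws \<in> kspan (length (filter (\<lambda>l. l \<noteq> y) ws))"
proof (induction ws rule: rev_induct)
  case Nil
  then show ?case using kspanI[of "[]" 0 0] by simp
next
  case (snoc w ws)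
  then show ?case using kspan_letter[of "mprod ws"] by auto
qed

lemma kspan_zero: "b \<ge> N \<Longrightarrow> kspan b \<subseteq> {0}"
  unfolding kspan_def by (rule cmat.span_minimal) (auto simp: annih_ge[OF N] cmat.subspace_0)

text \<open>Pigeonhole: \<open>b\<close> letters other than \<open>y\<close> leave
  \<open>b + 1\<close> runs of \<open>y\<close>, one of which has length at least \<open>M\<close>.
  The exponent \<open>a\<close> counts the run read so far.\<close>

lemma short_word_zero:
  "set ws \<subseteq> insert y K \<Longrightarrow> a + length ws \<ge> (length (filter (\<lambda>l. l \<noteq> y) ws) + 1) * M \<Longrightarrow> mpow y a ** mprod ws = 0"
proof (induction ws arbitrary: a)
  case Nil
  then have "a = M + (a - M)" by simp
  then have "mpow y a = mpow y M ** mpow y (a - M)" by (metis mpow_add)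
  then show ?case using M by simp
next
  case (Cons w ws)
  show ?case
  proof (cases "w = y")
    case True
    then have "mpow y (Suc a) ** mprod ws = 0" by (intro Cons.IH) (use Cons.prems in auto)
    then show ?thesis using True by (simp add: mpow_Suc_right matrix_mul_assoc)
  next
    case False
    show ?thesis
    proof (cases "a \<ge> M")
      case True
      then have "mpow y a = mpow y M ** mpow y (a - M)" by (metis mpow_add le_add_diff_inverse)
      then show ?thesis using M by simp
    next
      case aM: False
      have "mpow y 0 ** mprod ws = 0" by (rule Cons.IH) (use Cons.prems False aM in auto)
      then show ?thesis by simp
    qed
  qed
qed

text \<open>A word with at least \<open>N\<close> letters other than \<open>y\<close> vanishes after
  normal ordering; a word with fewer contains a long run of \<open>y\<close>.\<close>

lemma annih_insert: "annih (insert y K) ((N + 1) * M)"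
  unfolding annih_def
proof (intro allI impI, elim conjE)
  fix ws assume ws: "set ws \<subseteq> insert y K" "length ws = (N + 1) * M"
  let ?b = "length (filter (\<lambda>l. l \<noteq> y) ws)"
  show "mprod ws = 0"
  proof (cases "?b \<ge> N")
    case True
    then show ?thesis using word_in_kspan[OF ws(1)] kspan_zero by blast
  next
    case False
    then have "?b + 1 \<le> N + 1" by simp
    then have "(?b + 1) * M \<le> 0 + length ws" unfolding ws(2) by (metis add_0 mult_le_mono1)
    from short_word_zero[OF ws(1) this] show ?thesis by simp
  qed
qed

end

text \<open>Take a subalgebra \<open>K\<close> of greatest dimension with \<open>annih K N\<close>.
  If \<open>K\<close> is not \<open>L\<close>, repeated brackets of an outside element with
  \<open>K\<close> end up in \<open>K\<close>; the last stage outside is some \<open>y\<close> that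
  normalizes \<open>K\<close>, and \<open>annih_insert\<close> contradicts maximality.\<close>

theorem engel:
  fixes L :: "(complex^'n^'n) set"
  assumes L: "cmat.subspace L" and br: "\<And>a b. a \<in> L \<Longrightarrow> b \<in> L \<Longrightarrow> lie_bracket a b \<in> L"
    and nil: "\<And>a. a \<in> L \<Longrightarrow> nilpotent_mat a"
  shows "\<exists>N. annih L N"
proof -
  define good where "good K \<longleftrightarrow> cmat.subspace K \<and> K \<subseteq> L \<and> (\<forall>a\<in>K. \<forall>b\<in>K. lie_bracket a b \<in> K) \<and> (\<exists>N. annih K N)" for K
  have "annih {0 :: complex^'n^'n} 1" by (auto simp: annih_def length_Suc_conv)
  then have g0: "good {0}" using cmat.subspace_0[OF L] unfolding good_def by (auto simp: cmat.subspace_def cmat.scale_zero_right)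
  have "\<exists>K. good K \<and> (\<forall>K'. good K' \<longrightarrow> cmat.dim K' \<le> cmat.dim K)"
    by (rule ex_has_greatest_nat[of good "{0}" cmat.dim "Suc (cmat.dim (UNIV :: (complex^'n^'n) set))"])
       (use g0 in \<open>auto simp: less_Suc_eq_le cmat.dim_subset_UNIV[unfolded cmat.dimension_def]\<close>)
  then obtain K where K: "good K" and max: "\<And>K'. good K' \<Longrightarrow> cmat.dim K' \<le> cmat.dim K" by blast
  have Ks: "cmat.subspace K" and KL: "K \<subseteq> L" and Kb: "\<And>a b. a \<in> K \<Longrightarrow> b \<in> K \<Longrightarrow> lie_bracket a b \<in> K"
    using K by (auto simp: good_def)
  obtain N where N: "annih K N" using K by (auto simp: good_def)
  have "K = L"
  proof (rule ccontr)
    assume "K \<noteq> L"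
    then obtain y0 where y0: "y0 \<in> L" "y0 \<notin> K" using KL by blast
    define P where "P j \<longleftrightarrow> (\<forall>ks. set ks \<subseteq> K \<and> length ks = j \<longrightarrow> foldr lie_bracket ks y0 \<in> K)" for j :: nat
    have "P (2 * N)" unfolding P_def using bracket_words_zero[OF N] cmat.subspace_0[OF Ks] by auto
    define j where "j = (LEAST j. P j)"
    have Pj: "P j" unfolding j_def using \<open>P (2 * N)\<close> by (rule LeastI)
    have "j \<noteq> 0"
    proof
      assume "j = 0"
      then show False using Pj y0(2) unfolding P_def by force
    qed
    then obtain i where i: "j = Suc i" by (metis not0_implies_Suc)
    have "\<not> P i" using not_less_Least[of i P] i unfolding j_def by simp
    then obtain ks where ks: "set ks \<subseteq> K" "length ks = i" "foldr lie_bracket ks y0 \<notin> K" by (auto simp: P_def)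
    define y where "y = foldr lie_bracket ks y0"
    have yK: "lie_bracket k y \<in> K" if "k \<in> K" for k
      using Pj[unfolded P_def, rule_format, of "k # ks"] ks that i by (simp add: y_def)
    have yL: "y \<in> L"
    proof -
      have "set ks \<subseteq> L" using ks(1) KL by auto
      then show ?thesis unfolding y_def using y0(1) by (induction ks) (auto intro: br)
    qed
    have ynot: "y \<notin> K" using ks(3) by (simp add: y_def)
    obtain M where M: "mpow y M = 0" using nil[OF yL] by (auto simp: nilpotent_mat_iff)
    define K' where "K' = cmat.span (insert y K)"
    have "annih K' ((N + 1) * M)" unfolding K'_def by (rule annih_span[OF annih_insert[OF Ks yK ynot N M]])
    moreover have "cmat.subspace K'" by (simp add: K'_def)
    moreover have "K' \<subseteq> L" unfolding K'_def by (rule cmat.span_minimal) (use yL KL L in auto)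
    moreover have "lie_bracket a b \<in> K'" if ab: "a \<in> K'" "b \<in> K'" for a b
    proof -
      obtain c k where a: "a = c *\<^sub>C y + k" "k \<in> K"
        using ab(1) unfolding K'_def cmat.span_insert by (auto simp: cmat.span_eq_iff[THEN iffD2, OF Ks]) (metis add.commute diff_add_cancel)
      obtain d l where b: "b = d *\<^sub>C y + l" "l \<in> K"
        using ab(2) unfolding K'_def cmat.span_insert by (auto simp: cmat.span_eq_iff[THEN iffD2, OF Ks]) (metis add.commute diff_add_cancel)
      have "lie_bracket a b = d *\<^sub>C lie_bracket k y - c *\<^sub>C lie_bracket l y + lie_bracket k l"
        unfolding a(1) b(1) bracket_add_left bracket_add_right bracket_scale_left bracket_scale_right
        using bracket_anti[of y l] by (simp add: cmat.scale_zero_right cmat.scale_minus_right)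
      also have "\<dots> \<in> K"
        using yK[OF a(2)] yK[OF b(2)] Kb[OF a(2) b(2)] Ks
        by (intro cmat.subspace_add cmat.subspace_diff cmat.subspace_scale) auto
      also have "K \<subseteq> K'" unfolding K'_def using cmat.span_superset by blast
      finally show ?thesis .
    qed
    ultimately have "good K'" unfolding good_def by blast
    then have "cmat.dim K' \<le> cmat.dim K" by (rule max)
    moreover have "cmat.span K \<subset> cmat.span K'"
    proof -
      have "K \<subset> K'" unfolding K'_def using ynot cmat.span_superset[of "insert y K"] by auto
      then show ?thesis using Ks \<open>cmat.subspace K'\<close> by (simp add: cmat.span_eq_iff[THEN iffD2])
    qed
    then have "cmat.dim K < cmat.dim K'" by (rule cmat.dim_psubset)
    ultimately show False by simp
  qed
  then show ?thesis using N by blast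
qed

text \<open>Elements of the \<open>k\<close>-th derived algebra are combinations of words with at
  least \<open>k + 1\<close> letters.\<close>

lemma solvable_if_annih:
  assumes "annih L N"
  shows "solvable L"
proof -
  let ?W = "\<lambda>k. cmat.span {mprod ws | ws. set ws \<subseteq> L \<and> length ws \<ge> Suc k}"
  have sub: "(derived ^^ k) L \<subseteq> ?W k" for k
  proof (induction k)
    case 0
    show ?case
    proof
      fix x assume "x \<in> (derived ^^ 0) L"
      then show "x \<in> ?W 0" by (intro cmat.span_base CollectI exI[of _ "[x]"]) auto
    qed
  next
    case (Suc k)
    have prod: "a ** b \<in> ?W (Suc k)" if a: "a \<in> ?W k" and b: "b \<in> ?W k" for a b
    proof (rule span_mul_right[OF a])
      fix v assume "v \<in> {mprod ws | ws. set ws \<subseteq> L \<and> length ws \<ge> Suc k}"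
      then obtain vs where v: "v = mprod vs" "set vs \<subseteq> L" "length vs \<ge> Suc k" by blast
      show "v ** b \<in> ?W (Suc k)"
      proof (rule span_mul_left[OF b])
        fix w assume "w \<in> {mprod ws | ws. set ws \<subseteq> L \<and> length ws \<ge> Suc k}"
        then obtain ws where w: "w = mprod ws" "set ws \<subseteq> L" "length ws \<ge> Suc k" by blast
        show "v ** w \<in> ?W (Suc k)"
          using v w by (intro cmat.span_base CollectI exI[of _ "vs @ ws"]) auto
      qed
    qed
    show ?case
    proof
      fix x assume "x \<in> (derived ^^ Suc k) L"
      then have "x \<in> derived ((derived ^^ k) L)" by simp
      then show "x \<in> ?W (Suc k)"
      proof (rule derived_induct)
        fix a b assume "a \<in> (derived ^^ k) L" "b \<in> (derived ^^ k) L"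
        then have "a \<in> ?W k" "b \<in> ?W k" using Suc.IH by auto
        then show "lie_bracket a b \<in> ?W (Suc k)" unfolding lie_bracket_def by (intro cmat.span_diff prod)
      qed simp
    qed
  qed
  have "?W (Suc N) \<subseteq> {0}"
    by (rule cmat.span_minimal) (auto simp: annih_ge[OF assms] cmat.subspace_0)
  then have "(derived ^^ Suc N) L \<subseteq> {0}" using sub by blast
  moreover have "0 \<in> (derived ^^ Suc N) L" using cmat.subspace_0[OF subspace_derived] by simp
  ultimately show ?thesis unfolding solvable_def by blast
qed

text \<open>By \<open>nilpotent_derived\<close> the derived algebra consists of nilpotent matrices,
  so Engel's theorem applies to it.\<close>

theorem cartan_solvable:
  fixes R :: "(complex^'n^'n) set"
  assumes R: "cmat.subspace R" and br: "\<And>a b. a \<in> R \<Longrightarrow> b \<in> R \<Longrightarrow> lie_bracket a b \<in> R"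
    and tr: "\<And>a b. a \<in> R \<Longrightarrow> b \<in> R \<Longrightarrow> trace (a ** b) = 0"
  shows "solvable R"
proof -
  have sub: "z \<in> R" if "z \<in> derived R" for z by (rule derived_induct[OF that R br])
  have "\<exists>N. annih (derived R) N"
  proof (rule engel)
    fix a b assume "a \<in> derived R" "b \<in> derived R"
    then show "lie_bracket a b \<in> derived R" by (intro derivedI sub)
  next
    fix a assume a: "a \<in> derived R"
    show "nilpotent_mat a" by (rule nilpotent_derived[OF R _ _ a]) (auto intro: br tr)
  qed simp
  then have "solvable (derived R)" using solvable_if_annih by blast
  then obtain k where "(derived ^^ k) (derived R) = {0}" by (auto simp: solvable_def)
  then have "(derived ^^ Suc k) R = {0}" by (simp add: funpow_swap1)
  then show ?thesis unfolding solvable_def by blast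
qed

subsection \<open>The trace form of a semisimple ideal\<close>

definition nondeg :: "(complex^'n^'n) set \<Rightarrow> bool" where
  "nondeg V \<longleftrightarrow> (\<forall>w\<in>V. (\<forall>v\<in>V. trace (w ** v) = 0) \<longrightarrow> w = 0)"

lemma nondegD: "nondeg V \<Longrightarrow> w \<in> V \<Longrightarrow> (\<And>v. v \<in> V \<Longrightarrow> trace (w ** v) = 0) \<Longrightarrow> w = 0"
  by (simp add: nondeg_def)

lemma subspace_trace_zero_right: "cmat.subspace {z. trace (s ** z) = 0}"
  using subspace_trace_zero[of s] by (simp only: trace_mul_commute[of s])

lemma trace_sum_scale: "trace ((\<Sum>b\<in>B. u b *\<^sub>C f b) ** c) = (\<Sum>b\<in>B. u b * trace (f b ** c))"
  by (simp add: mm_sum_left mm_scale_left trace_sum trace_scale)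

text \<open>Nondegeneracy makes the map \<open>\<phi>\<close> from \<open>V\<close> to functions on
  a basis injective, and a count of dimensions makes it surjective. The \<open>\<delta> b\<close>
  are the standard basis of the target.\<close>

lemma trace_form_represents:
  fixes V :: "(complex^'n^'n) set"
  assumes V: "cmat.subspace V" and nd: "nondeg V" and B: "B \<subseteq> V" "cmat.independent B"
  shows "\<exists>v\<in>V. \<forall>b\<in>B. trace (v ** b) = g b"
proof -
  obtain B' where B': "B \<subseteq> B'" "B' \<subseteq> V" "cmat.independent B'" "V \<subseteq> cmat.span B'"
    using cmat.maximal_independent_subset_extend[OF B] by blast
  have fin: "finite B'" by (rule cmat.finiteI_independent[OF B'(3)])
  define \<phi> where "\<phi> z = (\<lambda>b. if b \<in> B' then trace (z ** b) else 0)" for z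
  define \<delta> :: "complex^'n^'n \<Rightarrow> complex^'n^'n \<Rightarrow> complex" where "\<delta> b = (\<lambda>c. if c = b then 1 else 0)" for b
  have spanV: "cmat.span B' = V" using B'(2,4) V cmat.span_minimal by blast
  have inj0: "u b = 0" if u: "\<And>c. c \<in> B' \<Longrightarrow> trace ((\<Sum>b\<in>B'. u b *\<^sub>C b) ** c) = 0" and b: "b \<in> B'" for u b
  proof -
    have in_V: "(\<Sum>b\<in>B'. u b *\<^sub>C b) \<in> V"
      unfolding spanV[symmetric] by (intro cmat.span_sum cmat.span_scale cmat.span_base)
    have "(\<Sum>b\<in>B'. u b *\<^sub>C b) = 0"
    proof (rule nondegD[OF nd in_V])
      fix v assume v: "v \<in> V"
      have "cmat.span B' \<subseteq> {v. trace ((\<Sum>b\<in>B'. u b *\<^sub>C b) ** v) = 0}"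
        by (rule cmat.span_minimal) (use u in \<open>auto simp: subspace_trace_zero_right\<close>)
      then show "trace ((\<Sum>b\<in>B'. u b *\<^sub>C b) ** v) = 0" using v spanV by auto
    qed
    then show ?thesis using B'(3) b fin by (auto simp: cmat.dependent_finite)
  qed
  have comb: "(\<Sum>b\<in>B'. fscale (u b) (\<phi> b)) c = (if c \<in> B' then trace ((\<Sum>b\<in>B'. u b *\<^sub>C b) ** c) else 0)" for u c
    by (simp add: sum_fun_apply fscale_def \<phi>_def trace_sum_scale)
  have inj: "inj_on \<phi> B'"
  proof (rule inj_onI)
    fix a b assume ab: "a \<in> B'" "b \<in> B'" "\<phi> a = \<phi> b"
    show "a = b"
    proof (rule ccontr)
      assume ne: "a \<noteq> b"
      define u where "u c = (if c = a then 1 else if c = b then - 1 else (0::complex))" for c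
      have "(\<Sum>c\<in>B'. u c *\<^sub>C c) = (\<Sum>c\<in>{a, b}. u c *\<^sub>C c)"
        by (rule sum.mono_neutral_right) (use ab fin in \<open>auto simp: u_def cmat.scale_zero_left\<close>)
      also have "\<dots> = a - b" using ne by (simp add: u_def cmat.scale_one cmat.scale_minus_left)
      finally have s: "(\<Sum>c\<in>B'. u c *\<^sub>C c) = a - b" .
      have "trace ((\<Sum>c\<in>B'. u c *\<^sub>C c) ** d) = 0" if "d \<in> B'" for d
        using fun_cong[OF ab(3), of d] that unfolding s by (simp add: \<phi>_def mm_diff_left trace_sub)
      from inj0[OF this ab(1)] show False by (simp add: u_def)
    qed
  qed
  have ind: "cfun.independent (\<phi> ` B')"
  proof
    assume "cfun.dependent (\<phi> ` B')"
    then obtain w where w: "\<exists>v\<in>\<phi> ` B'. w v \<noteq> 0" "(\<Sum>v\<in>\<phi> ` B'. fscale (w v) v) = 0"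
      using fin by (subst (asm) cfun.dependent_finite) auto
    have "(\<Sum>b\<in>B'. fscale (w (\<phi> b)) (\<phi> b)) = 0" using w(2) by (simp add: sum.reindex[OF inj])
    then have "trace ((\<Sum>b\<in>B'. w (\<phi> b) *\<^sub>C b) ** c) = 0" if "c \<in> B'" for c
      using comb[of "\<lambda>b. w (\<phi> b)" c] that by simp
    from inj0[OF this] show False using w(1) by auto
  qed
  have sub: "\<phi> ` B' \<subseteq> cfun.span (\<delta> ` B')"
  proof clarify
    fix b assume "b \<in> B'"
    have "\<phi> b = (\<Sum>c\<in>B'. fscale (trace (b ** c)) (\<delta> c))"
      by (rule ext) (use fin in \<open>simp add: sum_fun_apply fscale_def \<delta>_def \<phi>_def if_distrib cong: if_cong\<close>)
    then show "\<phi> b \<in> cfun.span (\<delta> ` B')"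
      by (simp only:) (intro cfun.span_sum cfun.span_scale cfun.span_base imageI)
  qed
  have \<delta>: "\<delta> b \<in> cfun.span (\<phi> ` B')" if b: "b \<in> B'" for b
  proof (rule ccontr)
    assume n: "\<delta> b \<notin> cfun.span (\<phi> ` B')"
    have "cfun.independent (insert (\<delta> b) (\<phi> ` B'))" by (rule cfun.independent_insertI[OF n ind])
    moreover have "insert (\<delta> b) (\<phi> ` B') \<subseteq> cfun.span (\<delta> ` B')" using sub b by (auto intro: cfun.span_base)
    ultimately have "card (insert (\<delta> b) (\<phi> ` B')) \<le> card (\<delta> ` B')"
      using cfun.independent_span_bound[of "\<delta> ` B'"] fin by blast
    also have "\<dots> \<le> card (\<phi> ` B')" using card_image_le[OF fin, of \<delta>] card_image[OF inj] by simp
    finally have "\<delta> b \<in> \<phi> ` B'" using fin by (simp add: card_insert_if split: if_splits)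
    then show False using n cfun.span_base by blast
  qed
  have "(\<Sum>c\<in>B'. fscale (g c) (\<delta> c)) \<in> cfun.span (\<phi> ` B')"
    by (intro cfun.span_sum cfun.span_scale \<delta>)
  then obtain w where w: "(\<Sum>c\<in>B'. fscale (g c) (\<delta> c)) = (\<Sum>v\<in>\<phi> ` B'. fscale (w v) v)"
    using cfun.span_finite[of "\<phi> ` B'"] fin by auto
  define v where "v = (\<Sum>b\<in>B'. w (\<phi> b) *\<^sub>C b)"
  have "v \<in> V" unfolding v_def spanV[symmetric] by (intro cmat.span_sum cmat.span_scale cmat.span_base)
  moreover have "trace (v ** b) = g b" if "b \<in> B'" for b
  proof -
    have "(\<Sum>c\<in>B'. fscale (g c) (\<delta> c)) b = (\<Sum>c\<in>B'. if c = b then g c else 0)"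
      unfolding sum_fun_apply by (rule sum.cong) (auto simp: fscale_def \<delta>_def)
    also have "\<dots> = g b" using that fin by simp
    finally show ?thesis using comb[of "\<lambda>b. w (\<phi> b)" b] that unfolding w v_def
      by (simp add: sum.reindex[OF inj])
  qed
  ultimately show ?thesis using B'(1) by blast
qed

lemma trace_form_projection:
  fixes V :: "(complex^'n^'n) set"
  assumes V: "cmat.subspace V" and nd: "nondeg V"
  shows "\<exists>v\<in>V. \<forall>w\<in>V. trace (v ** w) = trace (z ** w)"
proof -
  obtain B where B: "B \<subseteq> V" "cmat.independent B" "V \<subseteq> cmat.span B"
    using cmat.maximal_independent_subset by blast
  obtain v where v: "v \<in> V" "\<forall>b\<in>B. trace (v ** b) = trace (z ** b)"
    using trace_form_represents[OF V nd B(1,2), of "\<lambda>b. trace (z ** b)"] by blast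
  have "cmat.span B \<subseteq> {w. trace ((v - z) ** w) = 0}"
    by (rule cmat.span_minimal[OF _ subspace_trace_zero_right]) (use v(2) in \<open>auto simp: mm_diff_left trace_sub\<close>)
  then have "trace (v ** w) = trace (z ** w)" if "w \<in> V" for w
    using B(3) that by (auto simp: mm_diff_left trace_sub)
  then show ?thesis using v(1) by blast
qed

text \<open>Let \<open>v\<close> in \<open>V\<close> have the same trace pairing with
  \<open>V\<close> as \<open>z\<close>. By invariance of the form \<open>[z - v, w]\<close> pairs to
  0 with all of \<open>V\<close>, so \<open>z - v\<close> centralizes \<open>V\<close>.\<close>

lemma centralizing_complement:
  assumes V: "cmat.subspace V" and nd: "nondeg V" and z: "\<And>v. v \<in> V \<Longrightarrow> lie_bracket z v \<in> V"
    and br: "\<And>v w. v \<in> V \<Longrightarrow> w \<in> V \<Longrightarrow> lie_bracket v w \<in> V"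
  shows "\<exists>v\<in>V. \<forall>w\<in>V. lie_bracket z w = lie_bracket v w"
proof -
  obtain v where v: "v \<in> V" "\<forall>w\<in>V. trace (v ** w) = trace (z ** w)"
    using trace_form_projection[OF V nd, of z] by blast
  have "lie_bracket z w - lie_bracket v w = 0" if w: "w \<in> V" for w
  proof (rule nondegD[OF nd])
    show "lie_bracket z w - lie_bracket v w \<in> V" by (intro cmat.subspace_diff V z br v(1) w)
    fix u assume u: "u \<in> V"
    show "trace ((lie_bracket z w - lie_bracket v w) ** u) = 0"
      using v(2) br[OF w u] by (simp add: mm_diff_left trace_sub trace_bracket)
  qed
  then show ?thesis using v(1) by (intro bexI[of _ v]) auto
qed

text \<open>The radical of the trace form on \<open>V\<close> is an ideal of \<open>I\<close>,
  solvable by Cartan's criterion, hence zero.\<close>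

lemma nondeg_if_radical_ideal:
  assumes V: "cmat.subspace V" and br: "\<And>v w. v \<in> V \<Longrightarrow> w \<in> V \<Longrightarrow> lie_bracket v w \<in> V"
    and I: "semisimple I" "V \<subseteq> I" "\<And>i v. i \<in> I \<Longrightarrow> v \<in> V \<Longrightarrow> lie_bracket i v \<in> V"
  shows "nondeg V"
proof -
  define R where "R = {w\<in>V. \<forall>v\<in>V. trace (w ** v) = 0}"
  have R: "cmat.subspace R"
    using V unfolding R_def by (auto simp: cmat.subspace_def mm_simps trace_add trace_scale)
  have ideal: "lie_bracket i w \<in> R" if "i \<in> I" "w \<in> R" for i w
  proof -
    have "trace (lie_bracket i w ** v) = 0" if v: "v \<in> V" for v
    proof -
      have "trace (lie_bracket w i ** v) = 0" using \<open>w \<in> R\<close> I(3)[OF \<open>i \<in> I\<close> v] by (simp add: trace_bracket R_def)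
      then show ?thesis using bracket_anti[of i w] trace_scale[of "-1" "lie_bracket w i ** v"]
        by (simp add: mm_minus_left cmat.scale_minus_left cmat.scale_one)
    qed
    then show ?thesis using that I(3) by (auto simp: R_def)
  qed
  have "lie_ideal R I" using R ideal I(2) by (auto simp: lie_ideal_def R_def)
  moreover have "solvable R"
  proof (rule cartan_solvable[OF R])
    fix a b assume "a \<in> R" "b \<in> R"
    then show "lie_bracket a b \<in> R" "trace (a ** b) = 0" using ideal I(2) by (auto simp: R_def)
  qed
  ultimately have "R = {0}" using I(1) by (auto simp: semisimple_def)
  then show ?thesis by (auto simp: nondeg_def R_def)
qed

locale semisimple_ideal =
  fixes L I :: "(complex^'n^'n) set"
  assumes ideal: "lie_ideal I L" and ss: "semisimple I"
begin

lemma I_subspace: "cmat.subspace I" and I_sub: "I \<subseteq> L" and I_bracket: "x \<in> L \<Longrightarrow> y \<in> I \<Longrightarrow> lie_bracket x y \<in> I"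
  using ideal by (auto simp: lie_ideal_def)

lemma I_closed: "x \<in> I \<Longrightarrow> y \<in> I \<Longrightarrow> lie_bracket x y \<in> I"
  using I_bracket I_sub by blast

lemma I_nondeg: "nondeg I"
  by (rule nondeg_if_radical_ideal[OF I_subspace I_closed ss]) (auto intro: I_closed)

lemma bracket_via_I:
  assumes "z \<in> L"
  shows "\<exists>v\<in>I. \<forall>w\<in>I. lie_bracket z w = lie_bracket v w"
  by (rule centralizing_complement[OF I_subspace I_nondeg I_bracket[OF assms] I_closed])

text \<open>The trace form is nondegenerate on \<open>V\<close>, so every element of
  \<open>I\<close> acts on \<open>V\<close> like an element of \<open>V\<close>. Ideals of
  \<open>V\<close> are therefore ideals of \<open>I\<close>, and the solvable ones vanish.\<close>

lemma ideal_semisimple: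
  assumes V: "cmat.subspace V" "V \<subseteq> I" "\<And>z v. z \<in> L \<Longrightarrow> v \<in> V \<Longrightarrow> lie_bracket z v \<in> V"
  shows "lie_ideal V L \<and> semisimple V"
proof
  show "lie_ideal V L" using V I_sub by (auto simp: lie_ideal_def)
  have VL: "V \<subseteq> L" using V(2) I_sub by blast
  have br: "lie_bracket v w \<in> V" if "v \<in> V" "w \<in> V" for v w using V(3) VL that by blast
  have IV: "lie_bracket i v \<in> V" if "i \<in> I" "v \<in> V" for i v using V(3) I_sub that by blast
  have nd: "nondeg V" by (rule nondeg_if_radical_ideal[OF V(1) br ss V(2) IV])
  show "semisimple V"
    unfolding semisimple_def
  proof (intro allI impI, elim conjE)
    fix A assume A: "lie_ideal A V" "solvable A"
    have "lie_bracket i a \<in> A" if i: "i \<in> I" and a: "a \<in> A" for i a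
    proof -
      obtain v where v: "v \<in> V" "\<forall>w\<in>V. lie_bracket i w = lie_bracket v w"
        using centralizing_complement[OF V(1) nd IV[OF i] br] by blast
      then show ?thesis using A(1) a unfolding lie_ideal_def by auto
    qed
    then have "lie_ideal A I" using A(1) V(2) by (auto simp: lie_ideal_def)
    then show "A = {0}" using ss A(2) by (auto simp: semisimple_def)
  qed
qed

text \<open>A substitute for the Jacobson-Morozov theorem. The nilpotent \<open>x\<close> is
  trace-orthogonal to its centralizer, so \<open>[x, v] \<mapsto> tr (x v)\<close> is well defined
  on \<open>[x, I]\<close>; an \<open>h\<close> representing this functional satisfies
  \<open>tr ([h, x] v) = tr (x v)\<close> for all \<open>v\<close> in \<open>I\<close>.\<close>

lemma nilpotent_in_bracket:
  assumes x: "x \<in> I" "nilpotent_mat x"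
  shows "\<exists>h\<in>I. lie_bracket h x = x"
proof -
  define U where "U = lie_bracket x ` I"
  have UI: "U \<subseteq> I" using I_closed x(1) by (auto simp: U_def)
  have comm0: "trace (x ** w) = 0" if w: "lie_bracket x w = 0" for w
  proof -
    have c: "x ** w = w ** x" using w by (simp add: lie_bracket_def)
    have cw: "mpow x k ** w = w ** mpow x k" for k
    proof (induction k)
      case (Suc k)
      have "mpow x (Suc k) ** w = x ** (mpow x k ** w)" by (simp add: mpow_Suc matrix_mul_assoc)
      also have "\<dots> = (x ** w) ** mpow x k" unfolding Suc by (simp add: matrix_mul_assoc)
      also have "\<dots> = w ** mpow x (Suc k)" unfolding c by (simp add: mpow_Suc matrix_mul_assoc)
      finally show ?case .
    qed simp
    have pw: "mpow (x ** w) k = mpow x k ** mpow w k" for k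
    proof (induction k)
      case (Suc k)
      have "mpow (x ** w) (Suc k) = x ** (w ** mpow x k) ** mpow w k"
        unfolding mpow_Suc[of "x ** w"] Suc by (simp add: matrix_mul_assoc)
      then show ?case unfolding cw[symmetric] by (simp add: mpow_Suc matrix_mul_assoc)
    qed simp
    obtain k where "mpow x k = 0" using x(2) by (auto simp: nilpotent_mat_iff)
    then have "mpow (x ** w) k = 0" by (simp add: pw)
    then show ?thesis by (intro trace_nilpotent) (auto simp: nilpotent_mat_iff)
  qed
  obtain B where B: "B \<subseteq> U" "cmat.independent B" "U \<subseteq> cmat.span B"
    using cmat.maximal_independent_subset by blast
  have fin: "finite B" by (rule cmat.finiteI_independent[OF B(2)])
  have "\<forall>b\<in>B. \<exists>w\<in>I. lie_bracket x w = b" using B(1) by (auto simp: U_def)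
  then obtain w where w: "\<And>b. b \<in> B \<Longrightarrow> w b \<in> I" "\<And>b. b \<in> B \<Longrightarrow> lie_bracket x (w b) = b" by metis
  obtain h where h: "h \<in> I" "\<forall>b\<in>B. trace (h ** b) = trace (x ** w b)"
    using trace_form_represents[OF I_subspace I_nondeg _ B(2), of "\<lambda>b. trace (x ** w b)"] B(1) UI by blast
  have "lie_bracket h x - x = 0"
  proof (rule nondegD[OF I_nondeg])
    show "lie_bracket h x - x \<in> I" by (intro cmat.subspace_diff I_subspace I_closed h(1) x(1))
    fix v assume v: "v \<in> I"
    have "lie_bracket x v \<in> cmat.span B" using B(3) v by (auto simp: U_def)
    then obtain u where u: "lie_bracket x v = (\<Sum>b\<in>B. u b *\<^sub>C b)"
      using cmat.span_finite[OF fin] by auto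
    have "lie_bracket x (v - (\<Sum>b\<in>B. u b *\<^sub>C w b)) = 0"
    proof -
      have "lie_bracket x (\<Sum>b\<in>B. u b *\<^sub>C w b) = (\<Sum>b\<in>B. u b *\<^sub>C b)"
        unfolding clin_sum[OF clin_bracket] bracket_scale_right by (rule sum.cong) (simp_all add: w(2))
      then show ?thesis unfolding clin_diff[OF clin_bracket] u by simp
    qed
    from comm0[OF this] have "trace (x ** v) = (\<Sum>b\<in>B. u b * trace (x ** w b))"
      by (simp add: mm_diff_right trace_sub mm_sum_right mm_scale_right trace_sum trace_scale)
    also have "\<dots> = (\<Sum>b\<in>B. u b * trace (h ** b))" by (rule sum.cong) (simp_all add: h(2))
    also have "\<dots> = trace (h ** lie_bracket x v)"
      unfolding u by (simp add: mm_sum_right mm_scale_right trace_sum trace_scale)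
    finally show "trace ((lie_bracket h x - x) ** v) = 0" by (simp add: mm_diff_left trace_sub trace_bracket)
  qed
  then show ?thesis using h(1) by (intro bexI[of _ h]) auto
qed

end

subsection \<open>Derivations of matrix functions\<close>

lemma finite_mat_coords: "finite (mat_coords :: (complex^'n^'n \<Rightarrow> complex) set)"
proof -
  have "(mat_coords :: (complex^'n^'n \<Rightarrow> complex) set) = (\<lambda>(i, j) A. A $ i $ j) ` (UNIV :: ('n \<times> 'n) set)" by (auto simp: mat_coords_def)
  then show ?thesis by (rule finite_subset[OF eq_refl]) (intro finite_imageI finite)
qed

lemma coord_poly: "(\<lambda>A. A $ i $ j) \<in> poly_fun mat_coords"
  by (rule poly_fun.coord) (auto simp: mat_coords_def)

definition polymat :: "('q \<Rightarrow> complex) set \<Rightarrow> ('q \<Rightarrow> complex^'n^'n) \<Rightarrow> bool" where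
  "polymat C A \<longleftrightarrow> (\<forall>i j. (\<lambda>q. A q $ i $ j) \<in> poly_fun C)"

lemma polymatD: "polymat C A \<Longrightarrow> (\<lambda>q. A q $ i $ j) \<in> poly_fun C"
  by (simp add: polymat_def)

lemma polymat_const: "polymat C (\<lambda>_. a)"
  by (simp add: polymat_def poly_fun.const)

lemma polymat_add: "polymat C A \<Longrightarrow> polymat C B \<Longrightarrow> polymat C (\<lambda>q. A q + B q)"
  by (simp add: polymat_def poly_fun.add)

lemma polymat_mul: "polymat C A \<Longrightarrow> polymat C B \<Longrightarrow> polymat C (\<lambda>q. A q ** B q)"
  unfolding polymat_def matmul_nth by (intro allI poly_fun_sum poly_fun.mult) simp_all

lemma polymat_scale: "c \<in> poly_fun C \<Longrightarrow> polymat C A \<Longrightarrow> polymat C (\<lambda>q. c q *\<^sub>C A q)"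
  by (simp add: polymat_def poly_fun.mult)

lemma polymat_sum: "(\<And>i. i \<in> S \<Longrightarrow> polymat C (A i)) \<Longrightarrow> polymat C (\<lambda>q. \<Sum>i\<in>S. A i q)"
  unfolding polymat_def sum_component by (intro allI poly_fun_sum) simp_all

lemma polymat_id: "polymat mat_coords (\<lambda>A. A)"
  by (simp add: polymat_def coord_poly)

lemma polymat_compose:
  assumes "f \<in> poly_fun mat_coords" "polymat C A"
  shows "(\<lambda>q. f (A q)) \<in> poly_fun C"
  by (rule poly_fun_subst[OF assms(1)]) (use assms(2) in \<open>auto simp: mat_coords_def polymat_def\<close>)

lemma polymat_subst:
  assumes "polymat C A" "\<And>c. c \<in> C \<Longrightarrow> (\<lambda>r. c (k r)) \<in> poly_fun D"
  shows "polymat D (\<lambda>r. A (k r))"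
  unfolding polymat_def
proof (intro allI)
  fix i j show "(\<lambda>q. A (k q) $ i $ j) \<in> poly_fun D"
    by (rule poly_fun_subst[OF polymatD[OF assms(1)] assms(2)])
qed

lemma poly_fun_trace: "polymat C A \<Longrightarrow> (\<lambda>q. trace (A q)) \<in> poly_fun C"
  unfolding trace_def polymat_def by (intro poly_fun_sum) simp

definition dmat :: "(('q \<Rightarrow> complex) \<Rightarrow> complex) \<Rightarrow> ('q \<Rightarrow> complex^'n^'n) \<Rightarrow> complex^'n^'n" where
  "dmat \<xi> A = (\<chi> i j. \<xi> (\<lambda>q. A q $ i $ j))"

lemma dmat_nth [simp]: "dmat \<xi> A $ i $ j = \<xi> (\<lambda>q. A q $ i $ j)"
  by (simp add: dmat_def)

lemma dmat_const: "pder C p \<xi> \<Longrightarrow> dmat \<xi> (\<lambda>_. a) = 0"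
  by (rule mat_eqI) (simp add: pder_const)

lemma dmat_mul:
  assumes \<xi>: "pder C p \<xi>" and A: "polymat C A" and B: "polymat C B"
  shows "dmat \<xi> (\<lambda>q. A q ** B q) = dmat \<xi> A ** B p + A p ** dmat \<xi> B"
proof (rule mat_eqI)
  fix i j
  have "\<xi> (\<lambda>q. \<Sum>k\<in>UNIV. A q $ i $ k * B q $ k $ j) = (\<Sum>k\<in>UNIV. \<xi> (\<lambda>q. A q $ i $ k * B q $ k $ j))"
    by (rule pder_sum[OF \<xi>]) (rule poly_fun.mult[OF polymatD[OF A] polymatD[OF B]])
  also have "\<dots> = (\<Sum>k\<in>UNIV. A p $ i $ k * \<xi> (\<lambda>q. B q $ k $ j) + B p $ k $ j * \<xi> (\<lambda>q. A q $ i $ k))"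
    by (rule sum.cong[OF refl pder_mult[OF \<xi> polymatD[OF A] polymatD[OF B]]])
  finally show "dmat \<xi> (\<lambda>q. A q ** B q) $ i $ j = (dmat \<xi> A ** B p + A p ** dmat \<xi> B) $ i $ j"
    by (simp add: matmul_nth sum.distrib algebra_simps)
qed

lemma dmat_mul_const:
  "pder C p \<xi> \<Longrightarrow> polymat C A \<Longrightarrow> dmat \<xi> (\<lambda>q. A q ** b) = dmat \<xi> A ** b"
  using dmat_mul[of C p \<xi> A "\<lambda>_. b"] by (simp add: polymat_const dmat_const)

lemma dmat_const_mul:
  "pder C p \<xi> \<Longrightarrow> polymat C A \<Longrightarrow> dmat \<xi> (\<lambda>q. b ** A q) = b ** dmat \<xi> A"
  using dmat_mul[of C p \<xi> "\<lambda>_. b" A] by (simp add: polymat_const dmat_const)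

lemma dmat_eq_on:
  assumes \<xi>: "\<xi> \<in> tang C P p" and "polymat C A" "polymat C B" "\<And>q. q \<in> P \<Longrightarrow> A q = B q"
  shows "dmat \<xi> A = dmat \<xi> B"
proof (rule mat_eqI)
  fix i j
  have pd: "pder C p \<xi>" using \<xi> by (simp add: tang_def)
  have "(\<lambda>q. A q $ i $ j - B q $ i $ j) \<in> poly_fun C" by (intro poly_fun_diff polymatD assms)
  then have "\<xi> (\<lambda>q. A q $ i $ j - B q $ i $ j) = 0" using \<xi> assms(4) by (simp add: tang_def)
  then show "dmat \<xi> A $ i $ j = dmat \<xi> B $ i $ j"
    using pder_diff[OF pd polymatD[OF assms(2)] polymatD[OF assms(3)]] by simp
qed

text \<open>The directional derivative at \<open>z\<close> along \<open>u\<close>, normalized to 0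
  on nonpolynomial functions. By \<open>mder_eqI\<close> every derivation at a matrix has this
  form.\<close>

definition mder :: "complex^'n^'n \<Rightarrow> complex^'n^'n \<Rightarrow> (complex^'n^'n \<Rightarrow> complex) \<Rightarrow> complex" where
  "mder z u = vel mat_coords (\<lambda>\<tau>. z + \<tau> *\<^sub>C u)"

lemma pder_mat_eqI:
  assumes "pder mat_coords z \<xi>" "pder mat_coords z \<eta>" "dmat \<xi> (\<lambda>A. A) = dmat \<eta> (\<lambda>A. A)"
  shows "\<xi> = \<eta>"
proof (rule pder_unique[OF assms(1,2)])
  fix a assume "a \<in> (mat_coords :: (complex^'a^'a \<Rightarrow> complex) set)"
  then obtain i j where "a = (\<lambda>A. A $ i $ j)" by (auto simp: mat_coords_def)
  then show "\<xi> a = \<eta> a" using arg_cong[OF assms(3), of "\<lambda>M. M $ i $ j"] by simp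
qed

lemma vel_curve:
  assumes "\<And>i j. ((\<lambda>\<tau>. \<kappa> \<tau> $ i $ j) has_field_derivative u $ i $ j) (at 0)"
  shows "pder mat_coords (\<kappa> 0) (vel mat_coords \<kappa>)" and "dmat (vel mat_coords \<kappa>) (\<lambda>A. A) = u"
proof -
  have "(\<lambda>\<tau>. c (\<kappa> \<tau>)) field_differentiable at 0" if "c \<in> mat_coords" for c
    using that assms by (auto simp: mat_coords_def field_differentiable_def)
  then show "pder mat_coords (\<kappa> 0) (vel mat_coords \<kappa>)" by (rule pder_vel)
  show "dmat (vel mat_coords \<kappa>) (\<lambda>A. A) = u"
    by (rule mat_eqI) (simp add: vel_def coord_poly DERIV_imp_deriv[OF assms])
qed

lemma DERIV_line: "((\<lambda>\<tau>. (z + \<tau> *\<^sub>C u) $ i $ j) has_field_derivative u $ i $ j) (at 0)"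
  by (auto intro!: derivative_eq_intros)

lemma pder_mder: "pder mat_coords z (mder z u)"
  using vel_curve(1)[OF DERIV_line, of z u] by (simp add: mder_def cmat.scale_zero_left)

lemma dmat_mder: "dmat (mder z u) (\<lambda>A. A) = u"
  unfolding mder_def by (rule vel_curve(2)[OF DERIV_line])

lemma mder_eqI: "pder mat_coords z \<xi> \<Longrightarrow> dmat \<xi> (\<lambda>A. A) = u \<Longrightarrow> \<xi> = mder z u"
  by (rule pder_mat_eqI[OF _ pder_mder]) (simp_all add: dmat_mder)

lemma mder_curve:
  assumes "\<And>i j. ((\<lambda>\<tau>. \<kappa> \<tau> $ i $ j) has_field_derivative u $ i $ j) (at 0)" "f \<in> poly_fun mat_coords"
  shows "mder (\<kappa> 0) u f = deriv (\<lambda>\<tau>. f (\<kappa> \<tau>)) 0"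
proof -
  have "vel mat_coords \<kappa> = mder (\<kappa> 0) u" by (rule mder_eqI[OF vel_curve[OF assms(1)]])
  then show ?thesis using assms(2) by (metis vel_def)
qed

lemma mder_pullback:
  assumes \<phi>: "polymat mat_coords \<phi>" and f: "f \<in> poly_fun mat_coords"
  shows "mder z u (\<lambda>A. f (\<phi> A)) = mder (\<phi> z) (dmat (mder z u) \<phi>) f"
proof -
  define \<eta> where "\<eta> f = (if f \<in> poly_fun mat_coords then mder z u (\<lambda>A. f (\<phi> A)) else 0)" for f
  have pd: "pder mat_coords z (mder z u)" by (rule pder_mder)
  have comp: "(\<lambda>A. g (\<phi> A)) \<in> poly_fun mat_coords" if "g \<in> poly_fun mat_coords" for g
    by (rule polymat_compose[OF that \<phi>])
  have "pder mat_coords (\<phi> z) \<eta>"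
    unfolding pder_def \<eta>_def
    by (auto simp: poly_fun.add poly_fun.mult poly_fun.const pder_const[OF pd] pder_add[OF pd comp comp] pder_mult[OF pd comp comp])
  moreover have "dmat \<eta> (\<lambda>A. A) = dmat (mder z u) \<phi>"
    by (rule mat_eqI) (simp add: \<eta>_def coord_poly)
  ultimately have "\<eta> = mder (\<phi> z) (dmat (mder z u) \<phi>)" by (rule mder_eqI)
  then show ?thesis using f by (metis \<eta>_def)
qed

lemma mder_add: "mder z (u + v) f = mder z u f + mder z v f"
  and mder_scale: "mder z (c *\<^sub>C u) f = c * mder z u f"
proof -
  have "pder mat_coords z (\<lambda>f. mder z u f + mder z v f)" "pder mat_coords z (\<lambda>f. c * mder z u f)"
    using pder_mder[of z u] pder_mder[of z v] by (auto simp: pder_def algebra_simps)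
  moreover have "dmat (\<lambda>f. mder z u f + mder z v f) (\<lambda>A. A) = u + v" "dmat (\<lambda>f. c * mder z u f) (\<lambda>A. A) = c *\<^sub>C u"
    using dmat_mder[of z u] dmat_mder[of z v] by (auto simp: dmat_def vec_eq_iff)
  ultimately have "(\<lambda>f. mder z u f + mder z v f) = mder z (u + v)" "(\<lambda>f. c * mder z u f) = mder z (c *\<^sub>C u)"
    by (auto intro: mder_eqI)
  then show "mder z (u + v) f = mder z u f + mder z v f" "mder z (c *\<^sub>C u) f = c * mder z u f"
    by (metis)+
qed

lemma subspace_mder_kernel: "cmat.subspace {u. mder z u f = 0}"
  using mder_scale[of z 0 0 f] by (auto simp: cmat.subspace_def mder_add mder_scale cmat.scale_zero_left)

lemma mder_poly:
  assumes "f \<in> poly_fun mat_coords" "polymat mat_coords U"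
  shows "(\<lambda>z. mder z (U z) f) \<in> poly_fun mat_coords"
  using assms(1)
proof induction
  case (coord c)
  then obtain i j where c: "c = (\<lambda>A. A $ i $ j)" by (auto simp: mat_coords_def)
  have "mder z (U z) c = U z $ i $ j" for z
    using arg_cong[OF dmat_mder[of z "U z"], of "\<lambda>M. M $ i $ j"] by (simp add: c)
  then show ?case using assms(2) by (simp add: polymat_def)
next
  case (const a)
  then show ?case by (simp add: pder_const[OF pder_mder] poly_fun.const)
next
  case (add f g)
  then show ?case by (simp add: pder_add[OF pder_mder] poly_fun.add)
next
  case (mult f g)
  then show ?case by (simp add: pder_mult[OF pder_mder] poly_fun.add poly_fun.mult)
qed

section \<open>Inverse, adjugate and separation of subspaces\<close>

lemma matrix_inv:
  fixes A :: "complex^'n^'n"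
  assumes "invertible A"
  shows "A ** matrix_inv A = mat 1" "matrix_inv A ** A = mat 1"
proof -
  have "A ** matrix_inv A = mat 1 \<and> matrix_inv A ** A = mat 1"
    unfolding matrix_inv_def by (rule someI_ex) (use assms in \<open>simp add: invertible_def\<close>)
  then show "A ** matrix_inv A = mat 1" "matrix_inv A ** A = mat 1" by auto
qed

lemma matrix_inv_unique:
  fixes A B :: "complex^'n^'n"
  assumes "A ** B = mat 1" "B ** A = mat 1"
  shows "matrix_inv A = B"
proof -
  have inv: "invertible A" using assms by (auto simp: invertible_def)
  have "matrix_inv A = matrix_inv A ** (A ** B)" using assms(1) by simp
  also have "\<dots> = B" by (simp add: matrix_mul_assoc matrix_inv[OF inv])
  finally show ?thesis .
qed

text \<open>The adjugate, by Cramer's rule. It stands in for the inverse where a function polynomial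
  in the matrix entries is wanted.\<close>

definition adjm :: "complex^'n^'n \<Rightarrow> complex^'n^'n" where
  "adjm A = (\<chi> i j. det (\<chi> k l. if l = i then (if k = j then 1 else 0) else A $ k $ l))"

lemma adjm_eq:
  assumes "invertible (A :: complex^'n^'n)"
  shows "adjm A = det A *\<^sub>C matrix_inv A"
proof (rule mat_eqI)
  fix i j
  define x where "x = column j (matrix_inv A)"
  have e: "(A *v x) $ k = (if k = j then 1 else 0)" for k
    using arg_cong[OF matrix_inv(1)[OF assms], of "\<lambda>M. M $ k $ j"]
    by (simp add: x_def column_def matrix_vector_mult_def matmul_nth mat_def)
  have "adjm A $ i $ j = det (\<chi> k l. if l = i then (A *v x) $ k else A $ k $ l)" unfolding e by (simp add: adjm_def)
  also have "\<dots> = x $ i * det A" by (rule cramer_lemma)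
  finally show "adjm A $ i $ j = (det A *\<^sub>C matrix_inv A) $ i $ j"
    by (simp add: x_def column_def mult.commute)
qed

lemma polymat_adjm: "polymat mat_coords (adjm :: complex^'n^'n \<Rightarrow> complex^'n^'n)"
proof -
  have "(\<lambda>A. det ((\<chi> k l. if l = i then (if k = j then 1 else 0) else A $ k $ l) :: complex^'n^'n)) \<in> poly_fun mat_coords"
    for i j :: 'n
  proof (rule poly_fun_det)
    fix k l :: 'n
    show "(\<lambda>A. ((\<chi> k l. if l = i then (if k = j then 1 else 0) else A $ k $ l) :: complex^'n^'n) $ k $ l) \<in> poly_fun mat_coords"
      by (cases "l = i") (simp_all add: poly_fun.const coord_poly)
  qed
  then show ?thesis by (simp add: polymat_def adjm_def)
qed

text \<open>Pair \<open>w\<close> with its conjugate transpose.\<close>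

lemma nondeg_UNIV: "nondeg (UNIV :: (complex^'n^'n) set)"
  unfolding nondeg_def
proof (intro ballI impI)
  fix w :: "complex^'n^'n" assume w: "\<forall>v\<in>UNIV. trace (w ** v) = 0"
  show "w = 0"
  proof (rule mat_eqI)
    fix i j
    have "0 = trace (w ** (\<chi> k l. cnj (w $ l $ k)))" using w by simp
    also have "\<dots> = of_real (\<Sum>i\<in>UNIV. \<Sum>k\<in>UNIV. (cmod (w $ i $ k))\<^sup>2)"
      unfolding of_real_sum complex_norm_square by (simp add: trace_def matmul_nth)
    finally have "complex_of_real (\<Sum>i\<in>UNIV. \<Sum>k\<in>UNIV. (cmod (w $ i $ k))\<^sup>2) = 0" by (rule sym)
    then have "(\<Sum>i\<in>UNIV. \<Sum>k\<in>UNIV. (cmod (w $ i $ k))\<^sup>2) = 0" by (simp only: of_real_eq_0_iff)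
    then have "(\<Sum>k\<in>UNIV. (cmod (w $ i $ k))\<^sup>2) = 0"
      by (subst (asm) sum_nonneg_eq_0_iff) (auto intro: sum_nonneg)
    then show "w $ i $ j = (0 :: complex^'n^'n) $ i $ j"
      by (subst (asm) sum_nonneg_eq_0_iff) auto
  qed
qed

lemma subspace_separation:
  assumes V: "cmat.subspace V" and z: "(z :: complex^'n^'n) \<notin> V"
  shows "\<exists>s. (\<forall>v\<in>V. trace (s ** v) = 0) \<and> trace (s ** z) \<noteq> 0"
proof -
  obtain B where B: "B \<subseteq> V" "cmat.independent B" "V \<subseteq> cmat.span B" using cmat.maximal_independent_subset by blast
  have spanB: "cmat.span B = V" using B V cmat.span_minimal by blast
  have ind: "cmat.independent (insert z B)" by (rule cmat.independent_insertI) (use z spanB B(2) in auto)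
  from trace_form_represents[OF cmat.subspace_UNIV nondeg_UNIV subset_UNIV ind, of "\<lambda>b. if b = z then 1 else 0"]
  obtain s where s: "\<forall>b\<in>insert z B. trace (s ** b) = (if b = z then 1 else 0)" by auto
  have "cmat.span B \<subseteq> {v. trace (s ** v) = 0}"
    by (rule cmat.span_minimal[OF _ subspace_trace_zero_right]) (use s z B(1) in auto)
  then show ?thesis using s spanB by (intro exI[of _ s]) auto
qed

subsection \<open>Connected linear algebraic groups\<close>

lemma vanishing_ideal_iff: "f \<in> vanishing_ideal X \<longleftrightarrow> f \<in> poly_fun mat_coords \<and> (\<forall>x\<in>X. f x = 0)"
  by (simp add: vanishing_ideal_def)

text \<open>With the entries of the inverse as further coordinates conjugation becomes polynomial.
  At singular matrices these functions are arbitrary, which is harmless on a group.\<close>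

definition inv_coords :: "(complex^'n^'n \<Rightarrow> complex) set" where
  "inv_coords = {(\<lambda>A. matrix_inv A $ i $ j) | i j. True}"

abbreviation "group_coords \<equiv> mat_coords \<union> inv_coords"

lemma finite_group_coords: "finite (group_coords :: (complex^'n^'n \<Rightarrow> complex) set)"
proof -
  have "(inv_coords :: (complex^'n^'n \<Rightarrow> complex) set) = (\<lambda>(i, j) A. matrix_inv A $ i $ j) ` (UNIV :: ('n \<times> 'n) set)"
    by (auto simp: inv_coords_def)
  then have "finite (inv_coords :: (complex^'n^'n \<Rightarrow> complex) set)"
    by (rule finite_subset[OF eq_refl]) (intro finite_imageI finite)
  then show ?thesis using finite_mat_coords by blast
qed

lemma polymat_group_id: "polymat group_coords (\<lambda>A. A)"
  and polymat_group_inv: "polymat group_coords matrix_inv"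
  by (auto simp: polymat_def mat_coords_def inv_coords_def intro!: poly_fun.coord)

lemma clear_denominator:
  assumes "h \<in> poly_fun (group_coords :: (complex^'n^'n \<Rightarrow> complex) set)"
  shows "\<exists>k. \<exists>F\<in>poly_fun mat_coords. \<forall>A. invertible A \<longrightarrow> F A = det A ^ k * h A"
  using assms
proof induction
  case (coord c)
  have detp: "(\<lambda>A. det A) \<in> poly_fun mat_coords" by (rule poly_fun_det) (rule coord_poly)
  from coord show ?case
  proof
    assume "c \<in> mat_coords"
    then show ?thesis by (intro exI[of _ 0] bexI[of _ c]) (auto intro: poly_fun.coord)
  next
    assume "c \<in> inv_coords"
    then obtain i j where c: "c = (\<lambda>A. matrix_inv A $ i $ j)" by (auto simp: inv_coords_def)
    show ?thesis
      by (intro exI[of _ 1] bexI[of _ "\<lambda>A. adjm A $ i $ j"]) (auto simp: adjm_eq c polymatD[OF polymat_adjm])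
  qed
next
  case (const a)
  then show ?case by (intro exI[of _ 0] bexI[of _ "\<lambda>_. a"]) (auto intro: poly_fun.const)
next
  case (add f g)
  have detp: "(\<lambda>A. det A) \<in> poly_fun mat_coords" by (rule poly_fun_det) (rule coord_poly)
  obtain k F where F: "F \<in> poly_fun mat_coords" "\<forall>A. invertible A \<longrightarrow> F A = det A ^ k * f A" using add.IH(1) by blast
  obtain l H where H: "H \<in> poly_fun mat_coords" "\<forall>A. invertible A \<longrightarrow> H A = det A ^ l * g A" using add.IH(2) by blast
  have "(\<lambda>A. det A ^ l * F A + det A ^ k * H A) \<in> poly_fun mat_coords"
    by (intro poly_fun.add poly_fun.mult poly_fun_power detp F(1) H(1))
  moreover have "\<forall>A. invertible A \<longrightarrow> det A ^ l * F A + det A ^ k * H A = det A ^ (k + l) * (f A + g A)"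
    using F(2) H(2) by (simp add: power_add algebra_simps)
  ultimately show ?case by (intro exI[of _ "k + l"] bexI)
next
  case (mult f g)
  obtain k F where F: "F \<in> poly_fun mat_coords" "\<forall>A. invertible A \<longrightarrow> F A = det A ^ k * f A" using mult.IH(1) by blast
  obtain l H where H: "H \<in> poly_fun mat_coords" "\<forall>A. invertible A \<longrightarrow> H A = det A ^ l * g A" using mult.IH(2) by blast
  have "(\<lambda>A. F A * H A) \<in> poly_fun mat_coords" by (intro poly_fun.mult F(1) H(1))
  moreover have "\<forall>A. invertible A \<longrightarrow> F A * H A = det A ^ (k + l) * (f A * g A)"
    using F(2) H(2) by (simp add: power_add algebra_simps)
  ultimately show ?case by (intro exI[of _ "k + l"] bexI)
qed

text \<open>This is the exponential of \<open>\<tau> y\<close> only if \<open>y\<close> is nilpotent.\<close>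

definition nexp :: "complex^'n^'n \<Rightarrow> complex \<Rightarrow> complex^'n^'n" where
  "nexp y \<tau> = (\<Sum>j<(LEAST N. mpow y N = 0). (\<tau> ^ j / fact j) *\<^sub>C mpow y j)"

lemma nexp_0:
  fixes y :: "complex^'n^'n"
  shows "nilpotent_mat y \<Longrightarrow> nexp y 0 = mat 1"
proof -
  assume "nilpotent_mat y"
  then have "\<exists>N. mpow y N = 0" by (simp add: nilpotent_mat_iff)
  then have z: "mpow y (LEAST N. mpow y N = 0) = 0" by (rule LeastI_ex)
  define N where "N = (LEAST N. mpow y N = 0)"
  have "N \<noteq> 0"
  proof
    assume "N = 0"
    then have "mat 1 = (0 :: complex^'n^'n)" using z by (simp add: N_def[symmetric])
    then have "(mat 1 :: complex^'n^'n) $ undefined $ undefined = 0" by simp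
    then show False by (simp add: mat_def)
  qed
  then obtain M where M: "N = Suc M" by (metis not0_implies_Suc)
  show ?thesis
    unfolding nexp_def N_def[symmetric] M
    by (subst sum.lessThan_Suc_shift) (simp add: cmat.scale_one cmat.scale_zero_left)
qed

lemma polymat_nexp: "t \<in> poly_fun C \<Longrightarrow> polymat C (\<lambda>q. nexp y (t q))"
  unfolding nexp_def
  by (intro polymat_sum polymat_scale polymat_const)
     (simp add: divide_inverse, intro poly_fun.mult poly_fun_power poly_fun.const)

lemma DERIV_nexp:
  assumes "nilpotent_mat y"
  shows "((\<lambda>t. nexp y t $ i $ j) has_field_derivative (y ** nexp y \<tau>) $ i $ j) (at \<tau>)"
proof -
  have "\<exists>N. mpow y N = 0" using assms by (simp add: nilpotent_mat_iff)
  then have z: "mpow y (LEAST N. mpow y N = 0) = 0" by (rule LeastI_ex)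
  define N where "N = (LEAST N. mpow y N = 0)"
  have zN: "mpow y N = 0" using z by (simp add: N_def)
  \<comment> \<open>The derivative of a partial sum is the shifted sum without its last term; at
    \<open>n = N\<close> that term is 0 because \<open>mpow y N = 0\<close>.\<close>
  have "((\<lambda>t. \<Sum>k<n. t ^ k / fact k * mpow y k $ i $ j) has_field_derivative
    (\<Sum>k<n. \<tau> ^ k / fact k * mpow y (Suc k) $ i $ j) - (if n = 0 then 0 else \<tau> ^ (n - 1) / fact (n - 1) * mpow y n $ i $ j)) (at \<tau>)" for n
  proof (induction n)
    case (Suc n)
    have d: "((\<lambda>t. t ^ n / fact n * mpow y n $ i $ j) has_field_derivative
        (if n = 0 then 0 else \<tau> ^ (n - 1) / fact (n - 1) * mpow y n $ i $ j)) (at \<tau>)"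
    proof (cases n)
      case (Suc m)
      have "of_nat (Suc m) * \<tau> ^ m / fact (Suc m) = \<tau> ^ m / (fact m :: complex)"
        by (simp del: of_nat_Suc)
      then have c: "of_nat (Suc m) * \<tau> ^ (Suc m - Suc 0) * (mpow y (Suc m) $ i $ j / fact (Suc m)) = \<tau> ^ m / fact m * mpow y (Suc m) $ i $ j"
        by (auto simp del: of_nat_Suc fact_Suc simp: field_simps)
      have "((\<lambda>t. t ^ Suc m * (mpow y (Suc m) $ i $ j / fact (Suc m))) has_field_derivative
         of_nat (Suc m) * \<tau> ^ (Suc m - Suc 0) * (mpow y (Suc m) $ i $ j / fact (Suc m))) (at \<tau>)"
        by (rule DERIV_cmult_right) (rule DERIV_power[OF DERIV_ident, of "Suc m", unfolded mult_1])
      then show ?thesis unfolding Suc c by (simp del: fact_Suc)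
    qed simp
    from DERIV_add[OF Suc d] show ?case by (simp add: algebra_simps)
  qed simp
  from this[of N] have "((\<lambda>t. \<Sum>k<N. t ^ k / fact k * mpow y k $ i $ j) has_field_derivative
    (\<Sum>k<N. \<tau> ^ k / fact k * mpow y (Suc k) $ i $ j)) (at \<tau>)" by (simp add: zN split: if_splits)
  moreover have "(y ** nexp y \<tau>) $ i $ j = (\<Sum>k<N. \<tau> ^ k / fact k * mpow y (Suc k) $ i $ j)"
    unfolding nexp_def N_def[symmetric] mm_sum_right mm_scale_right mpow_Suc[symmetric] sum_component cscale_nth by (rule refl)
  ultimately show ?thesis unfolding nexp_def N_def[symmetric] by (simp add: sum_component)
qed

lemma nexp_commute: "y ** nexp y \<tau> = nexp y \<tau> ** y"
  unfolding nexp_def mm_sum_right mm_sum_left mm_scale_right mm_scale_left mpow_Suc[symmetric] mpow_Suc_right[symmetric]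
  by (rule refl)

lemma DERIV_matmul:
  assumes "\<And>i j. ((\<lambda>t. A t $ i $ j) has_field_derivative A' $ i $ j) (at \<tau>)"
    "\<And>i j. ((\<lambda>t. B t $ i $ j) has_field_derivative B' $ i $ j) (at (\<tau>::complex))"
  shows "((\<lambda>t. (A t ** B t) $ i $ j) has_field_derivative (A' ** B \<tau> + A \<tau> ** B') $ i $ j) (at \<tau>)"
proof -
  have "((\<lambda>t. \<Sum>k\<in>UNIV. A t $ i $ k * B t $ k $ j) has_field_derivative
     (\<Sum>k\<in>UNIV. A' $ i $ k * B \<tau> $ k $ j + B' $ k $ j * A \<tau> $ i $ k)) (at \<tau>)"
    by (rule DERIV_sum) (rule DERIV_mult[OF assms])
  then show ?thesis by (simp add: matmul_nth sum.distrib mult.commute)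
qed

lemma DERIV_nexp_minus:
  assumes "nilpotent_mat y"
  shows "((\<lambda>t. nexp y (- t) $ i $ j) has_field_derivative (- (y ** nexp y (- \<tau>))) $ i $ j) (at \<tau>)"
  using DERIV_chain2[OF DERIV_nexp[OF assms, of i j "- \<tau>"] DERIV_minus[OF DERIV_ident]] by simp

text \<open>The derivative in time is 0 since \<open>y\<close> commutes with
  \<open>nexp y \<tau>\<close>, so the value at time 0 persists.\<close>

lemma nexp_inverse:
  fixes y :: "complex^'n^'n"
  assumes "nilpotent_mat y"
  shows "nexp y \<tau> ** nexp y (- \<tau>) = mat 1"
proof (rule mat_eqI)
  fix i j
  have "((\<lambda>t. (nexp y t ** nexp y (- t)) $ i $ j) has_field_derivative 0) (at t)" for t
  proof -
    have e: "(y ** nexp y t) ** nexp y (- t) + nexp y t ** (- (y ** nexp y (- t))) = 0"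
      unfolding nexp_commute[of y t] by (simp add: mm_minus_right matrix_mul_assoc)
    show ?thesis
      using DERIV_matmul[OF DERIV_nexp[OF assms] DERIV_nexp_minus[OF assms], where \<tau>=t and i=i and j=j] unfolding e by simp
  qed
  then have "\<exists>c. \<forall>t\<in>UNIV. (nexp y t ** nexp y (- t)) $ i $ j = c"
    by (intro has_field_derivative_zero_constant) simp_all
  then have "(nexp y \<tau> ** nexp y (- \<tau>)) $ i $ j = (nexp y 0 ** nexp y (- 0)) $ i $ j" by (metis UNIV_I)
  then show "(nexp y \<tau> ** nexp y (- \<tau>)) $ i $ j = (mat 1 :: complex^'n^'n) $ i $ j"
    using nexp_0[OF assms] by simp
qed

lemma matrix_inv_nexp: "nilpotent_mat y \<Longrightarrow> matrix_inv (nexp y \<tau>) = nexp y (- \<tau>)"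
  using nexp_inverse[of y \<tau>] nexp_inverse[of y "- \<tau>"] by (intro matrix_inv_unique) auto

lemma invertible_nexp: "nilpotent_mat y \<Longrightarrow> invertible (nexp y \<tau>)"
  using nexp_inverse[of y \<tau>] nexp_inverse[of y "- \<tau>"] unfolding invertible_def by auto

locale conn_group =
  fixes G :: "(complex^'n^'n) set"
  assumes alg: "algebraic_group G" and conn: "connectedin mat_zariski G"
begin

lemma G_one: "mat 1 \<in> G" and G_mult: "A \<in> G \<Longrightarrow> B \<in> G \<Longrightarrow> A ** B \<in> G" and G_inv: "A \<in> G \<Longrightarrow> matrix_inv A \<in> G"
  using alg by (auto simp: algebraic_group_def)

lemma G_iff: "A \<in> G \<longleftrightarrow> invertible A \<and> (\<forall>f\<in>vanishing_ideal G. f A = 0)"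
proof -
  obtain F where F: "F \<subseteq> poly_fun mat_coords" "G = {A \<in> {A. invertible A}. \<forall>f\<in>F. f A = 0}"
    using alg unfolding algebraic_group_def closedin_sub_zariski by auto
  then have "F \<subseteq> vanishing_ideal G" by (auto simp: vanishing_ideal_iff)
  then show ?thesis using F(2) by (auto simp: vanishing_ideal_iff)
qed

lemma G_invertible: "A \<in> G \<Longrightarrow> invertible A"
  using G_iff by blast

lemma G_inv_mult: "A \<in> G \<Longrightarrow> A ** matrix_inv A = mat 1" "A \<in> G \<Longrightarrow> matrix_inv A ** A = mat 1"
  using matrix_inv[OF G_invertible] by auto

lemma G_inv_inv: "A \<in> G \<Longrightarrow> matrix_inv (matrix_inv A) = A"
  by (rule matrix_inv_unique) (auto simp: G_inv_mult)

lemma G_inv_product: "A \<in> G \<Longrightarrow> B \<in> G \<Longrightarrow> matrix_inv (A ** B) = matrix_inv B ** matrix_inv A"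
proof (rule matrix_inv_unique)
  assume A: "A \<in> G" and B: "B \<in> G"
  have "A ** B ** (matrix_inv B ** matrix_inv A) = A ** (B ** matrix_inv B) ** matrix_inv A" by (simp only: matrix_mul_assoc)
  then show "A ** B ** (matrix_inv B ** matrix_inv A) = mat 1" using A B by (simp add: G_inv_mult)
  have "matrix_inv B ** matrix_inv A ** (A ** B) = matrix_inv B ** (matrix_inv A ** A) ** B" by (simp only: matrix_mul_assoc)
  then show "matrix_inv B ** matrix_inv A ** (A ** B) = mat 1" using A B by (simp add: G_inv_mult)
qed

lemma polymat_left_mul: "polymat mat_coords (\<lambda>r. a ** r)" and polymat_right_mul: "polymat mat_coords (\<lambda>r. r ** a)"
  by (intro polymat_mul polymat_const polymat_id)+

lemma irr_G_mat: "irr mat_coords G"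
proof (rule irr_if_connected_homogeneous[OF finite_mat_coords _ conn])
  show "G \<noteq> {}" using G_one by blast
  fix p q assume pq: "p \<in> G" "q \<in> G"
  define a where "a = q ** matrix_inv p"
  have a: "a \<in> G" using pq G_mult G_inv by (simp add: a_def)
  have ap: "a ** p = q" unfolding a_def by (simp add: matrix_mul_assoc[symmetric] G_inv_mult pq)
  show "\<exists>\<phi> \<psi>. \<phi> p = q \<and> (\<forall>r\<in>G. \<phi> r \<in> G \<and> \<psi> r \<in> G \<and> \<phi> (\<psi> r) = r \<and> \<psi> (\<phi> r) = r) \<and>
      (\<forall>c\<in>mat_coords. (\<lambda>r. c (\<phi> r)) \<in> poly_fun mat_coords \<and> (\<lambda>r. c (\<psi> r)) \<in> poly_fun mat_coords)"
  proof (rule exI[of _ "\<lambda>r. a ** r"], rule exI[of _ "\<lambda>r. matrix_inv a ** r"], intro conjI ballI)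
    fix c assume c: "c \<in> (mat_coords :: (complex^'n^'n \<Rightarrow> complex) set)"
    show "(\<lambda>r. c (a ** r)) \<in> poly_fun mat_coords" "(\<lambda>r. c (matrix_inv a ** r)) \<in> poly_fun mat_coords"
      by (rule polymat_compose[OF poly_fun.coord[OF c] polymat_left_mul])+
  qed (use ap a in \<open>auto simp: G_mult G_inv G_inv_mult matrix_mul_assoc\<close>)
qed

text \<open>Multiplication by a power of the determinant, nonzero on \<open>G\<close>, reduces to
  functions of the matrix entries alone.\<close>

lemma irr_G: "irr group_coords G"
  unfolding irr_def
proof (intro conjI ballI impI)
  show "G \<noteq> {}" using G_one by blast
  fix f g assume fg: "f \<in> poly_fun group_coords" "g \<in> poly_fun group_coords" "\<forall>q\<in>G. f q * g q = 0"
  obtain k F where F: "F \<in> poly_fun mat_coords" "\<forall>A. invertible A \<longrightarrow> F A = det A ^ k * f A" using clear_denominator[OF fg(1)] by blast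
  obtain l H where H: "H \<in> poly_fun mat_coords" "\<forall>A. invertible A \<longrightarrow> H A = det A ^ l * g A" using clear_denominator[OF fg(2)] by blast
  have "\<forall>q\<in>G. F q * H q = 0" using F(2) H(2) fg(3) G_invertible by auto
  from irr_disj[OF irr_G_mat F(1) H(1) this]
  show "(\<forall>q\<in>G. f q = 0) \<or> (\<forall>q\<in>G. g q = 0)" using F(2) H(2) G_invertible by (auto simp: invertible_det_nz)
qed

abbreviation (input) "lie \<equiv> lie_algebra G"

text \<open>Divisibility of \<open>f (1 + t Y)\<close> by \<open>t ^ 2\<close> means that its value
  and first derivative at 0 vanish; the value is 0 because the identity lies in
  \<open>G\<close>.\<close>

lemma lie_iff: "Y \<in> lie \<longleftrightarrow> (\<forall>f\<in>vanishing_ideal G. mder (mat 1) Y f = 0)"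
proof
  assume "Y \<in> lie"
  then obtain \<gamma> where \<gamma>: "\<gamma> \<in> jets 1 G" "\<gamma> 0 = mat 1" "\<gamma> 1 = Y" by (auto simp: lie_algebra_def jets_over_def)
  have arc: "arc 1 \<gamma> t = mat 1 + t *\<^sub>C Y" for t
    using \<gamma>(2,3) by (simp add: arc_def cmat.scale_one)
  show "\<forall>f\<in>vanishing_ideal G. mder (mat 1) Y f = 0"
  proof
    fix f assume f: "f \<in> vanishing_ideal G"
    then obtain q where "\<forall>t. f (arc 1 \<gamma> t) = t ^ (1 + 1) * poly q t" using \<gamma>(1) unfolding jets_def by blast
    then have "(\<lambda>t. f (mat 1 + t *\<^sub>C Y)) = (\<lambda>t. t ^ 2 * poly q t)" by (simp add: fun_eq_iff arc[symmetric] numeral_2_eq_2)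
    moreover have "((\<lambda>t. t ^ 2 * poly q t) has_field_derivative 0) (at 0)" by (auto intro!: derivative_eq_intros)
    ultimately show "mder (mat 1) Y f = 0"
      using f by (simp add: mder_def vel_def vanishing_ideal_iff DERIV_imp_deriv)
  qed
next
  assume R: "\<forall>f\<in>vanishing_ideal G. mder (mat 1) Y f = 0"
  define \<gamma> where "\<gamma> k = (if k = 0 then mat 1 else if k = 1 then Y else 0)" for k :: nat
  have arc: "arc 1 \<gamma> t = mat 1 + t *\<^sub>C Y" for t by (simp add: arc_def \<gamma>_def cmat.scale_one)
  have "\<exists>q. \<forall>t. f (arc 1 \<gamma> t) = t ^ (1 + 1) * poly q t" if f: "f \<in> vanishing_ideal G" for f
  proof -
    have fp: "f \<in> poly_fun mat_coords" and f1: "f (mat 1) = 0" using f G_one by (auto simp: vanishing_ideal_iff)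
    obtain p where p: "\<And>t. f (arc 1 \<gamma> t) = poly p t" using poly_fun_arc[OF fp] by blast
    have "poly p 0 = 0" using p[of 0] f1 unfolding arc by (simp add: cmat.scale_zero_left)
    then obtain p1 where p1: "p = pCons 0 p1" by (cases p) auto
    have "(\<lambda>t. f (mat 1 + t *\<^sub>C Y)) = poly p" using p unfolding arc by (rule ext)
    then have "deriv (poly p) 0 = 0" using bspec[OF R f] fp by (simp add: mder_def vel_def)
    then have "poly (pderiv p) 0 = 0" by (simp add: DERIV_imp_deriv[OF poly_DERIV])
    then have "poly p1 0 = 0" by (simp add: p1 pderiv_pCons)
    then obtain p2 where p2: "p1 = pCons 0 p2" by (cases p1) auto
    show ?thesis unfolding p p1 p2 by (rule exI[of _ p2]) simp
  qed
  then have "\<gamma> \<in> jets_over 1 G {mat 1}" by (auto simp: jets_over_def jets_def \<gamma>_def)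
  then show "Y \<in> lie" unfolding lie_algebra_def by (rule_tac CollectI, rule_tac exI[of _ \<gamma>]) (simp add: \<gamma>_def)
qed

lemma lie_subspace: "cmat.subspace lie"
proof -
  have "lie = (\<Inter>f\<in>vanishing_ideal G. {u. mder (mat 1) u f = 0})" using lie_iff by blast
  then show ?thesis using subspace_mder_kernel by (auto intro!: cmat.subspace_Inter)
qed

lemma lie_tang: "Y \<in> lie \<Longrightarrow> mder (mat 1) Y \<in> tang mat_coords G (mat 1)"
  using pder_mder lie_iff by (auto simp: tang_def vanishing_ideal_iff)

text \<open>For \<open>s\<close> orthogonal to \<open>V\<close>, the function
  \<open>tr (s A v adjm A)\<close> is polynomial and vanishes on \<open>G\<close>, as
  \<open>adjm A\<close> is a multiple of the inverse. Its derivative at the identity along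
  \<open>Y\<close> is \<open>tr (s [Y, v])\<close> plus a multiple of
  \<open>tr (s v) = 0\<close>.\<close>

lemma stable_subspace_lie:
  assumes V: "cmat.subspace V" and st: "\<And>g v. g \<in> G \<Longrightarrow> v \<in> V \<Longrightarrow> g ** v ** matrix_inv g \<in> V"
    and Y: "Y \<in> lie" and v: "v \<in> V"
  shows "lie_bracket Y v \<in> V"
proof (rule ccontr)
  assume "lie_bracket Y v \<notin> V"
  from subspace_separation[OF V this] obtain s where s: "\<forall>v\<in>V. trace (s ** v) = 0" "trace (s ** lie_bracket Y v) \<noteq> 0"
    by blast
  let ?\<xi> = "mder (mat 1) Y"
  have pd: "pder mat_coords (mat 1) ?\<xi>" by (rule pder_mder)
  have tg: "?\<xi> \<in> tang mat_coords G (mat 1)" by (rule lie_tang[OF Y])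
  have detp: "(\<lambda>A. det A) \<in> poly_fun mat_coords" by (rule poly_fun_det) (rule coord_poly)
  have adj1: "adjm (mat 1 :: complex^'n^'n) = mat 1"
    using adjm_eq[of "mat 1 :: complex^'n^'n"] matrix_inv_unique[of "mat 1 :: complex^'n^'n" "mat 1"]
    by (simp add: invertible_def cmat.scale_one)
  \<comment> \<open>Differentiating \<open>A ** adjm A = det A\<close> on \<open>G\<close> yields
    the derivative of \<open>adjm\<close>.\<close>
  have "dmat ?\<xi> (\<lambda>A. A ** adjm A) = dmat ?\<xi> (\<lambda>A. det A *\<^sub>C mat 1)"
  proof (rule dmat_eq_on[OF tg])
    show "polymat mat_coords (\<lambda>A. A ** adjm A)" by (intro polymat_mul polymat_id polymat_adjm)
    show "polymat mat_coords (\<lambda>A. det A *\<^sub>C mat 1)" by (intro polymat_scale polymat_const detp)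
    show "q ** adjm q = det q *\<^sub>C mat 1" if "q \<in> G" for q
      using that by (simp add: adjm_eq G_invertible mm_scale_right G_inv_mult)
  qed
  moreover have "dmat ?\<xi> (\<lambda>A. det A *\<^sub>C mat 1) = ?\<xi> det *\<^sub>C (mat 1 :: complex^'n^'n)"
  proof (rule mat_eqI)
    fix i j
    have "?\<xi> (\<lambda>A. (mat 1 :: complex^'n^'n) $ i $ j * det A) = (mat 1 :: complex^'n^'n) $ i $ j * ?\<xi> (\<lambda>A. det A)"
      by (rule pder_cmult[OF pd detp])
    then show "dmat ?\<xi> (\<lambda>A. det A *\<^sub>C mat 1) $ i $ j = (?\<xi> det *\<^sub>C mat 1) $ i $ j" by (simp add: mult.commute)
  qed
  ultimately have da: "dmat ?\<xi> adjm = ?\<xi> det *\<^sub>C mat 1 - Y"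
    using dmat_mul[OF pd polymat_id polymat_adjm] by (simp add: dmat_mder adj1) (metis add_diff_cancel_left')
  have pA: "polymat mat_coords (\<lambda>A. s ** (A ** v ** adjm A))"
    by (intro polymat_mul polymat_id polymat_adjm polymat_const)
  have "dmat ?\<xi> (\<lambda>A. A ** v ** adjm A) = Y ** v + v ** (?\<xi> det *\<^sub>C mat 1 - Y)"
    by (subst dmat_mul[OF pd polymat_mul[OF polymat_id polymat_const] polymat_adjm])
       (simp add: dmat_mul_const[OF pd polymat_id] dmat_mder adj1 da)
  then have d: "dmat ?\<xi> (\<lambda>A. s ** (A ** v ** adjm A)) = s ** lie_bracket Y v + ?\<xi> det *\<^sub>C (s ** v)"
    by (subst dmat_const_mul[OF pd polymat_mul[OF polymat_mul[OF polymat_id polymat_const] polymat_adjm]])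
       (simp add: lie_bracket_def mm_simps)
  have "(\<lambda>A. trace (s ** (A ** v ** adjm A))) \<in> poly_fun mat_coords" by (rule poly_fun_trace[OF pA])
  moreover have "trace (s ** (A ** v ** adjm A)) = 0" if A: "A \<in> G" for A
  proof -
    have "A ** v ** adjm A = det A *\<^sub>C (A ** v ** matrix_inv A)" using A by (simp add: adjm_eq G_invertible mm_scale_right)
    then have "A ** v ** adjm A \<in> V" using st[OF A v] V by (simp add: cmat.subspace_scale)
    then show ?thesis using s(1) by blast
  qed
  ultimately have "?\<xi> (\<lambda>A. trace (s ** (A ** v ** adjm A))) = 0" using tg by (simp add: tang_def)
  also have "?\<xi> (\<lambda>A. trace (s ** (A ** v ** adjm A))) = trace (dmat ?\<xi> (\<lambda>A. s ** (A ** v ** adjm A)))"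
    unfolding trace_def dmat_nth by (rule pder_sum[OF pd]) (rule polymatD[OF pA])
  also have "\<dots> = trace (s ** lie_bracket Y v)" unfolding d using s(1) v by (simp add: trace_add trace_scale)
  finally show False using s(2) by simp
qed

lemma vanishing_translate: "a \<in> G \<Longrightarrow> f \<in> vanishing_ideal G \<Longrightarrow> (\<lambda>h. f (a ** h)) \<in> vanishing_ideal G"
  and vanishing_translate_right: "a \<in> G \<Longrightarrow> f \<in> vanishing_ideal G \<Longrightarrow> (\<lambda>h. f (h ** a)) \<in> vanishing_ideal G"
  using polymat_compose[OF _ polymat_left_mul[of a], of f] polymat_compose[OF _ polymat_right_mul[of a], of f]
  by (auto simp: vanishing_ideal_iff G_mult)

text \<open>The left-invariant derivation \<open>D\<close> along \<open>y\<close> preserves the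
  ideal of \<open>G\<close>. On the one-parameter group \<open>f\<close> is a polynomial in time,
  and its derivative is the polynomial of \<open>D f\<close>; induction on the degree makes it
  constant, and its value at the identity is 0.\<close>

lemma nexp_in_G:
  assumes y: "nilpotent_mat y" "y \<in> lie"
  shows "nexp y \<tau> \<in> G"
proof -
  define D where "D f h = mder h (h ** y) f" for f :: "complex^'n^'n \<Rightarrow> complex" and h
  have D: "D f \<in> vanishing_ideal G" if f: "f \<in> vanishing_ideal G" for f
  proof -
    have "D f \<in> poly_fun mat_coords" unfolding D_def using f by (intro mder_poly polymat_right_mul) (simp add: vanishing_ideal_iff)
    moreover have "D f h = 0" if h: "h \<in> G" for h
    proof -
      have "mder (mat 1) y (\<lambda>A. f (h ** A)) = mder (h ** mat 1) (dmat (mder (mat 1) y) (\<lambda>A. h ** A)) f"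
        using f by (intro mder_pullback polymat_left_mul) (simp add: vanishing_ideal_iff)
      also have "dmat (mder (mat 1) y) (\<lambda>A. h ** A) = h ** y"
        using dmat_const_mul[OF pder_mder polymat_id] by (simp add: dmat_mder)
      finally show ?thesis using y(2) vanishing_translate[OF h f] by (simp add: D_def lie_iff)
    qed
    ultimately show ?thesis by (simp add: vanishing_ideal_iff)
  qed
  have zero: "p = 0" if "f \<in> vanishing_ideal G" "\<And>t. f (nexp y t) = poly p t" "degree p \<le> n" for f p n
    using that
  proof (induction n arbitrary: f p)
    case 0
    have "poly p 0 = 0" using 0(1) 0(2)[of 0] nexp_0[OF y(1)] G_one by (simp add: vanishing_ideal_iff)
    moreover obtain c where "p = [:c:]" using 0(3) by (metis degree_eq_zeroE le_zero_eq)
    ultimately show ?case by simp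
  next
    case (Suc n)
    have "D f (nexp y t) = poly (pderiv p) t" for t
    proof -
      have d: "((\<lambda>s. nexp y (t + s) $ i $ j) has_field_derivative (nexp y t ** y) $ i $ j) (at 0)" for i j
        using DERIV_nexp[OF y(1), of i j t] DERIV_shift[of "\<lambda>s. nexp y s $ i $ j" _ 0 t]
        by (simp add: nexp_commute add.commute)
      have "mder (nexp y (t + 0)) (nexp y t ** y) f = deriv (\<lambda>s. f (nexp y (t + s))) 0"
        using Suc.prems(1) by (intro mder_curve d) (simp add: vanishing_ideal_iff)
      also have "\<dots> = deriv (\<lambda>s. poly p (t + s)) 0" by (simp add: Suc.prems(2))
      also have "\<dots> = poly (pderiv p) t"
        using poly_DERIV[of p t] DERIV_shift[of "poly p" "poly (pderiv p) t" 0 t] by (intro DERIV_imp_deriv) (simp add: add.commute)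
      finally show ?thesis by (simp add: D_def)
    qed
    moreover have "degree (pderiv p) \<le> n" using Suc.prems(3) by (simp add: degree_pderiv)
    ultimately have "pderiv p = 0" using Suc.IH D[OF Suc.prems(1)] by blast
    then have "degree p = 0" by (simp add: pderiv_eq_0_iff)
    then obtain c where c: "p = [:c:]" by (metis degree_eq_zeroE)
    have "poly p 0 = 0" using Suc.prems(1) Suc.prems(2)[of 0] nexp_0[OF y(1)] G_one by (simp add: vanishing_ideal_iff)
    then show ?case by (simp add: c)
  qed
  have "f (nexp y \<tau>) = 0" if f: "f \<in> vanishing_ideal G" for f
  proof -
    have "(\<lambda>t. f (nexp y t)) \<in> poly_fun {\<lambda>x. x}"
      by (rule polymat_compose[OF _ polymat_nexp[OF poly_fun_var]]) (use f in \<open>simp add: vanishing_ideal_iff\<close>)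
    then obtain p where p: "(\<lambda>t. f (nexp y t)) = poly p" using poly_fun_id by blast
    then have "p = 0" using zero[OF f, of p "degree p"] by (simp add: fun_eq_iff)
    then show ?thesis using fun_cong[OF p, of \<tau>] by simp
  qed
  then show ?thesis using invertible_nexp[OF y(1)] by (simp add: G_iff)
qed

text \<open>The orbit map has surjective differential at a generic \<open>q\<close>, so the claim
  concerns a conjugate of \<open>x\<close> that cannot be chosen. Right translation by the inverse
  of \<open>q\<close> moves the derivation \<open>\<zeta>\<close> to the identity, where it becomes
  \<open>Z\<close>.\<close>

theorem orbit_tangent:
  assumes \<xi>: "\<And>f. f \<in> poly_fun mat_coords \<Longrightarrow> (\<forall>z\<in>orbit G x. f z = 0) \<Longrightarrow> mder x u f = 0"
  shows "\<exists>q\<in>G. \<exists>Z\<in>lie. q ** u ** matrix_inv q = lie_bracket Z (q ** x ** matrix_inv q)"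
proof -
  define \<psi> where "\<psi> q = q ** x ** matrix_inv q" for q :: "complex^'n^'n"
  have \<psi>p: "polymat group_coords \<psi>" unfolding \<psi>_def[abs_def]
    by (intro polymat_mul polymat_group_id polymat_group_inv polymat_const)
  have "\<exists>q\<in>G. \<forall>\<xi>\<in>tang mat_coords (\<psi> ` G) (\<psi> q). \<exists>\<zeta>\<in>tang group_coords G q. \<forall>f\<in>poly_fun mat_coords. \<zeta> (\<lambda>r. f (\<psi> r)) = \<xi> f"
  proof (rule tang_pullback[OF finite_group_coords irr_G])
    fix c assume "c \<in> (mat_coords :: (complex^'n^'n \<Rightarrow> complex) set)"
    then show "(\<lambda>q. c (\<psi> q)) \<in> poly_fun group_coords" by (intro polymat_compose[OF poly_fun.coord \<psi>p])
  qed
  then obtain q where q: "q \<in> G"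
    "\<forall>\<xi>\<in>tang mat_coords (\<psi> ` G) (\<psi> q). \<exists>\<zeta>\<in>tang group_coords G q. \<forall>f\<in>poly_fun mat_coords. \<zeta> (\<lambda>r. f (\<psi> r)) = \<xi> f"
    by blast
  have orb: "\<psi> ` G = orbit G x" by (auto simp: \<psi>_def orbit_def)
  let ?i = "matrix_inv q"
  have qi: "q ** ?i = mat 1" "?i ** q = mat 1" using G_inv_mult[OF q(1)] by auto
  define u' where "u' = q ** u ** ?i"
  have conjp: "polymat mat_coords (\<lambda>A. q ** A ** ?i)" by (intro polymat_mul polymat_id polymat_const)
  have "mder (\<psi> q) u' f = 0" if f: "f \<in> poly_fun mat_coords" "\<forall>z\<in>\<psi> ` G. f z = 0" for f
  proof -
    have "mder x u (\<lambda>A. f (q ** A ** ?i)) = 0"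
    proof (rule \<xi>)
      show "(\<lambda>A. f (q ** A ** ?i)) \<in> poly_fun mat_coords" by (rule polymat_compose[OF f(1) conjp])
      show "\<forall>z\<in>orbit G x. f (q ** z ** ?i) = 0"
      proof
        fix z assume "z \<in> orbit G x"
        then obtain g where g: "g \<in> G" "z = g ** x ** matrix_inv g" by (auto simp: orbit_def)
        have "q ** z ** ?i = \<psi> (q ** g)"
          unfolding g(2) \<psi>_def G_inv_product[OF q(1) g(1)] by (simp only: matrix_mul_assoc)
        then show "f (q ** z ** ?i) = 0" using f(2) G_mult[OF q(1) g(1)] by simp
      qed
    qed
    also have "mder x u (\<lambda>A. f (q ** A ** ?i)) = mder (q ** x ** ?i) (dmat (mder x u) (\<lambda>A. q ** A ** ?i)) f"
      by (rule mder_pullback[OF conjp f(1)])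
    also have "dmat (mder x u) (\<lambda>A. q ** A ** ?i) = u'"
      using dmat_mul_const[OF pder_mder polymat_left_mul, of x u q ?i] dmat_const_mul[OF pder_mder polymat_id, of x u q]
      by (simp add: u'_def dmat_mder)
    finally show ?thesis by (simp add: \<psi>_def)
  qed
  then have "mder (\<psi> q) u' \<in> tang mat_coords (\<psi> ` G) (\<psi> q)" using pder_mder by (auto simp: tang_def)
  from bspec[OF q(2) this] obtain \<zeta> where \<zeta>: "\<zeta> \<in> tang group_coords G q"
    "\<forall>f\<in>poly_fun mat_coords. \<zeta> (\<lambda>r. f (\<psi> r)) = mder (\<psi> q) u' f" by (elim bexE)
  have pd: "pder group_coords q \<zeta>" using \<zeta>(1) by (simp add: tang_def)
  let ?W = "dmat \<zeta> (\<lambda>A. A)" and ?I = "dmat \<zeta> matrix_inv"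
  have du: "dmat \<zeta> \<psi> = u'"
  proof (rule mat_eqI)
    fix i j
    show "dmat \<zeta> \<psi> $ i $ j = u' $ i $ j"
      using bspec[OF \<zeta>(2) coord_poly[of i j]] arg_cong[OF dmat_mder[of "\<psi> q" u'], of "\<lambda>M. M $ i $ j"] by simp
  qed
  \<comment> \<open>The derivative of the inverse, from \<open>A ** matrix_inv A = mat 1\<close> on
    \<open>G\<close>.\<close>
  have "dmat \<zeta> (\<lambda>A. A ** matrix_inv A) = dmat \<zeta> (\<lambda>_. mat 1)"
    by (rule dmat_eq_on[OF \<zeta>(1)]) (auto intro: polymat_mul polymat_group_id polymat_group_inv polymat_const simp: G_inv_mult)
  then have "?W ** ?i + q ** ?I = 0"
    using dmat_mul[OF pd polymat_group_id polymat_group_inv] by (simp add: dmat_const[OF pd])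
  then have qI: "q ** ?I = - (?W ** ?i)" by (simp add: eq_neg_iff_add_eq_0 add.commute)
  have I: "?I = - (?i ** ?W ** ?i)"
  proof -
    have "?I = ?i ** (q ** ?I)" by (simp add: matrix_mul_assoc qi)
    then show ?thesis unfolding qI by (simp add: mm_minus_right matrix_mul_assoc)
  qed
  define Z where "Z = ?W ** ?i"
  have "dmat \<zeta> \<psi> = ?W ** x ** ?i + q ** x ** ?I"
    unfolding \<psi>_def
    by (subst dmat_mul[OF pd polymat_mul[OF polymat_group_id polymat_const] polymat_group_inv])
       (simp add: dmat_mul_const[OF pd polymat_group_id])
  also have "?W ** x ** ?i = Z ** \<psi> q"
  proof -
    have "Z ** \<psi> q = ?W ** (?i ** q) ** x ** ?i" unfolding Z_def \<psi>_def by (simp only: matrix_mul_assoc)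
    then show ?thesis by (simp add: qi)
  qed
  also have "q ** x ** ?I = - (\<psi> q ** Z)"
    unfolding I Z_def \<psi>_def by (simp add: mm_minus_right matrix_mul_assoc)
  finally have br: "u' = lie_bracket Z (\<psi> q)" unfolding du by (simp add: lie_bracket_def)
  have "Z \<in> lie"
    unfolding lie_iff
  proof
    fix f assume f: "f \<in> vanishing_ideal G"
    have fp: "f \<in> poly_fun mat_coords" using f by (simp add: vanishing_ideal_iff)
    have sub: "polymat group_coords (\<lambda>h. h ** ?i)" by (intro polymat_mul polymat_group_id polymat_const)
    define \<eta> where "\<eta> f = (if f \<in> poly_fun mat_coords then \<zeta> (\<lambda>h. f (h ** ?i)) else 0)" for f
    have comp: "(\<lambda>A. g (A ** ?i)) \<in> poly_fun group_coords" if "g \<in> poly_fun mat_coords" for g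
      by (rule polymat_compose[OF that sub])
    have "pder mat_coords (mat 1) \<eta>"
      unfolding pder_def \<eta>_def
      by (auto simp: poly_fun.add poly_fun.mult poly_fun.const pder_const[OF pd] pder_add[OF pd comp comp] pder_mult[OF pd comp comp] qi)
    moreover have "dmat \<eta> (\<lambda>A. A) = dmat \<zeta> (\<lambda>h. h ** ?i)"
      by (rule mat_eqI) (simp add: \<eta>_def coord_poly)
    then have "dmat \<eta> (\<lambda>A. A) = Z" by (simp add: Z_def dmat_mul_const[OF pd polymat_group_id])
    ultimately have "\<eta> = mder (mat 1) Z" by (rule mder_eqI)
    then have "mder (mat 1) Z f = \<zeta> (\<lambda>h. f (h ** ?i))" using fp by (metis \<eta>_def)
    also have "\<dots> = 0"
      using \<zeta>(1) comp[OF fp] vanishing_translate_right[OF G_inv[OF q(1)] f] by (simp add: tang_def vanishing_ideal_iff)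
    finally show "mder (mat 1) Z f = 0" .
  qed
  then show ?thesis using q(1) br unfolding u'_def \<psi>_def by blast
qed

end

subsection \<open>The orbit and its tangent spaces\<close>

locale little_setup = conn_group G for G :: "(complex^'n^'n) set" +
  fixes x :: "complex^'n^'n" and I :: "(complex^'n^'n) set"
  assumes x_lie: "x \<in> lie_algebra G" and x_nil: "nilpotent_mat x"
    and smallest: "smallest_semisimple_ideal G (orbit G x) I"
begin

abbreviation "Orb \<equiv> orbit G x"

sublocale semisimple_ideal "lie_algebra G" I
  using smallest by unfold_locales (auto simp: smallest_semisimple_ideal_def)

lemma O_sub_I: "Orb \<subseteq> I"
  using smallest by (simp add: smallest_semisimple_ideal_def)

lemma conj_product:
  "a \<in> G \<Longrightarrow> b \<in> G \<Longrightarrow> a ** (b ** z ** matrix_inv b) ** matrix_inv a = (a ** b) ** z ** matrix_inv (a ** b)"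
  by (simp add: G_inv_product matrix_mul_assoc)

lemma conj_one: "mat 1 ** z ** matrix_inv (mat 1) = (z :: complex^'n^'n)"
  using matrix_inv_unique[of "mat 1 :: complex^'n^'n" "mat 1"] by simp

lemma x_in_O: "x \<in> Orb"
  using G_one conj_one[of x] unfolding orbit_def by (intro CollectI exI[of _ "mat 1"]) simp

lemma O_conj: "g \<in> G \<Longrightarrow> z \<in> Orb \<Longrightarrow> g ** z ** matrix_inv g \<in> Orb"
  unfolding orbit_def using conj_product G_mult by blast

lemma x_in_I: "x \<in> I"
  using O_sub_I x_in_O by blast

lemma conj_conj_inv: "g \<in> G \<Longrightarrow> matrix_inv g ** (g ** z ** matrix_inv g) ** g = z"
  using conj_product[of "matrix_inv g" g z] G_inv[of g] G_inv_inv[of g] conj_one[of z] by (simp add: G_inv_mult)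

lemma conj_inv_conj: "g \<in> G \<Longrightarrow> g ** (matrix_inv g ** z ** g) ** matrix_inv g = z"
  using conj_product[of g "matrix_inv g" z] G_inv[of g] G_inv_inv[of g] conj_one[of z] by (simp add: G_inv_mult)

lemma conj_mpow: "g \<in> G \<Longrightarrow> mpow (g ** z ** matrix_inv g) k = g ** mpow z k ** matrix_inv g"
proof (induction k)
  case (Suc k)
  have "mpow (g ** z ** matrix_inv g) (Suc k) = g ** z ** (matrix_inv g ** g) ** mpow z k ** matrix_inv g"
    using Suc by (simp add: mpow_Suc matrix_mul_assoc)
  then show ?case using Suc.prems by (simp add: G_inv_mult mpow_Suc matrix_mul_assoc)
qed (simp add: G_inv_mult)

lemma O_nil: "z \<in> Orb \<Longrightarrow> nilpotent_mat z"
proof -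
  assume "z \<in> Orb"
  then obtain g where g: "g \<in> G" "z = g ** x ** matrix_inv g" by (auto simp: orbit_def)
  obtain k where "mpow x k = 0" using x_nil by (auto simp: nilpotent_mat_iff)
  then have "mpow z k = 0" by (simp add: g conj_mpow)
  then show ?thesis by (auto simp: nilpotent_mat_iff)
qed

lemma O_lie: "z \<in> Orb \<Longrightarrow> z \<in> lie_algebra G"
  using O_sub_I I_sub by blast

lemma conj_bracket:
  "g \<in> G \<Longrightarrow> g ** lie_bracket a b ** matrix_inv g = lie_bracket (g ** a ** matrix_inv g) (g ** b ** matrix_inv g)"
proof -
  assume g: "g \<in> G"
  have "g ** a ** matrix_inv g ** (g ** b ** matrix_inv g) = g ** a ** (matrix_inv g ** g) ** b ** matrix_inv g" for a b
    by (simp only: matrix_mul_assoc)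
  then show ?thesis using g by (simp add: lie_bracket_def mm_simps G_inv_mult)
qed

text \<open>The span is stable under the group, hence an ideal, and semisimple as an ideal inside
  \<open>I\<close>; minimality of \<open>I\<close> does the rest.\<close>

lemma span_O: "cmat.span Orb = I"
proof
  show "cmat.span Orb \<subseteq> I" by (rule cmat.span_minimal[OF O_sub_I I_subspace])
  have st: "g ** v ** matrix_inv g \<in> cmat.span Orb" if "g \<in> G" "v \<in> cmat.span Orb" for g v
    by (rule span_mul[OF that(2)]) (use O_conj[OF that(1)] cmat.span_base in blast)
  have "lie_ideal (cmat.span Orb) (lie_algebra G) \<and> semisimple (cmat.span Orb)"
    by (rule ideal_semisimple) (use \<open>cmat.span Orb \<subseteq> I\<close> stable_subspace_lie[OF _ st] in auto)
  then show "I \<subseteq> cmat.span Orb"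
    using smallest cmat.span_superset unfolding smallest_semisimple_ideal_def by blast
qed

lemma I_conj: "g \<in> G \<Longrightarrow> v \<in> I \<Longrightarrow> g ** v ** matrix_inv g \<in> I"
proof -
  assume g: "g \<in> G" and v: "v \<in> I"
  have "v \<in> cmat.span Orb" using v by (simp only: span_O)
  then have "g ** v ** matrix_inv g \<in> cmat.span Orb"
    by (rule span_mul) (use O_conj[OF g] cmat.span_base in blast)
  then show ?thesis by (simp only: span_O)
qed

text \<open>The tangent space of the orbit at \<open>x\<close>. In \<open>T_span\<close> it is
  rewritten by brackets with orbit elements, since these are the ones that act by flows.\<close>

definition T :: "(complex^'n^'n) set" where
  "T = (\<lambda>v. lie_bracket v x) ` I"

lemma T_span: "T = cmat.span ((\<lambda>y. lie_bracket y x) ` Orb)"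
proof
  show "T \<subseteq> cmat.span ((\<lambda>y. lie_bracket y x) ` Orb)"
  proof -
    have "cmat.span Orb \<subseteq> {v. lie_bracket v x \<in> cmat.span ((\<lambda>y. lie_bracket y x) ` Orb)}"
    proof (rule cmat.span_minimal)
      show "Orb \<subseteq> {v. lie_bracket v x \<in> cmat.span ((\<lambda>y. lie_bracket y x) ` Orb)}"
        by (auto intro: cmat.span_base)
      show "cmat.subspace {v. lie_bracket v x \<in> cmat.span ((\<lambda>y. lie_bracket y x) ` Orb)}"
        by (auto simp: cmat.subspace_def bracket_add_left bracket_scale_left cmat.span_zero intro: cmat.span_add cmat.span_scale)
    qed
    then show ?thesis using span_O by (auto simp: T_def)
  qed
  have "cmat.subspace T"
    unfolding cmat.subspace_def
  proof (intro conjI ballI allI)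
    show "0 \<in> T" using cmat.subspace_0[OF I_subspace] by (force simp: T_def)
    fix a b assume "a \<in> T" "b \<in> T"
    then obtain v w where "v \<in> I" "w \<in> I" "a = lie_bracket v x" "b = lie_bracket w x" by (auto simp: T_def)
    then show "a + b \<in> T" unfolding T_def
      by (intro image_eqI[of _ _ "v + w"]) (auto simp: bracket_add_left intro: cmat.subspace_add[OF I_subspace])
  next
    fix c a assume "a \<in> T"
    then obtain v where "v \<in> I" "a = lie_bracket v x" by (auto simp: T_def)
    then show "c *\<^sub>C a \<in> T" unfolding T_def
      by (intro image_eqI[of _ _ "c *\<^sub>C v"]) (auto simp: bracket_scale_left intro: cmat.subspace_scale[OF I_subspace])
  qed
  then show "cmat.span ((\<lambda>y. lie_bracket y x) ` Orb) \<subseteq> T"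
    by (intro cmat.span_minimal) (use O_sub_I in \<open>auto simp: T_def\<close>)
qed

definition JO :: "(complex^'n^'n \<Rightarrow> complex) set" where
  "JO = {f \<in> poly_fun mat_coords. \<forall>z\<in>Orb. f z = 0}"

lemma JO_iff: "f \<in> JO \<longleftrightarrow> f \<in> poly_fun mat_coords \<and> (\<forall>z\<in>Orb. f z = 0)"
  by (simp add: JO_def)

text \<open>\<open>orbit_tangent\<close> speaks of a conjugate of \<open>x\<close> and of
  \<open>Z\<close> in the whole Lie algebra. Replacing \<open>Z\<close> by an element of
  \<open>I\<close> with the same action on \<open>I\<close> and conjugating back brings
  \<open>u\<close> into \<open>[I, x]\<close>.\<close>

theorem tangent_in_T:
  assumes "\<And>f. f \<in> JO \<Longrightarrow> mder x u f = 0"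
  shows "u \<in> T"
proof -
  obtain q Z where q: "q \<in> G" "Z \<in> lie_algebra G" "q ** u ** matrix_inv q = lie_bracket Z (q ** x ** matrix_inv q)"
    using orbit_tangent[of x u] assms by (auto simp: JO_iff)
  let ?y = "q ** x ** matrix_inv q"
  have y: "?y \<in> I" using O_sub_I O_conj[OF q(1) x_in_O] by blast
  obtain v where v: "v \<in> I" "\<forall>w\<in>I. lie_bracket Z w = lie_bracket v w" using bracket_via_I[OF q(2)] by blast
  have i: "matrix_inv q \<in> G" "matrix_inv (matrix_inv q) = q" using G_inv[OF q(1)] G_inv_inv[OF q(1)] by auto
  have "u = matrix_inv q ** (q ** u ** matrix_inv q) ** q" by (simp add: conj_conj_inv q(1))
  also have "q ** u ** matrix_inv q = lie_bracket v ?y" using q(3) v(2) y by simp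
  also have "matrix_inv q ** lie_bracket v ?y ** q = lie_bracket (matrix_inv q ** v ** q) (matrix_inv q ** ?y ** q)"
    using conj_bracket[OF i(1), of v ?y] unfolding i(2) .
  also have "matrix_inv q ** ?y ** q = x" by (rule conj_conj_inv[OF q(1)])
  finally show ?thesis using I_conj[OF i(1) v(1)] unfolding i(2) by (simp add: T_def)
qed

definition fl :: "complex^'n^'n \<Rightarrow> complex \<Rightarrow> complex^'n^'n \<Rightarrow> complex^'n^'n" where
  "fl y \<tau> z = nexp y \<tau> ** z ** nexp y (- \<tau>)"

lemma fl_conj: "y \<in> Orb \<Longrightarrow> fl y \<tau> z = nexp y \<tau> ** z ** matrix_inv (nexp y \<tau>)"
  by (simp add: fl_def matrix_inv_nexp O_nil)

lemma nexp_G: "y \<in> Orb \<Longrightarrow> nexp y \<tau> \<in> G"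
  by (rule nexp_in_G[OF O_nil O_lie])

lemma fl_O: "y \<in> Orb \<Longrightarrow> z \<in> Orb \<Longrightarrow> fl y \<tau> z \<in> Orb"
  unfolding fl_conj by (rule O_conj[OF nexp_G])

lemma DERIV_fl:
  assumes "y \<in> Orb"
  shows "((\<lambda>\<tau>. fl y \<tau> z $ i $ j) has_field_derivative lie_bracket y z $ i $ j) (at 0)"
proof -
  have n: "nilpotent_mat y" by (rule O_nil[OF assms])
  have 1: "((\<lambda>\<tau>. (nexp y \<tau> ** z) $ i $ j) has_field_derivative (y ** z) $ i $ j) (at 0)" for i j
    using DERIV_matmul[OF DERIV_nexp[OF n, of _ _ 0], where B="\<lambda>_. z" and B'=0 and i=i and j=j] by (simp add: nexp_0[OF n])
  have "((\<lambda>\<tau>. (nexp y \<tau> ** z ** nexp y (- \<tau>)) $ i $ j) has_field_derivative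
      (y ** z ** nexp y (- 0) + nexp y 0 ** z ** (- (y ** nexp y (- 0)))) $ i $ j) (at 0)"
    by (rule DERIV_matmul[OF 1 DERIV_nexp_minus[OF n]])
  then show ?thesis by (simp add: fl_def nexp_0[OF n] lie_bracket_def mm_minus_right)
qed

lemma fl_0: "y \<in> Orb \<Longrightarrow> fl y 0 z = z"
  by (simp add: fl_def nexp_0 O_nil)

text \<open>For \<open>v\<close> in the orbit this is the derivative of \<open>f\<close> along the
  flow of \<open>v\<close>; linearity gives the rest, as the orbit spans \<open>I\<close>.\<close>

lemma mder_bracket:
  assumes f: "f \<in> JO" and z: "z \<in> Orb" and v: "v \<in> I"
  shows "mder z (lie_bracket v z) f = 0"
proof -
  have "cmat.span Orb \<subseteq> {v. mder z (lie_bracket v z) f = 0}"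
  proof (rule cmat.span_minimal)
    show "Orb \<subseteq> {v. mder z (lie_bracket v z) f = 0}"
    proof
      fix y assume y: "y \<in> Orb"
      have "mder (fl y 0 z) (lie_bracket y z) f = deriv (\<lambda>\<tau>. f (fl y \<tau> z)) 0"
        by (rule mder_curve[OF DERIV_fl[OF y]]) (use f in \<open>simp add: JO_iff\<close>)
      also have "\<dots> = 0" using f fl_O[OF y z] by (simp add: JO_iff)
      finally show "y \<in> {v. mder z (lie_bracket v z) f = 0}" by (simp add: fl_0[OF y])
    qed
    show "cmat.subspace {v. mder z (lie_bracket v z) f = 0}"
      using mder_scale[of z 0 0 f] by (auto simp: cmat.subspace_def bracket_add_left bracket_scale_left mder_add mder_scale)
  qed
  then show ?thesis using v span_O by blast
qed

lemma mder_euler: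
  assumes "f \<in> JO" "z \<in> Orb"
  shows "mder z z f = 0"
proof -
  obtain h where h: "h \<in> I" "lie_bracket h x = x" using nilpotent_in_bracket[OF x_in_I x_nil] by blast
  obtain g where g: "g \<in> G" "z = g ** x ** matrix_inv g" using assms(2) by (auto simp: orbit_def)
  have "lie_bracket (g ** h ** matrix_inv g) z = z"
    unfolding g(2) conj_bracket[OF g(1), symmetric] h(2) ..
  then show ?thesis using mder_bracket[OF assms I_conj[OF g(1) h(1)]] by simp
qed

lemma JO_euler: "f \<in> JO \<Longrightarrow> (\<lambda>z. c * f z - mder z z f) \<in> JO"
  unfolding JO_iff
  by (intro conjI ballI poly_fun_diff poly_fun_cmult mder_poly polymat_id) (simp_all add: mder_euler JO_iff)

text \<open>On \<open>p c = f (c z)\<close> the operator of \<open>JO_euler\<close> with constant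
  \<open>n + 1\<close> multiplies the coefficient of degree \<open>d\<close> by
  \<open>n + 1 - d\<close>. It kills the top degree, so by induction the result is 0 and only the
  top coefficient of \<open>p\<close> can survive; \<open>p 1 = 0\<close> removes that one
  too.\<close>

theorem JO_conical:
  assumes f: "f \<in> JO" and z: "z \<in> Orb"
  shows "f (c *\<^sub>C z) = 0"
proof -
  have zero: "p = 0" if "f \<in> JO" "\<And>c. f (c *\<^sub>C z) = poly p c" "degree p \<le> n" for f p n
    using that
  proof (induction n arbitrary: f p)
    case 0
    have "poly p 1 = 0" using 0(1) 0(2)[of 1] z by (simp add: JO_iff cmat.scale_one)
    moreover obtain c where "p = [:c:]" using 0(3) by (metis degree_eq_zeroE le_zero_eq)
    ultimately show ?case by simp
  next
    case (Suc n)
    have fp: "f \<in> poly_fun mat_coords" using Suc.prems(1) by (simp add: JO_iff)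
    define q where "q = smult (of_nat (Suc n)) p - [:0, 1:] * pderiv p"
    have "of_nat (Suc n) * f (c *\<^sub>C z) - mder (c *\<^sub>C z) (c *\<^sub>C z) f = poly q c" for c
    proof -
      have d: "((\<lambda>s. ((c + s) *\<^sub>C z) $ i $ j) has_field_derivative z $ i $ j) (at 0)" for i j
        by (auto intro!: derivative_eq_intros)
      have "mder ((c + 0) *\<^sub>C z) z f = deriv (\<lambda>s. f ((c + s) *\<^sub>C z)) 0" by (rule mder_curve[OF d fp])
      also have "\<dots> = deriv (\<lambda>s. poly p (c + s)) 0" by (simp add: Suc.prems(2))
      also have "\<dots> = poly (pderiv p) c"
        using poly_DERIV[of p c] DERIV_shift[of "poly p" "poly (pderiv p) c" 0 c] by (intro DERIV_imp_deriv) (simp add: add.commute)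
      finally show ?thesis by (simp add: mder_scale Suc.prems(2) q_def)
    qed
    moreover have coeffq: "coeff q d = (of_nat (Suc n) - of_nat d) * coeff p d" for d
      by (cases d) (simp_all add: q_def coeff_pderiv algebra_simps)
    have "degree q \<le> n"
    proof (rule degree_le, intro allI impI)
      fix i assume "n < i"
      then show "coeff q i = 0" using coeffq[of i] Suc.prems(3) coeff_eq_0[of p i] by (cases "i = Suc n") auto
    qed
    ultimately have "q = 0" using Suc.IH[OF JO_euler[OF Suc.prems(1)]] by blast
    then have low: "coeff p d = 0" if "d \<le> n" for d
    proof -
      have "(of_nat (Suc n) - of_nat d) * coeff p d = 0" using coeffq[of d] \<open>q = 0\<close> by simp
      moreover have "of_nat (Suc n) \<noteq> (of_nat d :: complex)" unfolding of_nat_eq_iff using that by simp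
      ultimately show ?thesis by (simp del: of_nat_Suc)
    qed
    have "p = monom (coeff p (Suc n)) (Suc n)"
    proof (rule poly_eqI)
      fix i show "coeff p i = coeff (monom (coeff p (Suc n)) (Suc n)) i"
        using low[of i] coeff_eq_0[of p i] Suc.prems(3) by (cases "i \<le> n"; cases "i = Suc n") auto
    qed
    moreover have "poly p 1 = 0" using Suc.prems(1) Suc.prems(2)[of 1] z by (simp add: JO_iff cmat.scale_one)
    ultimately have "coeff p (Suc n) = 0" by (metis mult_1_right poly_monom power_one)
    then show ?case using \<open>p = monom _ _\<close> by simp
  qed
  have "(\<lambda>x. x) \<in> poly_fun {\<lambda>x::complex. x}" by (rule poly_fun.coord) simp
  from polymat_scale[OF this polymat_const[of _ z]] have "polymat {\<lambda>x. x} (\<lambda>c. c *\<^sub>C z)" .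
  with f have "(\<lambda>c. f (c *\<^sub>C z)) \<in> poly_fun {\<lambda>x. x}"
    unfolding JO_iff by (elim conjE) (rule polymat_compose)
  then obtain p where p: "(\<lambda>c. f (c *\<^sub>C z)) = poly p" using poly_fun_id by blast
  then have "p = 0" using zero[OF f, of p "degree p"] by (simp add: fun_eq_iff)
  then show ?thesis using fun_cong[OF p, of c] by simp
qed

lemma JO_zero: "f \<in> JO \<Longrightarrow> f 0 = 0"
  using JO_conical[OF _ x_in_O, of f 0] by (simp add: cmat.scale_zero_left)

text \<open>\<open>f\<close> is 0 on each line through 0 and a point of the orbit, and the orbit
  spans \<open>I\<close>.\<close>

lemma mder_zero_I:
  assumes "f \<in> JO" "w \<in> I"
  shows "mder 0 w f = 0"
proof -
  have "cmat.span Orb \<subseteq> {w. mder 0 w f = 0}"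
  proof (rule cmat.span_minimal[OF _ subspace_mder_kernel])
    show "Orb \<subseteq> {w. mder 0 w f = 0}"
      using JO_conical[OF assms(1)] assms(1) by (auto simp: mder_def vel_def JO_iff)
  qed
  then show ?thesis using assms(2) span_O by blast
qed

lemma vanishing_ideal_closure: "vanishing_ideal (mat_zariski closure_of Orb) = JO"
proof
  have sub: "Orb \<subseteq> mat_zariski closure_of Orb" by (rule closure_of_subset) simp
  then show "vanishing_ideal (mat_zariski closure_of Orb) \<subseteq> JO" by (auto simp: vanishing_ideal_iff JO_iff dest!: subsetD[OF sub])
  show "JO \<subseteq> vanishing_ideal (mat_zariski closure_of Orb)"
  proof
    fix f assume f: "f \<in> JO"
    have "closedin mat_zariski (zero_set {f})" using f unfolding closedin_zariski by (intro exI[of _ "{f}"]) (simp add: JO_iff)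
    moreover have "Orb \<subseteq> zero_set {f}" using f by (auto simp: zero_set_def JO_iff)
    ultimately have "mat_zariski closure_of Orb \<subseteq> zero_set {f}" by (simp add: closure_of_minimal)
    then show "f \<in> vanishing_ideal (mat_zariski closure_of Orb)" using f by (auto simp: vanishing_ideal_iff JO_iff zero_set_def)
  qed
qed

lemma in_closure_iff: "z \<in> mat_zariski closure_of Orb \<longleftrightarrow> (\<forall>f\<in>JO. f z = 0)"
proof
  show "z \<in> mat_zariski closure_of Orb \<Longrightarrow> \<forall>f\<in>JO. f z = 0"
    unfolding vanishing_ideal_closure[symmetric] by (simp add: vanishing_ideal_def)
  have "closedin mat_zariski (mat_zariski closure_of Orb)" by simp
  then obtain F where F: "F \<subseteq> poly_fun mat_coords" "mat_zariski closure_of Orb = zero_set F"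
    unfolding closedin_zariski by blast
  then have "F \<subseteq> JO" unfolding vanishing_ideal_closure[symmetric] by (auto simp: zero_set_def vanishing_ideal_def)
  then show "\<forall>f\<in>JO. f z = 0 \<Longrightarrow> z \<in> mat_zariski closure_of Orb" using F(2) by (auto simp: zero_set_def)
qed

end

subsection \<open>Coefficients of arcs\<close>

lemma poly_fun_id_iff: "f \<in> poly_fun {\<lambda>x. x} \<longleftrightarrow> (\<exists>p. f = poly p)"
proof
  assume "\<exists>p. f = poly p"
  then obtain p where p: "f = poly p" ..
  have "poly p \<in> poly_fun {\<lambda>x. x}"
  proof (induction p)
    case 0
    have "poly 0 = (\<lambda>_. 0 :: complex)" by (simp add: fun_eq_iff)
    then show ?case by (simp add: poly_fun.const)
  next
    case (pCons a p)
    have "(\<lambda>x. a + x * poly p x) \<in> poly_fun {\<lambda>x. x}"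
      by (rule poly_fun.add[OF poly_fun.const poly_fun.mult[OF poly_fun_var pCons.IH]])
    moreover have "poly (pCons a p) = (\<lambda>x. a + x * poly p x)" by (simp add: fun_eq_iff)
    ultimately show ?case by simp
  qed
  with p show "f \<in> poly_fun {\<lambda>x. x}" by simp
qed (rule poly_fun_id)

text \<open>Coefficients of polynomial functions rather than of \<open>poly\<close>, because arcs
  are composed as functions. The polynomial is unique as the field is infinite; other functions give
  no meaningful value.\<close>

definition ceff :: "nat \<Rightarrow> (complex \<Rightarrow> complex) \<Rightarrow> complex" where
  "ceff l f = coeff (THE p. f = poly p) l"

lemma ceff_poly: "ceff l (poly p) = coeff p l"
proof -
  have "(THE q. poly p = poly q) = p" by (rule the_equality) (simp_all add: poly_eq_poly_eq_iff)
  then show ?thesis by (simp add: ceff_def)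
qed

lemma ceff_monom: "ceff l (\<lambda>t. a * t ^ k) = (if k = l then a else 0)"
proof -
  have "(\<lambda>t. a * t ^ k) = poly (monom a k)" by (simp add: poly_monom fun_eq_iff)
  then show ?thesis by (simp add: ceff_poly)
qed

lemma ceff_const: "ceff l (\<lambda>t. a) = (if l = 0 then a else 0)"
  using ceff_monom[of l a 0] by auto

lemma ceff_add: "f \<in> poly_fun {\<lambda>x. x} \<Longrightarrow> g \<in> poly_fun {\<lambda>x. x} \<Longrightarrow> ceff l (\<lambda>t. f t + g t) = ceff l f + ceff l g"
proof -
  assume "f \<in> poly_fun {\<lambda>x. x}" "g \<in> poly_fun {\<lambda>x. x}"
  then obtain p q where pq: "f = poly p" "g = poly q" unfolding poly_fun_id_iff by (elim exE)
  have "(\<lambda>t. f t + g t) = poly (p + q)" by (simp add: pq fun_eq_iff)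
  then show ?thesis by (simp add: ceff_poly pq)
qed

lemma ceff_mult:
  "f \<in> poly_fun {\<lambda>x. x} \<Longrightarrow> g \<in> poly_fun {\<lambda>x. x} \<Longrightarrow> ceff l (\<lambda>t. f t * g t) = (\<Sum>i\<le>l. ceff i f * ceff (l - i) g)"
proof -
  assume "f \<in> poly_fun {\<lambda>x. x}" "g \<in> poly_fun {\<lambda>x. x}"
  then obtain p q where pq: "f = poly p" "g = poly q" unfolding poly_fun_id_iff by (elim exE)
  have "(\<lambda>t. f t * g t) = poly (p * q)" by (simp add: pq fun_eq_iff)
  then show ?thesis by (simp add: ceff_poly pq coeff_mult)
qed

lemma ceff_sum:
  "(\<And>i. i \<in> S \<Longrightarrow> f i \<in> poly_fun {\<lambda>x. x}) \<Longrightarrow> ceff l (\<lambda>t. \<Sum>i\<in>S. f i t) = (\<Sum>i\<in>S. ceff l (f i))"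
proof (induction S rule: infinite_finite_induct)
  case (insert i S)
  have "ceff l (\<lambda>t. f i t + (\<Sum>i\<in>S. f i t)) = ceff l (f i) + ceff l (\<lambda>t. \<Sum>i\<in>S. f i t)"
    by (rule ceff_add[OF insert.prems poly_fun_sum[OF insert.prems]]) simp_all
  then show ?case using insert by simp
qed (simp_all add: ceff_const)

lemma poly_fun_monom: "(\<lambda>t. a * t ^ k) \<in> poly_fun {\<lambda>x. x}"
  by (rule poly_fun.mult[OF poly_fun.const poly_fun_power[OF poly_fun_var]])

lemma ceff_monom_sum: "finite S \<Longrightarrow> ceff l (\<lambda>t. \<Sum>i\<in>S. a i * t ^ k i) = (\<Sum>i\<in>{i\<in>S. k i = l}. a i)"
  by (subst ceff_sum[OF poly_fun_monom]) (simp add: ceff_monom sum.inter_filter)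

lemma ceff_0: "f \<in> poly_fun {\<lambda>x. x} \<Longrightarrow> ceff 0 f = f 0"
proof -
  assume "f \<in> poly_fun {\<lambda>x. x}"
  then obtain p where "f = poly p" unfolding poly_fun_id_iff ..
  then show ?thesis by (simp add: ceff_poly poly_0_coeff_0)
qed

lemma vanishing_order_iff:
  assumes "f \<in> poly_fun {\<lambda>x. x}"
  shows "(\<exists>q. \<forall>t. f t = t ^ (m + 1) * poly q t) \<longleftrightarrow> (\<forall>l\<le>m. ceff l f = 0)"
proof
  assume "\<exists>q. \<forall>t. f t = t ^ (m + 1) * poly q t"
  then obtain q where "\<And>t. f t = t ^ (m + 1) * poly q t" by blast
  then have "f = poly (monom 1 (m + 1) * q)" by (simp add: fun_eq_iff poly_monom)
  then show "\<forall>l\<le>m. ceff l f = 0" by (simp add: ceff_poly coeff_monom_mult)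
next
  assume z: "\<forall>l\<le>m. ceff l f = 0"
  obtain p where p: "f = poly p" using assms unfolding poly_fun_id_iff ..
  have "monom 1 (m + 1) dvd p"
    unfolding monom_1_dvd_iff' using z by (auto simp: p ceff_poly)
  then obtain q where "p = monom 1 (m + 1) * q" by (elim dvdE)
  then have "\<forall>t. f t = t ^ (m + 1) * poly q t" by (simp add: p poly_monom)
  then show "\<exists>q. \<forall>t. f t = t ^ (m + 1) * poly q t" ..
qed

lemma poly_fun_param_expand:
  assumes "F \<in> poly_fun (insert snd ((\<lambda>c x. c (fst x)) ` C))"
  shows "\<exists>n h. (\<forall>j. h j \<in> poly_fun C) \<and> (\<forall>q t. F (q, t) = (\<Sum>j\<le>(n::nat). h j q * t ^ j))"
proof -
  obtain n a where a: "\<forall>i. a i \<in> poly_fun ((\<lambda>c x. c (fst x)) ` C)" "F = (\<lambda>x. \<Sum>i\<le>(n::nat). a i x * snd x ^ i)"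
    using poly_fun_insert_ex[OF assms] by (elim exE conjE)
  have "\<forall>i. \<exists>f. f \<in> poly_fun C \<and> a i = (\<lambda>x. f (fst x))"
  proof
    fix i show "\<exists>f. f \<in> poly_fun C \<and> a i = (\<lambda>x. f (fst x))"
      using poly_fun_pullback[OF a(1)[rule_format, of i]] unfolding Bex_def .
  qed
  from choice[OF this] obtain h where h: "\<forall>i. h i \<in> poly_fun C \<and> a i = (\<lambda>x. h i (fst x))" ..
  have "F (q, t) = (\<Sum>j\<le>n. h j q * t ^ j)" for q t
    unfolding a(2) using h by simp
  then show ?thesis using h by (intro exI[of _ n] exI[of _ h] conjI allI) simp_all
qed

text \<open>This makes maps between jets polynomial: their coordinates are coefficients in
  \<open>t\<close> of expressions polynomial in \<open>t\<close> and the old coordinates.\<close>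

lemma poly_fun_ceff:
  assumes "F \<in> poly_fun (insert snd ((\<lambda>c x. c (fst x)) ` C))"
  shows "(\<lambda>q. ceff l (\<lambda>t. F (q, t))) \<in> poly_fun C"
proof -
  obtain n h where h: "\<forall>j. h j \<in> poly_fun C" "\<forall>q t. F (q, t) = (\<Sum>j\<le>(n::nat). h j q * t ^ j)"
    using poly_fun_param_expand[OF assms] by (elim exE conjE)
  have "ceff l (\<lambda>t. F (q, t)) = (if l \<le> n then h l q else 0)" for q
  proof -
    have "{i. i \<le> n \<and> i = l} = (if l \<le> n then {l} else {})" by auto
    then show ?thesis by (simp add: h(2) ceff_monom_sum)
  qed
  then show ?thesis using h(1) poly_fun.const[of 0 C] by (cases "l \<le> n") simp_all
qed

section \<open>Truncated arcs and coordinates on jets\<close>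

definition jet_of :: "nat \<Rightarrow> (complex \<Rightarrow> complex^'n^'n) \<Rightarrow> nat \<Rightarrow> complex^'n^'n" where
  "jet_of m P l = (if l \<le> m then \<chi> i j. ceff l (\<lambda>t. P t $ i $ j) else 0)"

lemma arc_nth: "arc m \<gamma> t $ i $ j = (\<Sum>k\<le>m. \<gamma> k $ i $ j * t ^ k)"
  by (simp add: arc_def sum_component mult.commute)

lemma polymat_arc: "polymat {\<lambda>x. x} (arc m \<gamma>)"
  unfolding polymat_def arc_nth by (intro allI poly_fun_sum poly_fun_monom)

lemma ceff_arc: "ceff l (\<lambda>t. arc m \<gamma> t $ i $ j) = (if l \<le> m then \<gamma> l $ i $ j else 0)"
proof -
  have "{k. k \<le> m \<and> k = l} = (if l \<le> m then {l} else {})" by auto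
  then show ?thesis unfolding arc_nth by (simp add: ceff_monom_sum)
qed

lemma jet_of_arc: "\<forall>k>m. \<gamma> k = 0 \<Longrightarrow> jet_of m (arc m \<gamma>) = \<gamma>"
  by (rule ext) (auto simp: jet_of_def ceff_arc vec_eq_iff)

text \<open>Congruence modulo \<open>t ^ (m + 1)\<close>.\<close>

definition agree :: "nat \<Rightarrow> (complex \<Rightarrow> complex^'n^'n) \<Rightarrow> (complex \<Rightarrow> complex^'n^'n) \<Rightarrow> bool" where
  "agree m P Q \<longleftrightarrow> (\<forall>l\<le>m. \<forall>i j. ceff l (\<lambda>t. P t $ i $ j) = ceff l (\<lambda>t. Q t $ i $ j))"

lemma agree_jet_of: "agree m (arc m (jet_of m P)) P"
  by (simp add: agree_def ceff_arc jet_of_def)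

lemma agree_imp_jet_of_eq: "agree m P Q \<Longrightarrow> jet_of m P = jet_of m Q"
  by (rule ext) (simp add: agree_def jet_of_def vec_eq_iff)

lemma agree_poly_fun:
  assumes "f \<in> poly_fun mat_coords" and PQ: "polymat {\<lambda>x. x} P" "polymat {\<lambda>x. x} Q" "agree m P Q"
  shows "\<forall>l\<le>m. ceff l (\<lambda>t. f (P t)) = ceff l (\<lambda>t. f (Q t))"
  using assms(1)
proof induction
  case (coord c)
  then obtain i j where "c = (\<lambda>A. A $ i $ j)" by (auto simp: mat_coords_def)
  then show ?case using PQ(3) by (simp add: agree_def)
next
  case (add f g)
  then show ?case by (simp add: ceff_add polymat_compose[OF _ PQ(1)] polymat_compose[OF _ PQ(2)])
next
  case (mult f g)
  then show ?case
    by (auto simp: ceff_mult polymat_compose[OF _ PQ(1)] polymat_compose[OF _ PQ(2)] intro!: sum.cong)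
qed simp

lemma agree_mul:
  assumes P: "polymat {\<lambda>x. x} P" "polymat {\<lambda>x. x} P'" and Q: "polymat {\<lambda>x. x} Q" "polymat {\<lambda>x. x} Q'"
    and "agree m P P'" "agree m Q Q'"
  shows "agree m (\<lambda>t. P t ** Q t) (\<lambda>t. P' t ** Q' t)"
  unfolding agree_def matmul_nth
proof (intro allI impI)
  fix l i j assume l: "l \<le> m"
  show "ceff l (\<lambda>t. \<Sum>k\<in>UNIV. P t $ i $ k * Q t $ k $ j) = ceff l (\<lambda>t. \<Sum>k\<in>UNIV. P' t $ i $ k * Q' t $ k $ j)"
    using assms(5,6) l
    by (subst (1 2) ceff_sum)
       (auto simp: ceff_mult polymatD P Q agree_def intro!: sum.cong poly_fun.mult polymatD)
qed

lemma agree_refl: "agree m P P"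
  by (simp add: agree_def)

lemma arc_0: "arc m \<gamma> 0 = \<gamma> 0"
  unfolding arc_def
  by (subst sum.remove[of _ 0]) (auto simp: cmat.scale_one cmat.scale_zero_left power_0_left intro!: sum.neutral)

lemma agree_lowest:
  assumes r: "1 \<le> r" "r \<le> m" and low: "\<And>k. 0 < k \<Longrightarrow> k < r \<Longrightarrow> \<gamma> k = 0"
  shows "agree r (arc m \<gamma>) (\<lambda>t. \<gamma> 0 + t ^ r *\<^sub>C \<gamma> r)"
  unfolding agree_def
proof (intro allI impI)
  fix l i j assume l: "l \<le> r"
  have "ceff l (\<lambda>t. (\<gamma> 0 + t ^ r *\<^sub>C \<gamma> r) $ i $ j) = ceff l (\<lambda>t. \<gamma> 0 $ i $ j) + ceff l (\<lambda>t. \<gamma> r $ i $ j * t ^ r)"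
    using ceff_add[OF poly_fun.const poly_fun_monom, of l "\<gamma> 0 $ i $ j" "\<gamma> r $ i $ j" r] by (simp add: mult.commute)
  then show "ceff l (\<lambda>t. arc m \<gamma> t $ i $ j) = ceff l (\<lambda>t. (\<gamma> 0 + t ^ r *\<^sub>C \<gamma> r) $ i $ j)"
    using l r low[of l] by (auto simp: ceff_arc ceff_const ceff_monom)
qed

lemma jets_iff:
  "\<gamma> \<in> jets m X \<longleftrightarrow> (\<forall>k>m. \<gamma> k = 0) \<and> (\<forall>f\<in>vanishing_ideal X. \<forall>l\<le>m. ceff l (\<lambda>t. f (arc m \<gamma> t)) = 0)"
proof -
  have "(\<exists>q. \<forall>t. f (arc m \<gamma> t) = t ^ (m + 1) * poly q t) \<longleftrightarrow> (\<forall>l\<le>m. ceff l (\<lambda>t. f (arc m \<gamma> t)) = 0)"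
    if "f \<in> vanishing_ideal X" for f
    using that by (intro vanishing_order_iff polymat_compose[OF _ polymat_arc]) (simp add: vanishing_ideal_def)
  then show ?thesis unfolding jets_def by auto
qed

lemma jet_of_in_jets:
  assumes P: "polymat {\<lambda>x. x} P" and "\<And>f l. f \<in> vanishing_ideal X \<Longrightarrow> l \<le> m \<Longrightarrow> ceff l (\<lambda>t. f (P t)) = 0"
  shows "jet_of m P \<in> jets m X"
  unfolding jets_iff
proof (intro conjI ballI allI impI)
  fix f l assume f: "f \<in> vanishing_ideal X" and l: "l \<le> m"
  have "ceff l (\<lambda>t. f (arc m (jet_of m P) t)) = ceff l (\<lambda>t. f (P t))"
    using agree_poly_fun[OF _ polymat_arc P agree_jet_of, of f m] f l by (simp add: vanishing_ideal_def)
  with assms(2)[OF f l] show "ceff l (\<lambda>t. f (arc m (jet_of m P) t)) = 0" by simp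
qed (simp add: jet_of_def)

text \<open>A finite set of coordinates, as the bound by tangent spaces requires. On jets of order
  \<open>m\<close> it yields the same chains as \<open>jet_zariski\<close>; see
  \<open>jet_zariski_zchain\<close>.\<close>

definition jet_coords :: "nat \<Rightarrow> ((nat \<Rightarrow> complex^'n^'n) \<Rightarrow> complex) set" where
  "jet_coords m = {(\<lambda>\<gamma>. \<gamma> k $ i $ j) | k i j. k \<le> m}"

lemma finite_jet_coords: "finite (jet_coords m :: ((nat \<Rightarrow> complex^'n^'n) \<Rightarrow> complex) set)"
proof -
  have "jet_coords m = (\<lambda>(k, i, j). \<lambda>\<gamma> :: nat \<Rightarrow> complex^'n^'n. \<gamma> k $ i $ j) ` ({..m} \<times> UNIV \<times> UNIV)"
    by (auto simp: jet_coords_def image_iff) blast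
  then show ?thesis by simp
qed

lemma jet_coordI: "k \<le> m \<Longrightarrow> (\<lambda>\<gamma>. \<gamma> k $ i $ j) \<in> poly_fun (jet_coords m)"
  by (rule poly_fun.coord) (auto simp: jet_coords_def)

lemma zchain_transfer:
  assumes ch: "zchain C S n Z"
    and bij: "\<And>q. q \<in> S \<Longrightarrow> \<Phi> q \<in> S'" "\<And>q. q \<in> S' \<Longrightarrow> \<Psi> q \<in> S" "\<And>q. q \<in> S \<Longrightarrow> \<Psi> (\<Phi> q) = q" "\<And>q. q \<in> S' \<Longrightarrow> \<Phi> (\<Psi> q) = q"
    and C': "\<And>c. c \<in> C' \<Longrightarrow> \<exists>g\<in>poly_fun C. \<forall>q\<in>S. c (\<Phi> q) = g q"
    and C: "\<And>c. c \<in> C \<Longrightarrow> \<exists>g\<in>poly_fun C'. \<forall>q\<in>S'. c (\<Psi> q) = g q"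
  shows "zchain C' S' n (\<lambda>i. \<Phi> ` Z i)"
proof -
  have pull: "\<exists>g\<in>poly_fun C'. \<forall>q\<in>S'. f (\<Psi> q) = g q" if "f \<in> poly_fun C" for f
    using that
  proof induction
    case (add f g)
    then obtain f' g' where "f' \<in> poly_fun C'" "g' \<in> poly_fun C'" "\<forall>q\<in>S'. f (\<Psi> q) = f' q" "\<forall>q\<in>S'. g (\<Psi> q) = g' q" by blast
    then show ?case by (intro bexI[of _ "\<lambda>q. f' q + g' q"]) (auto intro: poly_fun.add)
  next
    case (mult f g)
    then obtain f' g' where "f' \<in> poly_fun C'" "g' \<in> poly_fun C'" "\<forall>q\<in>S'. f (\<Psi> q) = f' q" "\<forall>q\<in>S'. g (\<Psi> q) = g' q" by blast
    then show ?case by (intro bexI[of _ "\<lambda>q. f' q * g' q"]) (auto intro: poly_fun.mult)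
  next
    case (const a)
    then show ?case by (intro bexI[of _ "\<lambda>_. a"]) (auto intro: poly_fun.const)
  qed (rule C)
  show ?thesis
    unfolding zchain_def
  proof (intro conjI allI impI)
    fix i assume i: "i \<le> n"
    have Zi: "irr C (Z i)" using ch i by (simp add: zchain_def)
    obtain F where F: "F \<subseteq> poly_fun C" "Z i = {q\<in>S. \<forall>f\<in>F. f q = 0}" using ch i unfolding zchain_def by blast
    have ZS: "Z i \<subseteq> S" using F(2) by auto
    show "irr C' (\<Phi> ` Z i)"
    proof (rule irr_image[OF Zi])
      fix c assume "c \<in> C'"
      from C'[OF this] ZS show "\<exists>g\<in>poly_fun C. \<forall>q\<in>Z i. c (\<Phi> q) = g q" by (meson subsetD)
    qed
    obtain k where k: "\<And>f. f \<in> F \<Longrightarrow> k f \<in> poly_fun C' \<and> (\<forall>q\<in>S'. f (\<Psi> q) = k f q)"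
      using bchoice[of F "\<lambda>f g. g \<in> poly_fun C' \<and> (\<forall>q\<in>S'. f (\<Psi> q) = g q)"] pull F(1) by (meson subsetD)
    have "\<Phi> ` Z i = {q\<in>S'. \<forall>f\<in>k ` F. f q = 0}"
    proof
      show "\<Phi> ` Z i \<subseteq> {q\<in>S'. \<forall>f\<in>k ` F. f q = 0}"
      proof
        fix p assume "p \<in> \<Phi> ` Z i"
        then obtain q where q: "q \<in> Z i" "p = \<Phi> q" by auto
        then have qS: "q \<in> S" using ZS by auto
        have "k f p = 0" if "f \<in> F" for f
          using k[OF that] bij(1,3)[OF qS] q F(2) that by fastforce
        then show "p \<in> {q\<in>S'. \<forall>f\<in>k ` F. f q = 0}" using bij(1)[OF qS] q(2) by simp
      qed
      show "{q\<in>S'. \<forall>f\<in>k ` F. f q = 0} \<subseteq> \<Phi> ` Z i"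
      proof
        fix p assume p: "p \<in> {q\<in>S'. \<forall>f\<in>k ` F. f q = 0}"
        have "f (\<Psi> p) = 0" if "f \<in> F" for f using k[OF that] p that by auto
        then have "\<Psi> p \<in> Z i" unfolding F(2) using p bij(2) by simp
        then show "p \<in> \<Phi> ` Z i" using bij(4)[of p] p by (metis (no_types, lifting) imageI mem_Collect_eq)
      qed
    qed
    then show "\<exists>F\<subseteq>poly_fun C'. \<Phi> ` Z i = {q\<in>S'. \<forall>f\<in>F. f q = 0}"
      by (rule exI[of _ "k ` F", OF conjI[rotated]]) (use k in blast)
  next
    fix i assume i: "i < n"
    have sub: "Z i \<subset> Z (Suc i)" using ch i by (simp add: zchain_def)
    have "\<forall>i\<le>n. \<exists>F\<subseteq>poly_fun C. Z i = {q\<in>S. \<forall>f\<in>F. f q = 0}" using ch by (simp add: zchain_def)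
    from this[rule_format, OF Suc_leI[OF i]] have "Z (Suc i) \<subseteq> S" by auto
    then have "inj_on \<Phi> (Z (Suc i))" using bij(3) by (metis inj_onI subsetD)
    then show "\<Phi> ` Z i \<subset> \<Phi> ` Z (Suc i)" using inj_on_image_eq_iff[of \<Phi> "Z (Suc i)" "Z i" "Z (Suc i)"] sub by blast
  qed
qed

lemma dual_family_card_set:
  assumes B: "finite B" and A: "finite A" and \<xi>: "\<And>a. a \<in> A \<Longrightarrow> \<xi> a \<in> cfun.span B"
    and dual: "\<And>a a'. a \<in> A \<Longrightarrow> a' \<in> A \<Longrightarrow> \<xi> a (f a') = (if a = a' then 1 else 0)"
  shows "card A \<le> card B"
proof -
  obtain h where h: "bij_betw h {0..<card A} A" using ex_bij_betw_nat_finite[OF A] by blast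
  have hA: "h i \<in> A" if "i < card A" for i using bij_betw_apply[OF h] that by simp
  have hinj: "h i = h j \<longleftrightarrow> i = j" if "i < card A" "j < card A" for i j
    using bij_betw_imp_inj_on[OF h] that by (auto simp: inj_on_def)
  show ?thesis
  proof (rule dual_family_card[OF B, of "card A" "\<lambda>i. \<xi> (h i)" "\<lambda>i. f (h i)"])
    show "\<And>j. j < card A \<Longrightarrow> \<xi> (h j) \<in> cfun.span B" using \<xi> hA by simp
    fix i j assume ij: "i < card A" "j < card A"
    show "\<xi> (h j) (f (h i)) = (if i = j then 1 else 0)" using dual[OF hA[OF ij(2)] hA[OF ij(1)]] hinj[OF ij] by auto
  qed
qed

text \<open>\<open>\<xi> l d\<close> stands for the tangent vector \<open>d\<close> in the \<open>l\<close>-th coordinate of a jet.\<close>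

lemma jet_velocities_card:
  fixes S :: "nat \<Rightarrow> (complex^'n^'n) set"
  assumes B: "finite B" and \<xi>: "\<And>l d. l \<le> m \<Longrightarrow> d \<in> S l \<Longrightarrow> \<xi> l d \<in> cfun.span B"
    and dual: "\<And>l d l' s. l \<le> m \<Longrightarrow> d \<in> S l \<Longrightarrow> l' \<le> m \<Longrightarrow> \<xi> l d (\<lambda>\<gamma>. trace (s ** \<gamma> l')) = (if l' = l then trace (s ** d) else 0)"
  shows "(\<Sum>l\<le>m. cmat.dim (S l)) \<le> card B"
proof -
  have "\<forall>l. \<exists>K. K \<subseteq> S l \<and> cmat.independent K \<and> card K = cmat.dim (S l)"
    using cmat.basis_exists by (metis)
  from choice[OF this] obtain K where K: "\<forall>l. K l \<subseteq> S l \<and> cmat.independent (K l) \<and> card (K l) = cmat.dim (S l)" ..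
  have finK: "finite (K l)" for l using K cmat.finiteI_independent by blast
  have "\<exists>s. \<forall>d\<in>K l. trace (s ** d) = (if d = b then 1 else 0)" for l b
    using trace_form_represents[OF cmat.subspace_UNIV nondeg_UNIV subset_UNIV, of "K l" "\<lambda>d. if d = b then 1 else 0"] K by blast
  then obtain s where s: "\<And>l b d. d \<in> K l \<Longrightarrow> trace (s l b ** d) = (if d = b then 1 else 0)" by metis
  have "card (Sigma {..m} K) \<le> card B"
  proof (rule dual_family_card_set[OF B, where \<xi>="\<lambda>(l, d). \<xi> l d" and f="\<lambda>(l, d) \<gamma>. trace (s l d ** \<gamma> l)"])
    show "finite (Sigma {..m} K)" using finK by simp
    show "\<And>a. a \<in> Sigma {..m} K \<Longrightarrow> (case a of (l, d) \<Rightarrow> \<xi> l d) \<in> cfun.span B" using \<xi> K by auto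
    fix a a' assume a: "a \<in> Sigma {..m} K" "a' \<in> Sigma {..m} K"
    obtain l d l' d' where eq: "a = (l, d)" "a' = (l', d')" by (cases a, cases a')
    have "d \<in> S l" using a K by (auto simp: eq)
    then show "(case a of (l, d) \<Rightarrow> \<xi> l d) (case a' of (l, d) \<Rightarrow> \<lambda>\<gamma>. trace (s l d ** \<gamma> l)) = (if a = a' then 1 else 0)"
      using a dual[of l d l' "s l' d'"] s[of d l d'] by (auto simp: eq)
  qed
  then show ?thesis using K finK by simp
qed

lemma ceff_subst:
  "ceff l (\<lambda>t. poly p (\<tau> * t ^ k) * t ^ r) = (\<Sum>j\<in>{j. j \<le> degree p \<and> k * j + r = l}. coeff p j * \<tau> ^ j)"
proof -
  have "(\<lambda>t. poly p (\<tau> * t ^ k) * t ^ r) = (\<lambda>t. \<Sum>j\<le>degree p. coeff p j * \<tau> ^ j * t ^ (k * j + r))"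
    unfolding poly_altdef by (simp add: sum_distrib_right power_mult_distrib power_mult power_add mult.assoc)
  then show ?thesis by (simp only: ceff_monom_sum[OF finite_atMost]) simp
qed

text \<open>Only the linear term of \<open>p\<close> has a nonzero derivative at
  \<open>\<tau> = 0\<close>, and it sits at \<open>t ^ (k + r)\<close>.\<close>

lemma DERIV_ceff_subst:
  "((\<lambda>\<tau>. ceff l (\<lambda>t. poly p (\<tau> * t ^ k) * t ^ r)) has_field_derivative (if l = k + r then coeff p 1 else 0)) (at 0)"
proof -
  let ?J = "{j. j \<le> degree p \<and> k * j + r = l}"
  have fin: "finite ?J" by simp
  have "((\<lambda>\<tau>. \<Sum>j\<in>?J. coeff p j * \<tau> ^ j) has_field_derivative (\<Sum>j\<in>?J. coeff p j * (if j = 1 then 1 else 0))) (at 0)"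
  proof (rule DERIV_sum)
    fix j
    have "((\<lambda>\<tau>::complex. \<tau> ^ j) has_field_derivative of_nat j * 0 ^ (j - 1)) (at 0)"
      by (auto intro!: derivative_eq_intros)
    moreover have "of_nat j * 0 ^ (j - 1) = (if j = 1 then 1 else 0 :: complex)" by (cases j) (auto simp: power_0_left)
    ultimately have "((\<lambda>\<tau>::complex. \<tau> ^ j) has_field_derivative (if j = 1 then 1 else 0)) (at 0)" by (simp only:)
    then show "((\<lambda>\<tau>. coeff p j * \<tau> ^ j) has_field_derivative coeff p j * (if j = 1 then 1 else 0)) (at 0)"
      by (rule DERIV_cmult)
  qed
  moreover have "(\<Sum>j\<in>?J. coeff p j * (if j = 1 then 1 else 0)) = (if l = k + r then coeff p 1 else 0)"
  proof -
    have "(\<Sum>j\<in>?J. coeff p j * (if j = 1 then 1 else 0)) = (\<Sum>j\<in>?J. if j = 1 then coeff p j else 0)"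
      by (rule sum.cong) auto
    also have "\<dots> = (if 1 \<in> ?J then coeff p 1 else 0)" by (rule sum.delta[OF fin])
    finally show ?thesis by (auto simp: coeff_eq_0)
  qed
  ultimately show ?thesis by (simp only: ceff_subst)
qed

lemma ceff_subst_low:
  assumes "1 \<le> k" "l \<le> k"
  shows "ceff l (\<lambda>t. poly p (\<tau> * t ^ k)) = (if l = 0 then coeff p 0 else if l = k then \<tau> * coeff p 1 else 0)"
    and "ceff l (\<lambda>t. t ^ k * poly p (\<tau> * t ^ k)) = (if l = k then coeff p 0 else 0)"
proof -
  have "{j. j \<le> degree p \<and> k * j + 0 = l} = (if l = 0 then {0} else if l = k \<and> 1 \<le> degree p then {1} else {})"
  proof -
    have "k * j = l \<longleftrightarrow> l = 0 \<and> j = 0 \<or> l = k \<and> j = 1" for j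
      using assms by (cases j) auto
    then show ?thesis using assms by auto
  qed
  then show "ceff l (\<lambda>t. poly p (\<tau> * t ^ k)) = (if l = 0 then coeff p 0 else if l = k then \<tau> * coeff p 1 else 0)"
    using ceff_subst[of l p \<tau> k 0] assms by (auto simp: coeff_eq_0)
  have "{j. j \<le> degree p \<and> k * j + k = l} = (if l = k then {0} else {})"
    using assms by auto
  then show "ceff l (\<lambda>t. t ^ k * poly p (\<tau> * t ^ k)) = (if l = k then coeff p 0 else 0)"
    using ceff_subst[of l p \<tau> k k] by (auto simp: mult.commute)
qed

lemma polymat_jet: "k \<le> m \<Longrightarrow> polymat (jet_coords m) (\<lambda>\<gamma>. \<gamma> k)"
  by (simp add: polymat_def jet_coordI)

lemma vel_jet_trace:
  assumes "l \<le> m" "\<And>i j. ((\<lambda>\<tau>. \<kappa> \<tau> l $ i $ j) has_field_derivative D $ i $ j) (at 0)"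
  shows "vel (jet_coords m) \<kappa> (\<lambda>\<gamma>. trace (s ** \<gamma> l)) = trace (s ** D)"
proof -
  have "(\<lambda>\<gamma>. trace (s ** \<gamma> l)) \<in> poly_fun (jet_coords m)"
    unfolding trace_def by (rule poly_fun_sum) (rule polymatD[OF polymat_mul[OF polymat_const polymat_jet[OF assms(1)]]])
  moreover have "((\<lambda>\<tau>. trace (s ** \<kappa> \<tau> l)) has_field_derivative trace (s ** D)) (at 0)"
    unfolding trace_def matmul_nth by (intro DERIV_sum DERIV_cmult assms(2))
  ultimately show ?thesis by (simp add: vel_def DERIV_imp_deriv)
qed

definition jet_shift :: "nat \<Rightarrow> complex^'n^'n \<Rightarrow> (nat \<Rightarrow> complex^'n^'n) \<Rightarrow> complex \<Rightarrow> nat \<Rightarrow> complex^'n^'n" where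
  "jet_shift l b p \<tau> = p(l := p l + \<tau> *\<^sub>C b)"

lemma DERIV_jet_shift:
  "((\<lambda>\<tau>. jet_shift l b p \<tau> k $ i $ j) has_field_derivative (if k = l then b else 0) $ i $ j) (at 0)"
  using DERIV_line[of "p l" b i j] by (simp add: jet_shift_def)

lemma jet_shift_0: "jet_shift l b p 0 = p"
  by (simp add: jet_shift_def cmat.scale_zero_left)

lemma jet_tang_span:
  fixes p :: "nat \<Rightarrow> complex^'n^'n"
  assumes \<xi>: "pder (jet_coords m) p \<xi>" and B: "finite B"
    and u: "\<And>l. l \<le> m \<Longrightarrow> (\<chi> i j. \<xi> (\<lambda>\<gamma>. \<gamma> l $ i $ j)) \<in> cmat.span B"
  shows "\<xi> \<in> cfun.span ((\<lambda>(l, b). vel (jet_coords m) (jet_shift l b p)) ` ({..m} \<times> B))"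
proof -
  have "\<forall>l. \<exists>w. l \<le> m \<longrightarrow> (\<chi> i j. \<xi> (\<lambda>\<gamma>. \<gamma> l $ i $ j)) = (\<Sum>b\<in>B. w b *\<^sub>C b)"
    using u unfolding cmat.span_finite[OF B] by blast
  from choice[OF this] obtain w where
    w: "\<forall>l. l \<le> m \<longrightarrow> (\<chi> i j. \<xi> (\<lambda>\<gamma>. \<gamma> l $ i $ j)) = (\<Sum>b\<in>B. w l b *\<^sub>C b)" ..
  let ?d = "\<lambda>(l, b). vel (jet_coords m) (jet_shift l b p)"
  have dc: "vel (jet_coords m) (jet_shift l b p) (\<lambda>\<gamma>. \<gamma> k $ i $ j) = (if k = l then b $ i $ j else 0)" if "k \<le> m" for l b k i j
    using DERIV_imp_deriv[OF DERIV_jet_shift[of l b p k i j]] by (simp add: vel_def jet_coordI[OF that])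
  have pd: "pder (jet_coords m) p (vel (jet_coords m) (jet_shift l b p))" for l b
  proof -
    have "pder (jet_coords m) (jet_shift l b p 0) (vel (jet_coords m) (jet_shift l b p))"
    proof (rule pder_vel)
      fix c assume "c \<in> (jet_coords m :: ((nat \<Rightarrow> complex^'n^'n) \<Rightarrow> complex) set)"
      then obtain k i j where "c = (\<lambda>\<gamma>. \<gamma> k $ i $ j)" by (auto simp: jet_coords_def)
      then show "(\<lambda>\<tau>. c (jet_shift l b p \<tau>)) field_differentiable at 0"
        using DERIV_jet_shift[of l b p k i j] by (auto simp: field_differentiable_def)
    qed
    then show ?thesis by (simp add: jet_shift_0)
  qed
  have "\<xi> = (\<Sum>a\<in>{..m} \<times> B. fscale (case a of (l, b) \<Rightarrow> w l b) (?d a))"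
  proof (rule pder_unique[OF \<xi> pder_scaled_sum])
    show "pder (jet_coords m) p (?d a)" if "a \<in> {..m} \<times> B" for a using pd by (simp add: split_def)
    fix c assume "c \<in> (jet_coords m :: ((nat \<Rightarrow> complex^'n^'n) \<Rightarrow> complex) set)"
    then obtain k i j where c: "c = (\<lambda>\<gamma>. \<gamma> k $ i $ j)" and k: "k \<le> m" by (auto simp: jet_coords_def)
    have "(\<Sum>a\<in>{..m} \<times> B. fscale (case a of (l, b) \<Rightarrow> w l b) (?d a)) c = (\<Sum>l\<le>m. \<Sum>b\<in>B. w l b * ?d (l, b) c)"
      unfolding sum.cartesian_product by (simp add: sum_fun_apply fscale_def split_def)
    also have "\<dots> = (\<Sum>l\<le>m. if l = k then \<Sum>b\<in>B. w l b * b $ i $ j else 0)"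
      by (rule sum.cong) (auto simp: c dc[OF k])
    also have "\<dots> = (\<Sum>b\<in>B. w k b *\<^sub>C b) $ i $ j" using k by (simp add: sum_component)
    also have "\<dots> = \<xi> c" using w[rule_format, OF k, symmetric] by (simp add: c)
    finally show "\<xi> c = (\<Sum>a\<in>{..m} \<times> B. fscale (case a of (l, b) \<Rightarrow> w l b) (?d a)) c" ..
  qed
  moreover have "(\<Sum>a\<in>{..m} \<times> B. fscale (case a of (l, b) \<Rightarrow> w l b) (?d a)) \<in> cfun.span (?d ` ({..m} \<times> B))"
    by (intro cfun.span_sum cfun.span_scale cfun.span_base imageI)
  ultimately show ?thesis by simp
qed

text \<open>Composition with \<open>\<psi>\<close> moves derivations from \<open>p\<close> to
  \<open>\<psi> p\<close>, and \<open>push\<close> moves them back, since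
  \<open>\<phi> (\<psi> q) = q\<close> on \<open>P\<close>.\<close>

lemma tang_transport:
  assumes \<phi>: "\<And>f. f \<in> poly_fun C \<Longrightarrow> (\<lambda>q. f (\<phi> q)) \<in> poly_fun C"
    and \<psi>: "\<And>f. f \<in> poly_fun C \<Longrightarrow> (\<lambda>q. f (\<psi> q)) \<in> poly_fun C"
    and P: "\<And>q. q \<in> P \<Longrightarrow> \<psi> q \<in> P" "\<And>q. q \<in> P \<Longrightarrow> \<phi> (\<psi> q) = q" and p: "p \<in> P"
    and B: "finite B" "tang C P (\<psi> p) \<subseteq> cfun.span B"
  shows "\<exists>B'. finite B' \<and> card B' \<le> card B \<and> tang C P p \<subseteq> cfun.span B'"
proof -
  define push where "push \<beta> f = (if f \<in> poly_fun C then \<beta> (\<lambda>q. f (\<phi> q)) else 0)" for \<beta> :: "('a \<Rightarrow> complex) \<Rightarrow> complex" and f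
  have lin: "push (\<alpha> + \<beta>) = push \<alpha> + push \<beta>" "push (fscale c \<beta>) = fscale c (push \<beta>)" "push 0 = 0" for \<alpha> \<beta> c
    by (auto simp: push_def fscale_def fun_eq_iff)
  have span: "cfun.span B \<subseteq> {\<beta>. push \<beta> \<in> cfun.span (push ` B)}"
  proof (rule cfun.span_minimal)
    show "B \<subseteq> {\<beta>. push \<beta> \<in> cfun.span (push ` B)}" by (auto intro: cfun.span_base)
    show "cfun.subspace {\<beta>. push \<beta> \<in> cfun.span (push ` B)}"
      unfolding cfun.subspace_def mem_Collect_eq lin
      by (auto intro: cfun.span_add cfun.span_scale cfun.span_zero)
  qed
  have "\<xi> \<in> cfun.span (push ` B)" if xi: "\<xi> \<in> tang C P p" for \<xi>
  proof -
    have pd: "pder C p \<xi>" using xi by (simp add: tang_def)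
    define \<eta> where "\<eta> f = (if f \<in> poly_fun C then \<xi> (\<lambda>q. f (\<psi> q)) else 0)" for f
    have "\<eta> \<in> tang C P (\<psi> p)"
      unfolding tang_def pder_def
    proof (intro CollectI conjI ballI allI impI)
      show "\<And>a. \<eta> (\<lambda>_. a) = 0" by (simp add: \<eta>_def poly_fun.const pder_const[OF pd])
      fix f g assume fg: "f \<in> poly_fun C" "g \<in> poly_fun C"
      show "\<eta> (\<lambda>q. f q + g q) = \<eta> f + \<eta> g" "\<eta> (\<lambda>q. f q * g q) = f (\<psi> p) * \<eta> g + g (\<psi> p) * \<eta> f"
        using fg pder_add[OF pd \<psi>[OF fg(1)] \<psi>[OF fg(2)]] pder_mult[OF pd \<psi>[OF fg(1)] \<psi>[OF fg(2)]]
        by (simp_all add: \<eta>_def poly_fun.add poly_fun.mult)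
    next
      fix f assume f: "f \<in> poly_fun C" "\<forall>q\<in>P. f q = 0"
      have "\<forall>q\<in>P. f (\<psi> q) = 0" using f(2) P(1) by simp
      then show "\<eta> f = 0" using xi \<psi>[OF f(1)] f(1) by (simp add: \<eta>_def tang_def)
    qed (simp add: \<eta>_def)
    moreover have "push \<eta> = \<xi>"
    proof
      fix f show "push \<eta> f = \<xi> f"
      proof (cases "f \<in> poly_fun C")
        case True
        have c: "(\<lambda>q. f (\<phi> (\<psi> q))) \<in> poly_fun C" by (rule \<psi>[OF \<phi>[OF True]])
        have "\<forall>q\<in>P. f (\<phi> (\<psi> q)) - f q = 0" using P(2) by simp
        moreover have "(\<lambda>q. f (\<phi> (\<psi> q)) - f q) \<in> poly_fun C" by (rule poly_fun_diff[OF c True])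
        ultimately have "\<xi> (\<lambda>q. f (\<phi> (\<psi> q)) - f q) = 0" using xi by (simp add: tang_def)
        then show ?thesis using pder_diff[OF pd c True] True \<phi>[OF True] by (simp add: push_def \<eta>_def)
      next
        case False
        then show ?thesis using pd by (simp add: push_def pder_def)
      qed
    qed
    ultimately show ?thesis using B(2) span by blast
  qed
  then show ?thesis using B(1) card_image_le[OF B(1), of push] by (intro exI[of _ "push ` B"]) auto
qed

subsection \<open>Flows on jets\<close>

context little_setup
begin

text \<open>Conjugation by \<open>g\<close> preserves the ideal \<open>JO\<close> and carries
  \<open>x\<close> to \<open>z\<close>.\<close>

lemma tangent_conj:
  assumes g: "g \<in> G" "z = g ** x ** matrix_inv g" and u: "\<And>f. f \<in> JO \<Longrightarrow> mder z u f = 0"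
  shows "matrix_inv g ** u ** g \<in> T"
proof (rule tangent_in_T)
  fix f assume f: "f \<in> JO"
  let ?\<phi> = "\<lambda>A. g ** A ** matrix_inv g"
  let ?f = "\<lambda>A. f (matrix_inv g ** A ** g)"
  have pm: "polymat mat_coords ?\<phi>" "polymat mat_coords (\<lambda>A. matrix_inv g ** A ** g)"
    by (intro polymat_mul polymat_const polymat_id)+
  have fp: "f \<in> poly_fun mat_coords" using f by (simp add: JO_iff)
  have f': "?f \<in> JO"
    unfolding JO_iff
  proof (intro conjI ballI)
    show "?f \<in> poly_fun mat_coords" by (rule polymat_compose[OF fp pm(2)])
    fix w assume "w \<in> Orb"
    then have "matrix_inv g ** w ** matrix_inv (matrix_inv g) \<in> Orb" by (rule O_conj[OF G_inv[OF g(1)]])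
    then show "?f w = 0" using f by (simp add: G_inv_inv[OF g(1)] JO_iff)
  qed
  have d: "dmat (mder x (matrix_inv g ** u ** g)) ?\<phi> = u"
  proof -
    have "dmat (mder x (matrix_inv g ** u ** g)) ?\<phi> = g ** (matrix_inv g ** u ** g) ** matrix_inv g"
      by (simp add: dmat_mul_const[OF pder_mder polymat_mul[OF polymat_const polymat_id]] dmat_const_mul[OF pder_mder polymat_id] dmat_mder)
    then show ?thesis by (simp add: conj_inv_conj[OF g(1)])
  qed
  have "mder x (matrix_inv g ** u ** g) f = mder x (matrix_inv g ** u ** g) (\<lambda>A. ?f (?\<phi> A))"
    by (simp add: conj_conj_inv[OF g(1)])
  also have "\<dots> = mder (?\<phi> x) u ?f"
    using mder_pullback[OF pm(1), of ?f] f' d by (simp add: JO_iff)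
  also have "\<dots> = 0" using u[OF f'] g(2) by simp
  finally show "mder x (matrix_inv g ** u ** g) f = 0" .
qed

lemma tangent_span:
  assumes z: "z \<in> Orb" and u: "\<And>f. f \<in> JO \<Longrightarrow> mder z u f = 0"
  shows "u \<in> cmat.span ((\<lambda>y. lie_bracket y z) ` Orb)"
proof -
  obtain g where g: "g \<in> G" "z = g ** x ** matrix_inv g" using z by (auto simp: orbit_def)
  have "matrix_inv g ** u ** g \<in> cmat.span ((\<lambda>y. lie_bracket y x) ` Orb)"
    using tangent_conj[OF g u] unfolding T_span .
  then have "g ** (matrix_inv g ** u ** g) ** matrix_inv g \<in> cmat.span ((\<lambda>y. lie_bracket y z) ` Orb)"
  proof (rule span_mul)
    fix v assume "v \<in> (\<lambda>y. lie_bracket y x) ` Orb"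
    then obtain y where "y \<in> Orb" "v = lie_bracket y x" by auto
    then have "g ** v ** matrix_inv g = lie_bracket (g ** y ** matrix_inv g) z" "g ** y ** matrix_inv g \<in> Orb"
      using conj_bracket[OF g(1)] O_conj[OF g(1)] g(2) by auto
    then show "g ** v ** matrix_inv g \<in> cmat.span ((\<lambda>y. lie_bracket y z) ` Orb)" by (auto intro: cmat.span_base)
  qed
  then show ?thesis by (simp add: conj_inv_conj[OF g(1)])
qed

lemma tangent_bound:
  assumes z: "z \<in> Orb"
  shows "\<exists>B. finite B \<and> card B \<le> cmat.dim T \<and> (\<forall>u. (\<forall>f\<in>JO. mder z u f = 0) \<longrightarrow> u \<in> cmat.span B)"
proof -
  obtain g where g: "g \<in> G" "z = g ** x ** matrix_inv g" using z by (auto simp: orbit_def)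
  obtain K where K: "K \<subseteq> T" "cmat.independent K" "T \<subseteq> cmat.span K" "card K = cmat.dim T"
    using cmat.basis_exists by blast
  let ?\<phi> = "\<lambda>A. g ** A ** matrix_inv g"
  have fin: "finite K" using cmat.finiteI_independent[OF K(2)] .
  have "u \<in> cmat.span (?\<phi> ` K)" if "\<forall>f\<in>JO. mder z u f = 0" for u
  proof -
    have "matrix_inv g ** u ** g \<in> cmat.span K" using tangent_conj[OF g] that K(3) by blast
    then have "g ** (matrix_inv g ** u ** g) ** matrix_inv g \<in> cmat.span (?\<phi> ` K)"
      by (rule span_mul) (auto intro: cmat.span_base)
    then show ?thesis by (simp add: conj_inv_conj[OF g(1)])
  qed
  then show ?thesis using fin K(4) card_image_le[OF fin, of ?\<phi>] by (intro exI[of _ "?\<phi> ` K"]) auto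
qed

lemma polymat_fl: "s \<in> poly_fun C \<Longrightarrow> polymat C A \<Longrightarrow> polymat C (\<lambda>q. fl y (s q) (A q))"
  unfolding fl_def by (intro polymat_mul polymat_nexp poly_fun_uminus)

lemma fl_add: "fl y s (a + b) = fl y s a + fl y s b" and fl_scale: "fl y s (c *\<^sub>C a) = c *\<^sub>C fl y s a"
  by (simp_all add: fl_def mm_simps)

lemma fl_inverse: "y \<in> Orb \<Longrightarrow> fl y (- s) (fl y s z) = z"
proof -
  assume "y \<in> Orb"
  then have n: "nexp y s ** nexp y (- s) = mat 1" "nexp y (- s) ** nexp y s = mat 1"
    using nexp_inverse[of y s] nexp_inverse[of y "- s"] O_nil by auto
  have "fl y (- s) (fl y s z) = (nexp y (- s) ** nexp y s) ** z ** (nexp y (- s) ** nexp y s)"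
    by (simp add: fl_def matrix_mul_assoc)
  then show ?thesis by (simp add: n)
qed

lemma fl_poly:
  assumes "y \<in> Orb"
  shows "\<exists>p. (\<forall>s. fl y s z $ i $ j = poly p s) \<and> coeff p 0 = z $ i $ j \<and> coeff p 1 = lie_bracket y z $ i $ j"
proof -
  have "polymat {\<lambda>x. x} (\<lambda>s. fl y s z)" by (rule polymat_fl[OF poly_fun_var polymat_const])
  then obtain p where p: "(\<lambda>s. fl y s z $ i $ j) = poly p" using poly_fun_id polymatD by blast
  have "(poly p has_field_derivative lie_bracket y z $ i $ j) (at 0)"
    using DERIV_fl[OF assms, of z i j] unfolding p .
  then have "poly (pderiv p) 0 = lie_bracket y z $ i $ j" using DERIV_unique[OF poly_DERIV] by blast
  moreover have "poly p 0 = z $ i $ j" using fun_cong[OF p, of 0] fl_0[OF assms] by simp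
  ultimately show ?thesis
    using fun_cong[OF p] by (intro exI[of _ p]) (simp add: poly_0_coeff_0 coeff_pderiv)
qed

abbreviation "X \<equiv> mat_zariski closure_of Orb"

lemma jets_X_iff:
  "\<gamma> \<in> jets m X \<longleftrightarrow> (\<forall>k>m. \<gamma> k = 0) \<and> (\<forall>f\<in>JO. \<forall>l\<le>m. ceff l (\<lambda>t. f (arc m \<gamma> t)) = 0)"
  by (simp add: jets_iff vanishing_ideal_closure)

text \<open>A polynomial in \<open>s\<close> that is 0 for every \<open>s\<close> has zero
  coefficients; applied at each point of the orbit, this puts the coefficients \<open>h j\<close>
  into \<open>JO\<close>.\<close>

lemma JO_expand:
  assumes F: "(\<lambda>x. F (fst x) (snd x)) \<in> poly_fun (insert snd ((\<lambda>c x. c (fst x)) ` mat_coords))"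
    and FO: "\<forall>z\<in>Orb. \<forall>s. F z s = (0 :: complex)"
  shows "\<exists>n h. (\<forall>j\<le>(n::nat). h j \<in> JO) \<and> (\<forall>z s. F z s = (\<Sum>j\<le>n. h j z * s ^ j))"
proof -
  obtain n h where h: "\<forall>j. h j \<in> poly_fun mat_coords" "\<forall>z s. F z s = (\<Sum>j\<le>(n::nat). h j z * s ^ j)"
    using poly_fun_param_expand[OF F] by auto
  have "h j z = 0" if "j \<le> n" "z \<in> Orb" for j z
  proof -
    have e: "{i. i \<le> n \<and> i = j} = {j}" using that by auto
    have "ceff j (\<lambda>s. F z s) = 0" using FO that(2) by (simp add: ceff_const)
    then show ?thesis by (simp add: h(2) ceff_monom_sum e)
  qed
  then show ?thesis using h by (intro exI[of _ n] exI[of _ h]) (auto simp: JO_iff)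
qed

text \<open>The index \<open>a = (k, y)\<close> stands for conjugation by
  \<open>exp (\<tau> t^k y)\<close>, truncated to order \<open>m\<close>.\<close>

definition jfl :: "nat \<Rightarrow> nat \<times> (complex^'n^'n) \<Rightarrow> complex \<Rightarrow> (nat \<Rightarrow> complex^'n^'n) \<Rightarrow> nat \<Rightarrow> complex^'n^'n" where
  "jfl m a \<tau> \<gamma> = jet_of m (\<lambda>t. fl (snd a) (\<tau> * t ^ fst a) (arc m \<gamma> t))"

lemma polymat_fl_arc: "polymat {\<lambda>x. x} (\<lambda>t. fl y (\<tau> * t ^ k) (arc m \<gamma> t))"
  by (rule polymat_fl[OF poly_fun_monom polymat_arc])

lemma jfl_flow: "flow (jet_coords m) (jfl m a)"
  unfolding flow_def
proof
  fix c assume "c \<in> (jet_coords m :: ((nat \<Rightarrow> complex^'n^'n) \<Rightarrow> complex) set)"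
  then obtain l i j where c: "c = (\<lambda>\<gamma>. \<gamma> l $ i $ j)" and l: "l \<le> m" by (auto simp: jet_coords_def)
  let ?C = "insert fst ((\<lambda>c x. c (snd x)) ` (jet_coords m :: ((nat \<Rightarrow> complex^'n^'n) \<Rightarrow> complex) set))"
  let ?D = "insert snd ((\<lambda>c x. c (fst x)) ` ?C)"
  let ?F = "\<lambda>p. fl (snd a) (fst (fst p) * snd p ^ fst a) (arc m (snd (fst p)) (snd p)) $ i $ j"
  have 1: "(\<lambda>p. fst (fst p)) \<in> poly_fun ?D" "snd \<in> poly_fun ?D" by (rule poly_fun.coord, blast)+
  have 2: "polymat ?D (\<lambda>p. snd (fst p) k)" if "k \<le> m" for k
    unfolding polymat_def
  proof (intro allI poly_fun.coord)
    fix i j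
    have "(\<lambda>\<gamma>. \<gamma> k $ i $ j) \<in> (jet_coords m :: ((nat \<Rightarrow> complex^'n^'n) \<Rightarrow> complex) set)"
      using that by (auto simp: jet_coords_def)
    then show "(\<lambda>p. snd (fst p) k $ i $ j) \<in> ?D" by (intro insertI2 image_eqI[where x="\<lambda>x. snd x k $ i $ j"]) auto
  qed
  have "polymat ?D (\<lambda>p. fl (snd a) (fst (fst p) * snd p ^ fst a) (arc m (snd (fst p)) (snd p)))"
    unfolding arc_def
    by (intro polymat_fl polymat_sum polymat_scale poly_fun.mult poly_fun_power 1 2) simp
  then have "?F \<in> poly_fun ?D" by (rule polymatD)
  from poly_fun_ceff[OF this, of l]
  have "(\<lambda>q. ceff l (\<lambda>t. ?F (q, t))) \<in> poly_fun ?C" .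
  moreover have "(\<lambda>q. c (jfl m a (fst q) (snd q))) = (\<lambda>q. ceff l (\<lambda>t. ?F (q, t)))"
    by (simp add: c jfl_def jet_of_def l)
  ultimately show "(\<lambda>q. c (jfl m a (fst q) (snd q))) \<in> poly_fun ?C" by simp
qed

text \<open>Expand \<open>f (fl y s z)\<close> in powers of \<open>s\<close> with coefficients
  \<open>h j\<close> in \<open>JO\<close>. Along the arc every \<open>h j\<close> vanishes modulo
  \<open>t ^ (m + 1)\<close>, and the substitution \<open>s = \<tau> t^k\<close> keeps this.\<close>

lemma jfl_jets:
  assumes \<gamma>: "\<gamma> \<in> jets m X" and y: "snd a \<in> Orb"
  shows "jfl m a \<tau> \<gamma> \<in> jets m X"
  unfolding jfl_def
proof (rule jet_of_in_jets[OF polymat_fl_arc])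
  fix f l assume "f \<in> vanishing_ideal X" and l: "l \<le> m"
  then have f: "f \<in> JO" by (simp add: vanishing_ideal_closure)
  let ?D = "insert snd ((\<lambda>c x. c (fst x)) ` (mat_coords :: (complex^'n^'n \<Rightarrow> complex) set))"
  have "polymat ?D fst" by (rule polymat_subst[OF polymat_id, where k=fst]) (rule poly_fun.coord, blast)
  moreover have "snd \<in> poly_fun ?D" by (rule poly_fun.coord) simp
  ultimately have "polymat ?D (\<lambda>x. fl (snd a) (snd x) (fst x))" by (rule polymat_fl[rotated])
  moreover have "f \<in> poly_fun mat_coords" using f by (simp add: JO_iff)
  ultimately have F: "(\<lambda>x. f (fl (snd a) (snd x) (fst x))) \<in> poly_fun ?D" by (rule polymat_compose[rotated])
  have FO: "\<forall>z\<in>Orb. \<forall>s. f (fl (snd a) s z) = 0" using f fl_O[OF y] by (simp add: JO_iff)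
  obtain n h where
    h: "\<forall>j\<le>(n::nat). h j \<in> JO" "\<forall>z s. f (fl (snd a) s z) = (\<Sum>j\<le>n. h j z * s ^ j)"
    using JO_expand[OF F FO] by (elim exE conjE)
  have hp: "(\<lambda>t. h j (arc m \<gamma> t)) \<in> poly_fun {\<lambda>x. x}" if "j \<le> n" for j
  proof (rule polymat_compose[OF _ polymat_arc])
    show "h j \<in> poly_fun mat_coords" using h(1) that by (simp add: JO_iff)
  qed
  have mp: "(\<lambda>t. (\<tau> * t ^ fst a) ^ j) \<in> poly_fun {\<lambda>x. x}" for j by (rule poly_fun_power[OF poly_fun_monom])
  have "ceff l (\<lambda>t. f (fl (snd a) (\<tau> * t ^ fst a) (arc m \<gamma> t))) = (\<Sum>j\<le>n. ceff l (\<lambda>t. h j (arc m \<gamma> t) * (\<tau> * t ^ fst a) ^ j))"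
    unfolding h(2)[rule_format] by (rule ceff_sum) (rule poly_fun.mult[OF hp mp], simp)
  also have "\<dots> = 0"
  proof (rule sum.neutral, rule ballI)
    fix j assume j: "j \<in> {..n}"
    have "ceff i (\<lambda>t. h j (arc m \<gamma> t)) = 0" if "i \<le> l" for i
      using \<gamma> h(1) j that l unfolding jets_X_iff by auto
    then show "ceff l (\<lambda>t. h j (arc m \<gamma> t) * (\<tau> * t ^ fst a) ^ j) = 0"
      using j by (subst ceff_mult[OF hp mp]) auto
  qed
  finally show "ceff l (\<lambda>t. f (fl (snd a) (\<tau> * t ^ fst a) (arc m \<gamma> t))) = 0" .
qed

lemma jfl_base:
  assumes "snd a \<in> Orb"
  shows "jfl m a \<tau> \<gamma> 0 = fl (snd a) (\<tau> * 0 ^ fst a) (\<gamma> 0)"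
  by (intro mat_eqI) (simp add: jfl_def jet_of_def ceff_0[OF polymatD[OF polymat_fl_arc]] arc_0)

lemma jfl_0: "\<gamma> \<in> jets m X \<Longrightarrow> snd a \<in> Orb \<Longrightarrow> jfl m a 0 \<gamma> = \<gamma>"
  unfolding jfl_def by (simp add: fl_0 jet_of_arc jets_X_iff)

lemma agree_fl:
  assumes "polymat {\<lambda>x. x} P" "polymat {\<lambda>x. x} Q" "agree m P Q" "s \<in> poly_fun {\<lambda>x. x}"
  shows "agree m (\<lambda>t. fl y (s t) (P t)) (\<lambda>t. fl y (s t) (Q t))"
  unfolding fl_def
  by (intro agree_mul agree_refl polymat_mul polymat_nexp assms poly_fun_uminus)

text \<open>Truncation between the two conjugations does no harm, as conjugation respects congruence
  modulo \<open>t ^ (m + 1)\<close>.\<close>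

lemma jfl_inverse:
  assumes "\<gamma> \<in> jets m X" "snd a \<in> Orb"
  shows "jfl m a (- \<tau>) (jfl m a \<tau> \<gamma>) = \<gamma>"
proof -
  have "agree m (\<lambda>t. fl (snd a) (- \<tau> * t ^ fst a) (arc m (jfl m a \<tau> \<gamma>) t))
      (\<lambda>t. fl (snd a) (- \<tau> * t ^ fst a) (fl (snd a) (\<tau> * t ^ fst a) (arc m \<gamma> t)))"
    unfolding jfl_def by (rule agree_fl[OF polymat_arc polymat_fl_arc agree_jet_of poly_fun_monom])
  from agree_imp_jet_of_eq[OF this]
  have "jfl m a (- \<tau>) (jfl m a \<tau> \<gamma>) = jet_of m (arc m \<gamma>)"
    using fl_inverse[OF assms(2)] by (simp add: jfl_def[of m a "- \<tau>"])
  then show ?thesis using assms(1) by (simp add: jet_of_arc jets_X_iff)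
qed

text \<open>Up to degree \<open>r\<close> conjugation affects only the constant term, and that only
  through the linear term of the exponential; everything further has degree above
  \<open>r\<close>.\<close>

lemma jfl_low:
  assumes y: "snd a \<in> Orb" and r: "fst a = r" "1 \<le> r" "r \<le> m" and low: "\<And>k. 0 < k \<Longrightarrow> k < r \<Longrightarrow> \<gamma> k = 0" and l: "l \<le> r"
  shows "jfl m a \<tau> \<gamma> l = \<gamma> l + (if l = r then \<tau> *\<^sub>C lie_bracket (snd a) (\<gamma> 0) else 0)"
proof (rule mat_eqI)
  fix i j
  let ?y = "snd a"
  let ?Q = "\<lambda>t. \<gamma> 0 + t ^ r *\<^sub>C \<gamma> r"
  have pQ: "polymat {\<lambda>x. x} ?Q" by (intro polymat_add polymat_scale polymat_const poly_fun_power poly_fun_var)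
  have ag: "agree r (arc m \<gamma>) ?Q" by (rule agree_lowest[OF r(2,3) low])
  obtain p where p: "\<forall>s. fl ?y s (\<gamma> 0) $ i $ j = poly p s" "coeff p 0 = \<gamma> 0 $ i $ j" "coeff p 1 = lie_bracket ?y (\<gamma> 0) $ i $ j"
    using fl_poly[OF y, of "\<gamma> 0" i j] by (elim exE conjE)
  obtain q where q: "\<forall>s. fl ?y s (\<gamma> r) $ i $ j = poly q s" "coeff q 0 = \<gamma> r $ i $ j"
    using fl_poly[OF y, of "\<gamma> r" i j] by (elim exE conjE)
  from agree_fl[OF polymat_arc pQ ag poly_fun_monom, of ?y \<tau> r]
  have "jfl m a \<tau> \<gamma> l $ i $ j = ceff l (\<lambda>t. fl ?y (\<tau> * t ^ r) (?Q t) $ i $ j)"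
    using l r by (simp add: agree_def jfl_def jet_of_def)
  also have "(\<lambda>t. fl ?y (\<tau> * t ^ r) (?Q t) $ i $ j) = (\<lambda>t. poly p (\<tau> * t ^ r) + t ^ r * poly q (\<tau> * t ^ r))"
    by (simp add: fl_add fl_scale p(1) q(1))
  also have "ceff l \<dots> = ceff l (\<lambda>t. poly p (\<tau> * t ^ r)) + ceff l (\<lambda>t. t ^ r * poly q (\<tau> * t ^ r))"
  proof (rule ceff_add)
    have *: "(\<lambda>t. poly u (\<tau> * t ^ r)) \<in> poly_fun {\<lambda>x. x}" for u
    proof -
      have "(\<lambda>t. poly u (\<tau> * t ^ r)) = poly (pcompose u (monom \<tau> r))" by (simp add: fun_eq_iff poly_pcompose poly_monom)
      then show ?thesis unfolding poly_fun_id_iff by blast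
    qed
    show "(\<lambda>t. poly p (\<tau> * t ^ r)) \<in> poly_fun {\<lambda>x. x}" by (rule *)
    show "(\<lambda>t. t ^ r * poly q (\<tau> * t ^ r)) \<in> poly_fun {\<lambda>x. x}" by (intro poly_fun.mult poly_fun_power poly_fun_var *)
  qed
  also have "\<dots> = (\<gamma> l + (if l = r then \<tau> *\<^sub>C lie_bracket ?y (\<gamma> 0) else 0)) $ i $ j"
    unfolding ceff_subst_low[OF r(2) l] p(2,3) q(2) using low[of l] l r(2) by (cases "l = 0") auto
  finally show "jfl m a \<tau> \<gamma> l $ i $ j = (\<gamma> l + (if l = r then \<tau> *\<^sub>C lie_bracket ?y (\<gamma> 0) else 0)) $ i $ j" .
qed

definition single :: "nat \<Rightarrow> complex^'n^'n \<Rightarrow> nat \<Rightarrow> complex^'n^'n" where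
  "single r z = (\<lambda>l. if l = r then z else 0)"

lemma arc_single: "r \<le> m \<Longrightarrow> arc m (single r z) t = t ^ r *\<^sub>C z"
  unfolding arc_def single_def by (subst sum.remove[of _ r]) (auto intro!: sum.neutral)

text \<open>By conicity \<open>f (t ^ r z)\<close> is 0 for every \<open>t\<close>, not only modulo
  a power of \<open>t\<close>.\<close>

lemma single_jets: "r \<le> m \<Longrightarrow> z \<in> Orb \<Longrightarrow> single r z \<in> jets m X"
proof -
  assume "r \<le> m" "z \<in> Orb"
  then have "(\<lambda>t. f (arc m (single r z) t)) = (\<lambda>t. 0)" if "f \<in> JO" for f
    using JO_conical[OF that] by (simp add: arc_single)
  then show "single r z \<in> jets m X"
    using \<open>r \<le> m\<close> unfolding jets_X_iff by (auto simp: ceff_const single_def)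
qed

lemma DERIV_jfl_single:
  assumes y: "snd a \<in> Orb" and rm: "r \<le> m" and l: "l \<le> m"
  shows "((\<lambda>\<tau>. jfl m a \<tau> (single r z) l $ i $ j) has_field_derivative (if l = fst a + r then lie_bracket (snd a) z else 0) $ i $ j) (at 0)"
proof -
  obtain p where p: "\<forall>s. fl (snd a) s z $ i $ j = poly p s" "coeff p 1 = lie_bracket (snd a) z $ i $ j"
    using fl_poly[OF y, of z i j] by (elim exE conjE)
  have "(\<lambda>\<tau>. jfl m a \<tau> (single r z) l $ i $ j) = (\<lambda>\<tau>. ceff l (\<lambda>t. poly p (\<tau> * t ^ fst a) * t ^ r))"
    using l by (simp add: jfl_def jet_of_def arc_single[OF rm] fl_scale p(1) mult.commute)
  then show ?thesis using DERIV_ceff_subst[of l p "fst a" r] p(2) by auto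
qed

end

subsection \<open>Irreducibility and dimension of the jets over the orbit\<close>

context little_setup
begin

abbreviation "JetO m \<equiv> jets_over m X Orb"
abbreviation "Jet0 m \<equiv> jets_over m X {0}"
abbreviation "e \<equiv> cmat.dim T"

lemma jets_over_iff: "\<gamma> \<in> jets_over m X S \<longleftrightarrow> \<gamma> \<in> jets m X \<and> \<gamma> 0 \<in> S"
  by (simp add: jets_over_def)

lemma jfl_JetO: "snd a \<in> Orb \<Longrightarrow> \<gamma> \<in> JetO m \<Longrightarrow> jfl m a \<tau> \<gamma> \<in> JetO m"
  by (simp add: jets_over_iff jfl_jets jfl_base fl_O)

lemma jfl_Jet0: "snd a \<in> Orb \<Longrightarrow> \<gamma> \<in> Jet0 m \<Longrightarrow> jfl m a \<tau> \<gamma> \<in> Jet0 m"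
  by (simp add: jets_over_iff jfl_jets jfl_base) (simp add: fl_def)

lemma single_JetO: "z \<in> Orb \<Longrightarrow> single 0 z \<in> JetO m"
  using single_jets[of 0 m z] by (simp add: jets_over_iff single_def)

text \<open>Jets reached from constant ones by a fixed list of flows with arbitrary times. For flows
  of orbit elements a cell is irreducible, and two cells lie in that of the concatenated
  list.\<close>

primrec cells :: "nat \<Rightarrow> (nat \<times> (complex^'n^'n)) list \<Rightarrow> (nat \<Rightarrow> complex^'n^'n) set" where
  "cells m [] = single 0 ` Orb"
| "cells m (a # as) = {jfl m a \<tau> \<gamma> | \<tau> \<gamma>. \<tau> \<in> UNIV \<and> \<gamma> \<in> cells m as}"

lemma cells_JetO: "snd ` set as \<subseteq> Orb \<Longrightarrow> cells m as \<subseteq> JetO m"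
proof (induction as)
  case Nil
  then show ?case using single_JetO by auto
next
  case (Cons a as)
  then show ?case using jfl_JetO[of a _ m] by auto
qed

lemma cells_Cons: "snd ` set (a # as) \<subseteq> Orb \<Longrightarrow> cells m as \<subseteq> cells m (a # as)"
proof
  fix \<gamma> assume a: "snd ` set (a # as) \<subseteq> Orb" and g: "\<gamma> \<in> cells m as"
  have "\<gamma> \<in> jets m X" using cells_JetO[of as m] a g by (auto simp: jets_over_iff)
  then have "jfl m a 0 \<gamma> = \<gamma>" using a by (intro jfl_0) auto
  then show "\<gamma> \<in> cells m (a # as)" using g unfolding cells.simps by (metis (mono_tags, lifting) UNIV_I mem_Collect_eq)
qed

lemma cells_append: "snd ` set (bs @ as) \<subseteq> Orb \<Longrightarrow> cells m as \<subseteq> cells m (bs @ as)"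
proof (induction bs)
  case (Cons b bs)
  then have "cells m as \<subseteq> cells m (bs @ as)" by simp
  also have "\<dots> \<subseteq> cells m (b # bs @ as)" by (rule cells_Cons) (use Cons in simp)
  finally show ?case by simp
qed simp

lemma cells_append_left: "snd ` set (bs @ as) \<subseteq> Orb \<Longrightarrow> cells m bs \<subseteq> cells m (bs @ as)"
proof (induction bs)
  case Nil
  then have "cells m [] \<subseteq> cells m (as @ [])" by (intro cells_append) simp
  then show ?case by simp
next
  case (Cons b bs)
  then have "cells m bs \<subseteq> cells m (bs @ as)" by simp
  then show ?case by auto
qed

lemma irr_cells: "snd ` set as \<subseteq> Orb \<Longrightarrow> irr (jet_coords m) (cells m as)"
proof (induction as)
  case Nil
  have "irr (jet_coords m) ((\<lambda>g. single 0 (g ** x ** matrix_inv g)) ` G)"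
  proof (rule irr_image[OF irr_G])
    fix c assume "c \<in> (jet_coords m :: ((nat \<Rightarrow> complex^'n^'n) \<Rightarrow> complex) set)"
    then obtain k i j where c: "c = (\<lambda>\<gamma>. \<gamma> k $ i $ j)" by (auto simp: jet_coords_def)
    have pm: "polymat group_coords (\<lambda>g. g ** x ** matrix_inv g)"
      by (intro polymat_mul polymat_group_id polymat_group_inv polymat_const)
    show "\<exists>f\<in>poly_fun group_coords. \<forall>g\<in>G. c (single 0 (g ** x ** matrix_inv g)) = f g"
    proof (cases "k = 0")
      case True
      then show ?thesis using polymatD[OF pm, of i j] by (intro bexI[of _ "\<lambda>g. (g ** x ** matrix_inv g) $ i $ j"]) (simp_all add: c single_def)
    next
      case False
      then show ?thesis by (intro bexI[of _ "\<lambda>_. 0"]) (simp_all add: c single_def poly_fun.const)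
    qed
  qed
  moreover have "(\<lambda>g. single 0 (g ** x ** matrix_inv g)) ` G = cells m []"
    by (auto simp: orbit_def)
  ultimately show ?case by simp
next
  case (Cons a as)
  then have "irr (jet_coords m) (cells m as)" by simp
  then show ?case
    unfolding cells.simps
    by (rule irr_product[OF irr_line]) (rule flow_curve[OF jfl_flow poly_fun.coord] flow_at[OF jfl_flow poly_fun.coord], assumption)+
qed

lemma reach_step:
  assumes "snd a \<in> Orb" "\<gamma> \<in> JetO m" and "\<exists>as. snd ` set as \<subseteq> Orb \<and> jfl m a \<tau> \<gamma> \<in> cells m as"
  shows "\<exists>as. snd ` set as \<subseteq> Orb \<and> \<gamma> \<in> cells m as"
proof -
  obtain as where as: "snd ` set as \<subseteq> Orb" "jfl m a \<tau> \<gamma> \<in> cells m as" using assms(3) by blast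
  have "jfl m a (- \<tau>) (jfl m a \<tau> \<gamma>) = \<gamma>" using assms by (intro jfl_inverse) (simp_all add: jets_over_iff)
  then have "\<gamma> \<in> cells m (a # as)" using as(2) unfolding cells.simps by (metis (mono_tags, lifting) UNIV_I mem_Collect_eq)
  then show ?thesis using as(1) assms(1) by (intro exI[of _ "a # as"]) simp
qed

text \<open>The first nonconstant coefficient of a jet is tangent to the orbit, so that the flows can remove it.\<close>

lemma lowest_tangent:
  assumes \<gamma>: "\<gamma> \<in> JetO m" and r: "1 \<le> r" "r \<le> m" and low: "\<And>k. 0 < k \<Longrightarrow> k < r \<Longrightarrow> \<gamma> k = 0"
  shows "\<gamma> r \<in> cmat.span ((\<lambda>y. lie_bracket y (\<gamma> 0)) ` Orb)"
proof (rule tangent_span)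
  show "\<gamma> 0 \<in> Orb" using \<gamma> by (simp add: jets_over_iff)
  fix f assume f: "f \<in> JO"
  then have fp: "f \<in> poly_fun mat_coords" by (simp add: JO_iff)
  let ?Q = "\<lambda>s. \<gamma> 0 + s *\<^sub>C \<gamma> r"
  have pQ: "polymat {\<lambda>x. x} ?Q" by (intro polymat_add polymat_scale polymat_const poly_fun_var)
  have pQ': "polymat {\<lambda>x. x} (\<lambda>t. ?Q (t ^ r))" by (intro polymat_add polymat_scale polymat_const poly_fun_power poly_fun_var)
  have ag: "agree r (arc m \<gamma>) (\<lambda>t. ?Q (t ^ r))" by (rule agree_lowest[OF r low])
  obtain p where p: "(\<lambda>s. f (?Q s)) = poly p" using poly_fun_id[OF polymat_compose[OF fp pQ]] ..
  \<comment> \<open>Modulo \<open>t ^ (r + 1)\<close> the arc is the line \<open>?Q\<close> at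
    \<open>s = t ^ r\<close>, so this coefficient is the derivative of \<open>f\<close> along
    \<open>\<gamma> r\<close>.\<close>
  have "0 = ceff r (\<lambda>t. f (arc m \<gamma> t))" using \<gamma> f r by (simp add: jets_over_iff jets_X_iff)
  also have "\<dots> = ceff r (\<lambda>t. f (?Q (t ^ r)))"
    using agree_poly_fun[OF fp polymat_arc pQ' ag] by simp
  also have "(\<lambda>t. f (?Q (t ^ r))) = (\<lambda>t. poly p (1 * t ^ r))" using fun_cong[OF p] by simp
  also have "ceff r \<dots> = coeff p 1" using ceff_subst_low(1)[OF r(1) order_refl, of p 1] r(1) by simp
  finally have "coeff p 1 = 0" ..
  moreover have "mder (\<gamma> 0) (\<gamma> r) f = deriv (poly p) 0" using fp by (simp add: mder_def vel_def p)
  moreover have "deriv (poly p) 0 = coeff p 1"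
    using DERIV_imp_deriv[OF poly_DERIV, of p 0] by (simp add: poly_0_coeff_0 coeff_pderiv)
  ultimately show "mder (\<gamma> 0) (\<gamma> r) f = 0" by simp
qed

text \<open>Induction on the number \<open>d\<close> of top coefficients that may be nonzero. The
  lowest of them, of index \<open>r\<close>, is a combination of brackets
  \<open>[y, \<gamma> 0]\<close>; an inner induction removes its summands one at a time by flows
  with \<open>t ^ r\<close>.\<close>

lemma reach:
  assumes "\<gamma> \<in> JetO m"
  shows "\<exists>as. snd ` set as \<subseteq> Orb \<and> \<gamma> \<in> cells m as"
proof -
  have main: "\<And>\<gamma>. \<gamma> \<in> JetO m \<Longrightarrow> (\<forall>k. 0 < k \<and> k + d \<le> m \<longrightarrow> \<gamma> k = 0) \<Longrightarrow> \<exists>as. snd ` set as \<subseteq> Orb \<and> \<gamma> \<in> cells m as" for d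
  proof (induction d)
    case 0
    have "\<gamma> = single 0 (\<gamma> 0)"
    proof
      fix k show "\<gamma> k = single 0 (\<gamma> 0) k"
        using 0 by (cases "k = 0"; cases "k \<le> m") (auto simp: single_def jets_over_iff jets_X_iff)
    qed
    then have "\<gamma> \<in> cells m []" using 0(1) by (auto simp: jets_over_iff)
    then show ?case by (intro exI[of _ "[]"]) simp
  next
    case (Suc d)
    show ?case
    proof (cases "d < m")
      case False
      then have "\<forall>k. 0 < k \<and> k + d \<le> m \<longrightarrow> \<gamma> k = 0" by auto
      then show ?thesis by (rule Suc.IH[OF Suc.prems(1)])
    next
      case True
      define r where "r = m - d"
      have r: "1 \<le> r" "r \<le> m" using True by (auto simp: r_def)
      have low: "\<forall>k. 0 < k \<and> k + d \<le> m \<longrightarrow> \<delta> k = 0" if "\<forall>k. 0 < k \<and> k < r \<longrightarrow> \<delta> k = 0" "\<delta> r = 0" for \<delta> :: "nat \<Rightarrow> complex^'n^'n"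
      proof (intro allI impI)
        fix k assume k: "0 < k \<and> k + d \<le> m"
        then show "\<delta> k = 0" using that by (cases "k = r") (auto simp: r_def)
      qed
      have claim: "\<forall>\<delta>\<in>JetO m. \<delta> 0 = \<gamma> 0 \<and> (\<forall>k. 0 < k \<and> k < r \<longrightarrow> \<delta> k = 0) \<and> \<delta> r = v \<longrightarrow> (\<exists>as. snd ` set as \<subseteq> Orb \<and> \<delta> \<in> cells m as)"
        if "v \<in> cmat.span ((\<lambda>y. lie_bracket y (\<gamma> 0)) ` Orb)" for v
        using that
      proof (induction rule: cmat.span_induct_alt)
        case base
        show ?case
        proof (intro ballI impI)
          fix \<delta> assume \<delta>: "\<delta> \<in> JetO m" "\<delta> 0 = \<gamma> 0 \<and> (\<forall>k. 0 < k \<and> k < r \<longrightarrow> \<delta> k = 0) \<and> \<delta> r = 0"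
          show "\<exists>as. snd ` set as \<subseteq> Orb \<and> \<delta> \<in> cells m as"
            by (rule Suc.IH[OF \<delta>(1) low]) (use \<delta>(2) in auto)
        qed
      next
        case (step c b w)
        then obtain y where y: "y \<in> Orb" "b = lie_bracket y (\<gamma> 0)" by auto
        show ?case
        proof (intro ballI impI)
          fix \<delta> assume \<delta>: "\<delta> \<in> JetO m" "\<delta> 0 = \<gamma> 0 \<and> (\<forall>k. 0 < k \<and> k < r \<longrightarrow> \<delta> k = 0) \<and> \<delta> r = c *\<^sub>C b + w"
          let ?\<epsilon> = "jfl m (r, y) (- c) \<delta>"
          have low: "?\<epsilon> l = \<delta> l + (if l = r then (- c) *\<^sub>C lie_bracket y (\<delta> 0) else 0)" if "l \<le> r" for l
            using jfl_low[of "(r, y)" r m \<delta> l "- c"] y(1) r \<delta>(2) that by simp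
          have "?\<epsilon> \<in> JetO m" using jfl_JetO[OF _ \<delta>(1), of "(r, y)"] y(1) by simp
          moreover have "?\<epsilon> 0 = \<gamma> 0 \<and> (\<forall>k. 0 < k \<and> k < r \<longrightarrow> ?\<epsilon> k = 0) \<and> ?\<epsilon> r = w"
            using low[of 0] low[of r] low r \<delta>(2) y(2) by (auto simp: cmat.scale_minus_left)
          ultimately have "\<exists>as. snd ` set as \<subseteq> Orb \<and> ?\<epsilon> \<in> cells m as" using step.IH by blast
          then show "\<exists>as. snd ` set as \<subseteq> Orb \<and> \<delta> \<in> cells m as" using y(1) by (intro reach_step[OF _ \<delta>(1)]) simp_all
        qed
      qed
      have g: "\<forall>k. 0 < k \<and> k < r \<longrightarrow> \<gamma> k = 0" using Suc.prems(2) by (auto simp: r_def)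
      have "\<gamma> r \<in> cmat.span ((\<lambda>y. lie_bracket y (\<gamma> 0)) ` Orb)"
        by (rule lowest_tangent[OF Suc.prems(1) r]) (use g in blast)
      from claim[OF this] show ?thesis using Suc.prems(1) g by blast
    qed
  qed
  show ?thesis using main[OF assms, of m] by simp
qed

text \<open>A jet where \<open>f\<close> is nonzero and a jet where \<open>g\<close> is nonzero lie
  in a common cell, and that cell is irreducible.\<close>

lemma irr_JetO: "irr (jet_coords m) (JetO m)"
  unfolding irr_def
proof (intro conjI ballI impI)
  show "JetO m \<noteq> {}" using single_JetO[OF x_in_O] by blast
  fix f g assume fg: "f \<in> poly_fun (jet_coords m)" "g \<in> poly_fun (jet_coords m)" "\<forall>q\<in>JetO m. f q * g q = 0"
  show "(\<forall>q\<in>JetO m. f q = 0) \<or> (\<forall>q\<in>JetO m. g q = 0)"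
  proof (rule ccontr)
    assume "\<not> ?thesis"
    then obtain p q where pq: "p \<in> JetO m" "f p \<noteq> 0" "q \<in> JetO m" "g q \<noteq> 0" by blast
    obtain as where as: "snd ` set as \<subseteq> Orb" "p \<in> cells m as" using reach[OF pq(1)] by blast
    obtain bs where bs: "snd ` set bs \<subseteq> Orb" "q \<in> cells m bs" using reach[OF pq(3)] by blast
    have ab: "snd ` set (as @ bs) \<subseteq> Orb" using as bs by auto
    have "\<forall>q\<in>cells m (as @ bs). f q * g q = 0" using fg(3) cells_JetO[OF ab] by blast
    from irr_disj[OF irr_cells[OF ab] fg(1,2) this] show False
      using cells_append[OF ab, of m] cells_append_left[OF ab, of m] as(2) bs(2) pq(2,4) by blast
  qed
qed

text \<open>Apply \<open>\<xi>\<close> to the \<open>l\<close>-th coefficient of \<open>f\<close>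
  along the arc. At a constant jet the coefficients of positive index vanish, so the result
  \<open>D\<close> is a derivation at \<open>z\<close>; it kills \<open>JO\<close>. Each of the
  \<open>m + 1\<close> coordinates of \<open>\<xi>\<close> is thus tangent to the orbit at
  \<open>z\<close>.\<close>

lemma JetO_tang_single:
  assumes z: "z \<in> Orb"
  shows "\<exists>B. finite B \<and> card B \<le> (m + 1) * e \<and> tang (jet_coords m) (JetO m) (single 0 z) \<subseteq> cfun.span B"
proof -
  obtain K where K: "finite K" "card K \<le> e" "\<forall>u. (\<forall>f\<in>JO. mder z u f = 0) \<longrightarrow> u \<in> cmat.span K"
    using tangent_bound[OF z] by blast
  let ?p = "single 0 z"
  have arcp: "arc m ?p t = z" for t using arc_single[of 0 m z t] by (simp add: cmat.scale_one)
  let ?B = "(\<lambda>(l, b). vel (jet_coords m) (jet_shift l b ?p)) ` ({..m} \<times> K)"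
  have "\<xi> \<in> cfun.span ?B" if xi: "\<xi> \<in> tang (jet_coords m) (JetO m) ?p" for \<xi>
  proof (rule jet_tang_span[OF _ K(1)])
    show pd: "pder (jet_coords m) ?p \<xi>" using xi by (simp add: tang_def)
    fix l assume l: "l \<le> m"
    let ?c = "\<lambda>l (f :: complex^'n^'n \<Rightarrow> complex) \<gamma>. ceff l (\<lambda>t. f (arc m \<gamma> t))"
    let ?C = "jet_coords m :: ((nat \<Rightarrow> complex^'n^'n) \<Rightarrow> complex) set"
    have pf: "(\<lambda>t. f (arc m \<gamma> t)) \<in> poly_fun {\<lambda>x. x}" if "f \<in> poly_fun mat_coords" for f \<gamma>
      by (rule polymat_compose[OF that polymat_arc])
    have pc: "?c l f \<in> poly_fun ?C" if "f \<in> poly_fun mat_coords" for f l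
    proof -
      let ?D = "insert snd ((\<lambda>c x. c (fst x)) ` ?C)"
      have "polymat ?D (\<lambda>x. fst x k)" if "k \<le> m" for k
        by (rule polymat_subst[OF polymat_jet[OF that], where k=fst]) (rule poly_fun.coord, blast)
      moreover have "snd \<in> poly_fun ?D" by (rule poly_fun.coord) simp
      ultimately have "polymat ?D (\<lambda>x. arc m (fst x) (snd x))"
        unfolding arc_def by (intro polymat_sum polymat_scale poly_fun_power) simp_all
      from poly_fun_ceff[OF polymat_compose[OF that this], of l] show ?thesis by simp
    qed
    define D where "D f = (if f \<in> poly_fun mat_coords then \<xi> (?c l f) else 0)" for f
    have "pder mat_coords z D"
      unfolding pder_def
    proof (intro conjI ballI allI impI)
      show "\<And>a. D (\<lambda>_. a) = 0" by (simp add: D_def poly_fun.const pder_const[OF pd])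
      fix f g :: "complex^'n^'n \<Rightarrow> complex" assume f: "f \<in> poly_fun mat_coords" and g: "g \<in> poly_fun mat_coords"
      have "?c l (\<lambda>q. f q + g q) = (\<lambda>\<gamma>. ?c l f \<gamma> + ?c l g \<gamma>)" by (simp add: ceff_add pf f g)
      then show "D (\<lambda>q. f q + g q) = D f + D g"
        using pder_add[OF pd pc[OF f] pc[OF g]] by (simp add: D_def f g poly_fun.add)
      have "?c l (\<lambda>q. f q * g q) = (\<lambda>\<gamma>. \<Sum>i\<le>l. ?c i f \<gamma> * ?c (l - i) g \<gamma>)" by (simp add: ceff_mult pf f g)
      then have "D (\<lambda>q. f q * g q) = \<xi> (\<lambda>\<gamma>. \<Sum>i\<le>l. ?c i f \<gamma> * ?c (l - i) g \<gamma>)" by (simp add: D_def f g poly_fun.mult)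
      also have "\<dots> = (\<Sum>i\<le>l. \<xi> (\<lambda>\<gamma>. ?c i f \<gamma> * ?c (l - i) g \<gamma>))"
        by (rule pder_sum[OF pd]) (rule poly_fun.mult[OF pc[OF f] pc[OF g]])
      also have "\<dots> = (\<Sum>i\<le>l. (if i = 0 then f z * \<xi> (?c l g) else 0) + (if i = l then g z * \<xi> (?c l f) else 0))"
        by (rule sum.cong[OF refl], subst pder_mult[OF pd pc[OF f] pc[OF g]]) (auto simp: arcp ceff_const)
      also have "\<dots> = f z * D g + g z * D f" by (simp add: sum.distrib D_def f g)
      finally show "D (\<lambda>q. f q * g q) = f z * D g + g z * D f" .
    qed (simp add: D_def)
    then have D: "D = mder z (\<chi> i j. \<xi> (\<lambda>\<gamma>. \<gamma> l $ i $ j))"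
    proof (rule mder_eqI)
      show "dmat D (\<lambda>A. A) = (\<chi> i j. \<xi> (\<lambda>\<gamma>. \<gamma> l $ i $ j))"
        using l by (intro mat_eqI) (simp add: D_def coord_poly ceff_arc)
    qed
    have "D f = 0" if "f \<in> JO" for f
    proof -
      have "\<forall>\<gamma>\<in>JetO m. ?c l f \<gamma> = 0" using that l by (simp add: jets_over_iff jets_X_iff)
      then show ?thesis using xi pc[of f l] that by (simp add: D_def tang_def)
    qed
    then show "(\<chi> i j. \<xi> (\<lambda>\<gamma>. \<gamma> l $ i $ j)) \<in> cmat.span K" using K(3) unfolding D by blast
  qed
  moreover have "card ?B \<le> (m + 1) * e"
  proof -
    have "card ?B \<le> card ({..m} \<times> K)" by (rule card_image_le) (simp add: K(1))
    also have "\<dots> \<le> (m + 1) * e" using mult_le_mono2[OF K(2), of "m + 1"] by (simp add: card_cartesian_product)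
    finally show ?thesis .
  qed
  ultimately show ?thesis using K(1) by (intro exI[of _ ?B]) auto
qed

text \<open>Flows connect every jet over the orbit with a constant one, and tangent spaces are
  transported along them.\<close>

lemma JetO_tang:
  assumes "p \<in> JetO m"
  shows "\<exists>B. finite B \<and> card B \<le> (m + 1) * e \<and> tang (jet_coords m) (JetO m) p \<subseteq> cfun.span B"
proof -
  obtain as where "snd ` set as \<subseteq> Orb" "p \<in> cells m as" using reach[OF assms] by blast
  then show ?thesis
  proof (induction as arbitrary: p)
    case Nil
    then show ?case using JetO_tang_single by auto
  next
    case (Cons a as)
    obtain \<tau> q where q: "p = jfl m a \<tau> q" "q \<in> cells m as" using Cons.prems(2) by auto
    have a: "snd a \<in> Orb" and as_O: "snd ` set as \<subseteq> Orb" using Cons.prems(1) by auto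
    have qJ: "q \<in> JetO m" using cells_JetO[OF as_O] q(2) by blast
    have ret: "jfl m a (- \<tau>) p = q" unfolding q(1) using jfl_inverse[OF _ a] qJ by (simp add: jets_over_iff)
    obtain B where B: "finite B" "card B \<le> (m + 1) * e" "tang (jet_coords m) (JetO m) q \<subseteq> cfun.span B"
      using Cons.IH[OF as_O q(2)] by blast
    have "\<exists>B'. finite B' \<and> card B' \<le> card B \<and> tang (jet_coords m) (JetO m) p \<subseteq> cfun.span B'"
    proof (rule tang_transport[where \<phi>="jfl m a \<tau>" and \<psi>="jfl m a (- \<tau>)"])
      show "jfl m a (- \<tau>) q \<in> JetO m" if "q \<in> JetO m" for q by (rule jfl_JetO[OF a that])
      show "jfl m a \<tau> (jfl m a (- \<tau>) q) = q" if "q \<in> JetO m" for q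
        using jfl_inverse[OF _ a, of q m "- \<tau>"] that by (simp add: jets_over_iff)
      show "p \<in> JetO m" unfolding q(1) by (rule jfl_JetO[OF a qJ])
    qed (use B ret in \<open>auto intro: flow_at[OF jfl_flow]\<close>)
    then show ?case using B(2) by (meson le_trans)
  qed
qed

lemma JetO_chain_le:
  assumes "zchain (jet_coords m) S n Z" "\<forall>f\<in>poly_fun (jet_coords m). (\<forall>p\<in>JetO m. f p = 0) \<longrightarrow> (\<forall>q\<in>S. f q = 0)"
  shows "n \<le> (m + 1) * e"
  by (rule chain_length_le[OF finite_jet_coords irr_JetO assms JetO_tang])

end

subsection \<open>Jets over zero\<close>

lemma deriv_eq_ceff: "f \<in> poly_fun {\<lambda>x. x} \<Longrightarrow> deriv f 0 = ceff 1 f"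
proof -
  assume "f \<in> poly_fun {\<lambda>x. x}"
  then obtain p where p: "f = poly p" unfolding poly_fun_id_iff ..
  show ?thesis unfolding p ceff_poly using DERIV_imp_deriv[OF poly_DERIV, of p 0] by (simp add: poly_0_coeff_0 coeff_pderiv)
qed

lemma flow_jet_shift:
  fixes w :: "complex^'n^'n"
  shows "flow (jet_coords m) (\<lambda>\<tau> \<gamma>. jet_shift l w \<gamma> \<tau>)"
  unfolding flow_def
proof
  fix c assume "c \<in> (jet_coords m :: ((nat \<Rightarrow> complex^'n^'n) \<Rightarrow> complex) set)"
  then obtain k i j where c: "c = (\<lambda>\<gamma>. \<gamma> k $ i $ j)" and k: "k \<le> m" by (auto simp: jet_coords_def)
  let ?D = "insert fst ((\<lambda>c x. c (snd x)) ` (jet_coords m :: ((nat \<Rightarrow> complex^'n^'n) \<Rightarrow> complex) set))"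
  have s: "polymat ?D (\<lambda>x. snd x k)"
    by (rule polymat_subst[OF polymat_jet[OF k], where k=snd]) (rule poly_fun.coord, blast)
  have f: "fst \<in> poly_fun ?D" by (rule poly_fun.coord) simp
  have "polymat ?D (\<lambda>x. snd x k + (if k = l then fst x *\<^sub>C w else 0))"
    using s polymat_add[OF s polymat_scale[OF f polymat_const[of _ w]]] by (cases "k = l") simp_all
  then have "(\<lambda>x. (snd x k + (if k = l then fst x *\<^sub>C w else 0)) $ i $ j) \<in> poly_fun ?D" by (rule polymatD)
  moreover have "(\<lambda>x. c (jet_shift l w (snd x) (fst x))) = (\<lambda>x. (snd x k + (if k = l then fst x *\<^sub>C w else 0)) $ i $ j)"
    by (auto simp: c jet_shift_def fun_eq_iff)
  ultimately show "(\<lambda>x. c (jet_shift l w (snd x) (fst x))) \<in> poly_fun ?D" by simp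
qed

text \<open>Coordinates of index above \<open>m\<close> are 0 on \<open>S\<close>, so both sets of
  coordinates restrict to the same functions there.\<close>

lemma jet_zariski_zchain:
  fixes S :: "(nat \<Rightarrow> complex^'n^'n) set"
  assumes S: "\<And>\<gamma> k. \<gamma> \<in> S \<Longrightarrow> k > m \<Longrightarrow> \<gamma> k = 0"
  shows "zchain {(\<lambda>\<gamma>. \<gamma> k $ i $ j) | k i j. True} S n Z \<longleftrightarrow> zchain (jet_coords m) S n Z"
proof
  let ?C = "{(\<lambda>\<gamma> :: nat \<Rightarrow> complex^'n^'n. \<gamma> k $ i $ j) | k i j. True}"
  have a: "\<exists>g\<in>poly_fun ?C. \<forall>q\<in>S. c q = g q" if "c \<in> jet_coords m" for c
    using that by (intro bexI[of _ c]) (auto simp: jet_coords_def intro!: poly_fun.coord)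
  have b: "\<exists>g\<in>poly_fun (jet_coords m). \<forall>q\<in>S. c q = g q" if "c \<in> ?C" for c
  proof -
    obtain k i j where c: "c = (\<lambda>\<gamma>. \<gamma> k $ i $ j)" using \<open>c \<in> ?C\<close> by blast
    show ?thesis
    proof (cases "k \<le> m")
      case True
      then show ?thesis unfolding c by (intro bexI[OF _ jet_coordI]) auto
    next
      case False
      then have "\<forall>q\<in>S. q k $ i $ j = 0" by (intro ballI, subst S) simp_all
      then show ?thesis unfolding c by (intro bexI[of _ "\<lambda>_. 0"]) (simp_all add: poly_fun.const)
    qed
  qed
  show "zchain ?C S n Z \<Longrightarrow> zchain (jet_coords m) S n Z"
    using zchain_transfer[of ?C S n Z "\<lambda>q. q" S "\<lambda>q. q" "jet_coords m"] a b by simp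
  show "zchain (jet_coords m) S n Z \<Longrightarrow> zchain ?C S n Z"
    using zchain_transfer[of "jet_coords m" S n Z "\<lambda>q. q" S "\<lambda>q. q" ?C] a b by simp
qed

lemma krull_dim_eqI:
  assumes "zchain C S e Z" "\<And>n Z. zchain C S n Z \<Longrightarrow> n \<le> e"
  shows "krull_dim (subtopology (zariski C) S) = enat e"
  by (rule antisym[OF krull_dim_leI krull_dim_geI]) (use assms in auto)

context little_setup
begin

lemma vel_jfl_trace:
  assumes "snd a \<in> Orb" "r \<le> m" "l \<le> m"
  shows "vel (jet_coords m) (\<lambda>\<tau>. jfl m a \<tau> (single r z)) (\<lambda>\<gamma>. trace (s ** \<gamma> l)) =
    (if l = fst a + r then trace (s ** lie_bracket (snd a) z) else 0)"
proof -
  have "vel (jet_coords m) (\<lambda>\<tau>. jfl m a \<tau> (single r z)) (\<lambda>\<gamma>. trace (s ** \<gamma> l)) =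
      trace (s ** (if l = fst a + r then lie_bracket (snd a) z else 0))"
    by (rule vel_jet_trace[OF assms(3)]) (rule DERIV_jfl_single[OF assms])
  then show ?thesis by (simp add: mm_simps)
qed

abbreviation "spd \<equiv> (\<lambda>y. lie_bracket y x) ` Orb"

lemma dim_spd: "cmat.dim spd = e"
  unfolding T_span by (rule cmat.dim_span[symmetric])

text \<open>At the constant jet \<open>x\<close> the flow with \<open>t ^ l\<close> has velocity
  \<open>[y, x]\<close> in coordinate \<open>l\<close> and 0 in all others, so the
  \<open>m + 1\<close> coordinates contribute independently.\<close>

lemma JetO_chain: "\<exists>Z. zchain (jet_coords m) (JetO m) ((m + 1) * e) Z"
proof (rule flows_chain[where \<Lambda>="UNIV \<times> Orb" and E="jfl m" and x="single 0 x"])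
  show "single 0 x \<in> JetO m" by (rule single_JetO[OF x_in_O])
  fix B assume B: "finite B" "\<forall>a\<in>UNIV \<times> Orb. vel (jet_coords m) (\<lambda>\<tau>. jfl m a \<tau> (single 0 x)) \<in> cfun.span B"
  obtain Y where Y: "\<And>d. d \<in> spd \<Longrightarrow> Y d \<in> Orb \<and> d = lie_bracket (Y d) x"
      using bchoice[of spd "\<lambda>d y. y \<in> Orb \<and> d = lie_bracket y x"] by blast
  have "(\<Sum>l\<le>m. cmat.dim spd) \<le> card B"
  proof (rule jet_velocities_card[OF B(1), where \<xi>="\<lambda>l d. vel (jet_coords m) (\<lambda>\<tau>. jfl m (l, Y d) \<tau> (single 0 x))"])
    show "vel (jet_coords m) (\<lambda>\<tau>. jfl m (l, Y d) \<tau> (single 0 x)) \<in> cfun.span B" if "d \<in> spd" for l d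
      using B(2) Y[OF that] by simp
    show "vel (jet_coords m) (\<lambda>\<tau>. jfl m (l, Y d) \<tau> (single 0 x)) (\<lambda>\<gamma>. trace (s ** \<gamma> l')) = (if l' = l then trace (s ** d) else 0)"
      if "d \<in> spd" "l' \<le> m" for l d l' s
      using vel_jfl_trace[of "(l, Y d)" 0 m l' x s] Y[OF that(1)] that(2) by auto
  qed
  then show "(m + 1) * e \<le> card B" by (simp add: dim_spd)
next
  fix a :: "nat \<times> (complex^'n^'n)" assume a: "a \<in> UNIV \<times> Orb"
  show "flow (jet_coords m) (jfl m a)" by (rule jfl_flow)
  fix \<tau> z assume z: "z \<in> JetO m"
  show "jfl m a \<tau> z \<in> JetO m" using jfl_JetO[OF _ z] a by auto
  show "jfl m a 0 z = z" "jfl m a (- \<tau>) (jfl m a \<tau> z) = z"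
    using a z by (auto simp: jets_over_iff intro!: jfl_0 jfl_inverse)
qed simp

lemma jets_tail: "\<gamma> \<in> jets_over m X S \<Longrightarrow> k > m \<Longrightarrow> \<gamma> k = 0"
  by (simp add: jets_over_iff jets_X_iff)

lemma krull_JetO: "krull_dim (subtopology jet_zariski (JetO m)) = enat ((m + 1) * e)"
proof -
  obtain Z where Z: "zchain (jet_coords m) (JetO m) ((m + 1) * e) Z" using JetO_chain by blast
  show ?thesis
  proof (rule krull_dim_eqI)
    show "zchain {(\<lambda>\<gamma>. \<gamma> k $ i $ j) | k i j. True} (JetO m) ((m + 1) * e) Z"
      using Z jet_zariski_zchain[of "JetO m" m] jets_tail by blast
    fix n Z' assume "zchain {(\<lambda>\<gamma> :: nat \<Rightarrow> complex^'n^'n. \<gamma> k $ i $ j) | k i j. True} (JetO m) n Z'"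
    then have "zchain (jet_coords m) (JetO m) n Z'" using jet_zariski_zchain[of "JetO m" m] jets_tail by blast
    then show "n \<le> (m + 1) * e" by (rule JetO_chain_le) simp
  qed
qed

text \<open>Jets of order 0 are points, so both bounds for jets apply with
  \<open>m = 0\<close>.\<close>

lemma krull_O: "krull_dim (subtopology mat_zariski Orb) = enat e"
proof -
  have J: "single 0 (\<gamma> 0) = \<gamma>" if "\<gamma> \<in> JetO 0" for \<gamma>
    using that by (auto simp: single_def jets_over_iff jets_X_iff fun_eq_iff)
  have c1: "\<exists>g\<in>poly_fun mat_coords. \<forall>z\<in>Orb. c (single 0 z) = g z" if "c \<in> jet_coords 0" for c
  proof -
    obtain i j where "c = (\<lambda>\<gamma>. \<gamma> 0 $ i $ j)" using \<open>c \<in> jet_coords 0\<close> by (auto simp: jet_coords_def)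
    then show ?thesis by (intro bexI[OF _ coord_poly[of i j]]) (simp add: single_def)
  qed
  have c2: "\<exists>g\<in>poly_fun (jet_coords 0). \<forall>\<gamma>\<in>JetO 0. c (\<gamma> 0) = g \<gamma>" if "c \<in> mat_coords" for c :: "complex^'n^'n \<Rightarrow> complex"
  proof -
    obtain i j where "c = (\<lambda>A. A $ i $ j)" using \<open>c \<in> mat_coords\<close> by (auto simp: mat_coords_def)
    then show ?thesis by (intro bexI[OF _ jet_coordI[of 0 0 i j]]) simp_all
  qed
  obtain Z where Z: "zchain (jet_coords 0) (JetO 0) e Z" using JetO_chain[of 0] by auto
  show ?thesis
  proof (rule krull_dim_eqI)
    show "zchain mat_coords Orb e (\<lambda>i. (\<lambda>\<gamma>. \<gamma> 0) ` Z i)"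
      by (rule zchain_transfer[OF Z, where \<Psi>="single 0"])
         (use single_JetO J c1 c2 in \<open>auto simp: jets_over_iff single_def\<close>)
    fix n Z assume Z: "zchain mat_coords Orb n Z"
    have "zchain (jet_coords 0) (JetO 0) n (\<lambda>i. single 0 ` Z i)"
      by (rule zchain_transfer[OF Z, where \<Psi>="\<lambda>\<gamma>. \<gamma> 0"])
         (use single_JetO J c1 c2 in \<open>auto simp: jets_over_iff single_def\<close>)
    from JetO_chain_le[OF this] show "n \<le> e" by simp
  qed
qed

text \<open>
  Over \<open>0\<close> the last coefficient of a jet moves freely in \<open>I\<close>, since every function vanishing on the
  orbit has zero derivative at \<open>0\<close> in the directions of \<open>I\<close>.
\<close>

lemma shift_Jet0:
  assumes m: "1 \<le> m" and \<gamma>: "\<gamma> \<in> Jet0 m" and w: "w \<in> I"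
  shows "jet_shift m w \<gamma> \<tau> \<in> Jet0 m"
proof -
  have \<gamma>X: "\<gamma> \<in> jets m X" "\<gamma> 0 = 0" using \<gamma> by (auto simp: jets_over_iff)
  have arcs: "arc m (jet_shift m w \<gamma> \<tau>) t = arc m \<gamma> t + (\<tau> * t ^ m) *\<^sub>C w" for t
  proof -
    have "(\<Sum>k\<in>{..m} - {m}. t ^ k *\<^sub>C jet_shift m w \<gamma> \<tau> k) = (\<Sum>k\<in>{..m} - {m}. t ^ k *\<^sub>C \<gamma> k)"
      by (rule sum.cong) (auto simp: jet_shift_def)
    then show ?thesis unfolding arc_def
      by (subst (1 2) sum.remove[of _ m]) (auto simp: jet_shift_def cmat.scale_right_distrib mult.commute)
  qed
  have "ceff l (\<lambda>t. f (arc m (jet_shift m w \<gamma> \<tau>) t)) = 0" if f: "f \<in> JO" and l: "l \<le> m" for f l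
  proof -
    have fp: "f \<in> poly_fun mat_coords" using f by (simp add: JO_iff)
    let ?D = "insert snd ((\<lambda>c x. c (fst x)) ` (mat_coords :: (complex^'n^'n \<Rightarrow> complex) set))"
    have "polymat ?D fst" by (rule polymat_subst[OF polymat_id, where k=fst]) (rule poly_fun.coord, blast)
    moreover have "snd \<in> poly_fun ?D" by (rule poly_fun.coord) simp
    ultimately have "polymat ?D (\<lambda>x. fst x + snd x *\<^sub>C w)" by (intro polymat_add polymat_scale polymat_const)
    \<comment> \<open>Expand \<open>f (z + s w)\<close> in \<open>s\<close> and put
      \<open>s = \<tau> t ^ m\<close>. The term of index 0 is the old jet condition; the term of
      index 1 reaches degree \<open>m\<close> only through \<open>h 1 0\<close>, the derivative of
      \<open>f\<close> at 0 along \<open>w\<close>; the later terms start beyond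
      \<open>t ^ m\<close>.\<close>
    from poly_fun_param_expand[OF polymat_compose[OF fp this], unfolded fst_conv snd_conv]
    obtain n h where h: "\<forall>j. h j \<in> poly_fun mat_coords" "\<forall>z s. f (z + s *\<^sub>C w) = (\<Sum>j\<le>(n::nat). h j z * s ^ j)"
      by (elim exE conjE)
    have h0: "h 0 z = f z" for z
      using h(2)[rule_format, of z 0] by (simp add: cmat.scale_zero_left sum.atMost_shift)
    have h1: "h 1 0 = 0" if "1 \<le> n"
    proof -
      have e: "{j. j \<le> n \<and> j = 1} = {1}" using that by auto
      have p: "(\<lambda>s. f (0 + s *\<^sub>C w)) \<in> poly_fun {\<lambda>x. x}"
        unfolding h(2)[rule_format] by (rule poly_fun_sum) (rule poly_fun_monom)
      have "mder 0 w f = ceff 1 (\<lambda>s. f (0 + s *\<^sub>C w))" using deriv_eq_ceff[OF p] fp by (simp add: mder_def vel_def)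
      also have "\<dots> = h 1 0" unfolding h(2)[rule_format] using e by (simp add: ceff_monom_sum)
      finally show ?thesis using mder_zero_I[OF f w] by simp
    qed
    have hp: "(\<lambda>t. h j (arc m \<gamma> t)) \<in> poly_fun {\<lambda>x. x}" for j
      by (rule polymat_compose[OF h(1)[rule_format] polymat_arc])
    have "ceff l (\<lambda>t. f (arc m (jet_shift m w \<gamma> \<tau>) t)) = (\<Sum>j\<le>n. ceff l (\<lambda>t. h j (arc m \<gamma> t) * (\<tau> ^ j * t ^ (m * j))))"
      unfolding arcs h(2)[rule_format] power_mult_distrib power_mult[symmetric]
      by (rule ceff_sum) (rule poly_fun.mult[OF hp poly_fun_monom])
    also have "\<dots> = 0"
    proof (rule sum.neutral, rule ballI)
      fix j assume j: "j \<in> {..n}"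
      have "ceff i (\<lambda>t. h j (arc m \<gamma> t)) * (if m * j = l - i then \<tau> ^ j else 0) = 0" if i: "i \<le> l" for i
      proof (cases "m * j = l - i")
        case True
        consider "j = 0" | "j = 1" | "2 \<le> j" by linarith
        then show ?thesis
        proof cases
          case 1
          have "ceff i (\<lambda>t. f (arc m \<gamma> t)) = 0" using \<gamma>X(1) f i l by (simp add: jets_X_iff)
          then show ?thesis using 1 by (simp add: h0)
        next
          case 2
          then have "i = 0" using True i l by auto
          then show ?thesis using 2 j h1 by (simp add: ceff_0[OF hp] arc_0 \<gamma>X(2))
        next
          case 3
          then have "m * 2 \<le> m * j" by simp
          then show ?thesis using True l m by linarith
        qed
      qed simp
      then show "ceff l (\<lambda>t. h j (arc m \<gamma> t) * (\<tau> ^ j * t ^ (m * j))) = 0"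
        unfolding ceff_mult[OF hp poly_fun_monom] ceff_monom by (intro sum.neutral ballI) (simp only: atMost_iff)
    qed
    finally show ?thesis .
  qed
  then have "jet_shift m w \<gamma> \<tau> \<in> jets m X"
    using \<gamma>X(1) unfolding jets_X_iff by (auto simp: jet_shift_def)
  then show ?thesis using \<gamma>X(2) m by (simp add: jets_over_iff jet_shift_def)
qed

lemma Jet0_chain:
  assumes m: "1 \<le> m" and n: "n \<le> (m - 1) * e + cmat.dim I"
  shows "\<exists>Z. zchain (jet_coords m) (Jet0 m) n Z"
proof -
  define E where "E a \<tau> \<gamma> = (case a of Inl a \<Rightarrow> jfl m a \<tau> \<gamma> | Inr w \<Rightarrow> jet_shift m w \<gamma> \<tau>)" for a \<tau> \<gamma>
  let ?\<Lambda> = "Inl ` ((UNIV :: nat set) \<times> Orb) \<union> Inr ` I"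
  let ?p = "single 1 x"
  show ?thesis
  proof (rule flows_chain[where \<Lambda>="?\<Lambda>" and E=E and x="?p"])
    show "?p \<in> Jet0 m" using single_jets[OF m x_in_O] by (simp add: jets_over_iff single_def)
    fix B assume B: "finite B" "\<forall>a\<in>?\<Lambda>. vel (jet_coords m) (\<lambda>\<tau>. E a \<tau> ?p) \<in> cfun.span B"
    obtain Y where Y: "\<And>d. d \<in> spd \<Longrightarrow> Y d \<in> Orb \<and> d = lie_bracket (Y d) x"
      using bchoice[of spd "\<lambda>d y. y \<in> Orb \<and> d = lie_bracket y x"] by blast
    \<comment> \<open>Coordinate 0 of a jet over 0 is fixed, coordinate \<open>m\<close> is shifted
      by all of \<open>I\<close>, and those in between move by brackets with \<open>x\<close>. For
      \<open>m = 1\<close> there are none in between.\<close>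
    define S where "S l = (if l = 0 then {} else if l = m then I else spd)" for l
    \<comment> \<open>The flow has index \<open>l - 1\<close> because the base jet
      \<open>t x\<close> supplies one power of \<open>t\<close>.\<close>
    define L where "L l d = (if l = m then Inr d else Inl (l - 1, Y d))" for l d
    have "(\<Sum>l\<le>m. cmat.dim (S l)) \<le> card B"
    proof (rule jet_velocities_card[OF B(1), where \<xi>="\<lambda>l d. vel (jet_coords m) (\<lambda>\<tau>. E (L l d) \<tau> ?p)"])
      fix l d assume l: "l \<le> m" and d: "d \<in> S l"
      show "vel (jet_coords m) (\<lambda>\<tau>. E (L l d) \<tau> ?p) \<in> cfun.span B"
        using B(2) d Y by (auto simp: S_def L_def split: if_splits)
      fix l' s assume l': "l' \<le> m"
      show "vel (jet_coords m) (\<lambda>\<tau>. E (L l d) \<tau> ?p) (\<lambda>\<gamma>. trace (s ** \<gamma> l')) = (if l' = l then trace (s ** d) else 0)"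
      proof (cases "l = m")
        case True
        have "vel (jet_coords m) (jet_shift m d ?p) (\<lambda>\<gamma>. trace (s ** \<gamma> l')) = trace (s ** (if l' = m then d else 0))"
          by (rule vel_jet_trace[OF l']) (rule DERIV_jet_shift)
        then show ?thesis using True by (simp add: E_def L_def mm_simps)
      next
        case False
        then have "l \<noteq> 0" "d \<in> spd" using d by (auto simp: S_def split: if_splits)
        then show ?thesis using vel_jfl_trace[of "(l - 1, Y d)" 1 m l' x s] Y[of d] m l' False by (auto simp: E_def L_def)
      qed
    qed
    moreover have "(\<Sum>l\<le>m. cmat.dim (S l)) = (m - 1) * e + cmat.dim I"
    proof -
      obtain k where k: "m = Suc k" using m by (cases m) auto
      have "(\<Sum>l\<le>m. cmat.dim (S l)) = (\<Sum>l\<le>k. cmat.dim (S l)) + cmat.dim I" by (simp add: k S_def)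
      also have "(\<Sum>l\<le>k. cmat.dim (S l)) = (\<Sum>l\<in>{1..k}. cmat.dim (S l))"
        by (rule sum.mono_neutral_right) (auto simp: S_def cmat.dim_empty)
      also have "\<dots> = (\<Sum>l\<in>{1..k}. e)" by (rule sum.cong) (auto simp: S_def k dim_spd)
      finally show ?thesis by (simp add: k)
    qed
    ultimately show "n \<le> card B" using n by simp
  next
    fix a assume a: "a \<in> ?\<Lambda>"
    show "flow (jet_coords m) (E a)"
      unfolding E_def using jfl_flow flow_jet_shift by (cases a) auto
    fix \<tau> \<gamma> assume \<gamma>: "\<gamma> \<in> Jet0 m"
    show "E a \<tau> \<gamma> \<in> Jet0 m" unfolding E_def using a \<gamma> jfl_Jet0 shift_Jet0[OF m \<gamma>] by auto
    show "E a 0 \<gamma> = \<gamma>" unfolding E_def using a \<gamma> by (auto simp: jets_over_iff jet_shift_0 intro!: jfl_0)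
    show "E a (- \<tau>) (E a \<tau> \<gamma>) = \<gamma>"
      unfolding E_def using a \<gamma> by (auto simp: jets_over_iff jet_shift_def fun_eq_iff cmat.scale_minus_left intro!: jfl_inverse[THEN fun_cong])
  qed simp
qed

text \<open>The numerical condition of littleness, \<open>e\<close> being the dimension of the orbit
  by \<open>krull_O\<close>.\<close>

context
  assumes e_pos: "0 < e" and dim_I: "2 * e \<le> cmat.dim I"
begin

lemma zero_notin_O: "0 \<notin> Orb"
proof
  assume "0 \<in> Orb"
  then obtain g where g: "g \<in> G" "0 = g ** x ** matrix_inv g" by (auto simp: orbit_def)
  then have "x = 0" using conj_conj_inv[OF g(1), of x] by (simp add: mm_simps)
  then have "T \<subseteq> cmat.span {}" unfolding T_def by (auto simp: lie_bracket_def mm_simps)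
  then have "e \<le> cmat.dim (cmat.span {} :: (complex^'n^'n) set)" by (rule cmat.dim_subset)
  then show False using e_pos unfolding cmat.dim_span cmat.dim_empty by linarith
qed

theorem RC2: "1 \<le> m \<Longrightarrow> RC2 G m Orb"
  unfolding RC2_def Let_def
proof (intro exI[of _ "{0}"] conjI)
  assume m: "1 \<le> m"
  have lie0: "0 \<in> lie_algebra G" using lie_subspace cmat.subspace_0 by blast
  have "orbit G 0 = {0}" using G_one by (auto simp: orbit_def mm_simps)
  moreover have "nilpotent_mat (0 :: complex^'n^'n)"
    unfolding nilpotent_mat_def by (intro exI[of _ 1]) (simp add: mm_simps)
  ultimately show "nilpotent_orbit G {0}" unfolding nilpotent_orbit_def using lie0 by (intro bexI[of _ 0]) auto
  show "{0} \<subseteq> X - Orb" using zero_notin_O JO_zero by (simp add: in_closure_iff)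
  show "krull_dim (subtopology jet_zariski (JetO m)) = enat (m + 1) * krull_dim (subtopology mat_zariski Orb)"
    by (simp only: krull_JetO krull_O times_enat_simps)
  \<comment> \<open>For \<open>m \<ge> 1\<close> this amounts to
    \<open>2 * e \<le> dim I\<close>.\<close>
  have "(m + 1) * e \<le> (m - 1) * e + cmat.dim I"
  proof -
    obtain k where "m = Suc k" using m by (cases m) auto
    then show ?thesis using dim_I by (simp add: algebra_simps)
  qed
  from Jet0_chain[OF m this] obtain Z where "zchain (jet_coords m) (Jet0 m) ((m + 1) * e) Z" ..
  then have "zchain {(\<lambda>\<gamma>. \<gamma> k $ i $ j) | k i j. True} (Jet0 m) ((m + 1) * e) Z"
    using jet_zariski_zchain[of "Jet0 m" m] jets_tail by blast
  from krull_dim_geI[OF this]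
  show "krull_dim (subtopology jet_zariski (Jet0 m)) \<ge> krull_dim (subtopology jet_zariski (JetO m))"
    by (simp only: krull_JetO)
qed

text \<open>If the closure of the jets over the orbit contained the fibre over 0, these jets would
  be dense in the union \<open>?S\<close>. A chain of length \<open>2 * e\<close> in the fibre could
  then be prolonged by \<open>?S\<close> itself, while chains in \<open>?S\<close> have length at
  most \<open>2 * e\<close>.\<close>

theorem RC1: "RC1 Orb"
  unfolding RC1_def Let_def
proof
  assume sub: "Jet0 1 \<subseteq> jet_zariski closure_of (JetO 1)"
  let ?C = "jet_coords 1 :: ((nat \<Rightarrow> complex^'n^'n) \<Rightarrow> complex) set"
  let ?S = "Jet0 1 \<union> JetO 1"
  have dense: "\<forall>q\<in>?S. f q = 0" if f: "f \<in> poly_fun ?C" "\<forall>p\<in>JetO 1. f p = 0" for f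
  proof -
    have "f \<in> poly_fun {(\<lambda>\<gamma>. \<gamma> k $ i $ j) | k i j. True}"
      by (rule poly_fun_mono[OF _ f(1)]) (auto simp: jet_coords_def)
    then have "closedin jet_zariski (zero_set {f})" unfolding closedin_zariski by (intro exI[of _ "{f}"]) simp
    moreover have "JetO 1 \<subseteq> zero_set {f}" using f(2) by (auto simp: zero_set_def)
    ultimately have "jet_zariski closure_of (JetO 1) \<subseteq> zero_set {f}" by (intro closure_of_minimal)
    then show ?thesis using sub f(2) by (auto simp: zero_set_def)
  qed
  obtain Z where Z: "zchain ?C (Jet0 1) (2 * e) Z" using Jet0_chain[of 1 "2 * e"] dim_I by auto
  define W where "W i = (if i \<le> 2 * e then Z i else ?S)" for i
  \<comment> \<open>Equations that cut the fibre out of \<open>?S\<close>, since 0 is not in the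
    orbit; they make sets closed in the fibre closed in \<open>?S\<close>.\<close>
  let ?H = "range (\<lambda>(i, j) (\<gamma> :: nat \<Rightarrow> complex^'n^'n). \<gamma> 0 $ i $ j)"
  have H: "?H \<subseteq> poly_fun ?C" by (auto intro: jet_coordI)
  have "(\<forall>f\<in>?H. f q = 0) \<longleftrightarrow> q 0 = 0" for q by (simp add: vec_eq_iff)
  then have fibre: "q \<in> Jet0 1 \<longleftrightarrow> q \<in> ?S \<and> (\<forall>f\<in>?H. f q = 0)" for q
    using zero_notin_O by (auto simp only: jets_over_iff mem_Collect_eq Un_iff singleton_iff)
  have "zchain ?C ?S (2 * e + 1) W"
    unfolding zchain_def
  proof (intro conjI allI impI)
    fix i assume i: "i \<le> 2 * e + 1"
    show "irr ?C (W i)"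
    proof (cases "i \<le> 2 * e")
      case True
      then show ?thesis using Z by (simp add: W_def zchain_def)
    next
      case False
      have "irr ?C ?S"
        unfolding irr_def
      proof (intro conjI ballI impI)
        show "?S \<noteq> {}" using single_JetO[OF x_in_O] by blast
        fix f g assume fg: "f \<in> poly_fun ?C" "g \<in> poly_fun ?C" "\<forall>q\<in>?S. f q * g q = 0"
        have "\<forall>q\<in>JetO 1. f q * g q = 0" using fg(3) by blast
        from irr_disj[OF irr_JetO fg(1,2) this]
        show "(\<forall>q\<in>?S. f q = 0) \<or> (\<forall>q\<in>?S. g q = 0)" using dense[OF fg(1)] dense[OF fg(2)] by argo
      qed
      then show ?thesis using False by (simp add: W_def)
    qed
    show "\<exists>F\<subseteq>poly_fun ?C. W i = {q\<in>?S. \<forall>f\<in>F. f q = 0}"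
    proof (cases "i \<le> 2 * e")
      case True
      then obtain F where F: "F \<subseteq> poly_fun ?C" "Z i = {q\<in>Jet0 1. \<forall>f\<in>F. f q = 0}" using Z unfolding zchain_def by blast
      have "{q\<in>Jet0 1. \<forall>f\<in>F. f q = 0} = {q\<in>?S. \<forall>f\<in>F \<union> ?H. f q = 0}"
        unfolding ball_Un using fibre by blast
      then have "W i = {q\<in>?S. \<forall>f\<in>F \<union> ?H. f q = 0}"
        using True F(2) by (simp only: W_def if_True)
      then show ?thesis using F(1) H by (intro exI[of _ "F \<union> ?H"]) blast
    next
      case False
      then show ?thesis by (intro exI[of _ "{}"]) (auto simp: W_def)
    qed
  next
    fix i assume i: "i < 2 * e + 1"
    show "W i \<subset> W (Suc i)"
    proof (cases "i = 2 * e")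
      case True
      have "Z i \<subseteq> Jet0 1" using Z True unfolding zchain_def by blast
      moreover have "single 0 x \<in> ?S - Jet0 1"
        using single_JetO[OF x_in_O] x_in_O zero_notin_O by (auto simp: jets_over_iff single_def)
      ultimately show ?thesis using True unfolding W_def by auto
    next
      case False
      then show ?thesis using Z i by (simp add: W_def zchain_def)
    qed
  qed
  then have "2 * e + 1 \<le> (1 + 1) * e" by (rule JetO_chain_le) (use dense in blast)
  then show False by simp
qed

end

end

theorem proposition4p2:
  fixes G \<O> :: "(complex^'n^'n) set"
  assumes "connected_reductive_group G"
    and "nilpotent_orbit G \<O>"
    and "little G \<O>"
  shows "RC1 \<O> \<and> (\<forall>m\<ge>1. RC2 G m \<O>)"
proof -
  obtain x where x: "x \<in> lie_algebra G" "nilpotent_mat x" "\<O> = orbit G x"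
    using assms(2) unfolding nilpotent_orbit_def by blast
  obtain I where I: "smallest_semisimple_ideal G \<O> I" "0 < 2 * krull_dim (subtopology mat_zariski \<O>)"
    "2 * krull_dim (subtopology mat_zariski \<O>) \<le> enat (cmat.dim I)"
    using assms(3) unfolding little_def by blast
  interpret little_setup G x I
    using assms(1) x I(1) by unfold_locales (simp_all add: connected_reductive_group_def)
  have two: "2 * enat k = enat (2 * k)" for k by (simp add: numeral_eq_enat)
  have "0 < cmat.dim T" "2 * cmat.dim T \<le> cmat.dim I"
    using I(2,3) unfolding x(3) krull_O two by (simp_all add: zero_enat_def)
  then show ?thesis unfolding x(3) using RC1 RC2 by blast
qed

end
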